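(* (Lower bound inequality.) Let $\mathbf n:\Omega\to\mathbb S^2$, with frame as in the context, and let $h=h_{\eta,\mathbf n(\mathbf x)}$ be a stable critical point of $A[f]$. Then there exists $c>0$ (independent of $\varepsilon$) such that for any $f\in H^1(\Omega\times\mathbb S^2)$ with $\int_{\mathbb S^2}f(\mathbf x,\mathbf m)d\mathbf m=0$ there holds $$-\big\langle\mathcal G_h^\varepsilon f,\mathcal H_h^\varepsilon f\big\rangle\ \ge\ c\Big\{\int_\Omega\int_0^\pi\Big(\gamma_0^2+\gamma_{a,1}^2+\gamma_{b,1}^2+\gamma_{a,2}^2+\gamma_{b,2}^2+\sum_{k\ge3}(a_k^2+b_k^2)\Big)\sin\hat\theta\,d\hat\theta\,d\mathbf x$$ $$+\int_\Omega\Big((2\zeta_0-\alpha N_0)^2+(\zeta_{a,1}-2\alpha N_{13})^2+(\zeta_{b,1}-2\alpha N_{23})^2+(\zeta_{a,2}-\alpha N_2)^2+(\zeta_{b,2}-\alpha N_{12})^2\Big)d\mathbf x\Big\}.$$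
   Context: $\Omega=\mathbb R^3$; $\langle\cdot,\cdot\rangle$ is the $L^2(\Omega\times\mathbb S^2)$ inner product; $\mathcal R=\mathbf m\times\nabla_{\mathbf m}$ is the rotational gradient. For the parameter $\alpha>0$, $\mathcal Uf(\mathbf m)=\alpha\int_{\mathbb S^2}|\mathbf m\times\mathbf m'|^2f(\mathbf m')d\mathbf m'$. $g$ is a radial Schwartz function on $\mathbb R^3$ with $\int g=1$, whose Fourier transform satisfies $0\le\hat g(\xi)<1$ for $\xi\neq0$, $\hat g''(0)<0$; $g_\varepsilon(\mathbf x)=\varepsilon^{-3/2}g(\mathbf x/\sqrt\varepsilon)$; $\mathcal U_\varepsilon f(\mathbf x,\mathbf m)=\alpha\int_\Omega\int_{\mathbb S^2}|\mathbf m\times\mathbf m'|^2g_\varepsilon(\mathbf x-\mathbf x')f(\mathbf x',\mathbf m')d\mathbf m'd\mathbf x'$. $$\mathcal G_h^\varepsilon f=\mathcal R\cdot(\mathcal Rf+h\,\mathcal R\,\mathcal U_\varepsilon f+f\,\mathcal R\,\mathcal Uh),\qquad\mathcal H_h^\varepsilon f=\frac fh+\mathcal U_\varepsilon f.$$ Equilibria: $A[f]=\int_{\mathbb S^2}\big(f\ln f+\frac12f\,\mathcal Uf\big)d\mathbf m$. A function $h$ on $\mathbb S^2$ is a critical point of $A[f]$ if $\ln h+\mathcal Uh$ is constant; it is stable if $\int_{\mathbb S^2}\big(\frac\phi h+\mathcal U\phi\big)\phi\,d\mathbf m\ge0$ for all mean-zero $\phi\in L^2(\mathbb S^2)$. All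 critical points of unit mass have the form $h_{\eta,\mathbf n}(\mathbf m)=e^{\eta(\mathbf m\cdot\mathbf n)^2}/\int_{\mathbb S^2}e^{\eta(\mathbf m'\cdot\mathbf n)^2}d\mathbf m'$, $\mathbf n\in\mathbb S^2$, $\eta$ depending on $\alpha$. Frame: $(\mathbf k_1(\mathbf x),\mathbf k_2(\mathbf x),\mathbf k_3(\mathbf x))$ is a right-handed orthonormal frame with $\mathbf k_3=\mathbf n$ and $\mathbf k_1,\mathbf k_2$ depending smoothly on $\mathbf n(\mathbf x)$. $\mathbf A=[\mathbf k_1\,\mathbf k_2\,\mathbf k_3]$ (columns), and $(\hat\theta,\hat\varphi)$ are the spherical coordinates $\mathbf m=\mathbf A(\mathbf x)\hat{\mathbf m}$, $\hat{\mathbf m}=(\sin\hat\theta\cos\hat\varphi,\sin\hat\theta\sin\hat\varphi,\cos\hat\theta)^T$. Decomposition of $f$: $f=a_0(\mathbf x,\hat\theta)+\sum_{k\ge1}(a_k(\mathbf x,\hat\theta)\cos k\hat\varphi+b_k(\mathbf x,\hat\theta)\sin k\hat\varphi)$, with $a_k,b_k$ ($k\ge1$) vanishing at $\hat\theta=0,\pi$. With $A_k=\int_0^\pi e^{\eta\cos^2\theta}\cos^k\theta\sin\theta\,d\theta$ and $f_0(\hat\theta)=e^{\eta\cos^2\hat\theta}/(2\pi A_0)$ write $a_0=\zeta_0(\mathbf x)f_0(\cos^2\hat\theta-A_2/A_0)+\gamma_0$, $a_1=\zeta_{a,1}(\mathbf x)f_0\sin\hat\theta\cos\hat\theta+\gamma_{a,1}$,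 $b_1=\zeta_{b,1}(\mathbf x)f_0\sin\hat\theta\cos\hat\theta+\gamma_{b,1}$, $a_2=\zeta_{a,2}(\mathbf x)f_0\sin^2\hat\theta+\gamma_{a,2}$, $b_2=\zeta_{b,2}(\mathbf x)f_0\sin^2\hat\theta+\gamma_{b,2}$, where the $\zeta$'s are uniquely determined by the conditions (for each $\mathbf x$) $\int_0^\pi\gamma_0\sin\hat\theta d\hat\theta=0$, $\int_0^\pi(3\cos^2\hat\theta-1)\gamma_0\sin\hat\theta d\hat\theta=0$, $\int_0^\pi\sin\hat\theta\cos\hat\theta\,\gamma_{a,1}\sin\hat\theta d\hat\theta=\int_0^\pi\sin\hat\theta\cos\hat\theta\,\gamma_{b,1}\sin\hat\theta d\hat\theta=0$, $\int_0^\pi\sin^2\hat\theta\,\gamma_{a,2}\sin\hat\theta d\hat\theta=\int_0^\pi\sin^2\hat\theta\,\gamma_{b,2}\sin\hat\theta d\hat\theta=0$. Moments: $\mathbf M(\mathbf x)=\int_{\mathbb S^2}\mathbf{mm}f\,d\mathbf m$, $N_{ij}=\sum_{k,l}A_{ki}A_{lj}(g_\varepsilon*M_{kl})$ (convolution in $\mathbf x$; here $A_{ki}$ are the entries of $\mathbf A$), $N_0=2N_{33}-N_{11}-N_{22}$, $N_2=N_{11}-N_{22}$.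
   Formalization: The term (ζ_{a,2} − αN_2)² is replaced by (2ζ_{a,2} − αN_2)²; as printed the inequality fails, e.g. for η=0, α=15/2, constant n and f=ζ(x)f_0 sin²θ cos2φ with slowly varying ζ. *)

theory Defs
  imports "HOL-Analysis.Analysis"
begin

section \<open>Smooth functions\<close>

primrec iter_deriv ::
  "'a::real_normed_vector list \<Rightarrow> ('a \<Rightarrow> 'b::real_normed_vector) \<Rightarrow> 'a \<Rightarrow> 'b" where
  "iter_deriv [] f = f"
| "iter_deriv (v # vs) f = (\<lambda>x. frechet_derivative (iter_deriv vs f) (at x) v)"

definition smooth_on :: "'a::real_normed_vector set \<Rightarrow> ('a \<Rightarrow> 'b::real_normed_vector) \<Rightarrow> bool" where
  "smooth_on S f \<longleftrightarrow> (\<forall>vs. \<forall>x\<in>S. iter_deriv vs f differentiable (at x))"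

definition schwartz :: "(real^3 \<Rightarrow> real) \<Rightarrow> bool" where
  "schwartz g \<longleftrightarrow> smooth_on UNIV g \<and>
     (\<forall>vs (k::nat). \<exists>C. \<forall>x. norm x ^ k * \<bar>iter_deriv vs g x\<bar> \<le> C)"


section \<open>The interaction kernel\<close>

definition fourier :: "(real^3 \<Rightarrow> real) \<Rightarrow> real^3 \<Rightarrow> complex" where
  "fourier g \<xi> = (LINT x|lborel. complex_of_real (g x) * cis (- (x \<bullet> \<xi>)))"

text \<open>The Fourier transform of a radial real function is real, so the real part loses nothing,
  and it is radial, so its second derivative at the origin is taken along any unit vector.\<close>

definition admissible_kernel :: "(real^3 \<Rightarrow> real) \<Rightarrow> bool" where
  "admissible_kernel g \<longleftrightarrow>
     schwartz g \<and>
     (\<forall>x y. norm x = norm y \<longrightarrow> g x = g y) \<and>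
     (LINT x|lborel. g x) = 1 \<and>
     (\<forall>\<xi>. \<xi> \<noteq> 0 \<longrightarrow> 0 \<le> Re (fourier g \<xi>) \<and> Re (fourier g \<xi>) < 1) \<and>
     (\<forall>e. norm e = 1 \<longrightarrow> (deriv ^^ 2) (\<lambda>r. Re (fourier g (r *\<^sub>R e))) 0 < 0)"

definition g_eps :: "(real^3 \<Rightarrow> real) \<Rightarrow> real \<Rightarrow> real^3 \<Rightarrow> real" where
  "g_eps g \<epsilon> x = \<epsilon> powr (- 3 / 2) * g (x /\<^sub>R sqrt \<epsilon>)"


section \<open>The unit sphere and the phase space\<close>

definition sph :: "real \<Rightarrow> real \<Rightarrow> real^3" where
  "sph \<theta> \<phi> = vector [sin \<theta> * cos \<phi>, sin \<theta> * sin \<phi>, cos \<theta>]"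

text \<open>Surface measure on the unit sphere (total mass \<open>4\<pi>\<close>), as the image of
  \<open>sin \<theta> d\<theta> d\<phi>\<close>; the underlying space is the sphere itself.\<close>

definition S2 :: "(real^3) measure" where
  "S2 = distr
     (density (restrict_space lborel ({0..pi} \<times> {0..2 * pi})) (\<lambda>(\<theta>, \<phi>). ennreal (sin \<theta>)))
     (restrict_space borel (sphere 0 1)) (\<lambda>(\<theta>, \<phi>). sph \<theta> \<phi>)"

type_synonym field = "(real^3) \<times> (real^3) \<Rightarrow> real"

definition phase :: "((real^3) \<times> (real^3)) measure" where
  "phase = lborel \<Otimes>\<^sub>M S2"


section \<open>The rotational gradient and the Sobolev space\<close>

text \<open>Test functions on \<open>\<real>\<^sup>3 \<times> \<S>\<^sup>2\<close> are taken as restrictions of smooth functions on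
  \<open>\<real>\<^sup>3 \<times> \<real>\<^sup>3\<close>; the rotational gradient is tangential, so it depends on the restriction only.\<close>

definition test_field :: "field \<Rightarrow> bool" where
  "test_field \<psi> \<longleftrightarrow> smooth_on UNIV \<psi> \<and> (\<exists>r. \<forall>x m. norm x > r \<longrightarrow> \<psi> (x, m) = 0)"

definition classical_grad_x :: "field \<Rightarrow> (real^3) \<times> (real^3) \<Rightarrow> real^3" where
  "classical_grad_x \<psi> = (\<lambda>p. \<chi> i. frechet_derivative \<psi> (at p) (axis i 1, 0))"

definition classical_rot :: "field \<Rightarrow> (real^3) \<times> (real^3) \<Rightarrow> real^3" where
  "classical_rot \<psi> = (\<lambda>p. cross3 (snd p) (\<chi> i. frechet_derivative \<psi> (at p) (0, axis i 1)))"

definition loc_integrable :: "((real^3) \<times> (real^3) \<Rightarrow> 'b::{banach, second_countable_topology}) \<Rightarrow> bool" where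
  "loc_integrable F \<longleftrightarrow> (\<forall>r. set_integrable phase (cball 0 r \<times> sphere 0 1) F)"

definition has_weak_grad_x :: "field \<Rightarrow> ((real^3) \<times> (real^3) \<Rightarrow> real^3) \<Rightarrow> bool" where
  "has_weak_grad_x F G \<longleftrightarrow> loc_integrable F \<and> loc_integrable G \<and>
     (\<forall>\<psi>. test_field \<psi> \<longrightarrow>
        (LINT p|phase. F p *\<^sub>R classical_grad_x \<psi> p) = - (LINT p|phase. \<psi> p *\<^sub>R G p))"

text \<open>Each component of the rotational gradient generates rotations of the sphere and is
  therefore skew-adjoint with respect to the surface measure.\<close>

definition has_weak_rot :: "field \<Rightarrow> ((real^3) \<times> (real^3) \<Rightarrow> real^3) \<Rightarrow> bool" where
  "has_weak_rot F G \<longleftrightarrow> loc_integrable F \<and> loc_integrable G \<and>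
     (\<forall>\<psi>. test_field \<psi> \<longrightarrow>
        (LINT p|phase. F p *\<^sub>R classical_rot \<psi> p) = - (LINT p|phase. \<psi> p *\<^sub>R G p))"

text \<open>The weak rotational gradient is unique up to null sets; any representative is chosen.\<close>

definition rot :: "field \<Rightarrow> (real^3) \<times> (real^3) \<Rightarrow> real^3" where
  "rot F = (SOME G. has_weak_rot F G)"

definition sq_integrable :: "'c measure \<Rightarrow> ('c \<Rightarrow> 'b::real_normed_vector) \<Rightarrow> bool" where
  "sq_integrable M F \<longleftrightarrow> F \<in> borel_measurable M \<and> integrable M (\<lambda>p. (norm (F p))\<^sup>2)"

definition H1 :: "field set" where
  "H1 = {F. sq_integrable phase F \<and>
            (\<exists>G. has_weak_grad_x F G \<and> sq_integrable phase G) \<and>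
            (\<exists>G. has_weak_rot F G \<and> sq_integrable phase G)}"


section \<open>Operators\<close>

definition U_op :: "real \<Rightarrow> (real^3 \<Rightarrow> real) \<Rightarrow> real^3 \<Rightarrow> real" where
  "U_op \<alpha> u m = \<alpha> * (LINT m'|S2. (norm (cross3 m m'))\<^sup>2 * u m')"

definition U_eps :: "real \<Rightarrow> (real^3 \<Rightarrow> real) \<Rightarrow> real \<Rightarrow> field \<Rightarrow> field" where
  "U_eps \<alpha> g \<epsilon> f = (\<lambda>(x, m).
     \<alpha> * (LINT x'|lborel. LINT m'|S2. (norm (cross3 m m'))\<^sup>2 * g_eps g \<epsilon> (x - x') * f (x', m')))"

definition flux :: "real \<Rightarrow> (real^3 \<Rightarrow> real) \<Rightarrow> real \<Rightarrow> field \<Rightarrow> field \<Rightarrow> (real^3) \<times> (real^3) \<Rightarrow> real^3" where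
  "flux \<alpha> g \<epsilon> h f = (\<lambda>p.
     rot f p + h p *\<^sub>R rot (U_eps \<alpha> g \<epsilon> f) p + f p *\<^sub>R rot (\<lambda>(x, m). U_op \<alpha> (\<lambda>m'. h (x, m')) m) p)"

text \<open>For \<open>f \<in> H\<^sup>1\<close> the rotational divergence of the flux is only a distribution, and its
  \<open>L\<^sup>2\<close> pairing with \<open>\<psi>\<close> is the duality pairing
  \<open>\<langle>\<R>\<cdot>V, \<psi>\<rangle> = - \<langle>V, \<R>\<psi>\<rangle>\<close>.  Accordingly \<open>G_op \<alpha> g \<epsilon> h f\<close> is a functional.\<close>

definition G_op :: "real \<Rightarrow> (real^3 \<Rightarrow> real) \<Rightarrow> real \<Rightarrow> field \<Rightarrow> field \<Rightarrow> field \<Rightarrow> real" where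
  "G_op \<alpha> g \<epsilon> h f \<psi> = - (LINT p|phase. flux \<alpha> g \<epsilon> h f p \<bullet> rot \<psi> p)"

definition H_op :: "real \<Rightarrow> (real^3 \<Rightarrow> real) \<Rightarrow> real \<Rightarrow> field \<Rightarrow> field \<Rightarrow> field" where
  "H_op \<alpha> g \<epsilon> h f = (\<lambda>p. f p / h p + U_eps \<alpha> g \<epsilon> f p)"


section \<open>Equilibria\<close>

definition h_eq :: "real \<Rightarrow> real^3 \<Rightarrow> real^3 \<Rightarrow> real" where
  "h_eq \<eta> n m = exp (\<eta> * (m \<bullet> n)\<^sup>2) / (LINT m'|S2. exp (\<eta> * (m' \<bullet> n)\<^sup>2))"

definition critical_point :: "real \<Rightarrow> (real^3 \<Rightarrow> real) \<Rightarrow> bool" where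
  "critical_point \<alpha> h \<longleftrightarrow> (\<exists>C. \<forall>m\<in>sphere 0 1. ln (h m) + U_op \<alpha> h m = C)"

definition stable_eq :: "real \<Rightarrow> (real^3 \<Rightarrow> real) \<Rightarrow> bool" where
  "stable_eq \<alpha> h \<longleftrightarrow> (\<forall>\<phi>. sq_integrable S2 \<phi> \<longrightarrow> (LINT m|S2. \<phi> m) = 0 \<longrightarrow>
     0 \<le> (LINT m|S2. (\<phi> m / h m + U_op \<alpha> \<phi> m) * \<phi> m))"


section \<open>Frame, decomposition and moments\<close>

text \<open>The columns of \<open>A x\<close> are the frame vectors.  Smooth dependence of the first two on
  \<open>n x\<close> means that they factor through a smooth map on a neighbourhood of the range of \<open>n\<close>.\<close>

definition adapted_frame :: "(real^3 \<Rightarrow> real^3) \<Rightarrow> (real^3 \<Rightarrow> real^3^3) \<Rightarrow> bool" where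
  "adapted_frame n A \<longleftrightarrow>
     (\<forall>x. rotation_matrix (A x) \<and> column 3 (A x) = n x) \<and>
     (\<exists>W K1 K2. open W \<and> range n \<subseteq> W \<and> smooth_on W K1 \<and> smooth_on W K2 \<and>
        (\<forall>x. column 1 (A x) = K1 (n x) \<and> column 2 (A x) = K2 (n x)))"

definition Ak :: "real \<Rightarrow> nat \<Rightarrow> real" where
  "Ak \<eta> k = (LINT \<theta>:{0..pi}|lborel. exp (\<eta> * (cos \<theta>)\<^sup>2) * cos \<theta> ^ k * sin \<theta>)"

definition f0 :: "real \<Rightarrow> real \<Rightarrow> real" where
  "f0 \<eta> \<theta> = exp (\<eta> * (cos \<theta>)\<^sup>2) / (2 * pi * Ak \<eta> 0)"

text \<open>The azimuthal series converges to \<open>f\<close> in \<open>L\<^sup>2(0, 2\<pi>)\<close> for almost every \<open>(x, \<theta>)\<close>;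
  this determines the coefficients up to null sets (\<open>b 0\<close> is irrelevant).\<close>

definition azimuthal_expansion ::
  "(real^3 \<Rightarrow> real^3^3) \<Rightarrow> field \<Rightarrow> (nat \<Rightarrow> real^3 \<Rightarrow> real \<Rightarrow> real) \<Rightarrow> (nat \<Rightarrow> real^3 \<Rightarrow> real \<Rightarrow> real) \<Rightarrow> bool"
where
  "azimuthal_expansion A f a b \<longleftrightarrow>
     (\<forall>k. case_prod (a k) \<in> borel_measurable (lborel \<Otimes>\<^sub>M restrict_space lborel {0..pi}) \<and>
          case_prod (b k) \<in> borel_measurable (lborel \<Otimes>\<^sub>M restrict_space lborel {0..pi})) \<and>
     (\<forall>k\<ge>1. \<forall>x. a k x 0 = 0 \<and> a k x pi = 0 \<and> b k x 0 = 0 \<and> b k x pi = 0) \<and>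
     (AE (x, \<theta>) in lborel \<Otimes>\<^sub>M restrict_space lborel {0..pi}.
        (\<lambda>K. \<integral>\<^sup>+\<phi>\<in>{0..2 * pi}. ennreal ((f (x, A x *v sph \<theta> \<phi>) -
              (a 0 x \<theta> + (\<Sum>k=1..K. a k x \<theta> * cos (real k * \<phi>) + b k x \<theta> * sin (real k * \<phi>))))\<^sup>2)
           \<partial>lborel) \<longlonglongrightarrow> 0)"

text \<open>\<open>u = \<zeta> p + \<gamma>\<close> with \<open>\<gamma>(x, \<cdot>)\<close> orthogonal to each weight in \<open>T\<close>
  with respect to \<open>sin \<theta> d\<theta>\<close>.\<close>

definition mode_split ::
  "(real \<Rightarrow> real) \<Rightarrow> (real \<Rightarrow> real) set \<Rightarrow> (real^3 \<Rightarrow> real \<Rightarrow> real) \<Rightarrow> (real^3 \<Rightarrow> real) \<Rightarrow>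
   (real^3 \<Rightarrow> real \<Rightarrow> real) \<Rightarrow> bool" where
  "mode_split p T u \<zeta> \<gamma> \<longleftrightarrow> (AE x in lborel.
     (\<forall>\<theta>\<in>{0..pi}. u x \<theta> = \<zeta> x * p \<theta> + \<gamma> x \<theta>) \<and>
     (\<forall>w\<in>T. (LINT \<theta>:{0..pi}|lborel. w \<theta> * \<gamma> x \<theta> * sin \<theta>) = 0))"

definition M_mom :: "field \<Rightarrow> real^3 \<Rightarrow> real^3^3" where
  "M_mom f x = (\<chi> i j. LINT m|S2. m $ i * m $ j * f (x, m))"

definition N_mom ::
  "(real^3 \<Rightarrow> real^3^3) \<Rightarrow> (real^3 \<Rightarrow> real) \<Rightarrow> real \<Rightarrow> field \<Rightarrow> real^3 \<Rightarrow> real^3^3" where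
  "N_mom A g \<epsilon> f x = (\<chi> i j. \<Sum>k\<in>UNIV. \<Sum>l\<in>UNIV.
     A x $ k $ i * A x $ l $ j * (LINT y|lborel. g_eps g \<epsilon> (x - y) * M_mom f y $ k $ l))"

definition N0 :: "(real^3 \<Rightarrow> real^3^3) \<Rightarrow> (real^3 \<Rightarrow> real) \<Rightarrow> real \<Rightarrow> field \<Rightarrow> real^3 \<Rightarrow> real" where
  "N0 A g \<epsilon> f x = 2 * N_mom A g \<epsilon> f x $ 3 $ 3 - N_mom A g \<epsilon> f x $ 1 $ 1 - N_mom A g \<epsilon> f x $ 2 $ 2"

text \<open>The factor in front of \<open>\<zeta>\<^sub>a\<^sub>2\<close>: since
  \<open>N\<^sub>1\<^sub>1 cos\<^sup>2 \<phi> + N\<^sub>2\<^sub>2 sin\<^sup>2 \<phi> = (N\<^sub>1\<^sub>1 + N\<^sub>2\<^sub>2) / 2 + (N\<^sub>2 / 2) cos 2\<phi>\<close>,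
  the coefficient of \<open>cos 2\<phi>\<close> in \<open>H_op\<close> applied to \<open>f\<close> is
  \<open>(\<zeta>\<^sub>a\<^sub>2 - \<alpha> N\<^sub>2 / 2) sin\<^sup>2 \<theta> + \<gamma>\<^sub>a\<^sub>2 / f\<^sub>0\<close>, so the quantity bounded below by the energy is
  \<open>2 \<zeta>\<^sub>a\<^sub>2 - \<alpha> N\<^sub>2\<close>.  The combination \<open>\<zeta>\<^sub>a\<^sub>2 - \<alpha> N\<^sub>2\<close> found in the literature
  omits the 2 and is not bounded by the energy in general.  For example, with
  \<open>\<eta> = 0\<close>, \<open>\<alpha> = 15/2\<close>, a constant frame and \<open>f = \<zeta>(x) f\<^sub>0 sin\<^sup>2 \<theta> cos 2\<phi>\<close>, one has
  \<open>\<alpha> N\<^sub>2 = 2 g\<^sub>\<epsilon> * \<zeta>\<close>: the energy is a multiple of \<open>\<parallel>\<zeta> - g\<^sub>\<epsilon> * \<zeta>\<parallel>\<^sup>2\<close>, while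
  \<open>\<parallel>\<zeta> - 2 g\<^sub>\<epsilon> * \<zeta>\<parallel>\<^sup>2\<close> is comparable to \<open>\<parallel>\<zeta>\<parallel>\<^sup>2\<close> when \<open>\<zeta>\<close> varies slowly.\<close>

definition N2 :: "(real^3 \<Rightarrow> real^3^3) \<Rightarrow> (real^3 \<Rightarrow> real) \<Rightarrow> real \<Rightarrow> field \<Rightarrow> real^3 \<Rightarrow> real" where
  "N2 A g \<epsilon> f x = N_mom A g \<epsilon> f x $ 1 $ 1 - N_mom A g \<epsilon> f x $ 2 $ 2"

end

theory Submission
  imports Defs
begin

text \<open>Write \<open>u\<close> for \<open>H_op \<alpha> g \<epsilon> h f\<close> and \<open>V\<close> for its weak rotational gradient.  At a critical point
\<open>ln h + U h\<close> does not depend on \<open>m\<close>, so the rotational gradient of \<open>U h\<close> is minus that of \<open>ln h\<close>,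
and by the product rule the flux in \<open>G_op\<close> equals \<open>h V\<close>.  The left-hand side is therefore
the integral of \<open>h (norm V)\<^sup>2\<close> (\<open>energy_identity\<close>).  As \<open>h\<close> lies between two positive
constants that depend on \<open>\<eta>\<close> only, it suffices to bound, for almost every \<open>x\<close>, the energy
\<open>E\<close> of one slice, that is, the integral of \<open>(norm (V (x, m)))\<^sup>2\<close> over the sphere, from below
by the two integrands of the claim at \<open>x\<close> (\<open>slice_lower_bound\<close>), and to integrate over \<open>x\<close>
(\<open>phase_energy_bound\<close>).

On one slice, let \<open>m = A sph \<theta> \<phi>\<close> be polar coordinates adapted to the frame.  Since \<open>f\<close> has mean
zero on the sphere, only the quadratic part of \<open>(norm (cross3 m m'))\<^sup>2 = 1 - (m \<bullet> m')\<^sup>2\<close>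
contributes to \<open>U_eps\<close>, and \<open>u = f / f0 - \<alpha> (y \<bullet> N y)\<close> with \<open>y = sph \<theta> \<phi>\<close> and the moment matrix
\<open>N\<close> of the statement (\<open>U_eps_eq\<close>, \<open>N_mom_quadratic\<close>).  A quadratic form on the sphere only has
the azimuthal modes 0, 1 and 2, so that these Fourier coefficients of \<open>u\<close> in \<open>\<phi>\<close> have the form
\<open>q P(\<theta>) + \<gamma>(\<theta>) / f0(\<theta>)\<close>, up to a constant for the mode 0, where \<open>P\<close> is one of the profiles
\<open>(cos \<theta>)\<^sup>2 - Ak 2 / Ak 0\<close>, \<open>sin \<theta> cos \<theta>\<close>, \<open>(sin \<theta>)\<^sup>2\<close> and \<open>q\<close> is, up to a factor 2, one of
the five expressions in \<open>\<zeta>\<close> and \<open>N\<close> to be estimated; from the mode 3 on, the coefficients of \<open>u\<close> are those of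
\<open>f\<close> divided by \<open>f0\<close>.

These coefficients are controlled by \<open>E\<close> as follows.  The rotation about the third frame vector acts
as the derivative in \<open>\<phi>\<close>, so it multiplies the modes by their index, and Bessel's inequality bounds
the sum of the squares of all modes of index at least 1 (\<open>slice_mode_bound\<close>).  The mode 0 is
controlled up to a constant by a one-dimensional Poincare inequality, proved by testing with the
primitives of polynomials in \<open>cos \<theta>\<close> (\<open>slice_zonal_bound\<close>).  Finally, integrate
\<open>f0 (q P + \<gamma> / f0 + c)\<^sup>2\<close> against \<open>sin \<theta>\<close>: the orthogonality conditions on \<open>\<gamma>\<close>, and for the mode 0
the fact that \<open>P\<close> has mean zero with respect to \<open>f0\<close>, make the mixed terms vanish, so that
\<open>q\<^sup>2\<close> and the square norm of \<open>\<gamma>\<close> are both bounded (\<open>mode_bound\<close>).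

Weak derivatives are handled throughout by testing with polynomials.  By Stone-Weierstrass,
polynomials determine finite measures on compact sets, and a function that is orthogonal to all of
them vanishes almost everywhere (\<open>AE_zero_if_orthogonal_polynomials\<close>).  The space of polynomials
is spanned by countably many monomials, so the weak identity on the phase space holds on almost
every slice for all polynomials at once (\<open>weak_rot_slices\<close>), and in polar coordinates it
becomes an identity for almost every \<open>\<theta>\<close>.\<close>

section \<open>Finite measures determined by polynomials\<close>

lemma real_poly_measurable:
  fixes p :: "'a::euclidean_space \<Rightarrow> real"
  assumes "real_polynomial_function p"
  shows "p \<in> borel_measurable borel"
  using assms by (intro borel_measurable_continuous_onI continuous_on_polymonial_function)
    (simp add: real_polynomial_function_eq)

text \<open>By Stone-Weierstrass the measures agree on continuous functions; the functions
\<open>min 1 (k infdist x (- U))\<close> increase to the indicator of an open set \<open>U\<close>, and open sets form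
a generator that is stable under intersection.\<close>

lemma finite_measure_eqI_polynomials:
  fixes M N :: "'a::euclidean_space measure"
  assumes fM: "finite_measure M" and fN: "finite_measure N"
    and sM: "sets M = sets borel" and sN: "sets N = sets borel"
    and K: "compact K" and KM: "AE x in M. x \<in> K" and KN: "AE x in N. x \<in> K"
    and eq: "\<And>p. real_polynomial_function p \<Longrightarrow> (LINT x|M. p x) = (LINT x|N. p x)"
  shows "M = N"
proof -
  interpret M: finite_measure M by fact
  interpret N: finite_measure N by fact
  have mM: "f \<in> borel_measurable M" if "f \<in> borel_measurable borel" for f :: "'a \<Rightarrow> real"
    using that sM measurable_cong_sets by blast
  have mN: "f \<in> borel_measurable N" if "f \<in> borel_measurable borel" for f :: "'a \<Rightarrow> real"
    using that sN measurable_cong_sets by blast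
  have spM: "space M = UNIV" and spN: "space N = UNIV"
    using sets_eq_imp_space_eq[OF sM] sets_eq_imp_space_eq[OF sN] by auto
  have near: "\<bar>(LINT x|L. f x) - (LINT x|L. p x)\<bar> \<le> e * measure L UNIV"
    if L: "finite_measure L" "sets L = sets borel" "AE x in L. x \<in> K"
      and f: "continuous_on UNIV f" and p: "real_polynomial_function p"
      and fp: "\<And>x. x \<in> K \<Longrightarrow> \<bar>f x - p x\<bar> < e" and e: "e > 0"
    for L :: "'a measure" and f p :: "'a \<Rightarrow> real" and e
  proof -
    interpret L: finite_measure L by fact
    have spL: "space L = UNIV" using sets_eq_imp_space_eq[OF L(2)] by simp
    have bound: "\<exists>C. \<forall>x\<in>K. \<bar>k x\<bar> \<le> C" if "continuous_on UNIV k" for k :: "'a \<Rightarrow> real"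
      using compact_imp_bounded[OF compact_continuous_image[OF continuous_on_subset[OF that] K]]
      by (auto simp: bounded_iff)
    have int: "integrable L k" if "continuous_on UNIV k" for k :: "'a \<Rightarrow> real"
    proof -
      obtain C where C: "\<forall>x\<in>K. \<bar>k x\<bar> \<le> C" using bound[OF \<open>continuous_on UNIV k\<close>] by blast
      have "k \<in> borel_measurable L"
        using borel_measurable_continuous_onI[OF that] L(2) measurable_cong_sets by blast
      then show ?thesis
        by (rule L.integrable_const_bound[rotated, of k C]) (use L(3) C in auto)
    qed
    have cp: "continuous_on UNIV p"
      using p by (simp add: continuous_on_polymonial_function real_polynomial_function_eq)
    have "\<bar>(LINT x|L. f x) - (LINT x|L. p x)\<bar> = \<bar>LINT x|L. f x - p x\<bar>"
      using int[OF f] int[OF cp] by simp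
    also have "\<dots> \<le> (LINT x|L. \<bar>f x - p x\<bar>)"
      using integral_abs_bound by blast
    also have "\<dots> \<le> (LINT x|L. e)"
      by (rule integral_mono_AE) (use int[OF f] int[OF cp] L(3) fp in \<open>auto intro!: less_imp_le\<close>)
    finally show ?thesis by (simp add: spL mult.commute)
  qed
  have cont: "(LINT x|M. f x) = (LINT x|N. f x)" if f: "continuous_on UNIV f" for f :: "'a \<Rightarrow> real"
  proof -
    have "\<bar>(LINT x|M. f x) - (LINT x|N. f x)\<bar> \<le> e * (measure M UNIV + measure N UNIV)" if e: "e > 0" for e
    proof -
      obtain p where p: "real_polynomial_function p" "\<And>x. x \<in> K \<Longrightarrow> \<bar>f x - p x\<bar> < e"
        using Stone_Weierstrass_real_polynomial_function[OF K continuous_on_subset[OF f] e] by auto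
      show ?thesis
        using near[OF fM sM KM f p e] near[OF fN sN KN f p e] eq[OF p(1)]
        by (simp add: algebra_simps)
    qed
    then have le: "\<bar>(LINT x|M. f x) - (LINT x|N. f x)\<bar> \<le> e * (measure M UNIV + measure N UNIV + 1)" if e: "e > 0" for e
      using that by (smt (verit) mult_left_mono)
    show ?thesis
    proof (rule ccontr)
      assume ne: "\<not> ?thesis"
      define d where "d = \<bar>(LINT x|M. f x) - (LINT x|N. f x)\<bar>"
      define S where "S = measure M UNIV + measure N UNIV + 1"
      have "d > 0" "S > 0" using ne measure_nonneg[of M UNIV] measure_nonneg[of N UNIV]
        unfolding d_def S_def by linarith+
      then show False using le[of "d / (2 * S)"] by (simp add: d_def[symmetric] S_def[symmetric])
    qed
  qed
  have opn: "emeasure M U = emeasure N U" if U: "open U" for U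
  proof (cases "U = UNIV")
    case True
    have "measure M UNIV = measure N UNIV"
      using cont[of "\<lambda>x. 1"] by (simp add: spM spN)
    then show ?thesis by (simp add: M.emeasure_eq_measure N.emeasure_eq_measure True)
  next
    case False
    then have ne: "- U \<noteq> {}" by auto
    define F where "F = (\<lambda>(k::nat) x. min 1 (real k * infdist x (- U)))"
    have Fc: "continuous_on UNIV (F k)" for k
      unfolding F_def by (intro continuous_intros)
    have Fb: "norm (F k x) \<le> 1" for k x
      unfolding F_def using infdist_nonneg[of x "- U"] by auto
    have Fl: "(\<lambda>k. F k x) \<longlonglongrightarrow> indicator U x" for x
    proof (cases "x \<in> U")
      case True
      then have "infdist x (- U) > 0"
        using U ne in_closed_iff_infdist_zero[of "-U" x] infdist_nonneg[of x "-U"]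
        by (metis ComplD closed_Compl less_eq_real_def)
      then have "eventually (\<lambda>k. real k * infdist x (- U) \<ge> 1) sequentially"
      proof -
        obtain N :: nat where N: "1 < real N * infdist x (- U)"
          using ex_less_of_nat_mult[OF \<open>infdist x (- U) > 0\<close>] by blast
        show ?thesis
        proof (rule eventually_sequentiallyI[of N])
          fix k assume "N \<le> k"
          then have "real N * infdist x (- U) \<le> real k * infdist x (- U)"
            by (intro mult_right_mono) (auto simp: infdist_nonneg)
          then show "1 \<le> real k * infdist x (- U)" using N by linarith
        qed
      qed
      then have "eventually (\<lambda>k. F k x = indicator U x) sequentially"
        by eventually_elim (use True in \<open>auto simp: F_def\<close>)
      then show ?thesis by (rule tendsto_eventually)
    next
      case False
      then show ?thesis by (simp add: F_def)
    qed
    have "(\<lambda>k. LINT x|M. F k x) \<longlonglongrightarrow> (LINT x|M. indicator U x)"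
      by (rule integral_dominated_convergence[where w="\<lambda>_. 1"])
        (auto intro!: mM borel_measurable_continuous_onI[OF Fc] borel_measurable_indicator Fl Fb simp: sM sN U simp del: real_norm_def)
    moreover have "(\<lambda>k. LINT x|N. F k x) \<longlonglongrightarrow> (LINT x|N. indicator U x)"
      by (rule integral_dominated_convergence[where w="\<lambda>_. 1"])
        (auto intro!: mN borel_measurable_continuous_onI[OF Fc] borel_measurable_indicator Fl Fb simp: sM sN U simp del: real_norm_def)
    ultimately have "measure M U = measure N U"
      using cont[OF Fc] LIMSEQ_unique by (fastforce simp: spM spN)
    then show ?thesis by (simp add: M.emeasure_eq_measure N.emeasure_eq_measure)
  qed
  show ?thesis
  proof (rule measure_eqI_generator_eq[where E="{U. open U}" and \<Omega>=UNIV and A="\<lambda>_. UNIV"])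
    show "Int_stable {U::'a set. open U}" by (auto intro!: Int_stableI)
    show "sets M = sigma_sets UNIV {U. open U}" "sets N = sigma_sets UNIV {U. open U}"
      using sM sN by (auto simp: borel_def)
  qed (use opn in auto)
qed

text \<open>The positive and the negative part of \<open>F\<close> are densities of two finite measures whose images under
\<open>T\<close> have the same polynomial moments, hence coincide.  Since \<open>T\<close> generates the measurable sets, the
set where \<open>F\<close> is positive is a preimage under \<open>T\<close>; it has measure zero for the negative part,
hence for the positive part as well.\<close>

lemma AE_zero_if_orthogonal_polynomials:
  fixes T :: "'w \<Rightarrow> 'a::euclidean_space" and F :: "'w \<Rightarrow> real"
  assumes F: "integrable M F" and T: "T \<in> M \<rightarrow>\<^sub>M borel"
    and gen: "\<And>A. A \<in> sets M \<Longrightarrow> \<exists>B\<in>sets borel. A = T -` B \<inter> space M"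
    and K: "compact K" "\<And>\<omega>. \<omega> \<in> space M \<Longrightarrow> F \<omega> \<noteq> 0 \<Longrightarrow> T \<omega> \<in> K"
    and orth: "\<And>p. real_polynomial_function p \<Longrightarrow> (LINT \<omega>|M. p (T \<omega>) * F \<omega>) = 0"
  shows "AE \<omega> in M. F \<omega> = 0"
proof -
  have Fm[measurable]: "F \<in> borel_measurable M" using F by auto
  note T[measurable]
  \<comment> \<open>\<open>P 1\<close> and \<open>P (-1)\<close> are the images of the positive and the negative part of \<open>F\<close>.\<close>
  define P where "P = (\<lambda>s. distr (density M (\<lambda>\<omega>. ennreal (s * F \<omega>))) borel T)"
  have Pfin: "finite_measure (P s)" for s
  proof (rule finite_measureI)
    have "(\<integral>\<^sup>+\<omega>. ennreal (s * F \<omega>) \<partial>M) < \<infinity>"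
      using integrable_mult_right[OF F, of s] unfolding real_integrable_def by (simp add: less_top)
    then show "emeasure (P s) (space (P s)) \<noteq> \<infinity>"
      by (auto simp: P_def emeasure_distr emeasure_density cong: nn_integral_cong)
  qed
  have PK: "AE x in P s. x \<in> K" for s
  proof -
    have "T \<omega> \<in> K" if "\<omega> \<in> space M" "0 < s * F \<omega>" for \<omega>
      using K(2)[OF that(1)] that(2) by fastforce
    then show ?thesis
      unfolding P_def by (subst AE_distr_iff) (use K(1) in \<open>auto simp: AE_density compact_imp_closed intro!: AE_I2\<close>)
  qed
  have Bdd: "\<exists>C. \<forall>x\<in>K. \<bar>p x\<bar> \<le> C" if "real_polynomial_function p" for p :: "'a \<Rightarrow> real"
  proof -
    have "continuous_on UNIV p" using that by (simp add: continuous_on_polymonial_function real_polynomial_function_eq)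
    from compact_imp_bounded[OF compact_continuous_image[OF continuous_on_subset[OF this] K(1)]]
    show ?thesis by (auto simp: bounded_iff)
  qed
  have Pint: "(LINT x|P s. p x) = (LINT \<omega>|M. max 0 (s * F \<omega>) * p (T \<omega>))"
    if p: "real_polynomial_function p" for p s
  proof -
    have [measurable]: "p \<in> borel_measurable borel" by (rule real_poly_measurable[OF p])
    have "density M (\<lambda>\<omega>. ennreal (s * F \<omega>)) = density M (\<lambda>\<omega>. ennreal (max 0 (s * F \<omega>)))"
      by (intro density_cong) (auto simp: max_def ennreal_neg)
    then show ?thesis unfolding P_def
      by (simp add: integral_distr integral_density)
  qed
  have "P 1 = P (-1)"
  proof (rule finite_measure_eqI_polynomials[OF Pfin Pfin _ _ K(1) PK PK])
    fix p :: "'a \<Rightarrow> real" assume p: "real_polynomial_function p"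
    have [measurable]: "p \<in> borel_measurable borel" by (rule real_poly_measurable[OF p])
    obtain C where C: "\<forall>x\<in>K. \<bar>p x\<bar> \<le> C" using Bdd[OF p] by blast
    have int: "integrable M (\<lambda>\<omega>. max 0 (s * F \<omega>) * p (T \<omega>))" if "\<bar>s\<bar> = 1" for s
    proof (rule Bochner_Integration.integrable_bound[where f="\<lambda>\<omega>. C * F \<omega>"])
      show "AE \<omega> in M. norm (max 0 (s * F \<omega>) * p (T \<omega>)) \<le> norm (C * F \<omega>)"
      proof (rule AE_I2)
        fix \<omega> assume w: "\<omega> \<in> space M"
        show "norm (max 0 (s * F \<omega>) * p (T \<omega>)) \<le> norm (C * F \<omega>)"
        proof (cases "F \<omega> = 0")
          case False
          then have "\<bar>p (T \<omega>)\<bar> \<le> \<bar>C\<bar>" using K(2)[OF w] C by force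
          moreover have "\<bar>max 0 (s * F \<omega>)\<bar> \<le> \<bar>F \<omega>\<bar>" using that by (auto simp: max_def abs_if split: if_splits)
          ultimately show ?thesis
            by (simp add: abs_mult mult.commute mult_mono)
        qed simp
      qed
    qed (use F in auto)
    have "(LINT x|P 1. p x) - (LINT x|P (-1). p x)
        = (LINT \<omega>|M. max 0 (1 * F \<omega>) * p (T \<omega>) - max 0 (-1 * F \<omega>) * p (T \<omega>))"
      unfolding Pint[OF p] using int[of 1] int[of "-1"] by simp
    also have "\<dots> = (LINT \<omega>|M. p (T \<omega>) * F \<omega>)"
      by (intro Bochner_Integration.integral_cong) (auto simp: max_def)
    finally show "(LINT x|P 1. p x) = (LINT x|P (-1). p x)" using orth[OF p] by simp
  qed (auto simp: P_def)
  have half: "AE \<omega> in M. s * F \<omega> \<le> 0" if s: "P s = P (-s)" "s \<noteq> 0" for s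
  proof -
    have "{\<omega>\<in>space M. s * F \<omega> > 0} \<in> sets M" by measurable
    from gen[OF this] obtain B where B: "B \<in> sets borel" "{\<omega>\<in>space M. s * F \<omega> > 0} = T -` B \<inter> space M"
      by blast
    have e: "emeasure (P r) B = (\<integral>\<^sup>+\<omega>. ennreal (r * F \<omega>) * indicator {\<omega>\<in>space M. s * F \<omega> > 0} \<omega> \<partial>M)" for r
      using B(1) by (simp add: P_def emeasure_distr emeasure_density B(2))
    have "emeasure (P (-s)) B = 0"
      unfolding e by (subst nn_integral_0_iff_AE) (auto simp: ennreal_neg split: split_indicator)
    then have "emeasure (P s) B = 0" using s by simp
    then have "AE \<omega> in M. ennreal (s * F \<omega>) * indicator {\<omega>\<in>space M. s * F \<omega> > 0} \<omega> = 0"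
      unfolding e by (subst (asm) nn_integral_0_iff_AE) auto
    then show ?thesis by (rule AE_mp) (auto intro!: AE_I2 split: split_indicator_asm simp: not_less ennreal_eq_0_iff)
  qed
  have "AE \<omega> in M. 1 * F \<omega> \<le> 0" "AE \<omega> in M. -1 * F \<omega> \<le> 0"
    using half[of 1] half[of "-1"] \<open>P 1 = P (-1)\<close> by auto
  then show ?thesis by eventually_elim auto
qed

section \<open>Polar coordinates on the sphere\<close>

text \<open>The polar and the azimuthal factor of the surface measure are measures on the whole real line, so that
no restricted spaces occur in the iterated integrals.\<close>

definition Theta :: "real measure" where
  "Theta = density lborel (\<lambda>\<theta>. ennreal (sin \<theta>) * indicator {0..pi} \<theta>)"

definition Phi :: "real measure" where
  "Phi = density lborel (indicator {0..2 * pi})"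

lemma sets_Theta [measurable_cong, simp]: "sets Theta = sets borel"
  and sets_Phi [measurable_cong, simp]: "sets Phi = sets borel"
  and space_Theta [simp]: "space Theta = UNIV"
  and space_Phi [simp]: "space Phi = UNIV"
  by (auto simp: Theta_def Phi_def)

lemma finite_measure_Phi: "finite_measure Phi"
  by (rule finite_measureI) (simp add: Phi_def emeasure_density)

lemma finite_measure_Theta: "finite_measure Theta"
proof (rule finite_measureI)
  have "emeasure Theta (space Theta) = (\<integral>\<^sup>+\<theta>. ennreal (sin \<theta>) * indicator {0..pi} \<theta> \<partial>lborel)"
    unfolding Theta_def by (simp add: emeasure_density)
  also have "\<dots> \<le> (\<integral>\<^sup>+\<theta>. indicator {0..pi} \<theta> \<partial>lborel)"
    by (intro nn_integral_mono) (simp split: split_indicator)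
  also have "\<dots> < \<infinity>" by simp
  finally show "emeasure Theta (space Theta) \<noteq> \<infinity>" by simp
qed

interpretation Theta: finite_measure Theta by (rule finite_measure_Theta)
interpretation Phi: finite_measure Phi by (rule finite_measure_Phi)
interpretation TP: pair_sigma_finite Theta Phi ..

lemma sph_components [simp]:
  "sph \<theta> \<phi> $ 1 = sin \<theta> * cos \<phi>" "sph \<theta> \<phi> $ 2 = sin \<theta> * sin \<phi>" "sph \<theta> \<phi> $ 3 = cos \<theta>"
  by (simp_all add: sph_def)

lemma norm_sph [simp]: "norm (sph \<theta> \<phi>) = 1"
proof -
  have "(norm (sph \<theta> \<phi>))\<^sup>2 = (sin \<theta>)\<^sup>2 * ((cos \<phi>)\<^sup>2 + (sin \<phi>)\<^sup>2) + (cos \<theta>)\<^sup>2"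
    unfolding power2_norm_eq_inner inner_vec_def sum_3 by (simp add: power2_eq_square algebra_simps del: sin_cos_squared_add sin_cos_squared_add2 sin_cos_squared_add3)
  then have "(norm (sph \<theta> \<phi>))\<^sup>2 = 1" by simp
  then show ?thesis using norm_ge_zero[of "sph \<theta> \<phi>"] power2_eq_1_iff[of "norm (sph \<theta> \<phi>)"] by linarith
qed

lemma sph_eq: "sph \<theta> \<phi> = (sin \<theta> * cos \<phi>) *\<^sub>R axis 1 1 + (sin \<theta> * sin \<phi>) *\<^sub>R axis 2 1 + cos \<theta> *\<^sub>R axis 3 1"
  by (simp add: vec_eq_iff forall_3 axis_def)

lemma continuous_on_sph [continuous_intros]:
  fixes f g :: "'a::t2_space \<Rightarrow> real"
  shows "continuous_on S f \<Longrightarrow> continuous_on S g \<Longrightarrow> continuous_on S (\<lambda>x. sph (f x) (g x))"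
  unfolding sph_eq by (intro continuous_intros)

lemma measurable_sph_borel [measurable]: "(\<lambda>(\<theta>, \<phi>). sph \<theta> \<phi>) \<in> borel \<Otimes>\<^sub>M borel \<rightarrow>\<^sub>M borel"
  unfolding sph_eq by measurable

lemma sets_S2 [measurable_cong]: "sets S2 = sets (restrict_space borel (sphere 0 1))"
  and space_S2 [simp]: "space S2 = sphere 0 1"
  by (auto simp: S2_def space_restrict_space)

lemma measurable_sph [measurable (raw)]:
  "f \<in> borel_measurable M \<Longrightarrow> g \<in> borel_measurable M \<Longrightarrow> (\<lambda>x. sph (f x) (g x)) \<in> M \<rightarrow>\<^sub>M S2"
  unfolding measurable_cong_sets[OF refl sets_S2]
  by (rule measurable_restrict_space2) auto

lemma measurable_S2_borel [measurable]: "(\<lambda>m. m) \<in> S2 \<rightarrow>\<^sub>M borel"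
  unfolding measurable_cong_sets[OF sets_S2 refl] by (rule measurable_restrict_space1) simp

lemma S2_eq_distr: "S2 = distr (Theta \<Otimes>\<^sub>M Phi) S2 (\<lambda>(\<theta>, \<phi>). sph \<theta> \<phi>)"
proof (rule measure_eqI)
  fix B assume B: "B \<in> sets S2"
  have [measurable]: "Measurable.pred (borel \<Otimes>\<^sub>M borel) (\<lambda>(\<theta>, \<phi>). sph \<theta> \<phi> \<in> B)"
  proof -
    have "(\<lambda>(\<theta>, \<phi>). sph \<theta> \<phi>) \<in> borel \<Otimes>\<^sub>M borel \<rightarrow>\<^sub>M S2" by measurable
    from measurable_sets[OF this B] show ?thesis
      by (simp add: pred_def vimage_def split_beta Int_def conj_commute)
  qed
  let ?R = "{0..pi} \<times> {0..2*pi::real}"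
  have m: "(\<lambda>(\<theta>, \<phi>). sph \<theta> \<phi>) \<in> restrict_space lborel ?R \<rightarrow>\<^sub>M restrict_space borel (sphere 0 1)"
  proof (rule measurable_restrict_space1)
    have "(\<lambda>x. sph (fst x) (snd x)) \<in> (borel :: (real \<times> real) measure) \<rightarrow>\<^sub>M S2"
      by (intro measurable_sph borel_measurable_continuous_onI continuous_intros)
    then show "(\<lambda>(\<theta>, \<phi>). sph \<theta> \<phi>) \<in> lborel \<rightarrow>\<^sub>M restrict_space borel (sphere 0 1)"
      unfolding measurable_cong_sets[OF refl sets_S2] by (simp add: split_beta measurable_cong_sets[OF sets_lborel refl])
  qed
  have R: "?R \<in> sets lborel" by (simp add: borel_Times)
  have sn: "(\<lambda>x::real\<times>real. ennreal (sin (fst x))) \<in> borel_measurable borel"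
    by (intro measurable_compose[OF _ measurable_ennreal] borel_measurable_continuous_onI continuous_intros)
  have "emeasure S2 B = emeasure (density (restrict_space lborel ?R) (\<lambda>(\<theta>, \<phi>). ennreal (sin \<theta>)))
      ((\<lambda>(\<theta>, \<phi>). sph \<theta> \<phi>) -` B \<inter> ?R)"
    using B m unfolding S2_def by (subst emeasure_distr) (auto simp: sets_S2[unfolded S2_def] space_restrict_space)
  also have "\<dots> = (\<integral>\<^sup>+x\<in>((\<lambda>(\<theta>, \<phi>). sph \<theta> \<phi>) -` B \<inter> ?R). ennreal (sin (fst x)) \<partial>restrict_space lborel ?R)"
  proof (subst emeasure_density)
    show "(\<lambda>(\<theta>, \<phi>). sph \<theta> \<phi>) -` B \<inter> ?R \<in> sets (restrict_space lborel ?R)"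
      using measurable_sets[OF m, of B] B by (simp add: sets_S2 space_restrict_space)
  qed (auto simp: split_beta' sn intro!: measurable_restrict_space1 sn)
  also have "\<dots> = (\<integral>\<^sup>+x. ennreal (sin (fst x)) * indicator ((\<lambda>(\<theta>, \<phi>). sph \<theta> \<phi>) -` B) x * indicator ?R x \<partial>lborel)"
    using R by (subst nn_integral_restrict_space) (auto intro!: nn_integral_cong split: split_indicator)
  also have "\<dots> = (\<integral>\<^sup>+x. (ennreal (sin (fst x)) * indicator {0..pi} (fst x)) * indicator {0..2*pi} (snd x)
       * indicator ((\<lambda>(\<theta>, \<phi>). sph \<theta> \<phi>) -` B) x \<partial>(lborel \<Otimes>\<^sub>M lborel))"
    unfolding lborel_prod by (auto intro!: nn_integral_cong split: split_indicator)
  also have "\<dots> = emeasure (density (lborel \<Otimes>\<^sub>M lborel)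
       (\<lambda>(\<theta>, \<phi>). ennreal (sin \<theta>) * indicator {0..pi} \<theta> * indicator {0..2*pi} \<phi>)) ((\<lambda>(\<theta>, \<phi>). sph \<theta> \<phi>) -` B)"
  proof (subst emeasure_density)
    have "{x \<in> space (borel \<Otimes>\<^sub>M borel). case x of (\<theta>, \<phi>) \<Rightarrow> sph \<theta> \<phi> \<in> B} \<in> sets (borel \<Otimes>\<^sub>M borel)"
      by measurable
    then show "(\<lambda>(\<theta>, \<phi>). sph \<theta> \<phi>) -` B \<in> sets (lborel \<Otimes>\<^sub>M lborel)"
      by (simp add: vimage_def split_beta borel_prod lborel_prod space_pair_measure)
  qed (auto simp: split_beta')
  also have "density (lborel \<Otimes>\<^sub>M lborel)
       (\<lambda>(\<theta>, \<phi>). ennreal (sin \<theta>) * indicator {0..pi} \<theta> * indicator {0..2*pi} \<phi>) = Theta \<Otimes>\<^sub>M Phi"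
    unfolding Theta_def Phi_def
    by (subst pair_measure_density)
      (auto simp: Phi_def[symmetric] split_beta' intro: sigma_finite_lborel Phi.sigma_finite_measure_axioms)
  finally show "emeasure S2 B = emeasure (distr (Theta \<Otimes>\<^sub>M Phi) S2 (\<lambda>(\<theta>, \<phi>). sph \<theta> \<phi>)) B"
    using B by (simp add: emeasure_distr space_pair_measure)
qed simp

lemma finite_measure_S2: "finite_measure S2"
proof -
  interpret P: finite_measure "Theta \<Otimes>\<^sub>M Phi"
    by (intro finite_measure_pair_measure finite_measure_Theta finite_measure_Phi)
  show ?thesis by (subst S2_eq_distr) (rule P.finite_measure_distr, measurable)
qed

interpretation S2: finite_measure S2 by (rule finite_measure_S2)

lemma
  fixes u :: "real^3 \<Rightarrow> 'b::{banach, second_countable_topology}"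
  assumes u: "integrable S2 u"
  shows integrable_S2_sph: "integrable (Theta \<Otimes>\<^sub>M Phi) (\<lambda>(\<theta>, \<phi>). u (sph \<theta> \<phi>))"
    and integral_S2_sph: "(LINT m|S2. u m) = (LINT \<theta>|Theta. LINT \<phi>|Phi. u (sph \<theta> \<phi>))"
proof -
  have [measurable]: "u \<in> borel_measurable S2" using u by auto
  show i: "integrable (Theta \<Otimes>\<^sub>M Phi) (\<lambda>(\<theta>, \<phi>). u (sph \<theta> \<phi>))"
    using u by (subst (asm) S2_eq_distr) (simp add: integrable_distr_eq split_beta')
  show "(LINT m|S2. u m) = (LINT \<theta>|Theta. LINT \<phi>|Phi. u (sph \<theta> \<phi>))"
    using TP.integral_fst'[OF i] by (subst S2_eq_distr) (simp add: integral_distr split_beta')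
qed

text \<open>For continuous integrands, the iterated integral in polar coordinates is a Henstock-Kurzweil integral, for which
the fundamental theorem of calculus and the interchange of integrals are available.\<close>

lemma integral_Theta_Phi_continuous:
  fixes u :: "real \<Rightarrow> real \<Rightarrow> 'b::euclidean_space"
  assumes u: "continuous_on UNIV (\<lambda>(\<theta>, \<phi>). u \<theta> \<phi>)"
  shows "(LINT \<theta>|Theta. LINT \<phi>|Phi. u \<theta> \<phi>) = integral {0..pi} (\<lambda>\<theta>. integral {0..2*pi} (\<lambda>\<phi>. sin \<theta> *\<^sub>R u \<theta> \<phi>))"
proof -
  have [measurable]: "(\<lambda>(\<theta>, \<phi>). u \<theta> \<phi>) \<in> borel_measurable (borel \<Otimes>\<^sub>M borel)"
    unfolding borel_prod by (rule borel_measurable_continuous_onI[OF u])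
  have c2: "continuous_on UNIV (u \<theta>)" for \<theta>
  proof -
    have "continuous_on UNIV (Pair \<theta> :: real \<Rightarrow> real \<times> real)" by (intro continuous_intros)
    from continuous_on_compose2[OF u this] show ?thesis by simp
  qed
  have [measurable]: "u \<theta> \<in> borel_measurable borel" for \<theta>
    by (rule borel_measurable_continuous_onI[OF c2])
  have inner: "(LINT \<phi>|Phi. u \<theta> \<phi>) = integral {0..2*pi} (u \<theta>)" for \<theta>
  proof -
    have e: "Phi = density lborel (\<lambda>\<phi>. ennreal (indicator {0..2*pi} \<phi>))"
      unfolding Phi_def by (intro density_cong) (auto split: split_indicator)
    have "(LINT \<phi>|Phi. u \<theta> \<phi>) = (LINT \<phi>:{0..2*pi}|lborel. u \<theta> \<phi>)"
      unfolding e set_lebesgue_integral_def by (subst integral_density) auto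
    also have "\<dots> = integral {0..2*pi} (u \<theta>)"
      by (rule set_borel_integral_eq_integral, rule borel_integrable_atLeastAtMost')
        (rule continuous_on_subset[OF c2], simp)
    finally show ?thesis .
  qed
  have ci: "continuous_on {0..pi} (\<lambda>\<theta>. integral {0..2*pi} (u \<theta>))"
    using integral_continuous_on_param[of "{0..pi}" 0 "2*pi" u] continuous_on_subset[OF u]
    by (simp add: cbox_interval)
  have "(LINT \<theta>|Theta. LINT \<phi>|Phi. u \<theta> \<phi>) = (LINT \<theta>|Theta. indicator {0..pi} \<theta> *\<^sub>R integral {0..2*pi} (u \<theta>))"
    unfolding inner Theta_def
    by (rule integral_cong_AE) (auto simp: AE_density inner[symmetric] split: split_indicator)
  also have "\<dots> = (LINT \<theta>|lborel. (indicator {0..pi} \<theta> * sin \<theta>) *\<^sub>R (indicator {0..pi} \<theta> *\<^sub>R integral {0..2*pi} (u \<theta>)))"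
  proof -
    have e: "Theta = density lborel (\<lambda>\<theta>. ennreal (indicator {0..pi} \<theta> * sin \<theta>))"
      unfolding Theta_def by (intro density_cong) (auto split: split_indicator)
    show ?thesis unfolding e
      by (subst integral_density) (auto simp: inner[symmetric] sin_ge_zero split: split_indicator)
  qed
  also have "\<dots> = (LINT \<theta>:{0..pi}|lborel. sin \<theta> *\<^sub>R integral {0..2*pi} (u \<theta>))"
    unfolding set_lebesgue_integral_def by (rule Bochner_Integration.integral_cong) (auto split: split_indicator)
  also have "\<dots> = integral {0..pi} (\<lambda>\<theta>. sin \<theta> *\<^sub>R integral {0..2*pi} (u \<theta>))"
    by (rule set_borel_integral_eq_integral, rule borel_integrable_atLeastAtMost')
      (intro continuous_intros ci)
  finally show ?thesis by simp
qed

lemma continuous_on_sphere_integrable_S2: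
  fixes u :: "real^3 \<Rightarrow> 'b::euclidean_space"
  assumes u: "continuous_on (sphere 0 1) u"
  shows "integrable S2 u"
proof -
  obtain C where C: "\<forall>x\<in>sphere 0 1. norm (u x) \<le> C"
    using compact_imp_bounded[OF compact_continuous_image[OF u compact_sphere]] by (auto simp: bounded_iff)
  show ?thesis
    by (rule S2.integrable_const_bound[of u C])
      (use C in \<open>auto simp: measurable_cong_sets[OF sets_S2 refl] intro!: borel_measurable_continuous_on_restrict u\<close>)
qed

section \<open>Rotation invariance of the surface measure\<close>

lemma integral_S2_continuous:
  fixes u :: "real^3 \<Rightarrow> 'b::euclidean_space"
  assumes u: "continuous_on (sphere 0 1) u"
  shows "(LINT m|S2. u m) = integral {0..pi} (\<lambda>\<theta>. integral {0..2*pi} (\<lambda>\<phi>. sin \<theta> *\<^sub>R u (sph \<theta> \<phi>)))"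
proof -
  have "continuous_on UNIV (\<lambda>x. sph (fst x) (snd x))" by (intro continuous_intros)
  from continuous_on_compose2[OF u this] have "continuous_on UNIV (\<lambda>(\<theta>, \<phi>). u (sph \<theta> \<phi>))"
    by (auto simp: split_beta image_subset_iff)
  from integral_Theta_Phi_continuous[OF this] show ?thesis
    by (simp add: integral_S2_sph[OF continuous_on_sphere_integrable_S2[OF u]])
qed

text \<open>The identity that makes rotational gradients skew-adjoint.  With the unit vectors \<open>e\<close>
along the meridians and the parallels, \<open>sin \<theta>\<close> times the integrand is
the \<open>\<theta>\<close>-derivative of \<open>w sin \<theta> e(parallel)\<close>, which vanishes at both poles, plus the
\<open>\<phi>\<close>-derivative of \<open>- w e(meridian)\<close>, which is periodic.\<close>

lemma integral_rot_S2_eq_0: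
  fixes w :: "real^3 \<Rightarrow> real"
  assumes w: "\<And>m. m \<in> sphere 0 1 \<Longrightarrow> (w has_derivative (\<lambda>v. D m \<bullet> v)) (at m)"
    and D: "continuous_on (sphere 0 1) D"
  shows "(LINT m|S2. cross3 m (D m)) = 0"
proof -
  let ?e\<phi> = "\<lambda>\<phi>. vector [- sin \<phi>, cos \<phi>, 0] :: real^3"
  let ?e\<theta> = "\<lambda>\<theta> \<phi>. vector [cos \<theta> * cos \<phi>, cos \<theta> * sin \<phi>, - sin \<theta>] :: real^3"
  have ephi: "?e\<phi> \<phi> = (- sin \<phi>) *\<^sub>R axis 1 1 + cos \<phi> *\<^sub>R axis 2 1" for \<phi>
    by (simp add: vec_eq_iff forall_3 axis_def)
  have etheta: "?e\<theta> \<theta> \<phi> = (cos \<theta> * cos \<phi>) *\<^sub>R axis 1 1 + (cos \<theta> * sin \<phi>) *\<^sub>R axis 2 1 + (- sin \<theta>) *\<^sub>R axis 3 1" for \<theta> \<phi>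
    by (simp add: vec_eq_iff forall_3 axis_def)
  have cw: "continuous_on (sphere 0 1) w"
    by (rule continuous_at_imp_continuous_on) (use w has_derivative_continuous in blast)
  define W where "W = (\<lambda>\<theta> \<phi>. w (sph \<theta> \<phi>))"
  define W\<theta> where "W\<theta> = (\<lambda>\<theta> \<phi>. D (sph \<theta> \<phi>) \<bullet> ?e\<theta> \<theta> \<phi>)"
  define W\<phi> where "W\<phi> = (\<lambda>\<theta> \<phi>. sin \<theta> * (D (sph \<theta> \<phi>) \<bullet> ?e\<phi> \<phi>))"
  have dW\<theta>: "((\<lambda>\<theta>. W \<theta> \<phi>) has_vector_derivative W\<theta> \<theta> \<phi>) (at \<theta> within X)" for \<theta> \<phi> X
  proof -
    have "((\<lambda>\<theta>. sph \<theta> \<phi>) has_vector_derivative ?e\<theta> \<theta> \<phi>) (at \<theta> within X)"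
      unfolding sph_eq etheta by (auto intro!: derivative_eq_intros simp: has_vector_derivative_def algebra_simps)
    from vector_derivative_diff_chain_within[OF this has_derivative_at_withinI[OF w]]
    show ?thesis by (simp add: W_def W\<theta>_def comp_def)
  qed
  have dW\<phi>: "((\<lambda>\<phi>. W \<theta> \<phi>) has_vector_derivative W\<phi> \<theta> \<phi>) (at \<phi> within X)" for \<theta> \<phi> X
  proof -
    have "((\<lambda>\<phi>. sph \<theta> \<phi>) has_vector_derivative (sin \<theta> *\<^sub>R ?e\<phi> \<phi>)) (at \<phi> within X)"
      unfolding sph_eq ephi by (auto intro!: derivative_eq_intros simp: has_vector_derivative_def algebra_simps)
    from vector_derivative_diff_chain_within[OF this has_derivative_at_withinI[OF w]]
    show ?thesis by (simp add: W_def W\<phi>_def comp_def)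
  qed
  define P where "P = (\<lambda>\<theta> \<phi>. (W \<theta> \<phi> * sin \<theta>) *\<^sub>R ?e\<phi> \<phi>)"
  define Q where "Q = (\<lambda>\<theta> \<phi>. - (W \<theta> \<phi> *\<^sub>R ?e\<theta> \<theta> \<phi>))"
  define P' where "P' = (\<lambda>\<theta> \<phi>. (W\<theta> \<theta> \<phi> * sin \<theta> + W \<theta> \<phi> * cos \<theta>) *\<^sub>R ?e\<phi> \<phi>)"
  define Q' where "Q' = (\<lambda>\<theta> \<phi>. - (W\<phi> \<theta> \<phi> *\<^sub>R ?e\<theta> \<theta> \<phi> + (W \<theta> \<phi> * cos \<theta>) *\<^sub>R ?e\<phi> \<phi>))"
  have dP: "((\<lambda>\<theta>. P \<theta> \<phi>) has_vector_derivative P' \<theta> \<phi>) (at \<theta> within X)" for \<theta> \<phi> X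
    unfolding P_def P'_def
    by (rule has_vector_derivative_eq_rhs,
        (rule has_vector_derivative_scaleR[OF _ has_vector_derivative_const]), rule DERIV_mult'[OF dW\<theta>[unfolded has_real_derivative_iff_has_vector_derivative[symmetric]]], (rule derivative_intros)+)
       (simp add: algebra_simps)
  have e\<theta>d: "((\<lambda>\<phi>. ?e\<theta> \<theta> \<phi>) has_vector_derivative (cos \<theta> *\<^sub>R ?e\<phi> \<phi>)) (at \<phi> within X)" for \<theta> \<phi> X
    unfolding etheta ephi by (auto intro!: derivative_eq_intros simp: has_vector_derivative_def algebra_simps)
  have dQ: "((\<lambda>\<phi>. Q \<theta> \<phi>) has_vector_derivative Q' \<theta> \<phi>) (at \<phi> within X)" for \<theta> \<phi> X
    unfolding Q_def Q'_def
    by (rule has_vector_derivative_eq_rhs,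
        (rule has_vector_derivative_minus, rule has_vector_derivative_scaleR[OF dW\<phi>[unfolded has_real_derivative_iff_has_vector_derivative[symmetric]] e\<theta>d]))
       (simp add: algebra_simps)
  \<comment> \<open>Both sides are expressed in the Cartesian components of the gradient.\<close>
  have key: "sin \<theta> *\<^sub>R cross3 (sph \<theta> \<phi>) (D (sph \<theta> \<phi>)) = P' \<theta> \<phi> + Q' \<theta> \<phi>" for \<theta> \<phi>
  proof -
    have sc: "cos \<theta> * cos \<theta> = 1 - sin \<theta> * sin \<theta>" "cos \<phi> * cos \<phi> = 1 - sin \<phi> * sin \<phi>"
      using sin_cos_squared_add[of \<theta>] sin_cos_squared_add[of \<phi>] by (simp_all add: power2_eq_square)
    define d1 d2 d3 where "d1 = D (sph \<theta> \<phi>) $ 1" "d2 = D (sph \<theta> \<phi>) $ 2" "d3 = D (sph \<theta> \<phi>) $ 3"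
    define s c t k where "s = sin \<theta>" "c = cos \<theta>" "t = sin \<phi>" "k = cos \<phi>"
    have r: "c * c = 1 - s * s" "k * k = 1 - t * t" using sc by (simp_all add: s_c_t_k_def)
    have 1: "s * (s * t * d3 - c * d2) = - (d1 * (c * k) + d2 * (c * t) - d3 * s) * s * t - (s * (d2 * k - d1 * t)) * (c * k)"
      using r by algebra
    have 2: "s * (c * d1 - s * k * d3) = (d1 * (c * k) + d2 * (c * t) - d3 * s) * s * k - (s * (d2 * k - d1 * t)) * (c * t)"
      using r by algebra
    have 3: "s * (s * k * d2 - s * t * d1) = (s * (d2 * k - d1 * t)) * s"
      by algebra
    show ?thesis
      using 1 2 3 unfolding P'_def Q'_def W\<theta>_def W\<phi>_def
      by (simp add: vec_eq_iff forall_3 cross_components inner_vec_def sum_3 d1_d2_d3_def[symmetric] s_c_t_k_def[symmetric])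
        (simp add: algebra_simps)
  qed
  have csph: "continuous_on UNIV (\<lambda>x::real\<times>real. sph (fst x) (snd x))" by (intro continuous_intros)
  have cW: "continuous_on UNIV (\<lambda>x. W (fst x) (snd x))"
    unfolding W_def by (rule continuous_on_compose2[OF cw csph]) auto
  have cD: "continuous_on UNIV (\<lambda>x. D (sph (fst x) (snd x)))"
    by (rule continuous_on_compose2[OF D csph]) auto
  have cW\<theta>: "continuous_on UNIV (\<lambda>x. W\<theta> (fst x) (snd x))" and cW\<phi>: "continuous_on UNIV (\<lambda>x. W\<phi> (fst x) (snd x))"
    unfolding W\<theta>_def W\<phi>_def etheta ephi by (intro continuous_intros cD)+
  have cP: "continuous_on UNIV (\<lambda>x. P' (fst x) (snd x))"
    unfolding P'_def ephi by (intro continuous_intros cW cW\<theta>)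
  have cQ: "continuous_on UNIV (\<lambda>x. Q' (fst x) (snd x))"
    unfolding Q'_def ephi etheta by (intro continuous_intros cW cW\<phi>)
  have cP2: "continuous_on UNIV (P' \<theta>)" and cQ2: "continuous_on UNIV (Q' \<theta>)" for \<theta>
  proof -
    have "continuous_on UNIV (\<lambda>\<phi>::real. (\<theta>, \<phi>))" by (intro continuous_intros)
    from continuous_on_compose2[OF cP this] continuous_on_compose2[OF cQ this]
    show "continuous_on UNIV (P' \<theta>)" "continuous_on UNIV (Q' \<theta>)" by simp_all
  qed
  have iP: "integral {0..pi} (\<lambda>\<theta>. P' \<theta> \<phi>) = 0" for \<phi>
    using fundamental_theorem_of_calculus[of 0 pi "\<lambda>\<theta>. P \<theta> \<phi>" "\<lambda>\<theta>. P' \<theta> \<phi>", OF _ dP]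
    by (auto simp: P_def dest!: integral_unique)
  have iQ: "integral {0..2*pi} (\<lambda>\<phi>. Q' \<theta> \<phi>) = 0" for \<theta>
    using fundamental_theorem_of_calculus[of 0 "2*pi" "\<lambda>\<phi>. Q \<theta> \<phi>" "\<lambda>\<phi>. Q' \<theta> \<phi>", OF _ dQ]
    by (auto simp: Q_def W_def sph_def dest!: integral_unique)
  have "(LINT m|S2. cross3 m (D m)) = integral {0..pi} (\<lambda>\<theta>. integral {0..2*pi} (\<lambda>\<phi>. P' \<theta> \<phi> + Q' \<theta> \<phi>))"
    by (subst integral_S2_continuous) (auto intro!: continuous_on_cross continuous_intros D simp: key)
  also have "\<dots> = integral {0..pi} (\<lambda>\<theta>. integral {0..2*pi} (\<lambda>\<phi>. P' \<theta> \<phi>))"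
  proof (rule integral_cong)
    fix \<theta>
    have "P' \<theta> integrable_on {0..2*pi}" "Q' \<theta> integrable_on {0..2*pi}"
      by (auto intro!: integrable_continuous_interval continuous_on_subset[OF cP2] continuous_on_subset[OF cQ2])
    then show "integral {0..2*pi} (\<lambda>\<phi>. P' \<theta> \<phi> + Q' \<theta> \<phi>) = integral {0..2*pi} (\<lambda>\<phi>. P' \<theta> \<phi>)"
      using iQ[of \<theta>] by (simp add: Henstock_Kurzweil_Integration.integral_add)
  qed
  also have "\<dots> = integral {0..2*pi} (\<lambda>\<phi>. integral {0..pi} (\<lambda>\<theta>. P' \<theta> \<phi>))"
    using integral_swap_continuous[of 0 0 pi "2*pi" P'] continuous_on_subset[OF cP]
    by (simp add: cbox_interval split_beta)
  also have "\<dots> = 0" by (simp add: iP)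
  finally show ?thesis .
qed

lemma real_polynomial_gradient:
  fixes p :: "'a::euclidean_space \<Rightarrow> real"
  assumes "real_polynomial_function p"
  shows "\<exists>D. polynomial_function D \<and> (\<forall>m. (p has_derivative (\<lambda>v. D m \<bullet> v)) (at m))"
  using assms
proof (induction rule: real_polynomial_function.induct)
  case (linear f)
  interpret f: bounded_linear f by fact
  have "(\<Sum>b\<in>Basis. f b *\<^sub>R b) \<bullet> v = f v" for v
  proof -
    have "f v = f (\<Sum>b\<in>Basis. (v \<bullet> b) *\<^sub>R b)" by (simp add: euclidean_representation)
    also have "\<dots> = (\<Sum>b\<in>Basis. (v \<bullet> b) * f b)" by (simp add: f.sum f.scaleR)
    also have "\<dots> = (\<Sum>b\<in>Basis. f b *\<^sub>R b) \<bullet> v" by (subst inner_sum_left) (simp add: inner_commute[of v] mult.commute)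
    finally show ?thesis by (rule sym)
  qed
  then have "(\<lambda>v. (\<Sum>b\<in>Basis. f b *\<^sub>R b) \<bullet> v) = f" by (rule ext)
  then show ?case
    using bounded_linear_imp_has_derivative[OF linear]
    by (intro exI[of _ "\<lambda>_. \<Sum>b\<in>Basis. f b *\<^sub>R b"]) simp
next
  case (const c)
  then show ?case by (intro exI[of _ "\<lambda>_. 0"]) auto
next
  case (add f g)
  then obtain D E where "polynomial_function D" "polynomial_function E"
    "\<forall>m. (f has_derivative (\<lambda>v. D m \<bullet> v)) (at m)" "\<forall>m. (g has_derivative (\<lambda>v. E m \<bullet> v)) (at m)" by blast
  then show ?case
    by (intro exI[of _ "\<lambda>m. D m + E m"]) (auto intro!: derivative_eq_intros simp: inner_add_left)
next
  case (mult f g)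
  then obtain D E where "polynomial_function D" "polynomial_function E"
    "\<forall>m. (f has_derivative (\<lambda>v. D m \<bullet> v)) (at m)" "\<forall>m. (g has_derivative (\<lambda>v. E m \<bullet> v)) (at m)" by blast
  moreover have "polynomial_function f" "polynomial_function g"
    using mult by (auto simp: real_polynomial_function_eq)
  ultimately show ?case
    by (intro exI[of _ "\<lambda>m. f m *\<^sub>R E m + g m *\<^sub>R D m"])
      (auto intro!: derivative_eq_intros simp: inner_add_left algebra_simps)
qed

text \<open>The derivative of the integral of \<open>p (R s m)\<close> in \<open>s\<close> is the integral of a component of the rotational gradient of
the polynomial \<open>p o R s\<close>, which vanishes.  So the flow preserves the integrals of polynomials, and they determine
the measure.\<close>

lemma rotation_flow_invariant:
  fixes R :: "real \<Rightarrow> real^3 \<Rightarrow> real^3"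
  assumes flow: "\<And>s r m. R (s + r) m = R s (R r m)" and R0: "\<And>m. R 0 m = m"
    and lin: "\<And>s. bounded_linear (R s)"
    and deriv: "\<And>m. ((\<lambda>r. R r m) has_vector_derivative cross3 e m) (at 0)"
    and sph: "\<And>s m. norm m = 1 \<Longrightarrow> norm (R s m) = 1"
    and cont: "continuous_on UNIV (\<lambda>(s, m). R s m)"
  shows "distr S2 S2 (R t) = S2"
proof -
  have meas[measurable]: "R s \<in> S2 \<rightarrow>\<^sub>M S2" for s
  proof -
    have "R s \<in> borel_measurable borel"
      by (intro borel_measurable_continuous_onI linear_continuous_on lin)
    then have "R s \<in> borel_measurable S2" by measurable
    then show ?thesis unfolding measurable_cong_sets[OF refl sets_S2]
      by (rule measurable_restrict_space2[rotated]) (use sph in auto)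
  qed
  have poly: "(LINT m|S2. p (R t m)) = (LINT m|S2. p m)" if p: "real_polynomial_function p" and t: "t \<ge> 0" for p t
  proof -
    obtain D where D: "polynomial_function D" "\<And>m. (p has_derivative (\<lambda>v. D m \<bullet> v)) (at m)"
      using real_polynomial_gradient[OF p] by blast
    have cD: "continuous_on UNIV D" using D(1) by (rule continuous_on_polymonial_function)
    define k where "k = (\<lambda>s m. D (R s m) \<bullet> cross3 e (R s m))"
    have dR: "((\<lambda>s. R s m) has_vector_derivative cross3 e (R s m)) (at s)" for s m
    proof -
      have "((\<lambda>r. R r (R s m)) \<circ> (\<lambda>x. x - s) has_vector_derivative 1 *\<^sub>R cross3 e (R s m)) (at s)"
        by (rule vector_diff_chain_at) (use deriv in \<open>auto intro!: derivative_eq_intros\<close>)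
      moreover have "(\<lambda>r. R r (R s m)) \<circ> (\<lambda>x. x - s) = (\<lambda>s. R s m)"
        by (simp add: fun_eq_iff flow[symmetric])
      ultimately show ?thesis by simp
    qed
    have dk: "((\<lambda>s. p (R s m)) has_vector_derivative k s m) (at s within X)" for s m X
      using vector_derivative_diff_chain_within[OF has_vector_derivative_at_within[OF dR] has_derivative_at_withinI[OF D(2)]]
      by (simp add: comp_def k_def)
    have ck: "continuous_on UNIV (\<lambda>x. k (fst x) (snd x))"
    proof -
      have cR: "continuous_on UNIV (\<lambda>x. R (fst x) (snd x))" using cont by (simp add: split_beta')
      then show ?thesis
        unfolding k_def by (intro continuous_intros continuous_on_cross continuous_on_compose2[OF cD]) auto
    qed
    \<comment> \<open>By linearity of the flow, \<open>p o R s\<close> is again a polynomial, and \<open>k s m\<close> is its derivative along the axis \<open>e\<close>.\<close>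
    have zero: "(LINT m|S2. k s m) = 0" for s
    proof -
      have "real_polynomial_function (p \<circ> R s)"
        by (intro real_polynomial_function_compose polynomial_function_bounded_linear lin p)
      from real_polynomial_gradient[OF this] obtain E where
        E: "polynomial_function E" "\<And>m. (p \<circ> R s has_derivative (\<lambda>v. E m \<bullet> v)) (at m)" by blast
      have "k s m = e \<bullet> cross3 m (E m)" for m
      proof -
        have 1: "((p \<circ> R s) \<circ> (\<lambda>r. R r m) has_vector_derivative E (R 0 m) \<bullet> cross3 e m) (at 0)"
          by (rule vector_derivative_diff_chain_within[OF deriv has_derivative_at_withinI[OF E(2)]])
        have "((\<lambda>u. p (R u m)) \<circ> (\<lambda>r. s + r) has_vector_derivative 1 *\<^sub>R k s m) (at 0)"
          by (rule vector_diff_chain_at) (use dk in \<open>auto intro!: derivative_eq_intros\<close>)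
        moreover have "(\<lambda>u. p (R u m)) \<circ> (\<lambda>r. s + r) = (p \<circ> R s) \<circ> (\<lambda>r. R r m)"
          by (auto simp: flow)
        ultimately have 2: "((p \<circ> R s) \<circ> (\<lambda>r. R r m) has_vector_derivative k s m) (at 0)"
          by simp
        have "E m \<bullet> cross3 e m = k s m"
          using vector_derivative_unique_at[OF 1 2] by (simp add: R0)
        then show ?thesis by (simp add: cross_components inner_vec_def sum_3 algebra_simps)
      qed
      moreover have "(LINT m|S2. e \<bullet> cross3 m (E m)) = e \<bullet> (LINT m|S2. cross3 m (E m))"
        by (intro integral_inner_right continuous_on_sphere_integrable_S2 continuous_on_cross continuous_intros
          continuous_on_subset[OF continuous_on_polymonial_function[OF E(1)]]) auto
      moreover have "(LINT m|S2. cross3 m (E m)) = 0"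
        by (rule integral_rot_S2_eq_0[OF E(2)])
          (auto intro: continuous_on_subset[OF continuous_on_polymonial_function[OF E(1)]])
      ultimately show ?thesis by simp
    qed
    have "\<exists>C. \<forall>s\<in>{0..t}. \<forall>m\<in>sphere 0 1. \<bar>k s m\<bar> \<le> C"
      using compact_imp_bounded[OF compact_continuous_image[OF continuous_on_subset[OF ck]
        compact_Times[OF compact_Icc[of 0 t] compact_sphere[of "0::real^3" 1]]]] by (auto simp: bounded_iff)
    then obtain C where C: "\<And>s m. s \<in> {0..t} \<Longrightarrow> m \<in> sphere 0 1 \<Longrightarrow> \<bar>k s m\<bar> \<le> C"
      by blast
    let ?L = "density lborel (\<lambda>s. ennreal (indicator {0..t} s))"
    interpret L: finite_measure ?L
      by (rule finite_measureI) (use t in \<open>simp add: emeasure_density ennreal_indicator\<close>)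
    interpret LS: pair_sigma_finite ?L S2 ..
    interpret LSf: finite_measure "?L \<Otimes>\<^sub>M S2"
      by (intro finite_measure_pair_measure L.finite_measure_axioms S2.finite_measure_axioms)
    have km: "(\<lambda>(s, m). k s m) \<in> borel_measurable (borel \<Otimes>\<^sub>M borel)"
      unfolding borel_prod using ck by (auto simp: split_beta' intro: borel_measurable_continuous_onI)
    have "(\<lambda>(s, m). k s m) \<in> borel_measurable (borel \<Otimes>\<^sub>M S2)"
    proof -
      have "(\<lambda>x. (fst x, snd x)) \<in> borel \<Otimes>\<^sub>M S2 \<rightarrow>\<^sub>M borel \<Otimes>\<^sub>M (borel :: (real^3) measure)"
        by (intro measurable_Pair measurable_fst measurable_compose[OF measurable_snd measurable_S2_borel])
      from measurable_compose[OF this km] show ?thesis by simp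
    qed
    then have [measurable]: "(\<lambda>(s, m). k s m) \<in> borel_measurable (?L \<Otimes>\<^sub>M S2)"
      by (subst measurable_cong_sets[OF sets_pair_measure_cong[OF _ refl] refl, of _ borel]) auto
    have int: "integrable (?L \<Otimes>\<^sub>M S2) (\<lambda>(s, m). k s m)"
    proof (rule LSf.integrable_const_bound[where B=C])
      show "AE x in ?L \<Otimes>\<^sub>M S2. norm (case x of (s, m) \<Rightarrow> k s m) \<le> C"
      proof -
        have Lt: "AE s in ?L. s \<in> {0..t}"
          by (auto simp: AE_density intro!: AE_I2 split: split_indicator_asm)
        have "AE x in ?L \<Otimes>\<^sub>M S2. fst x \<in> {0..t}"
        proof (rule LS.AE_pair_measure)
          show "{x \<in> space (?L \<Otimes>\<^sub>M S2). fst x \<in> {0..t}} \<in> sets (?L \<Otimes>\<^sub>M S2)" by measurable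
          show "AE x in ?L. AE y in S2. fst (x, y) \<in> {0..t}"
            using Lt by (rule AE_mp) (auto intro!: AE_I2)
        qed
        then show ?thesis by (rule AE_mp) (use C in \<open>auto intro!: AE_I2 simp: space_pair_measure\<close>)
      qed
    qed measurable
    have ps: "p (R t m) - p m = (LINT s|?L. k s m)" for m
    proof -
      have ckm: "continuous_on UNIV (\<lambda>s. k s m)"
      proof -
        have "continuous_on UNIV (\<lambda>s::real. (s, m))" by (intro continuous_intros)
        from continuous_on_compose2[OF ck this] show ?thesis by simp
      qed
      have "(LINT s|?L. k s m) = (LINT s|lborel. indicator {0..t} s *\<^sub>R k s m)"
        by (rule integral_density) (auto intro!: borel_measurable_continuous_onI ckm)
      also have "\<dots> = p (R t m) - p (R 0 m)"
        using t by (intro integral_FTC_atLeastAtMost dk continuous_on_subset[OF ckm]) auto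
      finally show ?thesis by (simp add: R0)
    qed
    have ip: "integrable S2 p" "integrable S2 (\<lambda>m. p (R t m))"
    proof -
      have c: "continuous_on UNIV p" using p by (simp add: continuous_on_polymonial_function real_polynomial_function_eq)
      then show "integrable S2 p" by (intro continuous_on_sphere_integrable_S2) (auto intro: continuous_on_subset)
      show "integrable S2 (\<lambda>m. p (R t m))"
        by (intro continuous_on_sphere_integrable_S2 continuous_on_compose2[OF c] linear_continuous_on lin) auto
    qed
    have "(LINT m|S2. p (R t m)) - (LINT m|S2. p m) = (LINT m|S2. p (R t m) - p m)"
      using ip by simp
    also have "\<dots> = (LINT m|S2. LINT s|?L. k s m)" by (simp add: ps)
    also have "\<dots> = (LINT s|?L. LINT m|S2. k s m)" by (rule LS.Fubini_integral[OF int])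
    also have "\<dots> = 0" by (simp add: zero)
    finally show ?thesis by simp
  qed
  have poly': "(LINT m|S2. p (R t m)) = (LINT m|S2. p m)" if p: "real_polynomial_function p" for p t
  proof (cases "t \<ge> 0")
    case False
    have q: "real_polynomial_function (p \<circ> R t)"
      by (intro real_polynomial_function_compose polynomial_function_bounded_linear lin p)
    have "R t (R (- t) m) = m" for m using flow[of t "- t" m] by (simp add: R0)
    then show ?thesis using poly[OF q, of "-t"] False by simp
  qed (use poly p in auto)
  have bm: "R t \<in> S2 \<rightarrow>\<^sub>M borel" using measurable_compose[OF meas measurable_S2_borel] .
  have eq: "distr S2 borel (R t) = distr S2 borel (\<lambda>m. m)"
  proof (rule finite_measure_eqI_polynomials[OF _ _ _ _ compact_sphere[of 0 1]])
    fix p :: "real^3 \<Rightarrow> real" assume p: "real_polynomial_function p"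
    show "(LINT x|distr S2 borel (R t). p x) = (LINT x|distr S2 borel (\<lambda>m. m). p x)"
      using real_poly_measurable[OF p] poly'[OF p] bm by (simp add: integral_distr)
  qed (use bm sph in \<open>auto intro!: S2.finite_measure_distr AE_I2 simp: AE_distr_iff\<close>)
  show ?thesis
  proof (rule measure_eqI)
    fix B assume "B \<in> sets (distr S2 S2 (R t))"
    then have BS: "B \<in> sets S2" by simp
    then obtain B' where B': "B' \<in> sets borel" "B = B' \<inter> sphere 0 1"
      unfolding sets_S2 sets_restrict_space by auto
    have "emeasure (distr S2 S2 (R t)) B = emeasure S2 (R t -` B \<inter> sphere 0 1)"
      using BS by (simp add: emeasure_distr)
    also have "R t -` B \<inter> sphere 0 1 = R t -` B' \<inter> sphere 0 1" using B'(2) sph by auto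
    also have "emeasure S2 \<dots> = emeasure (distr S2 borel (R t)) B'"
      using B' bm by (simp add: emeasure_distr)
    also have "\<dots> = emeasure S2 B" unfolding eq using B' by (simp add: emeasure_distr)
    finally show "emeasure (distr S2 S2 (R t)) B = emeasure S2 B" .
  qed simp
qed

definition rotz :: "real \<Rightarrow> real^3 \<Rightarrow> real^3" where
  "rotz t v = vector [cos t * v$1 - sin t * v$2, sin t * v$1 + cos t * v$2, v$3]"

definition roty :: "real \<Rightarrow> real^3 \<Rightarrow> real^3" where
  "roty t v = vector [cos t * v$1 + sin t * v$3, v$2, cos t * v$3 - sin t * v$1]"

lemma linear_rotz: "linear (rotz t)" and linear_roty: "linear (roty t)"
  by (auto intro!: linearI simp: rotz_def roty_def vec_eq_iff forall_3 algebra_simps)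

lemma inner_rotz: "rotz t v \<bullet> rotz t w = v \<bullet> w"
  and inner_roty: "roty t v \<bullet> roty t w = v \<bullet> w"
proof -
  have r: "cos t * cos t = 1 - sin t * sin t" using sin_cos_squared_add[of t] by (simp add: power2_eq_square)
  show "rotz t v \<bullet> rotz t w = v \<bullet> w"
    unfolding inner_vec_def sum_3 rotz_def vector_3 inner_real_def using r by algebra
  show "roty t v \<bullet> roty t w = v \<bullet> w"
    unfolding inner_vec_def sum_3 roty_def vector_3 inner_real_def using r by algebra
qed

lemma cross3_rotz: "cross3 (rotz t v) (rotz t w) = rotz t (cross3 v w)"
  and cross3_roty: "cross3 (roty t v) (roty t w) = roty t (cross3 v w)"
proof -
  have r: "cos t * cos t = 1 - sin t * sin t" using sin_cos_squared_add[of t] by (simp add: power2_eq_square)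
  show "cross3 (rotz t v) (rotz t w) = rotz t (cross3 v w)"
    unfolding vec_eq_iff forall_3 cross_components rotz_def vector_3
    by (intro conjI) (use r in algebra | simp add: algebra_simps)+
  show "cross3 (roty t v) (roty t w) = roty t (cross3 v w)"
    unfolding vec_eq_iff forall_3 cross_components roty_def vector_3
    by (intro conjI) (use r in algebra | simp add: algebra_simps)+
qed

lemma rotz_add: "rotz (s + r) m = rotz s (rotz r m)" and roty_add: "roty (s + r) m = roty s (roty r m)"
  by (auto simp: rotz_def roty_def vec_eq_iff forall_3 cos_add sin_add algebra_simps)

lemma rotz_0 [simp]: "rotz 0 m = m" and roty_0 [simp]: "roty 0 m = m"
  by (auto simp: rotz_def roty_def vec_eq_iff forall_3)

lemma norm_rotz [simp]: "norm (rotz t v) = norm v" and norm_roty [simp]: "norm (roty t v) = norm v"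
  by (simp_all add: norm_eq_sqrt_inner inner_rotz inner_roty)

lemma distr_S2_rotz: "distr S2 S2 (rotz t) = S2"
proof (rule rotation_flow_invariant[where e = "axis 3 1"])
  have e: "rotz t m = (cos t * m$1 - sin t * m$2) *\<^sub>R axis 1 1 + (sin t * m$1 + cos t * m$2) *\<^sub>R axis 2 1
      + m$3 *\<^sub>R axis 3 1" for t m
    by (simp add: rotz_def vec_eq_iff forall_3 axis_def)
  show "((\<lambda>r. rotz r m) has_vector_derivative cross3 (axis 3 1) m) (at 0)" for m
  proof -
    have "((\<lambda>r. rotz r m) has_vector_derivative (- m$2) *\<^sub>R axis 1 1 + m$1 *\<^sub>R axis 2 1) (at 0)"
      unfolding e by (auto intro!: derivative_eq_intros simp: has_vector_derivative_def algebra_simps)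
    also have "(- m$2) *\<^sub>R axis 1 1 + m$1 *\<^sub>R axis 2 1 = cross3 (axis 3 1) m"
      by (simp add: vec_eq_iff forall_3 cross_components axis_def)
    finally show ?thesis .
  qed
  show "continuous_on UNIV (\<lambda>(s, m). rotz s m)"
    unfolding split_beta' e by (intro continuous_intros)
qed (auto simp: rotz_add linear_rotz linear_conv_bounded_linear[symmetric])

lemma distr_S2_roty: "distr S2 S2 (roty t) = S2"
proof (rule rotation_flow_invariant[where e = "axis 2 1"])
  have e: "roty t m = (cos t * m$1 + sin t * m$3) *\<^sub>R axis 1 1 + m$2 *\<^sub>R axis 2 1
      + (cos t * m$3 - sin t * m$1) *\<^sub>R axis 3 1" for t m
    by (simp add: roty_def vec_eq_iff forall_3 axis_def)
  show "((\<lambda>r. roty r m) has_vector_derivative cross3 (axis 2 1) m) (at 0)" for m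
  proof -
    have "((\<lambda>r. roty r m) has_vector_derivative (m$3) *\<^sub>R axis 1 1 + (- m$1) *\<^sub>R axis 3 1) (at 0)"
      unfolding e by (auto intro!: derivative_eq_intros simp: has_vector_derivative_def algebra_simps)
    also have "(m$3) *\<^sub>R axis 1 1 + (- m$1) *\<^sub>R axis 3 1 = cross3 (axis 2 1) m"
      by (simp add: vec_eq_iff forall_3 cross_components axis_def)
    finally show ?thesis .
  qed
  show "continuous_on UNIV (\<lambda>(s, m). roty s m)"
    unfolding split_beta' e by (intro continuous_intros)
qed (auto simp: roty_add linear_roty linear_conv_bounded_linear[symmetric])

lemma unit_circle_angle:
  fixes x y r :: real
  assumes "x\<^sup>2 + y\<^sup>2 = r\<^sup>2"
  shows "\<exists>t. x = r * cos t \<and> y = r * sin t"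
proof (cases "r = 0")
  case True
  then show ?thesis using assms by (auto simp: sum_power2_eq_zero_iff)
next
  case False
  then have "(x / r)\<^sup>2 + (y / r)\<^sup>2 = 1" using assms by (simp add: power_divide add_divide_distrib[symmetric])
  then obtain t where "x / r = cos t" "y / r = sin t" using sincos_total_2pi by metis
  then show ?thesis using False by (auto simp: field_simps intro!: exI[of _ t])
qed

lemma ex_sph:
  assumes "norm v = 1" shows "\<exists>b a. v = sph b a"
proof -
  have "(v$1)\<^sup>2 + (v$2)\<^sup>2 + (v$3)\<^sup>2 = 1"
    using assms power2_norm_eq_inner[of v] by (simp add: inner_vec_def sum_3 power2_eq_square)
  then have *: "(sqrt ((v$1)\<^sup>2 + (v$2)\<^sup>2))\<^sup>2 + (v$3)\<^sup>2 = 1\<^sup>2" by simp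
  from unit_circle_angle[of "v$3" "sqrt ((v$1)\<^sup>2 + (v$2)\<^sup>2)" 1] *
  obtain b where b: "v$3 = cos b" "sqrt ((v$1)\<^sup>2 + (v$2)\<^sup>2) = sin b" by (auto simp: add.commute)
  then have "(v$1)\<^sup>2 + (v$2)\<^sup>2 = (sin b)\<^sup>2" by (metis real_sqrt_pow2 sum_power2_ge_zero)
  from unit_circle_angle[OF this] b(1) show ?thesis
    by (auto simp: vec_eq_iff forall_3)
qed

text \<open>Euler angles: two of the rotations bring the image of the third axis back to that axis, and what remains
is a rotation about it.  It reduces rotation invariance to one-parameter groups.\<close>

lemma rotation_matrix_eq_rotations:
  assumes A: "rotation_matrix A"
  shows "\<exists>a b c. \<forall>m. A *v m = rotz a (roty b (rotz c m))"
proof -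
  have orth: "orthogonal_transformation ((*v) A)"
    using A by (simp add: rotation_matrix_def orthogonal_transformation_matrix)
  have "norm (A *v axis 3 1) = 1" using orth by (simp add: orthogonal_transformation)
  then obtain b a where ba: "A *v axis 3 1 = sph b a" using ex_sph by blast
  \<comment> \<open>\<open>C\<close> fixes the third axis, hence it is a rotation about it.\<close>
  define C where "C = (\<lambda>m. roty (-b) (rotz (-a) (A *v m)))"
  have linC: "linear C" unfolding C_def
    using linear_compose[OF linear_compose[OF matrix_vector_mul_linear linear_rotz] linear_roty]
    by (simp add: comp_def)
  have innC: "C v \<bullet> C w = v \<bullet> w" for v w
    using orth by (simp add: C_def inner_roty inner_rotz orthogonal_transformation_def)
  have crC: "cross3 (C v) (C w) = C (cross3 v w)" for v w
    by (simp add: C_def cross3_roty cross3_rotz cross_rotation_matrix[OF A])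
  have C3: "C (axis 3 1) = axis 3 1"
  proof -
    have r: "cos b * cos b + sin b * sin b = 1" "cos a * cos a + sin a * sin a = 1"
      using sin_cos_squared_add2[of a] sin_cos_squared_add2[of b] by (simp_all add: power2_eq_square)
    have 1: "cos b * (cos a * (sin b * cos a) + sin a * (sin b * sin a)) - sin b * cos b = 0" using r by algebra
    have 2: "cos a * (sin b * sin a) - sin a * (sin b * cos a) = 0" by algebra
    have 3: "cos b * cos b + sin b * (cos a * (sin b * cos a) + sin a * (sin b * sin a)) = 1" using r by algebra
    show ?thesis using 1 2 3
      unfolding C_def ba rotz_def roty_def vec_eq_iff forall_3 by (simp add: axis_def)
  qed
  have n1: "(C (axis 1 1) $ 1)\<^sup>2 + (C (axis 1 1) $ 2)\<^sup>2 = 1\<^sup>2" and z1: "C (axis 1 1) $ 3 = 0"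
  proof -
    show z: "C (axis 1 1) $ 3 = 0"
    proof -
      have "(axis 1 1 :: real^3) $ 3 = 0" by (simp add: axis_def)
      then show ?thesis
        using innC[of "axis 1 1" "axis 3 1"] by (simp only: C3) (simp add: inner_axis)
    qed
    have "C (axis 1 1) \<bullet> C (axis 1 1) = 1" by (simp add: innC inner_axis_axis)
    then show "(C (axis 1 1) $ 1)\<^sup>2 + (C (axis 1 1) $ 2)\<^sup>2 = 1\<^sup>2"
      by (simp add: inner_vec_def sum_3 z power2_eq_square)
  qed
  obtain c where c: "C (axis 1 1) $ 1 = cos c" "C (axis 1 1) $ 2 = sin c"
    using unit_circle_angle[OF n1] by auto
  have C2: "C (axis 2 1) = cross3 (axis 3 1) (C (axis 1 1))"
    using crC[of "axis 3 1" "axis 1 1"] by (simp add: C3 cross_basis)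
  have "C m = rotz c m" for m
  proof -
    have m: "m = m$1 *\<^sub>R axis 1 1 + m$2 *\<^sub>R axis 2 1 + m$3 *\<^sub>R axis 3 1"
      by (simp add: vec_eq_iff forall_3 axis_def)
    have "C m = m$1 *\<^sub>R C (axis 1 1) + m$2 *\<^sub>R C (axis 2 1) + m$3 *\<^sub>R C (axis 3 1)"
      by (subst m) (simp only: linear_add[OF linC] linear_scale[OF linC])
    moreover have "(axis 3 1 :: real^3) $ 1 = 0" "(axis 3 1 :: real^3) $ 2 = 0" "(axis 3 1 :: real^3) $ 3 = 1"
      by (simp_all add: axis_def)
    ultimately show ?thesis
      by (simp add: C2 C3 vec_eq_iff forall_3 rotz_def cross_components c z1 algebra_simps)
  qed
  then have "A *v m = rotz a (roty b (rotz c m))" for m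
    using rotz_add[of a "-a" "A *v m"] roty_add[of b "-b" "rotz (-a) (A *v m)"]
    by (simp add: C_def flip: \<open>\<And>m. C m = rotz c m\<close>)
  then show ?thesis by blast
qed

lemma measurable_S2_S2:
  assumes "linear R" "\<And>m. norm (R m) = norm m"
  shows "R \<in> S2 \<rightarrow>\<^sub>M S2"
proof -
  have "R \<in> borel_measurable borel"
    using assms(1) by (intro borel_measurable_continuous_onI linear_continuous_on) (simp add: linear_conv_bounded_linear)
  then have "R \<in> borel_measurable S2" by measurable
  then show ?thesis unfolding measurable_cong_sets[OF refl sets_S2]
    by (rule measurable_restrict_space2[rotated]) (use assms in auto)
qed

lemma
  assumes A: "rotation_matrix A"
  shows norm_rotation_matrix: "norm (A *v m) = norm m"
    and measurable_rotation_S2: "(\<lambda>m. A *v m) \<in> S2 \<rightarrow>\<^sub>M S2"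
    and distr_S2_rotation: "distr S2 S2 (\<lambda>m. A *v m) = S2"
proof -
  obtain a b c where abc: "\<And>m. A *v m = rotz a (roty b (rotz c m))"
    using rotation_matrix_eq_rotations[OF A] by blast
  have [measurable]: "rotz t \<in> S2 \<rightarrow>\<^sub>M S2" "roty t \<in> S2 \<rightarrow>\<^sub>M S2" for t
    by (auto intro!: measurable_S2_S2 linear_rotz linear_roty)
  show "norm (A *v m) = norm m" by (simp add: abc)
  show "(\<lambda>m. A *v m) \<in> S2 \<rightarrow>\<^sub>M S2" unfolding abc by measurable
  have "distr S2 S2 (\<lambda>m. A *v m) = distr (distr (distr S2 S2 (rotz c)) S2 (roty b)) S2 (rotz a)"
    by (simp add: distr_distr measurable_comp comp_def abc)
  then show "distr S2 S2 (\<lambda>m. A *v m) = S2"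
    by (simp add: distr_S2_rotz distr_S2_roty)
qed

section \<open>Smooth cut-off functions\<close>

text \<open>Smoothness quantifies over all iterated directional derivatives; a class of differentiable
functions that is closed under directional derivatives consists of smooth functions.\<close>

lemma smooth_on_coinduct:
  fixes f :: "'a::real_normed_vector \<Rightarrow> 'b::real_normed_vector"
  assumes "C f"
    and step: "\<And>f. C f \<Longrightarrow> (\<forall>x. f differentiable (at x)) \<and> (\<forall>v. C (\<lambda>x. frechet_derivative f (at x) v))"
  shows "smooth_on UNIV f"
proof -
  have "C (iter_deriv vs f)" for vs
    by (induction vs) (use assms in auto)
  then show ?thesis using step by (auto simp: smooth_on_def)
qed

lemma iter_deriv_append: "iter_deriv vs (iter_deriv ws f) = iter_deriv (vs @ ws) f"
  by (induction vs) auto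

lemma smooth_on_derivative:
  "smooth_on S f \<Longrightarrow> smooth_on S (\<lambda>x. frechet_derivative f (at x) v)"
  using iter_deriv_append[of _ "[v]" f] by (auto simp: smooth_on_def)

lemma smooth_on_differentiable: "smooth_on S f \<Longrightarrow> x \<in> S \<Longrightarrow> f differentiable (at x)"
  using iter_deriv.simps(1)[of f] unfolding smooth_on_def by metis

text \<open>The functions \<open>p(1/t) exp(-1/t)\<close>, continued by zero, are closed under differentiation; the one with
\<open>p = 1\<close> is the usual flat function from which cut-offs are built.\<close>

definition flat :: "real poly \<Rightarrow> real \<Rightarrow> real" where
  "flat p t = (if t \<le> 0 then 0 else poly p (1 / t) * exp (- (1 / t)))"

lemma poly_exp_neg_tendsto_0: "((\<lambda>x. poly p x * exp (- x)) \<longlongrightarrow> 0) (at_top :: real filter)"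
proof -
  have "((\<lambda>x. \<Sum>i\<le>degree p. coeff p i * (x ^ i / exp x)) \<longlongrightarrow> (\<Sum>i\<le>degree p. coeff p i * 0)) (at_top :: real filter)"
    by (intro tendsto_intros tendsto_power_div_exp_0)
  moreover have "(\<lambda>x. \<Sum>i\<le>degree p. coeff p i * (x ^ i / exp x)) = (\<lambda>x. poly p x * exp (- x))"
    by (auto simp: poly_altdef sum_distrib_right exp_minus divide_inverse mult.assoc)
  ultimately show ?thesis by simp
qed

lemma DERIV_flat: "(flat p has_real_derivative flat ([:0, 0, 1:] * (p - pderiv p)) t) (at t)"
proof -
  consider "t < 0" | "t = 0" | "t > 0" by linarith
  then show ?thesis
  proof cases
    case 1
    have "((\<lambda>_. 0) has_real_derivative 0) (at t)" by simp
    then have "(flat p has_real_derivative 0) (at t)"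
      by (rule has_field_derivative_transform_within_open[where S="{..<0}"]) (use 1 in \<open>auto simp: flat_def\<close>)
    then show ?thesis using 1 by (simp add: flat_def)
  next
    case 3
    have "((\<lambda>t. poly p (1 / t) * exp (- (1 / t))) has_real_derivative
        poly ([:0, 0, 1:] * (p - pderiv p)) (1 / t) * exp (- (1 / t))) (at t)"
      using 3 by (auto intro!: derivative_eq_intros simp: field_simps power2_eq_square)
    then have "(flat p has_real_derivative poly ([:0, 0, 1:] * (p - pderiv p)) (1 / t) * exp (- (1 / t))) (at t)"
      by (rule has_field_derivative_transform_within_open[where S="{0<..}"]) (use 3 in \<open>auto simp: flat_def\<close>)
    then show ?thesis using 3 by (simp add: flat_def)
  next
    case 2
    have r: "((\<lambda>h. flat p h / h) \<longlongrightarrow> 0) (at_right 0)"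
    proof -
      have "(((\<lambda>x. poly (pCons 0 p) x * exp (- x)) \<circ> inverse) \<longlongrightarrow> 0) (at_right (0::real))"
        unfolding comp_def by (rule filterlim_compose[OF poly_exp_neg_tendsto_0 filterlim_inverse_at_top_right])
      moreover have "eventually (\<lambda>h. ((\<lambda>x. poly (pCons 0 p) x * exp (- x)) \<circ> inverse) h = flat p h / h) (at_right (0::real))"
        using eventually_at_right_less[of "0::real"] by eventually_elim (auto simp: flat_def field_simps)
      ultimately show ?thesis by (rule Lim_transform_eventually)
    qed
    have l: "((\<lambda>h. flat p h / h) \<longlongrightarrow> 0) (at_left 0)"
    proof (rule tendsto_eventually)
      show "eventually (\<lambda>h. flat p h / h = 0) (at_left (0::real))"
        by (rule eventually_mono[OF eventually_at_left_real[of "-1" 0]]) (auto simp: flat_def)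
    qed
    have "((\<lambda>h. flat p h / h) \<longlongrightarrow> 0) (at 0)"
      using filterlim_split_at[OF l r] .
    then have "(flat p has_real_derivative 0) (at 0)"
      by (simp add: DERIV_def flat_def[of p 0])
    then show ?thesis using 2 by (simp add: flat_def)
  qed
qed

text \<open>Closed under directional derivatives, which is why its members are smooth.  It contains all products of a test
function, a polynomial and a cut-off.\<close>

inductive smooth_alg :: "('a::euclidean_space \<Rightarrow> real) \<Rightarrow> bool" where
  base: "smooth_on UNIV f \<Longrightarrow> smooth_alg f"
| poly: "real_polynomial_function p \<Longrightarrow> smooth_alg p"
| flat: "real_polynomial_function q \<Longrightarrow> smooth_alg (\<lambda>x. flat p (q x))"
| add: "smooth_alg f \<Longrightarrow> smooth_alg g \<Longrightarrow> smooth_alg (\<lambda>x. f x + g x)"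
| mult: "smooth_alg f \<Longrightarrow> smooth_alg g \<Longrightarrow> smooth_alg (\<lambda>x. f x * g x)"

lemma frechet_derivativeI: "(f has_derivative F) (at x) \<Longrightarrow> frechet_derivative f (at x) = F"
  by (rule frechet_derivative_at[symmetric])

lemma smooth_alg_derivative:
  assumes "smooth_alg f"
  shows "(\<forall>x. f differentiable (at x)) \<and> (\<forall>v. smooth_alg (\<lambda>x. frechet_derivative f (at x) v))"
  using assms
proof induction
  have polyd: "\<exists>D. (\<forall>x. (p has_derivative (\<lambda>v. D x v)) (at x)) \<and> (\<forall>v. real_polynomial_function (\<lambda>x. D x v))"
    if p: "real_polynomial_function p" for p :: "'a \<Rightarrow> real"
  proof -
    obtain D where D: "polynomial_function D" "\<And>m. (p has_derivative (\<lambda>v. D m \<bullet> v)) (at m)"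
      using real_polynomial_gradient[OF p] by blast
    have "real_polynomial_function (\<lambda>x. D x \<bullet> v)" for v
      using polynomial_function_inner[OF D(1), of v] by (simp add: real_polynomial_function_eq)
    then show ?thesis using D(2) by (intro exI[of _ "\<lambda>x v. D x \<bullet> v"]) auto
  qed
  {
    case (base f)
    then show ?case
      using smooth_on_differentiable[OF base] smooth_on_derivative[OF base] smooth_alg.base by auto
  next
    case (poly p)
    from polyd[OF this] obtain D where D: "\<And>x. (p has_derivative D x) (at x)" "\<And>v. real_polynomial_function (\<lambda>x. D x v)" by auto
    show ?case
      using D by (auto simp: frechet_derivativeI[OF D(1)] intro!: smooth_alg.poly differentiableI)
  next
    case (flat q p)
    from polyd[OF this] obtain D where D: "\<And>x. (q has_derivative D x) (at x)" "\<And>v. real_polynomial_function (\<lambda>x. D x v)" by auto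
    have d: "((\<lambda>x. flat p (q x)) has_derivative (\<lambda>v. D x v * flat ([:0, 0, 1:] * (p - pderiv p)) (q x))) (at x)" for x
      using DERIV_compose_FDERIV[OF DERIV_flat D(1)] .
    show ?case
      using d smooth_alg.mult[OF smooth_alg.poly[OF D(2)] smooth_alg.flat[OF flat]]
      by (auto simp: frechet_derivativeI[OF d] intro!: differentiableI simp del: mult_pCons_left)
  next
    case (add f g)
    have d: "((\<lambda>x. f x + g x) has_derivative (\<lambda>v. frechet_derivative f (at x) v + frechet_derivative g (at x) v)) (at x)" for x
      using add.IH by (intro has_derivative_add) (auto simp: frechet_derivative_works[symmetric])
    show ?case
      using d add.IH by (auto simp: frechet_derivativeI[OF d] intro!: smooth_alg.add differentiableI)
  next
    case (mult f g)
    have d: "((\<lambda>x. f x * g x) has_derivative (\<lambda>v. f x * frechet_derivative g (at x) v + frechet_derivative f (at x) v * g x)) (at x)" for x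
      using mult.IH by (intro has_derivative_mult) (auto simp: frechet_derivative_works[symmetric])
    show ?case
      using d mult by (auto simp: frechet_derivativeI[OF d] intro!: smooth_alg.add smooth_alg.mult differentiableI)
  }
qed

lemma smooth_alg_smooth: "smooth_alg f \<Longrightarrow> smooth_on UNIV f"
  by (rule smooth_on_coinduct[of smooth_alg]) (use smooth_alg_derivative in auto)

lemma smooth_on_continuous:
  assumes "smooth_on UNIV f" shows "continuous_on UNIV f"
  using smooth_on_differentiable[OF assms] by (auto intro!: continuous_at_imp_continuous_on differentiable_imp_continuous_within)

section \<open>Weak rotational gradients on phase space\<close>

interpretation XS: pair_sigma_finite "lborel :: (real^3) measure" S2 ..

lemma space_phase [simp]: "space phase = UNIV \<times> sphere 0 1"
  by (simp add: phase_def space_pair_measure)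

lemma measurable_phase_borel: "(\<lambda>p. p) \<in> phase \<rightarrow>\<^sub>M (borel :: ((real^3) \<times> (real^3)) measure)"
proof -
  have "(\<lambda>p. (fst p, snd p)) \<in> lborel \<Otimes>\<^sub>M S2 \<rightarrow>\<^sub>M borel \<Otimes>\<^sub>M borel" by measurable
  then show ?thesis by (simp add: phase_def borel_prod)
qed

lemma borel_measurable_phase: "K \<in> borel_measurable borel \<Longrightarrow> K \<in> borel_measurable phase"
  using measurable_compose[OF measurable_phase_borel] by auto

text \<open>There is a measurable retraction of the ambient space onto the phase space, and \<open>B\<close> is a preimage under it.\<close>

lemma sets_phase_ex_borel:
  assumes "A \<in> sets phase"
  shows "\<exists>B\<in>sets borel. A = (\<lambda>p. p) -` B \<inter> space phase"
proof -
  define r :: "(real^3) \<times> (real^3) \<Rightarrow> (real^3) \<times> (real^3)"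
    where "r = (\<lambda>p. (fst p, if norm (snd p) = 1 then snd p else axis 1 1))"
  have s: "(\<lambda>p::(real^3) \<times> (real^3). if norm (snd p) = 1 then snd p else axis 1 1) \<in> borel \<Otimes>\<^sub>M borel \<rightarrow>\<^sub>M S2"
    unfolding measurable_cong_sets[OF refl sets_S2]
    by (rule measurable_restrict_space2) auto
  then have "r \<in> borel \<Otimes>\<^sub>M borel \<rightarrow>\<^sub>M phase"
    unfolding r_def phase_def by (intro measurable_Pair) (auto simp: measurable_cong_sets[OF refl sets_lborel])
  from measurable_sets[OF this assms] have "r -` A \<in> sets (borel \<Otimes>\<^sub>M borel)"
    by (simp add: space_pair_measure)
  then have "r -` A \<in> sets borel" by (simp only: borel_prod)
  moreover have "A = (\<lambda>p. p) -` (r -` A) \<inter> space phase"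
    using sets.sets_into_space[OF assms] by (auto simp: r_def)
  ultimately show ?thesis by blast
qed

lemma loc_integrable_measurable:
  assumes "loc_integrable F" shows "F \<in> borel_measurable phase"
proof (rule borel_measurable_LIMSEQ_metric)
  show "(\<lambda>p. indicator (cball 0 (real k) \<times> sphere 0 1) p *\<^sub>R F p) \<in> borel_measurable phase" for k
    using assms unfolding loc_integrable_def set_integrable_def by (intro borel_measurable_integrable) blast
  show "(\<lambda>k. indicator (cball 0 (real k) \<times> sphere 0 1) p *\<^sub>R F p) \<longlonglongrightarrow> F p" if "p \<in> space phase" for p
  proof (rule tendsto_eventually)
    obtain N :: nat where "norm (fst p) \<le> real N" using real_arch_simple by blast
    then have "indicator (cball 0 (real k) \<times> sphere 0 1) p *\<^sub>R F p = F p" if "k \<ge> N" for k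
      using \<open>p \<in> space phase\<close> that by (auto simp: indicator_def mem_Times_iff)
    then show "eventually (\<lambda>k. indicator (cball 0 (real k) \<times> sphere 0 1) p *\<^sub>R F p = F p) sequentially"
      by (auto intro: eventually_sequentiallyI)
  qed
qed

lemma cball_sphere_sets: "cball 0 r \<times> sphere 0 1 \<in> sets phase"
proof -
  have "{p \<in> space phase. norm (fst p) \<le> r} \<in> sets phase" unfolding phase_def by measurable
  moreover have "{p \<in> space phase. norm (fst p) \<le> r} = cball 0 r \<times> sphere 0 1" by auto
  ultimately show ?thesis by simp
qed

text \<open>Test functions are bounded with compact support in position, so that all pairings with locally integrable functions
exist.\<close>

lemma loc_integrable_bounded_mult:
  fixes F :: "(real^3) \<times> (real^3) \<Rightarrow> 'b::{banach, second_countable_topology}" and k :: "(real^3) \<times> (real^3) \<Rightarrow> real"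
  assumes F: "loc_integrable F" and k: "k \<in> borel_measurable phase"
    and b: "\<And>p. p \<in> space phase \<Longrightarrow> \<bar>k p\<bar> \<le> C" and z: "\<And>x m. norm x > r \<Longrightarrow> k (x, m) = 0"
  shows "integrable phase (\<lambda>p. k p *\<^sub>R F p)"
proof (rule Bochner_Integration.integrable_bound)
  show "integrable phase (\<lambda>p. C *\<^sub>R (indicator (cball 0 r \<times> sphere 0 1) p *\<^sub>R F p))"
    using F unfolding loc_integrable_def set_integrable_def by (intro integrable_scaleR_right) blast
  show "(\<lambda>p. k p *\<^sub>R F p) \<in> borel_measurable phase"
    using k loc_integrable_measurable[OF F] by measurable
  show "AE p in phase. norm (k p *\<^sub>R F p) \<le> norm (C *\<^sub>R (indicator (cball 0 r \<times> sphere 0 1) p *\<^sub>R F p))"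
  proof (rule AE_I2)
    fix p assume p: "p \<in> space phase"
    show "norm (k p *\<^sub>R F p) \<le> norm (C *\<^sub>R (indicator (cball 0 r \<times> sphere 0 1) p *\<^sub>R F p))"
    proof (cases "norm (fst p) > r")
      case True
      then show ?thesis using z[of "fst p" "snd p"] by simp
    next
      case False
      then have "indicator (cball 0 r \<times> sphere 0 1) p = (1::real)" using p by (auto simp: indicator_def mem_Times_iff)
      moreover have "\<bar>k p\<bar> \<le> \<bar>C\<bar>" using b[OF p] by linarith
      ultimately show ?thesis by (simp add: mult_right_mono)
    qed
  qed
qed

lemma loc_integrable_mult_vec:
  fixes F :: field and K :: "(real^3) \<times> (real^3) \<Rightarrow> real^3"
  assumes F: "loc_integrable F" and k: "K \<in> borel_measurable phase"
    and b: "\<And>p. p \<in> space phase \<Longrightarrow> norm (K p) \<le> C" and z: "\<And>x m. norm x > r \<Longrightarrow> K (x, m) = 0"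
  shows "integrable phase (\<lambda>p. F p *\<^sub>R K p)"
proof (rule Bochner_Integration.integrable_bound)
  have n: "(\<lambda>p. norm (K p)) \<in> borel_measurable phase" using k by measurable
  show "integrable phase (\<lambda>p. norm (K p) *\<^sub>R F p)"
    by (rule loc_integrable_bounded_mult[OF F n, of C r]) (use b z in auto)
  show "(\<lambda>p. F p *\<^sub>R K p) \<in> borel_measurable phase"
    using k loc_integrable_measurable[OF F] by measurable
  show "AE p in phase. norm (F p *\<^sub>R K p) \<le> norm (norm (K p) *\<^sub>R F p)"
    by (simp add: abs_mult)
qed

definition grad_m :: "field \<Rightarrow> (real^3) \<times> (real^3) \<Rightarrow> real^3" where
  "grad_m \<psi> = (\<lambda>p. \<chi> i. frechet_derivative \<psi> (at p) (0, axis i 1))"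

lemma classical_rot_eq: "classical_rot \<psi> (x, m) = cross3 m (grad_m \<psi> (x, m))"
  by (simp add: classical_rot_def grad_m_def)

lemma linear_grad_vec:
  fixes L :: "real^3 \<Rightarrow> real"
  assumes "linear L" shows "L v = (\<chi> i. L (axis i 1)) \<bullet> v"
proof -
  have v: "v = v$1 *\<^sub>R axis 1 1 + v$2 *\<^sub>R axis 2 1 + v$3 *\<^sub>R axis 3 1"
    by (simp add: vec_eq_iff forall_3 axis_def)
  have "L v = v$1 * L (axis 1 1) + v$2 * L (axis 2 1) + v$3 * L (axis 3 1)"
    by (subst v) (simp only: linear_add[OF assms] linear_scale[OF assms] real_scaleR_def)
  then show ?thesis by (simp add: inner_vec_def sum_3)
qed

lemma grad_m_has_derivative:
  assumes "\<psi> differentiable (at (x, m))"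
  shows "((\<lambda>m. \<psi> (x, m)) has_derivative (\<lambda>v. grad_m \<psi> (x, m) \<bullet> v)) (at m)"
proof -
  let ?D = "frechet_derivative \<psi> (at (x, m))"
  have D: "(\<psi> has_derivative ?D) (at (x, m))" using assms by (simp add: frechet_derivative_works)
  have "((\<lambda>m. (x, m)) has_derivative (\<lambda>v. (0, v))) (at m)" by (auto intro!: derivative_eq_intros)
  from has_derivative_compose[OF this D] have d: "((\<lambda>m. \<psi> (x, m)) has_derivative (\<lambda>v. ?D (0, v))) (at m)" .
  then have "linear (\<lambda>v. ?D (0, v))" by (rule has_derivative_linear)
  from linear_grad_vec[OF this] have "(\<lambda>v. ?D (0, v)) = (\<lambda>v. grad_m \<psi> (x, m) \<bullet> v)"
    unfolding grad_m_def by (rule ext)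
  with d show ?thesis by simp
qed

lemma grad_m_eqI:
  assumes "\<psi> differentiable (at (x, m))" "((\<lambda>m. \<psi> (x, m)) has_derivative (\<lambda>v. D \<bullet> v)) (at m)"
  shows "grad_m \<psi> (x, m) = D"
proof -
  have "(\<lambda>v. grad_m \<psi> (x, m) \<bullet> v) = (\<lambda>v. D \<bullet> v)"
    using has_derivative_unique[OF grad_m_has_derivative[OF assms(1)] assms(2)] .
  then show ?thesis by (metis vector_eq_rdot)
qed

lemma test_field_facts:
  assumes "test_field \<psi>"
  shows test_field_differentiable: "\<psi> differentiable (at p)"
    and test_field_continuous: "continuous_on UNIV \<psi>"
    and test_field_continuous_grad: "continuous_on UNIV (grad_m \<psi>)"
    and test_field_continuous_rot: "continuous_on UNIV (classical_rot \<psi>)"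
proof -
  have s: "smooth_on UNIV \<psi>" using assms by (simp add: test_field_def)
  show "\<psi> differentiable (at p)" using smooth_on_differentiable[OF s] by simp
  show "continuous_on UNIV \<psi>" by (rule smooth_on_continuous[OF s])
  show g: "continuous_on UNIV (grad_m \<psi>)"
    unfolding grad_m_def by (intro continuous_on_vec_lambda smooth_on_continuous smooth_on_derivative s)
  have "continuous_on UNIV (\<lambda>p. cross3 (snd p) (grad_m \<psi> p))"
    by (intro continuous_on_cross continuous_intros g)
  then show "continuous_on UNIV (classical_rot \<psi>)"
    by (simp add: classical_rot_def grad_m_def)
qed

lemma test_field_support:
  assumes "test_field \<psi>"
  obtains r where "\<And>x m. norm x > r \<Longrightarrow> \<psi> (x, m) = 0" "\<And>x m. norm x > r \<Longrightarrow> grad_m \<psi> (x, m) = 0"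
proof -
  obtain r where r: "\<And>x m. norm x > r \<Longrightarrow> \<psi> (x, m) = 0" using assms by (auto simp: test_field_def)
  have "grad_m \<psi> (x, m) = 0" if "norm x > r" for x m
    by (rule grad_m_eqI[OF test_field_differentiable[OF assms]]) (simp add: r[OF that])
  then show ?thesis using r that by blast
qed

lemma continuous_compact_support_bounded:
  fixes K :: "(real^3) \<times> (real^3) \<Rightarrow> 'b::real_normed_vector"
  assumes "continuous_on UNIV K" "\<And>x m. norm x > r \<Longrightarrow> K (x, m) = 0"
  obtains C where "\<And>p. p \<in> space phase \<Longrightarrow> norm (K p) \<le> C"
proof -
  have "bounded (K ` (cball 0 r \<times> sphere 0 1))"
    by (intro compact_imp_bounded compact_continuous_image continuous_on_subset[OF assms(1)] compact_Times) auto
  then obtain C where C: "\<And>p. p \<in> cball 0 r \<times> sphere 0 1 \<Longrightarrow> norm (K p) \<le> C"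
    by (auto simp: bounded_iff)
  have "norm (K p) \<le> max C 0" if p: "p \<in> space phase" for p
  proof (cases "norm (fst p) > r")
    case True
    then show ?thesis using assms(2)[of "fst p" "snd p"] by simp
  next
    case False
    then have "p \<in> cball 0 r \<times> sphere 0 1" using p by (auto simp: mem_Times_iff)
    from C[OF this] show ?thesis by linarith
  qed
  then show ?thesis using that by blast
qed

lemma weak_rot_integrable:
  assumes "test_field \<psi>"
  shows "loc_integrable F \<Longrightarrow> integrable phase (\<lambda>p. F p *\<^sub>R classical_rot \<psi> p)"
    and "loc_integrable (G :: (real^3) \<times> (real^3) \<Rightarrow> 'b::{banach, second_countable_topology}) \<Longrightarrow> integrable phase (\<lambda>p. \<psi> p *\<^sub>R G p)"
proof -
  obtain r where r: "\<And>x m. norm x > r \<Longrightarrow> \<psi> (x, m) = 0" "\<And>x m. norm x > r \<Longrightarrow> grad_m \<psi> (x, m) = 0"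
    using test_field_support[OF assms] by metis
  have z: "classical_rot \<psi> (x, m) = 0" if "norm x > r" for x m
    by (simp add: classical_rot_eq r[OF that])
  note c = test_field_continuous_rot[OF assms] test_field_continuous[OF assms]
  obtain C where C: "\<And>p. p \<in> space phase \<Longrightarrow> norm (classical_rot \<psi> p) \<le> C"
    using continuous_compact_support_bounded[OF c(1) z] by metis
  obtain C' where C': "\<And>p. p \<in> space phase \<Longrightarrow> norm (\<psi> p) \<le> C'"
    using continuous_compact_support_bounded[OF c(2) r(1)] by metis
  show "loc_integrable F \<Longrightarrow> integrable phase (\<lambda>p. F p *\<^sub>R classical_rot \<psi> p)"
    by (rule loc_integrable_mult_vec[where C=C and r=r]) (auto intro!: borel_measurable_phase borel_measurable_continuous_onI c C z)
  show "loc_integrable G \<Longrightarrow> integrable phase (\<lambda>p. \<psi> p *\<^sub>R G p)"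
    by (rule loc_integrable_bounded_mult[where C=C' and r=r])
      (use C' in \<open>auto intro!: borel_measurable_phase borel_measurable_continuous_onI c r\<close>)
qed

lemma test_field_mult:
  assumes "test_field \<psi>" "smooth_alg P"
  shows "test_field (\<lambda>p. \<psi> p * P p)"
proof -
  have "smooth_on UNIV (\<lambda>p. \<psi> p * P p)"
    using assms smooth_alg_smooth[OF smooth_alg.mult[OF smooth_alg.base assms(2)]] unfolding test_field_def by blast
  moreover obtain r where "\<And>x m. norm x > r \<Longrightarrow> \<psi> (x, m) = 0" using assms unfolding test_field_def by blast
  ultimately show ?thesis unfolding test_field_def by (intro conjI exI[of _ r]) auto
qed

definition cutoff :: "real \<Rightarrow> field" where
  "cutoff r = (\<lambda>p. flat 1 (r\<^sup>2 - fst p \<bullet> fst p))"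

lemma test_field_cutoff: "test_field (cutoff r)"
proof -
  have "polynomial_function (fst :: (real^3) \<times> (real^3) \<Rightarrow> real^3)"
    by (intro polynomial_function_bounded_linear bounded_linear_fst)
  then have "real_polynomial_function (\<lambda>p::(real^3) \<times> (real^3). fst p \<bullet> i)" for i
    unfolding real_polynomial_function_eq by (rule polynomial_function_inner)
  then have "real_polynomial_function (\<lambda>p::(real^3) \<times> (real^3). fst p \<bullet> fst p)"
    unfolding euclidean_inner[of "fst _" "fst _"]
    by (intro real_polynomial_function_sum real_polynomial_function.intros(4)) auto
  then have "smooth_on UNIV (cutoff r)"
    unfolding cutoff_def
    by (intro smooth_alg_smooth smooth_alg.flat real_polynomial_function_diff real_polynomial_function.intros(2))
  moreover have "cutoff r (x, m) = 0" if "norm x > \<bar>r\<bar>" for x m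
  proof -
    have "r\<^sup>2 \<le> (norm x)\<^sup>2" using that by (intro power2_le_iff_abs_le[THEN iffD2]) auto
    then show ?thesis by (simp add: cutoff_def flat_def power2_norm_eq_inner)
  qed
  ultimately show ?thesis unfolding test_field_def by blast
qed

lemma cutoff_pos: "norm x < r \<Longrightarrow> cutoff r (x, m) > 0"
  by (auto simp: cutoff_def flat_def power2_norm_eq_inner[symmetric] not_le power_strict_mono)

lemma cutoff_eq_0: "norm x > \<bar>r\<bar> \<Longrightarrow> cutoff r (x, m) = 0"
proof -
  assume "norm x > \<bar>r\<bar>"
  then have "r\<^sup>2 \<le> (norm x)\<^sup>2" by (intro power2_le_iff_abs_le[THEN iffD2]) auto
  then show ?thesis by (simp add: cutoff_def flat_def power2_norm_eq_inner)
qed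

text \<open>Polynomials times a cut-off are test functions, so the difference of two weak gradients, times
a cut-off, is orthogonal to all polynomials.\<close>

lemma weak_rot_unique:
  assumes "has_weak_rot F G1" "has_weak_rot F G2"
  shows "AE p in phase. G1 p = G2 p"
proof -
  have L: "loc_integrable G1" "loc_integrable G2" using assms by (auto simp: has_weak_rot_def)
  have z: "AE p in phase. cutoff (real k) p * ((G1 p - G2 p) $ i) = 0" for k :: nat and i
  proof (rule AE_zero_if_orthogonal_polynomials[where T="\<lambda>p. p" and K="cball 0 (real k) \<times> sphere 0 1"])
    have i1: "integrable phase (\<lambda>p. \<psi> p *\<^sub>R G1 p)" "integrable phase (\<lambda>p. \<psi> p *\<^sub>R G2 p)" if "test_field \<psi>" for \<psi>
      using weak_rot_integrable(2)[OF that] L by auto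
    have i2: "integrable phase (\<lambda>p. \<psi> p *\<^sub>R (G1 p - G2 p))" and i3: "(LINT p|phase. \<psi> p *\<^sub>R (G1 p - G2 p)) = 0"
      if "test_field \<psi>" for \<psi>
      using i1[OF that] assms that by (auto simp: has_weak_rot_def scaleR_diff_right)
    have bl: "bounded_linear (\<lambda>v::real^3. v $ i)" by (rule bounded_linear_vec_nth)
    show "integrable phase (\<lambda>p. cutoff (real k) p * ((G1 p - G2 p) $ i))"
      using integrable_bounded_linear[OF bl i2[OF test_field_cutoff]] by simp
    fix p :: "(real^3) \<times> (real^3) \<Rightarrow> real" assume p: "real_polynomial_function p"
    have t: "test_field (\<lambda>q. cutoff (real k) q * p q)"
      by (intro test_field_mult test_field_cutoff smooth_alg.poly p)
    have "(LINT q|phase. p q * (cutoff (real k) q * ((G1 q - G2 q) $ i))) = (LINT q|phase. ((cutoff (real k) q * p q) *\<^sub>R (G1 q - G2 q)) $ i)"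
      by (intro Bochner_Integration.integral_cong) auto
    also have "\<dots> = (LINT q|phase. ((cutoff (real k) q * p q) *\<^sub>R (G1 q - G2 q))) $ i"
      by (rule integral_bounded_linear[OF bl i2[OF t]])
    finally show "(LINT q|phase. p q * (cutoff (real k) q * ((G1 q - G2 q) $ i))) = 0"
      by (simp add: i3[OF t])
  next
    fix p assume "p \<in> space phase" "cutoff (real k) p * ((G1 p - G2 p) $ i) \<noteq> 0"
    then show "p \<in> cball 0 (real k) \<times> sphere 0 1"
      using cutoff_eq_0[of "real k" "fst p" "snd p"] by (cases "real k < norm (fst p)") (auto simp: mem_Times_iff)
  next
    show "(\<lambda>p. p) \<in> borel_measurable phase" by (rule measurable_phase_borel)
    show "compact (cball 0 (real k) \<times> sphere 0 1 :: ((real^3) \<times> (real^3)) set)" by (intro compact_Times) auto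
  qed (rule sets_phase_ex_borel)
  then have "AE p in phase. \<forall>k i. cutoff (real k) p * ((G1 p - G2 p) $ i) = 0"
    unfolding AE_all_countable by blast
  then show ?thesis
  proof (rule AE_mp, intro AE_I2 impI)
    fix p assume *: "\<forall>k i. cutoff (real k) p * ((G1 p - G2 p) $ i) = 0"
    obtain k :: nat where "norm (fst p) < real k" using reals_Archimedean2 by blast
    from cutoff_pos[OF this, of "snd p"] * show "G1 p = G2 p"
      unfolding vec_eq_iff by (metis less_irrefl mult_eq_0_iff prod.collapse right_minus_eq vector_minus_component)
  qed
qed

lemma loc_integrable_add: "loc_integrable F \<Longrightarrow> loc_integrable G \<Longrightarrow> loc_integrable (\<lambda>p. F p + G p)"
  by (auto simp: loc_integrable_def intro: set_integral_add)

lemma cball_sphere_measurable: "(\<lambda>p. indicator (cball 0 r \<times> sphere 0 1) p :: real) \<in> borel_measurable phase"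
  by (rule borel_measurable_indicator[OF cball_sphere_sets])

lemma loc_integrable_scale_bounded:
  fixes F :: "(real^3) \<times> (real^3) \<Rightarrow> 'b::{banach, second_countable_topology}" and k :: "(real^3) \<times> (real^3) \<Rightarrow> real"
  assumes F: "loc_integrable F" and k[measurable]: "k \<in> borel_measurable phase"
    and b: "\<And>p. p \<in> space phase \<Longrightarrow> \<bar>k p\<bar> \<le> C"
  shows "loc_integrable (\<lambda>p. k p *\<^sub>R F p)"
  unfolding loc_integrable_def set_integrable_def
proof
  fix r :: real
  have "integrable phase (\<lambda>p. (indicator (cball 0 r \<times> sphere 0 1) p * k p) *\<^sub>R F p)"
  proof (rule loc_integrable_bounded_mult[OF F, where C="\<bar>C\<bar>" and r=r])
    show "(\<lambda>p. indicator (cball 0 r \<times> sphere 0 1) p * k p) \<in> borel_measurable phase"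
      using cball_sphere_measurable by measurable
    show "\<bar>indicator (cball 0 r \<times> sphere 0 1) p * k p\<bar> \<le> \<bar>C\<bar>" if "p \<in> space phase" for p
      using b[OF that] by (auto simp: indicator_def)
  qed (auto simp: indicator_def)
  then show "integrable phase (\<lambda>x. indicat_real (cball 0 r \<times> sphere 0 1) x *\<^sub>R k x *\<^sub>R F x)" by simp
qed

lemma loc_integrable_scale_bounded_vec:
  fixes F :: field and K :: "(real^3) \<times> (real^3) \<Rightarrow> real^3"
  assumes F: "loc_integrable F" and k[measurable]: "K \<in> borel_measurable phase"
    and b: "\<And>p. p \<in> space phase \<Longrightarrow> norm (K p) \<le> C"
  shows "loc_integrable (\<lambda>p. F p *\<^sub>R K p)"
  unfolding loc_integrable_def set_integrable_def
proof
  fix r :: real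
  have "integrable phase (\<lambda>p. F p *\<^sub>R (indicator (cball 0 r \<times> sphere 0 1) p *\<^sub>R K p))"
  proof (rule loc_integrable_mult_vec[OF F, where C="\<bar>C\<bar>" and r=r])
    show "(\<lambda>p. indicator (cball 0 r \<times> sphere 0 1) p *\<^sub>R K p) \<in> borel_measurable phase"
      using cball_sphere_measurable by measurable
    show "norm (indicator (cball 0 r \<times> sphere 0 1) p *\<^sub>R K p) \<le> \<bar>C\<bar>" if "p \<in> space phase" for p
      using b[OF that] by (auto simp: indicator_def)
  qed (auto simp: indicator_def)
  then show "integrable phase (\<lambda>x. indicat_real (cball 0 r \<times> sphere 0 1) x *\<^sub>R F x *\<^sub>R K x)"
    by (simp add: mult.commute)
qed

lemma has_weak_rot_add:
  assumes "has_weak_rot F1 G1" "has_weak_rot F2 G2"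
  shows "has_weak_rot (\<lambda>p. F1 p + F2 p) (\<lambda>p. G1 p + G2 p)"
  unfolding has_weak_rot_def
proof (intro conjI allI impI)
  have L: "loc_integrable F1" "loc_integrable F2" "loc_integrable G1" "loc_integrable G2"
    using assms by (auto simp: has_weak_rot_def)
  then show "loc_integrable (\<lambda>p. F1 p + F2 p)" "loc_integrable (\<lambda>p. G1 p + G2 p)"
    by (auto intro: loc_integrable_add)
  fix \<psi> assume t: "test_field \<psi>"
  show "(LINT p|phase. (F1 p + F2 p) *\<^sub>R classical_rot \<psi> p) = - (LINT p|phase. \<psi> p *\<^sub>R (G1 p + G2 p))"
    using weak_rot_integrable(1)[OF t L(1)] weak_rot_integrable(1)[OF t L(2)]
      weak_rot_integrable(2)[OF t L(3)] weak_rot_integrable(2)[OF t L(4)] assms t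
    by (simp add: has_weak_rot_def scaleR_add_left scaleR_add_right)
qed

lemma
  fixes I :: "(real^3) \<times> (real^3) \<Rightarrow> 'b::{banach, second_countable_topology}"
  assumes "integrable phase I"
  shows phase_AE_slice_integrable: "AE x in lborel. integrable S2 (\<lambda>m. I (x, m))"
    and phase_integrable_slice: "integrable lborel (\<lambda>x. LINT m|S2. I (x, m))"
    and phase_integral: "(LINT p|phase. I p) = (LINT x|lborel. LINT m|S2. I (x, m))"
  using XS.AE_integrable_fst'[of I] XS.integrable_fst'[of I] XS.integral_fst'[of I] assms
  by (auto simp: phase_def)

text \<open>On every slice the two integrands add up to the rotational gradient of \<open>w \<psi>\<close>, whose integral over the sphere vanishes.
The argument never differentiates in \<open>x\<close>, so it applies to potentials that depend on \<open>x\<close> through merely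
measurable functions such as \<open>n\<close>.\<close>

lemma has_weak_rot_classical:
  assumes LF: "loc_integrable F" and LG: "loc_integrable (\<lambda>p. cross3 (snd p) (D (fst p) (snd p)))"
    and d: "\<And>x m. norm m = 1 \<Longrightarrow> (w x has_derivative (\<lambda>v. D x m \<bullet> v)) (at m)"
    and eq: "\<And>x m. norm m = 1 \<Longrightarrow> F (x, m) = w x m"
    and c: "\<And>x. continuous_on (sphere 0 1) (D x)"
  shows "has_weak_rot F (\<lambda>p. cross3 (snd p) (D (fst p) (snd p)))"
  unfolding has_weak_rot_def
proof (intro conjI LF LG allI impI)
  fix \<psi> assume t: "test_field \<psi>"
  have "((LINT p|phase. F p *\<^sub>R classical_rot \<psi> p) + (LINT p|phase. \<psi> p *\<^sub>R cross3 (snd p) (D (fst p) (snd p))))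
      = (LINT p|phase. F p *\<^sub>R classical_rot \<psi> p + \<psi> p *\<^sub>R cross3 (snd p) (D (fst p) (snd p)))"
    using weak_rot_integrable(1)[OF t LF] weak_rot_integrable(2)[OF t LG] by simp
  also have "\<dots> = (LINT x|lborel. LINT m|S2. F (x, m) *\<^sub>R classical_rot \<psi> (x, m) + \<psi> (x, m) *\<^sub>R cross3 m (D x m))"
    using weak_rot_integrable(1)[OF t LF] weak_rot_integrable(2)[OF t LG] by (subst phase_integral) auto
  also have "\<dots> = (LINT x|(lborel :: (real^3) measure). (0 :: real^3))"
  proof (rule Bochner_Integration.integral_cong[OF refl])
    fix x :: "real^3"
    have "(LINT m|S2. F (x, m) *\<^sub>R classical_rot \<psi> (x, m) + \<psi> (x, m) *\<^sub>R cross3 m (D x m))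
       = (LINT m|S2. cross3 m (w x m *\<^sub>R grad_m \<psi> (x, m) + \<psi> (x, m) *\<^sub>R D x m))"
      by (intro Bochner_Integration.integral_cong)
        (auto simp: classical_rot_eq eq cross_add_right cross_mult_right)
    also have "\<dots> = 0"
    proof (rule integral_rot_S2_eq_0[where w="\<lambda>m. w x m * \<psi> (x, m)"])
      show "((\<lambda>m. w x m * \<psi> (x, m)) has_derivative (\<lambda>v. (w x m *\<^sub>R grad_m \<psi> (x, m) + \<psi> (x, m) *\<^sub>R D x m) \<bullet> v)) (at m)"
        if "m \<in> sphere 0 1" for m
        using that has_derivative_mult[OF d grad_m_has_derivative[OF test_field_differentiable[OF t]], of m x x]
        by (simp add: inner_add_left algebra_simps)
      have "continuous_on (sphere 0 1) (\<lambda>m. (x, m))" by (intro continuous_intros)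
      note cc = continuous_on_compose2[OF test_field_continuous[OF t] this] continuous_on_compose2[OF test_field_continuous_grad[OF t] this]
      have "continuous_on (sphere 0 1) (w x)"
        by (rule continuous_at_imp_continuous_on) (use has_derivative_continuous[OF d] in simp)
      then show "continuous_on (sphere 0 1) (\<lambda>m. w x m *\<^sub>R grad_m \<psi> (x, m) + \<psi> (x, m) *\<^sub>R D x m)"
        using cc c by (intro continuous_intros) auto
    qed
    finally show "(LINT m|S2. F (x, m) *\<^sub>R classical_rot \<psi> (x, m) + \<psi> (x, m) *\<^sub>R cross3 m (D x m)) = 0" .
  qed
  finally show "(LINT p|phase. F p *\<^sub>R classical_rot \<psi> p) = - (LINT p|phase. \<psi> p *\<^sub>R cross3 (snd p) (D (fst p) (snd p)))"
    by (simp add: eq_neg_iff_add_eq_0)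
qed

section \<open>Slices of weak rotational gradients\<close>

definition gradient :: "(real^3 \<Rightarrow> real) \<Rightarrow> real^3 \<Rightarrow> real^3" where
  "gradient w m = (\<chi> i. frechet_derivative w (at m) (axis i 1))"

lemma gradient_eqI:
  assumes "(w has_derivative (\<lambda>v. D \<bullet> v)) (at m)" shows "gradient w m = D"
  unfolding gradient_def frechet_derivativeI[OF assms] by (simp add: vec_eq_iff inner_axis)

lemma real_polynomial_has_gradient:
  assumes "real_polynomial_function w"
  shows "(w has_derivative (\<lambda>v. gradient w m \<bullet> v)) (at m)"
proof -
  obtain D where D: "\<And>m. (w has_derivative (\<lambda>v. D m \<bullet> v)) (at m)"
    using real_polynomial_gradient[OF assms] by blast
  show ?thesis unfolding gradient_eqI[OF D] by (rule D)
qed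

text \<open>The polynomials in three variables as an explicit span of monomials.  It provides a countable family of
test functions, as is needed to exchange \<open>for all\<close> and \<open>almost everywhere\<close>.\<close>

inductive mono_span :: "(real^3 \<Rightarrow> real) \<Rightarrow> bool" where
  mono: "mono_span (\<lambda>m. m$1 ^ a * m$2 ^ b * m$3 ^ c)"
| add: "mono_span f \<Longrightarrow> mono_span g \<Longrightarrow> mono_span (\<lambda>m. f m + g m)"
| scale: "mono_span f \<Longrightarrow> mono_span (\<lambda>m. k * f m)"

lemma mono_span_mult_mono: "mono_span f \<Longrightarrow> mono_span (\<lambda>m. f m * (m$1 ^ a * m$2 ^ b * m$3 ^ c))"
proof (induction rule: mono_span.induct)
  case (mono a' b' c')
  have "(\<lambda>m::real^3. m$1 ^ a' * m$2 ^ b' * m$3 ^ c' * (m$1 ^ a * m$2 ^ b * m$3 ^ c)) =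
     (\<lambda>m. m$1 ^ (a' + a) * m$2 ^ (b' + b) * m$3 ^ (c' + c))"
    by (auto simp: power_add algebra_simps)
  then show ?case by (simp only: mono_span.mono)
next
  case (add f g)
  then show ?case by (simp only: distrib_right mono_span.add)
next
  case (scale f k)
  then show ?case by (simp only: mult.assoc mono_span.scale)
qed

lemma mono_span_mult: "mono_span g \<Longrightarrow> mono_span f \<Longrightarrow> mono_span (\<lambda>m. f m * g m)"
proof (induction rule: mono_span.induct)
  case (scale g k)
  then show ?case using mono_span.scale[of "\<lambda>m. f m * g m" k] by (simp add: mult.left_commute)
next
  case (mono a b c)
  then show ?case by (rule mono_span_mult_mono)
next
  case (add g h)
  then show ?case by (simp only: distrib_left mono_span.add)
qed

lemma real_polynomial_mono_span: "real_polynomial_function p \<Longrightarrow> mono_span p"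
proof (induction rule: real_polynomial_function.induct)
  case (linear f)
  have lf: "f v = f (axis 1 1) * v$1 + f (axis 2 1) * v$2 + f (axis 3 1) * v$3" for v
  proof -
    have "linear f" using linear by (rule bounded_linear.linear)
    from linear_grad_vec[OF this, of v] show ?thesis unfolding inner_vec_def sum_3 by simp
  qed
  have "mono_span (\<lambda>v. v$1)" "mono_span (\<lambda>v. v$2)" "mono_span (\<lambda>v. v$3)"
    using mono_span.mono[of 1 0 0] mono_span.mono[of 0 1 0] mono_span.mono[of 0 0 1] by simp_all
  then have "mono_span (\<lambda>v. f (axis 1 1) * v$1 + f (axis 2 1) * v$2 + f (axis 3 1) * v$3)"
    by (intro mono_span.add mono_span.scale)
  moreover have "(\<lambda>v. f (axis 1 1) * v$1 + f (axis 2 1) * v$2 + f (axis 3 1) * v$3) = f"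
    by (rule ext) (rule lf[symmetric])
  ultimately show ?case by simp
next
  case (const c)
  then show ?case using mono_span.scale[OF mono_span.mono[of 0 0 0], of c] by simp
next
  case (add f g)
  then show ?case by (intro mono_span.add)
next
  case (mult f g)
  then show ?case by (intro mono_span_mult)
qed

lemma mono_span_polynomial: "mono_span p \<Longrightarrow> real_polynomial_function p"
proof (induction rule: mono_span.induct)
  case (mono a b c)
  have "real_polynomial_function (\<lambda>m::real^3. m $ i)" for i
    by (intro real_polynomial_function.intros(1) bounded_linear_vec_nth)
  then show ?case by (intro real_polynomial_function.intros(4) real_polynomial_function_power)
next
  case (add f g)
  then show ?case by (intro real_polynomial_function.intros(3))
next
  case (scale f k)
  then show ?case by (intro real_polynomial_function.intros(4) real_polynomial_function.intros(2))
qed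

text \<open>The integrand of the weak identity at position \<open>x\<close> for the test function \<open>\<psi> w\<close>, where \<open>w\<close> is
a function of \<open>m\<close> only.\<close>

definition slice_term :: "field \<Rightarrow> field \<Rightarrow> ((real^3) \<times> (real^3) \<Rightarrow> real^3) \<Rightarrow> (real^3 \<Rightarrow> real) \<Rightarrow> real^3 \<Rightarrow> real^3 \<Rightarrow> real^3" where
  "slice_term \<psi> F G w x m = F (x, m) *\<^sub>R (w m *\<^sub>R classical_rot \<psi> (x, m) + \<psi> (x, m) *\<^sub>R cross3 m (gradient w m))
     + (\<psi> (x, m) * w m) *\<^sub>R G (x, m)"

lemma slice_term_add:
  assumes "real_polynomial_function v" "real_polynomial_function w"
  shows "slice_term \<psi> F G (\<lambda>m. v m + w m) x m = slice_term \<psi> F G v x m + slice_term \<psi> F G w x m"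
proof -
  have "gradient (\<lambda>m. v m + w m) m = gradient v m + gradient w m"
    by (rule gradient_eqI) (auto intro!: derivative_eq_intros real_polynomial_has_gradient assms simp: inner_add_left)
  then show ?thesis by (simp add: slice_term_def algebra_simps cross_add_right)
qed

lemma slice_term_scale:
  assumes "real_polynomial_function w"
  shows "slice_term \<psi> F G (\<lambda>m. k * w m) x m = k *\<^sub>R slice_term \<psi> F G w x m"
proof -
  have "gradient (\<lambda>m. k * w m) m = k *\<^sub>R gradient w m"
    by (rule gradient_eqI) (auto intro!: derivative_eq_intros real_polynomial_has_gradient assms)
  then show ?thesis by (simp add: slice_term_def algebra_simps cross_mult_right)
qed

lemma real_polynomial_fst: "real_polynomial_function w \<Longrightarrow> real_polynomial_function (\<lambda>p::(real^3)\<times>(real^3). w (fst p))"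
  and real_polynomial_snd: "real_polynomial_function w \<Longrightarrow> real_polynomial_function (\<lambda>p::(real^3)\<times>(real^3). w (snd p))"
proof -
  have "polynomial_function (fst :: (real^3)\<times>(real^3) \<Rightarrow> _)" "polynomial_function (snd :: (real^3)\<times>(real^3) \<Rightarrow> _)"
    by (intro polynomial_function_bounded_linear bounded_linear_fst bounded_linear_snd)+
  note real_polynomial_function_compose[OF this(1)] real_polynomial_function_compose[OF this(2)]
  then show "real_polynomial_function w \<Longrightarrow> real_polynomial_function (\<lambda>p::(real^3)\<times>(real^3). w (fst p))"
    "real_polynomial_function w \<Longrightarrow> real_polynomial_function (\<lambda>p::(real^3)\<times>(real^3). w (snd p))"
    by (auto simp: comp_def)
qed

text \<open>Testing with \<open>\<psi>(x, m) w(m) q(x)\<close> shows that the integral over the slice is orthogonal to every polynomial \<open>q\<close>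
in the position.\<close>

lemma weak_rot_slice_poly:
  assumes wr: "has_weak_rot F G" and t: "test_field \<psi>" and w: "real_polynomial_function w"
  shows "AE x in lborel. integrable S2 (slice_term \<psi> F G w x) \<and> (LINT m|S2. slice_term \<psi> F G w x m) = 0"
proof -
  have L: "loc_integrable F" "loc_integrable G" using wr by (auto simp: has_weak_rot_def)
  define T where "T = (\<lambda>q p. \<psi> p * (w (snd p) * q (fst p)))"
  have tT: "test_field (T q)" if "real_polynomial_function q" for q
    unfolding T_def
    by (intro test_field_mult[OF t] smooth_alg.poly real_polynomial_function.intros(4) real_polynomial_fst real_polynomial_snd that w)
  have rT: "classical_rot (T q) (x, m) = q x *\<^sub>R (w m *\<^sub>R classical_rot \<psi> (x, m) + \<psi> (x, m) *\<^sub>R cross3 m (gradient w m))"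
    if "real_polynomial_function q" for q x m
  proof -
    have "grad_m (T q) (x, m) = q x *\<^sub>R (w m *\<^sub>R grad_m \<psi> (x, m) + \<psi> (x, m) *\<^sub>R gradient w m)"
    proof (rule grad_m_eqI[OF test_field_differentiable[OF tT[OF that]]])
      show "((\<lambda>m. T q (x, m)) has_derivative (\<lambda>v. (q x *\<^sub>R (w m *\<^sub>R grad_m \<psi> (x, m) + \<psi> (x, m) *\<^sub>R gradient w m)) \<bullet> v)) (at m)"
        unfolding T_def fst_conv snd_conv
        by (rule has_derivative_eq_rhs[OF has_derivative_mult[OF
              grad_m_has_derivative[OF test_field_differentiable[OF t]]
              has_derivative_mult[OF real_polynomial_has_gradient[OF w] has_derivative_const]]])
          (auto simp: fun_eq_iff inner_add_left algebra_simps)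
    qed
    then show ?thesis by (simp add: classical_rot_eq cross_mult_right cross_add_right)
  qed
  define I where "I = (\<lambda>p. slice_term \<psi> F G w (fst p) (snd p))"
  have key: "integrable phase (\<lambda>p. q (fst p) *\<^sub>R I p) \<and> (LINT p|phase. q (fst p) *\<^sub>R I p) = 0"
    if c: "real_polynomial_function q" for q
  proof -
    have e: "(\<lambda>p. q (fst p) *\<^sub>R I p) = (\<lambda>p. F p *\<^sub>R classical_rot (T q) p + T q p *\<^sub>R G p)"
    proof
      fix p :: "(real^3) \<times> (real^3)"
      have "T q p = \<psi> p * (w (snd p) * q (fst p))" by (simp add: T_def)
      then show "q (fst p) *\<^sub>R I p = F p *\<^sub>R classical_rot (T q) p + T q p *\<^sub>R G p"
        using rT[OF c, of "fst p" "snd p"] by (simp add: I_def slice_term_def algebra_simps)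
    qed
    have "integrable phase (\<lambda>p. F p *\<^sub>R classical_rot (T q) p)" "integrable phase (\<lambda>p. T q p *\<^sub>R G p)"
      using weak_rot_integrable[OF tT[OF c]] L by auto
    moreover have "(LINT p|phase. F p *\<^sub>R classical_rot (T q) p) = - (LINT p|phase. T q p *\<^sub>R G p)"
      using wr tT[OF c] unfolding has_weak_rot_def by blast
    ultimately show ?thesis unfolding e by simp
  qed
  have iI: "integrable phase I" using key[of "\<lambda>_. 1"] by auto
  obtain r where r: "\<And>x m. norm x > r \<Longrightarrow> \<psi> (x, m) = 0" "\<And>x m. norm x > r \<Longrightarrow> grad_m \<psi> (x, m) = 0"
    using test_field_support[OF t] by metis
  define B where "B = (\<lambda>x. LINT m|S2. I (x, m))"
  have iB: "integrable lborel B" unfolding B_def by (rule phase_integrable_slice[OF iI])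
  have bl: "bounded_linear (\<lambda>v::real^3. v $ i)" for i by (rule bounded_linear_vec_nth)
  have "AE x in lborel. B x $ i = 0" for i
  proof (rule AE_zero_if_orthogonal_polynomials[where T="\<lambda>x. x" and K="cball 0 r"])
    show "integrable lborel (\<lambda>x. B x $ i)" by (rule integrable_bounded_linear[OF bl iB])
    show "\<exists>B\<in>sets borel. A = (\<lambda>x. x) -` B \<inter> space lborel" if "A \<in> sets lborel" for A :: "(real^3) set"
      using that by auto
    show "x \<in> cball 0 r" if "B x $ i \<noteq> 0" for x
    proof (rule ccontr)
      assume "x \<notin> cball 0 r"
      then have "norm x > r" by simp
      then have "B x = 0" by (simp add: B_def I_def slice_term_def classical_rot_eq r)
      then show False using that by simp
    qed
    fix p :: "real^3 \<Rightarrow> real" assume p: "real_polynomial_function p"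
    have "(LINT x|lborel. LINT m|S2. p x *\<^sub>R I (x, m)) = 0"
      using key[OF p] phase_integral[of "\<lambda>y. p (fst y) *\<^sub>R I y"] by simp
    then have z: "(LINT x|lborel. p x *\<^sub>R B x) = 0" by (simp add: B_def)
    have ip: "integrable lborel (\<lambda>x. p x *\<^sub>R B x)"
      using phase_integrable_slice[OF conjunct1[OF key[OF p]]] by (simp add: B_def)
    have "(LINT x|lborel. p x * B x $ i) = (LINT x|lborel. (p x *\<^sub>R B x) $ i)" by simp
    also have "\<dots> = (LINT x|lborel. p x *\<^sub>R B x) $ i" by (rule integral_bounded_linear[OF bl ip])
    finally show "(LINT x|lborel. p x * B x $ i) = 0" using z by simp
  qed auto
  then have "AE x in lborel. \<forall>i. B x $ i = 0" unfolding AE_all_countable by blast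
  then have "AE x in lborel. B x = 0" by (simp add: vec_eq_iff)
  moreover have "AE x in lborel. integrable S2 (\<lambda>m. I (x, m))" by (rule phase_AE_slice_integrable[OF iI])
  ultimately show ?thesis by eventually_elim (simp add: B_def I_def)
qed

text \<open>The exceptional null set is the union of those of the countably many monomials; both parts of the claim are
linear in \<open>w\<close>.\<close>

lemma weak_rot_slices:
  assumes wr: "has_weak_rot F G" and t: "test_field \<psi>"
  shows "AE x in lborel. \<forall>w. real_polynomial_function w \<longrightarrow>
    integrable S2 (slice_term \<psi> F G w x) \<and> (LINT m|S2. slice_term \<psi> F G w x m) = 0"
proof -
  let ?P = "\<lambda>x w. integrable S2 (slice_term \<psi> F G w x) \<and> (LINT m|S2. slice_term \<psi> F G w x m) = 0"
  have "AE x in lborel. \<forall>a b c. ?P x (\<lambda>m. m$1 ^ a * m$2 ^ b * m$3 ^ c)"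
    unfolding AE_all_countable
    using weak_rot_slice_poly[OF wr t mono_span_polynomial[OF mono_span.mono]] by blast
  then show ?thesis
  proof eventually_elim
    case (elim x)
    have "?P x w" if "mono_span w" for w
      using that
    proof (induction rule: mono_span.induct)
      case (mono a b c)
      then show ?case using elim by blast
    next
      case (add f g)
      have "slice_term \<psi> F G (\<lambda>m. f m + g m) x = (\<lambda>m. slice_term \<psi> F G f x m + slice_term \<psi> F G g x m)"
        using slice_term_add[OF add(1,2)[THEN mono_span_polynomial]] by auto
      then show ?case using add by auto
    next
      case (scale f k)
      have "slice_term \<psi> F G (\<lambda>m. k * f m) x = (\<lambda>m. k *\<^sub>R slice_term \<psi> F G f x m)"
        using slice_term_scale[OF scale(1)[THEN mono_span_polynomial]] by auto
      then show ?case using scale by auto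
    qed
    then show ?case using real_polynomial_mono_span by blast
  qed
qed

text \<open>\<open>V\<close> is the weak rotational gradient of \<open>u\<close> on the sphere, tested with polynomials.\<close>

definition slice_weak_rot :: "(real^3 \<Rightarrow> real) \<Rightarrow> (real^3 \<Rightarrow> real^3) \<Rightarrow> bool" where
  "slice_weak_rot u V \<longleftrightarrow> (\<forall>w. real_polynomial_function w \<longrightarrow>
     integrable S2 (\<lambda>m. u m *\<^sub>R cross3 m (gradient w m) + w m *\<^sub>R V m) \<and>
     (LINT m|S2. u m *\<^sub>R cross3 m (gradient w m) + w m *\<^sub>R V m) = 0)"

text \<open>Near a given \<open>x\<close> one may test with a cut-off in the position alone, which is a constant on the slice.\<close>

lemma AE_slice_weak_rot:
  assumes "has_weak_rot F G"
  shows "AE x in lborel. slice_weak_rot (\<lambda>m. F (x, m)) (\<lambda>m. G (x, m))"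
proof -
  have "AE x in lborel. \<forall>k::nat. \<forall>w. real_polynomial_function w \<longrightarrow>
    integrable S2 (slice_term (cutoff (real k)) F G w x) \<and> (LINT m|S2. slice_term (cutoff (real k)) F G w x m) = 0"
    unfolding AE_all_countable using weak_rot_slices[OF assms test_field_cutoff] by blast
  then show ?thesis
  proof eventually_elim
    case (elim x)
    obtain k :: nat where k: "norm x < real k" using reals_Archimedean2 by blast
    define c where "c = cutoff (real k) (x, 0)"
    have c: "cutoff (real k) (x, m) = c" for m by (simp add: c_def cutoff_def)
    have c0: "c > 0" using cutoff_pos[OF k] by (simp add: c_def)
    have g: "grad_m (cutoff (real k)) (x, m) = 0" for m
      by (rule grad_m_eqI[OF test_field_differentiable[OF test_field_cutoff]]) (simp add: c)
    have s: "slice_term (cutoff (real k)) F G w x = (\<lambda>m. c *\<^sub>R (F (x, m) *\<^sub>R cross3 m (gradient w m) + w m *\<^sub>R G (x, m)))" for w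
      by (auto simp: fun_eq_iff slice_term_def classical_rot_eq c g scaleR_add_right mult.commute)
    show ?case unfolding slice_weak_rot_def
    proof (intro allI impI)
      fix w :: "real^3 \<Rightarrow> real" assume "real_polynomial_function w"
      then have "integrable S2 (slice_term (cutoff (real k)) F G w x) \<and> (LINT m|S2. slice_term (cutoff (real k)) F G w x m) = 0"
        using elim by blast
      then have *: "integrable S2 (\<lambda>m. c *\<^sub>R (F (x, m) *\<^sub>R cross3 m (gradient w m) + w m *\<^sub>R G (x, m)))"
        "(LINT m|S2. c *\<^sub>R (F (x, m) *\<^sub>R cross3 m (gradient w m) + w m *\<^sub>R G (x, m))) = 0"
        unfolding s by auto
      have i: "integrable S2 (\<lambda>m. F (x, m) *\<^sub>R cross3 m (gradient w m) + w m *\<^sub>R G (x, m))"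
        using integrable_scaleR_right[of "inverse c", OF *(1)] c0 by simp
      show "integrable S2 (\<lambda>m. F (x, m) *\<^sub>R cross3 m (gradient w m) + w m *\<^sub>R G (x, m)) \<and>
        (LINT m|S2. F (x, m) *\<^sub>R cross3 m (gradient w m) + w m *\<^sub>R G (x, m)) = 0"
      proof -
        have "(LINT m|S2. c *\<^sub>R (F (x, m) *\<^sub>R cross3 m (gradient w m) + w m *\<^sub>R G (x, m)))
            = c *\<^sub>R (LINT m|S2. F (x, m) *\<^sub>R cross3 m (gradient w m) + w m *\<^sub>R G (x, m))"
          by (rule integral_scaleR_right)
        then show ?thesis using i *(2) c0 by simp
      qed
    qed
  qed
qed

section \<open>A product rule for the inverse equilibrium weight\<close>

text \<open>The Taylor polynomials of the exponential function.  Their values at \<open>- \<eta> (m \<bullet> n x)\<^sup>2\<close> are polynomials in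
\<open>m\<close>, hence admissible in \<open>weak_rot_slices\<close>.\<close>

definition exp_trunc :: "nat \<Rightarrow> real \<Rightarrow> real" where
  "exp_trunc N y = (\<Sum>j<N. y ^ j / fact j)"

lemma DERIV_exp_trunc: "(exp_trunc (Suc N) has_real_derivative exp_trunc N y) (at y)"
proof (induction N)
  case 0
  then show ?case by (simp add: exp_trunc_def)
next
  case (Suc N)
  have e: "exp_trunc (Suc (Suc N)) = (\<lambda>y. exp_trunc (Suc N) y + y ^ Suc N / fact (Suc N))"
    by (auto simp: exp_trunc_def)
  have "((\<lambda>y. y ^ Suc N / fact (Suc N)) has_real_derivative y ^ N / fact N) (at y)"
  proof -
    have f: "fact (Suc N) = (1 + real N) * fact N" by (simp add: algebra_simps)
    have "((\<lambda>y. y ^ Suc N / fact (Suc N)) has_real_derivative (real (Suc N) * y ^ N) / fact (Suc N)) (at y)"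
      by (rule DERIV_cdivide) (use DERIV_pow[of "Suc N" y UNIV] in simp)
    also have "(real (Suc N) * y ^ N) / fact (Suc N) = ((1 + real N) * y ^ N) / ((1 + real N) * fact N)"
      by (simp only: f of_nat_Suc)
    also have "\<dots> = y ^ N / fact N" by (rule mult_divide_mult_cancel_left) simp
    finally show ?thesis .
  qed
  from DERIV_add[OF Suc this] show ?case unfolding e by (simp add: exp_trunc_def)
qed

lemma abs_exp_trunc_le: "\<bar>exp_trunc N y\<bar> \<le> exp \<bar>y\<bar>"
proof -
  have "\<bar>exp_trunc N y\<bar> \<le> (\<Sum>j<N. \<bar>y\<bar> ^ j / fact j)"
    unfolding exp_trunc_def by (rule order_trans[OF sum_abs]) (simp add: power_abs)
  also have "\<dots> \<le> (\<Sum>j. \<bar>y\<bar> ^ j / fact j)"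
    by (rule sum_le_suminf) (use summable_exp[of "\<bar>y\<bar>"] in \<open>auto simp: divide_inverse mult.commute\<close>)
  also have "\<dots> = exp \<bar>y\<bar>" by (simp add: exp_def divide_inverse mult.commute)
  finally show ?thesis .
qed

lemma exp_trunc_tendsto: "(\<lambda>N. exp_trunc N y) \<longlonglongrightarrow> exp y"
  using exp_converges[of y] by (simp add: sums_def exp_trunc_def divide_inverse mult.commute)

lemma norm_cross3_le: "norm (cross3 x y) \<le> norm x * norm y"
proof -
  have "(norm (cross3 x y))\<^sup>2 \<le> (norm x * norm y)\<^sup>2"
    using norm_cross_dot[of x y] zero_le_power2[of "x \<bullet> y"] by linarith
  then show ?thesis by (rule power2_le_imp_le) simp
qed

lemma abs_inner_unit_le: "norm m = 1 \<Longrightarrow> norm n = 1 \<Longrightarrow> \<bar>m \<bullet> n\<bar> \<le> 1"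
  using Cauchy_Schwarz_ineq2[of m n] by simp

lemma measurable_fst_phase [measurable]: "fst \<in> phase \<rightarrow>\<^sub>M (borel :: (real^3) measure)"
  and measurable_snd_phase [measurable]: "snd \<in> phase \<rightarrow>\<^sub>M (borel :: (real^3) measure)"
proof -
  show "fst \<in> phase \<rightarrow>\<^sub>M (borel :: (real^3) measure)" "snd \<in> phase \<rightarrow>\<^sub>M (borel :: (real^3) measure)"
    by (intro borel_measurable_phase borel_measurable_continuous_onI continuous_intros)+
qed

lemma measurable_cross3 [measurable (raw)]:
  assumes [measurable]: "f \<in> borel_measurable M" "g \<in> borel_measurable M"
  shows "(\<lambda>x. cross3 (f x) (g x)) \<in> borel_measurable M"
proof -
  have "(\<lambda>x. cross3 (f x) (g x)) = (\<lambda>x. (f x \<bullet> axis 2 1 * (g x \<bullet> axis 3 1) - f x \<bullet> axis 3 1 * (g x \<bullet> axis 2 1)) *\<^sub>R axis 1 1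
     + (f x \<bullet> axis 3 1 * (g x \<bullet> axis 1 1) - f x \<bullet> axis 1 1 * (g x \<bullet> axis 3 1)) *\<^sub>R axis 2 1
     + (f x \<bullet> axis 1 1 * (g x \<bullet> axis 2 1) - f x \<bullet> axis 2 1 * (g x \<bullet> axis 1 1)) *\<^sub>R axis 3 1)"
    by (simp add: fun_eq_iff vec_eq_iff forall_3 cross_components inner_axis) (simp add: axis_def)
  then show ?thesis by simp
qed

text \<open>The product rule for multiplication by \<open>1 / h\<close>.  As \<open>n\<close> is only measurable, \<open>\<kappa> \<psi>\<close> is not a test function,
so the rule is proved slice by slice: on the slice at \<open>x\<close> the Taylor polynomials of \<open>\<kappa>\<close> are allowed,
and dominated convergence gives the identity for \<open>\<kappa>\<close> itself.\<close>

lemma has_weak_rot_gaussian_mult: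
  fixes n :: "real^3 \<Rightarrow> real^3" and Z \<eta> :: real
  assumes wr: "has_weak_rot F G" and n[measurable]: "n \<in> borel_measurable borel" and n1: "\<And>x. norm (n x) = 1"
  defines "\<kappa> \<equiv> \<lambda>p. Z * exp (- \<eta> * (snd p \<bullet> n (fst p))\<^sup>2)"
  shows "has_weak_rot (\<lambda>p. \<kappa> p * F p)
    (\<lambda>p. \<kappa> p *\<^sub>R G p + (F p * (\<kappa> p * (- 2 * \<eta> * (snd p \<bullet> n (fst p))))) *\<^sub>R cross3 (snd p) (n (fst p)))"
proof -
  have LF: "loc_integrable F" and LG: "loc_integrable G" using wr by (auto simp: has_weak_rot_def)
  define B where "B = \<bar>Z\<bar> * exp \<bar>\<eta>\<bar>"
  have B0: "B \<ge> 0" by (simp add: B_def)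
  define s where "s = (\<lambda>x m. m \<bullet> n x)"
  have s1: "\<bar>s x m\<bar> \<le> 1" if "norm m = 1" for x m using abs_inner_unit_le[OF that n1] by (simp add: s_def)
  have y1: "\<bar>- \<eta> * (s x m)\<^sup>2\<bar> \<le> \<bar>\<eta>\<bar>" if "norm m = 1" for x m
  proof -
    have "\<bar>\<eta>\<bar> * (s x m)\<^sup>2 \<le> \<bar>\<eta>\<bar> * 1" using s1[OF that, of x] by (intro mult_left_mono) (simp_all add: abs_square_le_1)
    then show ?thesis by (simp add: abs_mult)
  qed
  have bd: "\<bar>Z * e\<bar> \<le> B" if "\<bar>e\<bar> \<le> exp \<bar>- \<eta> * (s x m)\<^sup>2\<bar>" "norm m = 1" for e x m
  proof -
    have "\<bar>e\<bar> \<le> exp \<bar>\<eta>\<bar>" using that(1) y1[OF that(2), of x] by (meson exp_le_cancel_iff order_trans)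
    then show ?thesis by (simp add: B_def abs_mult mult_left_mono)
  qed
  have k_eq: "\<kappa> (x, m) = Z * exp (- \<eta> * (s x m)\<^sup>2)" for x m by (simp add: \<kappa>_def s_def)
  have k1: "\<bar>\<kappa> (x, m)\<bar> \<le> B" if "norm m = 1" for x m
    unfolding k_eq by (rule bd[where x=x, OF _ that]) (simp only: abs_exp_cancel exp_le_cancel_iff abs_ge_self)
  have km: "\<kappa> \<in> borel_measurable phase" unfolding \<kappa>_def by measurable
  have LkF: "loc_integrable (\<lambda>p. \<kappa> p * F p)"
    using loc_integrable_scale_bounded[OF LF km, of B] k1 by force
  have LkG: "loc_integrable (\<lambda>p. \<kappa> p *\<^sub>R G p)"
    by (rule loc_integrable_scale_bounded[OF LG km, of B]) (use k1 in auto)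
  define K where "K = (\<lambda>p. (\<kappa> p * (- 2 * \<eta> * (snd p \<bullet> n (fst p)))) *\<^sub>R cross3 (snd p) (n (fst p)))"
  have "norm (K (x, m)) \<le> B * (2 * \<bar>\<eta>\<bar>) * 1" if m: "norm m = 1" for x m
  proof -
    have a: "\<bar>\<kappa> (x, m) * (- 2 * \<eta> * s x m)\<bar> \<le> B * (2 * \<bar>\<eta>\<bar>)"
      unfolding abs_mult
    proof (rule mult_mono)
      show "\<bar>- 2\<bar> * \<bar>\<eta>\<bar> * \<bar>s x m\<bar> \<le> 2 * \<bar>\<eta>\<bar>"
        using s1[OF m, of x] mult_left_mono[of "\<bar>s x m\<bar>" 1 "2 * \<bar>\<eta>\<bar>"] by simp
    qed (use k1[OF m] B0 in auto)
    have "norm (cross3 m (n x)) \<le> 1" using norm_cross3_le[of m "n x"] by (simp add: m n1)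
    from mult_mono[OF a this] show ?thesis using B0 by (simp add: K_def s_def)
  qed
  then have LK: "loc_integrable (\<lambda>p. F p *\<^sub>R K p)"
    using km by (intro loc_integrable_scale_bounded_vec[OF LF, where C="B * (2 * \<bar>\<eta>\<bar>) * 1"]) (auto simp: K_def)
  have LG': "loc_integrable (\<lambda>p. \<kappa> p *\<^sub>R G p + (F p * (\<kappa> p * (- 2 * \<eta> * (snd p \<bullet> n (fst p))))) *\<^sub>R cross3 (snd p) (n (fst p)))"
    using loc_integrable_add[OF LkG LK] by (simp add: K_def)
  show ?thesis
    unfolding has_weak_rot_def
  proof (intro conjI allI impI LkF LG')
    fix \<psi> assume t: "test_field \<psi>"
    define w where "w = (\<lambda>x N m. Z * exp_trunc (Suc N) (- \<eta> * (s x m)\<^sup>2))"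
    have wp: "real_polynomial_function (w x N)" for x N
      unfolding w_def exp_trunc_def s_def
      by (intro real_polynomial_function.intros(4) real_polynomial_function.intros(2) real_polynomial_function_sum
          real_polynomial_function_divide real_polynomial_function_power real_polynomial_function.intros(1)
          bounded_linear_inner_left) auto
    \<comment> \<open>The gradient of one truncation involves the preceding one, and both converge to the same limit.\<close>
    have wg: "gradient (w x N) m = (Z * exp_trunc N (- \<eta> * (s x m)\<^sup>2) * (- 2 * \<eta> * s x m)) *\<^sub>R n x" for x N m
    proof (rule gradient_eqI)
      have 1: "((\<lambda>m. - \<eta> * (s x m)\<^sup>2) has_derivative (\<lambda>v. - \<eta> * (2 * s x m * (v \<bullet> n x)))) (at m)"
        unfolding s_def by (auto intro!: derivative_eq_intros simp: algebra_simps)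
      have 2: "((\<lambda>m. exp_trunc (Suc N) (- \<eta> * (s x m)\<^sup>2)) has_derivative
          (\<lambda>v. (- \<eta> * (2 * s x m * (v \<bullet> n x))) * exp_trunc N (- \<eta> * (s x m)\<^sup>2))) (at m)"
        using DERIV_compose_FDERIV[OF DERIV_exp_trunc 1] .
      show "(w x N has_derivative (\<lambda>v. ((Z * exp_trunc N (- \<eta> * (s x m)\<^sup>2) * (- 2 * \<eta> * s x m)) *\<^sub>R n x) \<bullet> v)) (at m)"
        unfolding w_def
        by (rule has_derivative_eq_rhs[OF has_derivative_mult_right[OF 2]]) (auto simp: fun_eq_iff algebra_simps inner_commute)
    qed
    define L where "L = (\<lambda>x m. (\<kappa> (x, m) * F (x, m)) *\<^sub>R classical_rot \<psi> (x, m) + \<psi> (x, m) *\<^sub>R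
       (\<kappa> (x, m) *\<^sub>R G (x, m) + (F (x, m) * (\<kappa> (x, m) * (- 2 * \<eta> * (m \<bullet> n x)))) *\<^sub>R cross3 m (n x)))"
    have i1: "integrable phase (\<lambda>p. F p *\<^sub>R classical_rot \<psi> p)" "integrable phase (\<lambda>p. \<psi> p *\<^sub>R F p)" "integrable phase (\<lambda>p. \<psi> p *\<^sub>R G p)"
      using weak_rot_integrable(1)[OF t LF] weak_rot_integrable(2)[OF t LF] weak_rot_integrable(2)[OF t LG] by auto
    have i2: "integrable phase (\<lambda>p. (\<kappa> p * F p) *\<^sub>R classical_rot \<psi> p)"
       "integrable phase (\<lambda>p. \<psi> p *\<^sub>R (\<kappa> p *\<^sub>R G p + (F p * (\<kappa> p * (- 2 * \<eta> * (snd p \<bullet> n (fst p))))) *\<^sub>R cross3 (snd p) (n (fst p))))"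
      by (rule weak_rot_integrable(1)[OF t LkF], rule weak_rot_integrable(2)[OF t LG'])
    have i3: "integrable phase (\<lambda>p. L (fst p) (snd p))"
      using Bochner_Integration.integrable_add[OF i2] by (simp add: L_def)
    have "AE x in lborel. (LINT m|S2. L x m) = 0"
      using weak_rot_slices[OF wr t] phase_AE_slice_integrable[OF i1(1)] phase_AE_slice_integrable[OF i1(2)]
        phase_AE_slice_integrable[OF i1(3)] phase_AE_slice_integrable[OF i3]
    proof eventually_elim
      case (elim x)
      have e1: "integrable S2 (slice_term \<psi> F G (w x N) x)" "(LINT m|S2. slice_term \<psi> F G (w x N) x m) = 0" for N
        using elim(1)[rule_format, OF wp[of x N]] by auto
      have "(\<lambda>N. LINT m|S2. slice_term \<psi> F G (w x N) x m) \<longlonglongrightarrow> (LINT m|S2. L x m)"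
      proof (rule integral_dominated_convergence[where w="\<lambda>m. B * norm (F (x, m) *\<^sub>R classical_rot \<psi> (x, m))
          + B * (2 * \<bar>\<eta>\<bar>) * norm (\<psi> (x, m) *\<^sub>R F (x, m)) + B * norm (\<psi> (x, m) *\<^sub>R G (x, m))"])
        show "L x \<in> borel_measurable S2" using elim(5) by (simp add: borel_measurable_integrable)
        show "slice_term \<psi> F G (w x N) x \<in> borel_measurable S2" for N using e1(1) by (rule borel_measurable_integrable)
        show "integrable S2 (\<lambda>m. B * norm (F (x, m) *\<^sub>R classical_rot \<psi> (x, m))
          + B * (2 * \<bar>\<eta>\<bar>) * norm (\<psi> (x, m) *\<^sub>R F (x, m)) + B * norm (\<psi> (x, m) *\<^sub>R G (x, m)))"
          by (intro Bochner_Integration.integrable_add integrable_mult_right integrable_norm elim)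
        show "AE m in S2. (\<lambda>N. slice_term \<psi> F G (w x N) x m) \<longlonglongrightarrow> L x m"
        proof (rule AE_I2)
          fix m
          have l1: "(\<lambda>N. w x N m) \<longlonglongrightarrow> \<kappa> (x, m)"
            unfolding w_def k_eq by (intro tendsto_intros LIMSEQ_Suc exp_trunc_tendsto)
          have l2: "(\<lambda>N. Z * exp_trunc N (- \<eta> * (s x m)\<^sup>2)) \<longlonglongrightarrow> \<kappa> (x, m)"
            unfolding k_eq by (intro tendsto_intros exp_trunc_tendsto)
          have "(\<lambda>N. F (x, m) *\<^sub>R (w x N m *\<^sub>R classical_rot \<psi> (x, m)
               + \<psi> (x, m) *\<^sub>R (Z * exp_trunc N (- \<eta> * (s x m)\<^sup>2) * (- 2 * \<eta> * s x m)) *\<^sub>R cross3 m (n x))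
               + (\<psi> (x, m) * w x N m) *\<^sub>R G (x, m)) \<longlonglongrightarrow>
             F (x, m) *\<^sub>R (\<kappa> (x, m) *\<^sub>R classical_rot \<psi> (x, m)
               + \<psi> (x, m) *\<^sub>R (\<kappa> (x, m) * (- 2 * \<eta> * s x m)) *\<^sub>R cross3 m (n x))
               + (\<psi> (x, m) * \<kappa> (x, m)) *\<^sub>R G (x, m)"
            by (intro tendsto_intros l1 l2)
          then show "(\<lambda>N. slice_term \<psi> F G (w x N) x m) \<longlonglongrightarrow> L x m"
            unfolding slice_term_def wg cross_mult_right L_def s_def by (simp add: algebra_simps)
        qed
        show "AE m in S2. norm (slice_term \<psi> F G (w x N) x m) \<le> B * norm (F (x, m) *\<^sub>R classical_rot \<psi> (x, m))
          + B * (2 * \<bar>\<eta>\<bar>) * norm (\<psi> (x, m) *\<^sub>R F (x, m)) + B * norm (\<psi> (x, m) *\<^sub>R G (x, m))" for N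
        proof (rule AE_I2)
          fix m assume "m \<in> space S2"
          then have m: "norm m = 1" by simp
          have b1: "\<bar>w x N m\<bar> \<le> B" unfolding w_def by (rule bd[OF abs_exp_trunc_le m])
          have b2: "\<bar>Z * exp_trunc N (- \<eta> * (s x m)\<^sup>2)\<bar> \<le> B" by (rule bd[OF abs_exp_trunc_le m])
          have c1: "norm (cross3 m (n x)) \<le> 1" using norm_cross3_le[of m "n x"] by (simp add: m n1)
          have b3: "\<bar>Z * exp_trunc N (- \<eta> * (s x m)\<^sup>2) * (- 2 * \<eta> * s x m)\<bar> \<le> B * (2 * \<bar>\<eta>\<bar>)"
            unfolding abs_mult[of "Z * _"]
          proof (rule mult_mono[OF b2])
            show "\<bar>- 2 * \<eta> * s x m\<bar> \<le> 2 * \<bar>\<eta>\<bar>"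
              using s1[OF m, of x] mult_left_mono[of "\<bar>s x m\<bar>" 1 "2 * \<bar>\<eta>\<bar>"] by (simp add: abs_mult)
          qed (use B0 in auto)
          have e: "slice_term \<psi> F G (w x N) x m = w x N m *\<^sub>R (F (x, m) *\<^sub>R classical_rot \<psi> (x, m))
              + (Z * exp_trunc N (- \<eta> * (s x m)\<^sup>2) * (- 2 * \<eta> * s x m)) *\<^sub>R ((\<psi> (x, m) *\<^sub>R F (x, m)) *\<^sub>R cross3 m (n x))
              + w x N m *\<^sub>R (\<psi> (x, m) *\<^sub>R G (x, m))"
            unfolding slice_term_def wg cross_mult_right by (simp add: algebra_simps)
          have t1: "norm (w x N m *\<^sub>R (F (x, m) *\<^sub>R classical_rot \<psi> (x, m))) \<le> B * norm (F (x, m) *\<^sub>R classical_rot \<psi> (x, m))"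
            unfolding norm_scaleR[of "w x N m"] by (rule mult_right_mono[OF b1]) simp
          have t3: "norm (w x N m *\<^sub>R (\<psi> (x, m) *\<^sub>R G (x, m))) \<le> B * norm (\<psi> (x, m) *\<^sub>R G (x, m))"
            unfolding norm_scaleR[of "w x N m"] by (rule mult_right_mono[OF b1]) simp
          have "norm ((\<psi> (x, m) *\<^sub>R F (x, m)) *\<^sub>R cross3 m (n x)) \<le> norm (\<psi> (x, m) *\<^sub>R F (x, m)) * 1"
            unfolding norm_scaleR[of "\<psi> (x, m) *\<^sub>R F (x, m)"] real_norm_def by (rule mult_left_mono[OF c1]) simp
          then have t2: "norm ((Z * exp_trunc N (- \<eta> * (s x m)\<^sup>2) * (- 2 * \<eta> * s x m)) *\<^sub>R ((\<psi> (x, m) *\<^sub>R F (x, m)) *\<^sub>R cross3 m (n x)))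
              \<le> B * (2 * \<bar>\<eta>\<bar>) * norm (\<psi> (x, m) *\<^sub>R F (x, m))"
            unfolding norm_scaleR[of "Z * _ * _"] by (intro mult_mono[OF b3]) (use B0 in auto)
          show "norm (slice_term \<psi> F G (w x N) x m) \<le> B * norm (F (x, m) *\<^sub>R classical_rot \<psi> (x, m))
            + B * (2 * \<bar>\<eta>\<bar>) * norm (\<psi> (x, m) *\<^sub>R F (x, m)) + B * norm (\<psi> (x, m) *\<^sub>R G (x, m))"
            unfolding e by (rule order_trans[OF norm_triangle_ineq add_mono[OF order_trans[OF norm_triangle_ineq add_mono[OF t1 t2]] t3]])
        qed
      qed
      then show ?case by (simp add: e1(2) LIMSEQ_const_iff)
    qed
    then have "(LINT x|lborel. LINT m|S2. L x m) = 0"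
      by (subst integral_cong_AE[where g="\<lambda>_. 0"])
        (use phase_integrable_slice[OF i3] in auto)
    moreover have "(LINT p|phase. L (fst p) (snd p)) = (LINT x|lborel. LINT m|S2. L x m)"
      using phase_integral[OF i3] by simp
    moreover have "(LINT p|phase. L (fst p) (snd p)) = (LINT p|phase. (\<kappa> p * F p) *\<^sub>R classical_rot \<psi> p) +
       (LINT p|phase. \<psi> p *\<^sub>R (\<kappa> p *\<^sub>R G p + (F p * (\<kappa> p * (- 2 * \<eta> * (snd p \<bullet> n (fst p))))) *\<^sub>R cross3 (snd p) (n (fst p))))"
      unfolding L_def prod.collapse by (rule Bochner_Integration.integral_add[OF i2])
    ultimately show "(LINT p|phase. (\<kappa> p * F p) *\<^sub>R classical_rot \<psi> p) = - (LINT p|phase. \<psi> p *\<^sub>R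
       (\<kappa> p *\<^sub>R G p + (F p * (\<kappa> p * (- 2 * \<eta> * (snd p \<bullet> n (fst p))))) *\<^sub>R cross3 (snd p) (n (fst p))))"
      by (simp add: eq_neg_iff_add_eq_0)
  qed
qed

section \<open>Fourier coefficients on the circle\<close>

lemma integrable_Phi_continuous:
  fixes u :: "real \<Rightarrow> real"
  assumes "continuous_on UNIV u" shows "integrable Phi u"
proof -
  obtain C where C: "\<forall>x\<in>{0..2*pi}. \<bar>u x\<bar> \<le> C"
    using compact_imp_bounded[OF compact_continuous_image[OF continuous_on_subset[OF assms] compact_Icc[of 0 "2*pi"]]] by (auto simp: bounded_iff)
  have "AE x in Phi. x \<in> {0..2*pi}" unfolding Phi_def by (simp add: AE_density split: split_indicator)
  then have "AE x in Phi. norm (u x) \<le> C" by (rule AE_mp) (use C in \<open>auto intro!: AE_I2\<close>)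
  then show ?thesis
    by (rule Phi.integrable_const_bound) (simp add: measurable_cong_sets[OF sets_Phi refl] borel_measurable_continuous_onI assms)
qed

lemma integral_Phi_FTC:
  fixes u :: "real \<Rightarrow> real"
  assumes u: "continuous_on UNIV u" and U: "\<And>\<phi>. (U has_real_derivative u \<phi>) (at \<phi>)"
  shows "(LINT \<phi>|Phi. u \<phi>) = U (2 * pi) - U 0"
proof -
  have e: "Phi = density lborel (\<lambda>\<phi>. ennreal (indicator {0..2*pi} \<phi>))"
    unfolding Phi_def by (intro density_cong) (auto split: split_indicator)
  have "(LINT \<phi>|Phi. u \<phi>) = (LINT \<phi>|lborel. indicator {0..2*pi} \<phi> *\<^sub>R u \<phi>)"
    unfolding e by (rule integral_density) (auto intro!: borel_measurable_continuous_onI u)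
  also have "\<dots> = U (2 * pi) - U 0"
    by (rule integral_FTC_atLeastAtMost)
      (use U in \<open>auto intro!: continuous_on_subset[OF u] simp: has_real_derivative_iff_has_vector_derivative[symmetric] intro: has_field_derivative_at_within\<close>)
  finally show ?thesis .
qed

lemma integral_Phi_const [simp]: "(LINT \<phi>|Phi. c) = 2 * pi * c"
  by (subst integral_Phi_FTC[where U="\<lambda>\<phi>. c * \<phi>"]) (auto intro!: derivative_eq_intros)

lemma measure_Phi [simp]: "measure Phi UNIV = 2 * pi"
  using integral_Phi_const[of 1] by simp

lemma integral_Phi_cos_sin:
  assumes "k \<noteq> (0::int)"
  shows "(LINT \<phi>|Phi. cos (of_int k * \<phi>)) = 0" "(LINT \<phi>|Phi. sin (of_int k * \<phi>)) = 0"
proof -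
  have k: "of_int k \<noteq> (0::real)" using assms by simp
  have p: "sin (of_int k * (2 * pi)) = 0" "cos (of_int k * (2 * pi)) = 1"
    using sin_int_2pin[of k] cos_int_2pin[of k] by (simp_all add: mult_ac)
  show "(LINT \<phi>|Phi. cos (of_int k * \<phi>)) = 0"
    by (subst integral_Phi_FTC[where U="\<lambda>\<phi>. sin (of_int k * \<phi>) / of_int k"])
      (use k p in \<open>auto intro!: derivative_eq_intros continuous_intros\<close>)
  show "(LINT \<phi>|Phi. sin (of_int k * \<phi>)) = 0"
    by (subst integral_Phi_FTC[where U="\<lambda>\<phi>. - cos (of_int k * \<phi>) / of_int k"])
      (use k p in \<open>auto intro!: derivative_eq_intros continuous_intros\<close>)
qed

lemma trig_orthogonality:
  fixes j k :: nat
  assumes j: "j \<ge> 1" and k: "k \<ge> 1"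
  shows "(LINT \<phi>|Phi. cos (real j * \<phi>) * cos (real k * \<phi>)) = (if j = k then pi else 0)" (is ?cc)
    and "(LINT \<phi>|Phi. sin (real j * \<phi>) * sin (real k * \<phi>)) = (if j = k then pi else 0)" (is ?ss)
    and "(LINT \<phi>|Phi. cos (real j * \<phi>) * sin (real k * \<phi>)) = 0" (is ?cs)
    and "(LINT \<phi>|Phi. cos (real k * \<phi>)) = 0" "(LINT \<phi>|Phi. sin (real k * \<phi>)) = 0"
proof -
  let ?d = "int j - int k" and ?s = "int j + int k"
  have s0: "?s \<noteq> 0" using j by linarith
  have ic: "integrable Phi (\<lambda>\<phi>. cos (of_int i * \<phi>))" "integrable Phi (\<lambda>\<phi>. sin (of_int i * \<phi>))" for i :: int
    by (auto intro!: integrable_Phi_continuous continuous_intros)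
  have d: "(LINT \<phi>|Phi. cos (of_int ?d * \<phi>)) = (if j = k then 2 * pi else 0)"
    using integral_Phi_cos_sin(1)[of ?d] by auto
  have ds: "(LINT \<phi>|Phi. sin (of_int ?d * \<phi>)) = 0"
    using integral_Phi_cos_sin(2)[of ?d] by (cases "j = k") auto
  have add: "(LINT \<phi>|Phi. (u \<phi> + v \<phi>) / 2) = ((LINT \<phi>|Phi. u \<phi>) + (LINT \<phi>|Phi. v \<phi>)) / 2"
    and diff: "(LINT \<phi>|Phi. (u \<phi> - v \<phi>) / 2) = ((LINT \<phi>|Phi. u \<phi>) - (LINT \<phi>|Phi. v \<phi>)) / 2"
    if "integrable Phi u" "integrable Phi v" for u v :: "real \<Rightarrow> real"
    using that by simp_all
  have "(LINT \<phi>|Phi. cos (real j * \<phi>) * cos (real k * \<phi>)) = (LINT \<phi>|Phi. (cos (of_int ?d * \<phi>) + cos (of_int ?s * \<phi>)) / 2)"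
    by (intro Bochner_Integration.integral_cong) (auto simp: cos_times_cos algebra_simps)
  also have "\<dots> = ((if j = k then 2 * pi else 0) + 0) / 2"
    by (simp only: add[OF ic(1) ic(1)] d integral_Phi_cos_sin(1)[OF s0])
  finally show ?cc by (cases "j = k") auto
  have "(LINT \<phi>|Phi. sin (real j * \<phi>) * sin (real k * \<phi>)) = (LINT \<phi>|Phi. (cos (of_int ?d * \<phi>) - cos (of_int ?s * \<phi>)) / 2)"
    by (intro Bochner_Integration.integral_cong) (auto simp: sin_times_sin algebra_simps)
  also have "\<dots> = ((if j = k then 2 * pi else 0) - 0) / 2"
    by (simp only: diff[OF ic(1) ic(1)] d integral_Phi_cos_sin(1)[OF s0])
  finally show ?ss by (cases "j = k") auto
  have "(LINT \<phi>|Phi. cos (real j * \<phi>) * sin (real k * \<phi>)) = (LINT \<phi>|Phi. (sin (of_int ?s * \<phi>) - sin (of_int ?d * \<phi>)) / 2)"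
    by (intro Bochner_Integration.integral_cong) (auto simp: cos_times_sin algebra_simps)
  also have "\<dots> = (0 - 0) / 2"
    by (simp only: diff[OF ic(2) ic(2)] ds integral_Phi_cos_sin(2)[OF s0])
  finally show ?cs by simp
  show "(LINT \<phi>|Phi. cos (real k * \<phi>)) = 0" "(LINT \<phi>|Phi. sin (real k * \<phi>)) = 0"
    using integral_Phi_cos_sin[of "int k"] k by auto
qed

definition trig_poly :: "real \<Rightarrow> (nat \<Rightarrow> real) \<Rightarrow> (nat \<Rightarrow> real) \<Rightarrow> nat \<Rightarrow> real \<Rightarrow> real" where
  "trig_poly a0 a b K \<phi> = a0 + (\<Sum>k=1..K. a k * cos (real k * \<phi>) + b k * sin (real k * \<phi>))"

lemma continuous_trig_poly: "continuous_on UNIV (trig_poly a0 a b K)"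
  unfolding trig_poly_def by (intro continuous_intros)

lemma trig_poly_coefficients:
  shows "(LINT \<phi>|Phi. trig_poly a0 a b K \<phi>) = 2 * pi * a0"
    and "1 \<le> j \<Longrightarrow> j \<le> K \<Longrightarrow> (LINT \<phi>|Phi. trig_poly a0 a b K \<phi> * cos (real j * \<phi>)) = pi * a j"
    and "1 \<le> j \<Longrightarrow> j \<le> K \<Longrightarrow> (LINT \<phi>|Phi. trig_poly a0 a b K \<phi> * sin (real j * \<phi>)) = pi * b j"
proof -
  have i: "integrable Phi (\<lambda>\<phi>. c * (cos (real k * \<phi>) * q \<phi>))" "integrable Phi (\<lambda>\<phi>. c * (sin (real k * \<phi>) * q \<phi>))"
    if "continuous_on UNIV q" for k c and q :: "real \<Rightarrow> real"
    by (intro integrable_Phi_continuous continuous_intros that)+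
  have gen: "(LINT \<phi>|Phi. trig_poly a0 a b K \<phi> * q \<phi>) = a0 * (LINT \<phi>|Phi. q \<phi>) +
     (\<Sum>k=1..K. a k * (LINT \<phi>|Phi. cos (real k * \<phi>) * q \<phi>) + b k * (LINT \<phi>|Phi. sin (real k * \<phi>) * q \<phi>))"
    if q: "continuous_on UNIV q" for q :: "real \<Rightarrow> real"
  proof -
    have "(LINT \<phi>|Phi. trig_poly a0 a b K \<phi> * q \<phi>) = (LINT \<phi>|Phi. a0 * q \<phi> + (\<Sum>k=1..K. a k * (cos (real k * \<phi>) * q \<phi>) + b k * (sin (real k * \<phi>) * q \<phi>)))"
      by (simp add: trig_poly_def algebra_simps sum_distrib_left)
    also have "\<dots> = (LINT \<phi>|Phi. a0 * q \<phi>) + (LINT \<phi>|Phi. (\<Sum>k=1..K. a k * (cos (real k * \<phi>) * q \<phi>) + b k * (sin (real k * \<phi>) * q \<phi>)))"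
      by (intro Bochner_Integration.integral_add Bochner_Integration.integrable_sum Bochner_Integration.integrable_add i[OF q]
        integrable_Phi_continuous continuous_intros q)
    also have "(LINT \<phi>|Phi. (\<Sum>k=1..K. a k * (cos (real k * \<phi>) * q \<phi>) + b k * (sin (real k * \<phi>) * q \<phi>)))
      = (\<Sum>k=1..K. (LINT \<phi>|Phi. a k * (cos (real k * \<phi>) * q \<phi>) + b k * (sin (real k * \<phi>) * q \<phi>)))"
      by (intro Bochner_Integration.integral_sum Bochner_Integration.integrable_add i[OF q])
    also have "\<dots> = (\<Sum>k=1..K. a k * (LINT \<phi>|Phi. cos (real k * \<phi>) * q \<phi>) + b k * (LINT \<phi>|Phi. sin (real k * \<phi>) * q \<phi>))"
      by (intro sum.cong refl) (subst Bochner_Integration.integral_add[OF i(1)[OF q] i(2)[OF q]], simp)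
    finally show ?thesis by simp
  qed
  have "(LINT \<phi>|Phi. trig_poly a0 a b K \<phi> * 1) = a0 * (2 * pi)"
    by (subst gen) (auto simp: trig_orthogonality(4,5) intro!: sum.neutral)
  then show "(LINT \<phi>|Phi. trig_poly a0 a b K \<phi>) = 2 * pi * a0" by simp
  assume j: "1 \<le> j" "j \<le> K"
  have ps: "(LINT \<phi>|Phi. sin (real k * \<phi>) * cos (real j * \<phi>)) = 0" if "1 \<le> k" for k
    using trig_orthogonality(3)[OF j(1) that] by (simp add: mult.commute)
  have pick: "(\<Sum>k=1..K. c k * (if k = j then pi else 0)) = pi * c j" for c :: "nat \<Rightarrow> real"
  proof -
    have "(\<Sum>k=1..K. c k * (if k = j then pi else 0)) = (\<Sum>k=1..K. if k = j then c k * pi else 0)"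
      by (intro sum.cong) auto
    then show ?thesis using j by simp
  qed
  show "(LINT \<phi>|Phi. trig_poly a0 a b K \<phi> * cos (real j * \<phi>)) = pi * a j"
  proof -
    have "(\<Sum>k=1..K. a k * (LINT \<phi>|Phi. cos (real k * \<phi>) * cos (real j * \<phi>)) + b k * (LINT \<phi>|Phi. sin (real k * \<phi>) * cos (real j * \<phi>)))
       = (\<Sum>k=1..K. a k * (if k = j then pi else 0))"
      by (intro sum.cong refl) (simp add: trig_orthogonality(1)[OF _ j(1)] ps)
    then show ?thesis
      by (subst gen) (auto intro!: continuous_intros simp: trig_orthogonality(4,5)[OF j(1) j(1)] pick[unfolded One_nat_def])
  qed
  show "(LINT \<phi>|Phi. trig_poly a0 a b K \<phi> * sin (real j * \<phi>)) = pi * b j"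
  proof -
    have "(\<Sum>k=1..K. a k * (LINT \<phi>|Phi. cos (real k * \<phi>) * sin (real j * \<phi>)) + b k * (LINT \<phi>|Phi. sin (real k * \<phi>) * sin (real j * \<phi>)))
       = (\<Sum>k=1..K. b k * (if k = j then pi else 0))"
      by (intro sum.cong refl) (simp add: trig_orthogonality(2)[OF _ j(1)] trig_orthogonality(3)[OF _ j(1)])
    then show ?thesis
      by (subst gen) (auto intro!: continuous_intros simp: trig_orthogonality(4,5)[OF j(1) j(1)] pick[unfolded One_nat_def])
  qed
qed

lemma integrable_mult_bounded:
  fixes w q :: "'a \<Rightarrow> real"
  assumes w: "integrable M w" and q: "q \<in> borel_measurable M" "\<And>x. \<bar>q x\<bar> \<le> C"
  shows "integrable M (\<lambda>x. w x * q x)"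
proof (rule Bochner_Integration.integrable_bound)
  show "integrable M (\<lambda>x. \<bar>C\<bar> * w x)" using w by simp
  show "(\<lambda>x. w x * q x) \<in> borel_measurable M" using w q by measurable
  have "\<bar>w x\<bar> * \<bar>q x\<bar> \<le> \<bar>C\<bar> * \<bar>w x\<bar>" for x
    using mult_right_mono[of "\<bar>q x\<bar>" "\<bar>C\<bar>" "\<bar>w x\<bar>"] q(2)[of x] by (simp add: mult.commute)
  then show "AE x in M. norm (w x * q x) \<le> norm (\<bar>C\<bar> * w x)" by (simp add: abs_mult)
qed

text \<open>Expand the square norm of the difference of \<open>w\<close> and its Fourier polynomial.\<close>

lemma Bessel_Phi:
  assumes w: "integrable Phi w" "integrable Phi (\<lambda>\<phi>. (w \<phi>)\<^sup>2)"
  shows "(\<Sum>k=1..K. (LINT \<phi>|Phi. w \<phi> * cos (real k * \<phi>))\<^sup>2 + (LINT \<phi>|Phi. w \<phi> * sin (real k * \<phi>))\<^sup>2) \<le> pi * (LINT \<phi>|Phi. (w \<phi>)\<^sup>2)"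
proof -
  define a where "a = (\<lambda>k::nat. (LINT \<phi>|Phi. w \<phi> * cos (real k * \<phi>)))"
  define b where "b = (\<lambda>k::nat. (LINT \<phi>|Phi. w \<phi> * sin (real k * \<phi>)))"
  define S where "S = (\<Sum>k=1..K. (a k)\<^sup>2 + (b k)\<^sup>2)"
  define T where "T = trig_poly 0 a b K"
  have cT: "continuous_on UNIV T" unfolding T_def by (rule continuous_trig_poly)
  have iw: "integrable Phi (\<lambda>\<phi>. w \<phi> * cos (real k * \<phi>))" "integrable Phi (\<lambda>\<phi>. w \<phi> * sin (real k * \<phi>))" for k
    by (auto intro!: integrable_mult_bounded[OF w(1), where C=1] borel_measurable_continuous_onI continuous_intros)
  have wT_eq: "w \<phi> * T \<phi> = (\<Sum>k=1..K. a k * (w \<phi> * cos (real k * \<phi>)) + b k * (w \<phi> * sin (real k * \<phi>)))" for \<phi>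
    by (simp add: T_def trig_poly_def sum_distrib_left algebra_simps)
  have iwT: "integrable Phi (\<lambda>\<phi>. w \<phi> * T \<phi>)"
    unfolding wT_eq by (intro Bochner_Integration.integrable_sum Bochner_Integration.integrable_add integrable_mult_right iw)
  have wT: "(LINT \<phi>|Phi. w \<phi> * T \<phi>) = S"
  proof -
    have "(LINT \<phi>|Phi. w \<phi> * T \<phi>) = (\<Sum>k=1..K. (LINT \<phi>|Phi. a k * (w \<phi> * cos (real k * \<phi>)) + b k * (w \<phi> * sin (real k * \<phi>))))"
      unfolding wT_eq by (intro Bochner_Integration.integral_sum Bochner_Integration.integrable_add integrable_mult_right iw)
    also have "\<dots> = S" unfolding S_def
      by (intro sum.cong refl, subst Bochner_Integration.integral_add[OF integrable_mult_right[OF iw(1)] integrable_mult_right[OF iw(2)]])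
        (simp add: a_def b_def power2_eq_square)
    finally show ?thesis .
  qed
  have TT: "(LINT \<phi>|Phi. (T \<phi>)\<^sup>2) = pi * S"
  proof -
    have i: "integrable Phi (\<lambda>\<phi>. T \<phi> * cos (real k * \<phi>))" "integrable Phi (\<lambda>\<phi>. T \<phi> * sin (real k * \<phi>))" for k
      by (intro integrable_Phi_continuous continuous_intros cT)+
    have "(T \<phi>)\<^sup>2 = (\<Sum>k=1..K. a k * (T \<phi> * cos (real k * \<phi>)) + b k * (T \<phi> * sin (real k * \<phi>)))" for \<phi>
    proof -
      have "(T \<phi>)\<^sup>2 = T \<phi> * (\<Sum>k=1..K. a k * cos (real k * \<phi>) + b k * sin (real k * \<phi>))"
        by (simp add: power2_eq_square T_def trig_poly_def)
      then show ?thesis by (simp add: sum_distrib_left algebra_simps)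
    qed
    then have "(LINT \<phi>|Phi. (T \<phi>)\<^sup>2) = (\<Sum>k=1..K. (LINT \<phi>|Phi. a k * (T \<phi> * cos (real k * \<phi>)) + b k * (T \<phi> * sin (real k * \<phi>))))"
      by (simp only:) (intro Bochner_Integration.integral_sum Bochner_Integration.integrable_add integrable_mult_right i)
    also have "\<dots> = (\<Sum>k=1..K. pi * ((a k)\<^sup>2 + (b k)\<^sup>2))"
      by (intro sum.cong refl, subst Bochner_Integration.integral_add[OF integrable_mult_right[OF i(1)] integrable_mult_right[OF i(2)]])
        (simp add: T_def trig_poly_coefficients, simp add: power2_eq_square algebra_simps)
    finally show ?thesis by (simp add: S_def sum_distrib_left)
  qed
  have "0 \<le> (LINT \<phi>|Phi. (w \<phi> - (1/pi) * T \<phi>)\<^sup>2)" by (rule integral_nonneg_AE) simp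
  also have "\<dots> = (LINT \<phi>|Phi. (w \<phi>)\<^sup>2 - (2/pi) * (w \<phi> * T \<phi>) + (1/pi\<^sup>2) * (T \<phi>)\<^sup>2)"
    by (intro Bochner_Integration.integral_cong) (auto simp: power2_eq_square algebra_simps)
  also have "\<dots> = (LINT \<phi>|Phi. (w \<phi>)\<^sup>2) - (2/pi) * S + (1/pi\<^sup>2) * (pi * S)"
  proof -
    have "integrable Phi (\<lambda>\<phi>. (T \<phi>)\<^sup>2)" by (intro integrable_Phi_continuous continuous_intros cT)
    then show ?thesis using w iwT by (simp add: wT TT)
  qed
  also have "\<dots> = (LINT \<phi>|Phi. (w \<phi>)\<^sup>2) - S / pi" by (simp add: power2_eq_square field_simps)
  finally show ?thesis by (simp add: S_def a_def b_def field_simps)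
qed

text \<open>Square-mean convergence of the series determines its coefficients, by Cauchy-Schwarz.\<close>

lemma L2_series_coefficients:
  assumes w[measurable]: "w \<in> borel_measurable Phi"
    and lim: "(\<lambda>K. \<integral>\<^sup>+\<phi>. ennreal ((w \<phi> - trig_poly a0 a b K \<phi>)\<^sup>2) \<partial>Phi) \<longlonglongrightarrow> 0"
  shows "integrable Phi w" "integrable Phi (\<lambda>\<phi>. (w \<phi>)\<^sup>2)"
    and "(LINT \<phi>|Phi. w \<phi>) = 2 * pi * a0"
    and "k \<ge> 1 \<Longrightarrow> (LINT \<phi>|Phi. w \<phi> * cos (real k * \<phi>)) = pi * a k"
    and "k \<ge> 1 \<Longrightarrow> (LINT \<phi>|Phi. w \<phi> * sin (real k * \<phi>)) = pi * b k"
proof -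
  define E where "E = (\<lambda>K. \<integral>\<^sup>+\<phi>. ennreal ((w \<phi> - trig_poly a0 a b K \<phi>)\<^sup>2) \<partial>Phi)"
  have tm[measurable]: "trig_poly a0 a b K \<in> borel_measurable borel" for K
    by (rule borel_measurable_continuous_onI[OF continuous_trig_poly])
  have "eventually (\<lambda>K. E K < 1) sequentially"
    using order_tendstoD(2)[OF lim, of 1] by (simp add: E_def)
  then obtain K0 where K0: "E K0 < 1" by (auto simp: eventually_sequentially)
  have i0: "integrable Phi (\<lambda>\<phi>. (w \<phi> - trig_poly a0 a b K0 \<phi>)\<^sup>2)"
    by (rule integrableI_bounded) (use K0 less_trans[OF K0 ennreal_one_less_top] in \<open>auto simp: E_def\<close>)
  have it: "integrable Phi (trig_poly a0 a b K)" "integrable Phi (\<lambda>\<phi>. (trig_poly a0 a b K \<phi>)\<^sup>2)" for K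
    by (intro integrable_Phi_continuous continuous_intros continuous_trig_poly)+
  show iw2: "integrable Phi (\<lambda>\<phi>. (w \<phi>)\<^sup>2)"
  proof (rule Bochner_Integration.integrable_bound)
    show "integrable Phi (\<lambda>\<phi>. 2 * (w \<phi> - trig_poly a0 a b K0 \<phi>)\<^sup>2 + 2 * (trig_poly a0 a b K0 \<phi>)\<^sup>2)"
      using i0 it by auto
    have "(w \<phi>)\<^sup>2 \<le> 2 * (w \<phi> - trig_poly a0 a b K0 \<phi>)\<^sup>2 + 2 * (trig_poly a0 a b K0 \<phi>)\<^sup>2" for \<phi>
      using zero_le_power2[of "w \<phi> - 2 * trig_poly a0 a b K0 \<phi>"] by (simp add: power2_eq_square algebra_simps)
    then show "AE \<phi> in Phi. norm ((w \<phi>)\<^sup>2) \<le> norm (2 * (w \<phi> - trig_poly a0 a b K0 \<phi>)\<^sup>2 + 2 * (trig_poly a0 a b K0 \<phi>)\<^sup>2)"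
      by simp
  qed measurable
  show iw: "integrable Phi w" by (rule Phi.square_integrable_imp_integrable[OF w iw2])
  have conv: "(LINT \<phi>|Phi. w \<phi> * q \<phi>) = L"
    if q: "continuous_on UNIV q" "\<And>\<phi>. \<bar>q \<phi>\<bar> \<le> 1" and L: "eventually (\<lambda>K. (LINT \<phi>|Phi. trig_poly a0 a b K \<phi> * q \<phi>) = L) sequentially"
    for q L
  proof -
    have [measurable]: "q \<in> borel_measurable borel" by (rule borel_measurable_continuous_onI[OF q(1)])
    have bound: "(ennreal \<bar>(LINT \<phi>|Phi. w \<phi> * q \<phi>) - (LINT \<phi>|Phi. trig_poly a0 a b K \<phi> * q \<phi>)\<bar>)\<^sup>2 \<le> E K * ennreal (2 * pi)" for K
    proof -
      have "\<bar>(LINT \<phi>|Phi. w \<phi> * q \<phi>) - (LINT \<phi>|Phi. trig_poly a0 a b K \<phi> * q \<phi>)\<bar> = \<bar>LINT \<phi>|Phi. (w \<phi> - trig_poly a0 a b K \<phi>) * q \<phi>\<bar>"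
        using integrable_mult_bounded[OF iw, of q 1] integrable_mult_bounded[OF it(1)[of K], of q 1] q(2)
        by (simp add: left_diff_distrib)
      also have "ennreal \<dots> \<le> (\<integral>\<^sup>+\<phi>. ennreal \<bar>(w \<phi> - trig_poly a0 a b K \<phi>) * q \<phi>\<bar> \<partial>Phi)"
        using integral_norm_bound_ennreal[of Phi "\<lambda>\<phi>. (w \<phi> - trig_poly a0 a b K \<phi>) * q \<phi>"]
          integrable_mult_bounded[OF Bochner_Integration.integrable_diff[OF iw it(1)[of K]], of q 1] q(2) by simp
      also have "\<dots> \<le> (\<integral>\<^sup>+\<phi>. ennreal \<bar>w \<phi> - trig_poly a0 a b K \<phi>\<bar> * 1 \<partial>Phi)"
        by (intro nn_integral_mono) (use q(2) in \<open>auto simp: abs_mult intro!: ennreal_leI mult_left_le\<close>)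
      finally have "(ennreal \<bar>(LINT \<phi>|Phi. w \<phi> * q \<phi>) - (LINT \<phi>|Phi. trig_poly a0 a b K \<phi> * q \<phi>)\<bar>)\<^sup>2
         \<le> (\<integral>\<^sup>+\<phi>. ennreal \<bar>w \<phi> - trig_poly a0 a b K \<phi>\<bar> * 1 \<partial>Phi)\<^sup>2" by (intro power_mono) auto
      also have "\<dots> \<le> (\<integral>\<^sup>+\<phi>. (ennreal \<bar>w \<phi> - trig_poly a0 a b K \<phi>\<bar>)\<^sup>2 \<partial>Phi) * (\<integral>\<^sup>+\<phi>. 1\<^sup>2 \<partial>Phi)"
        by (rule Cauchy_Schwarz_nn_integral) measurable
      also have "(\<integral>\<^sup>+\<phi>. (ennreal \<bar>w \<phi> - trig_poly a0 a b K \<phi>\<bar>)\<^sup>2 \<partial>Phi) = E K"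
        unfolding E_def by (intro nn_integral_cong) (simp add: ennreal_power)
      also have "(\<integral>\<^sup>+\<phi>. 1\<^sup>2 \<partial>Phi) = ennreal (2 * pi)"
        using Phi.emeasure_eq_measure[of UNIV] by simp
      finally show ?thesis .
    qed
    have "(\<lambda>K. E K * ennreal (2 * pi)) \<longlonglongrightarrow> 0 * ennreal (2 * pi)"
      by (rule tendsto_mult_ennreal) (use lim in \<open>auto simp: E_def\<close>)
    then have z: "(\<lambda>K. E K * ennreal (2 * pi)) \<longlonglongrightarrow> 0" by simp
    have "eventually (\<lambda>K. (ennreal \<bar>(LINT \<phi>|Phi. w \<phi> * q \<phi>) - L\<bar>)\<^sup>2 \<le> E K * ennreal (2 * pi)) sequentially"
      using L by eventually_elim (use bound in metis)
    then have "(ennreal \<bar>(LINT \<phi>|Phi. w \<phi> * q \<phi>) - L\<bar>)\<^sup>2 \<le> 0"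
      by (rule tendsto_lowerbound[OF z _ sequentially_bot])
    then show ?thesis by (simp add: ennreal_power)
  qed
  show "(LINT \<phi>|Phi. w \<phi>) = 2 * pi * a0"
    using conv[of "\<lambda>_. 1" "2 * pi * a0"] by (simp add: trig_poly_coefficients)
  show "(LINT \<phi>|Phi. w \<phi> * cos (real k * \<phi>)) = pi * a k" if "k \<ge> 1"
    by (rule conv) (auto intro!: continuous_intros eventually_sequentiallyI[of k] trig_poly_coefficients that)
  show "(LINT \<phi>|Phi. w \<phi> * sin (real k * \<phi>)) = pi * b k" if "k \<ge> 1"
    by (rule conv) (auto intro!: continuous_intros eventually_sequentiallyI[of k] trig_poly_coefficients that)
qed

section \<open>The polar angle\<close>

lemma Cauchy_Schwarz_integral:
  fixes f g :: "'a \<Rightarrow> real"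
  assumes [measurable]: "f \<in> borel_measurable M" "g \<in> borel_measurable M"
    and f: "integrable M (\<lambda>x. (f x)\<^sup>2)" and g: "integrable M (\<lambda>x. (g x)\<^sup>2)"
  shows integrable_mult_L2: "integrable M (\<lambda>x. f x * g x)"
    and "(LINT x|M. f x * g x)\<^sup>2 \<le> (LINT x|M. (f x)\<^sup>2) * (LINT x|M. (g x)\<^sup>2)"
proof -
  have i: "integrable M (\<lambda>x. f x * g x)"
  proof (rule Bochner_Integration.integrable_bound)
    show "integrable M (\<lambda>x. (f x)\<^sup>2 + (g x)\<^sup>2)" using f g by simp
    have "\<bar>a * b\<bar> \<le> a\<^sup>2 + b\<^sup>2" for a b :: real
    proof -
      have "2 * (\<bar>a\<bar> * \<bar>b\<bar>) \<le> a\<^sup>2 + b\<^sup>2" using sum_squares_bound[of "\<bar>a\<bar>" "\<bar>b\<bar>"] by simp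
      moreover have "0 \<le> \<bar>a\<bar> * \<bar>b\<bar>" by simp
      ultimately show ?thesis unfolding abs_mult by linarith
    qed
    then show "AE x in M. norm (f x * g x) \<le> norm ((f x)\<^sup>2 + (g x)\<^sup>2)" by simp
  qed measurable
  then show "integrable M (\<lambda>x. f x * g x)" .
  define a b c where "a = (LINT x|M. (f x)\<^sup>2)" "b = (LINT x|M. f x * g x)" "c = (LINT x|M. (g x)\<^sup>2)"
  note abc = this
  have q: "0 \<le> a - 2 * t * b + t\<^sup>2 * c" for t
  proof -
    have "0 \<le> (LINT x|M. (f x - t * g x)\<^sup>2)" by (rule integral_nonneg_AE) simp
    also have "\<dots> = (LINT x|M. (f x)\<^sup>2 - 2 * t * (f x * g x) + t\<^sup>2 * (g x)\<^sup>2)"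
      by (intro Bochner_Integration.integral_cong) (auto simp: power2_eq_square algebra_simps)
    also have "\<dots> = a - 2 * t * b + t\<^sup>2 * c" using f g i by (simp add: abc)
    finally show ?thesis .
  qed
  have c0: "c \<ge> 0" unfolding abc by (rule integral_nonneg_AE) simp
  have "b\<^sup>2 \<le> a * c"
  proof (cases "c = 0")
    case True
    have "b = 0"
    proof (rule ccontr)
      assume "b \<noteq> 0"
      then show False using q[of "(a + 1) / (2 * b)"] True by simp
    qed
    then show ?thesis using True by simp
  next
    case False
    then have "c > 0" using c0 by simp
    have "0 \<le> a - b\<^sup>2 / c" using q[of "b / c"] False by (simp add: power2_eq_square field_simps)
    then show ?thesis using \<open>c > 0\<close> by (simp add: field_simps)
  qed
  then show "(LINT x|M. f x * g x)\<^sup>2 \<le> (LINT x|M. (f x)\<^sup>2) * (LINT x|M. (g x)\<^sup>2)" by (simp add: abc)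
qed

lemma AE_Theta: "AE \<theta> in Theta. \<theta> \<in> {0..pi} \<and> sin \<theta> > 0"
  unfolding Theta_def by (auto simp: AE_density ennreal_zero_less_mult_iff split: split_indicator)

lemma Theta_eq: "Theta = density lborel (\<lambda>\<theta>. ennreal (indicator {0..pi} \<theta> * sin \<theta>))"
  unfolding Theta_def by (intro density_cong) (auto split: split_indicator)

lemma integrable_Theta_continuous:
  fixes u :: "real \<Rightarrow> real"
  assumes "continuous_on UNIV u" shows "integrable Theta u"
proof -
  obtain C where C: "\<forall>x\<in>{0..pi}. \<bar>u x\<bar> \<le> C"
    using compact_imp_bounded[OF compact_continuous_image[OF continuous_on_subset[OF assms] compact_Icc[of 0 pi]]] by (auto simp: bounded_iff)
  have "AE x in Theta. norm (u x) \<le> C" using AE_Theta by eventually_elim (use C in auto)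
  then show ?thesis
    by (rule Theta.integrable_const_bound) (simp add: measurable_cong_sets[OF sets_Theta refl] borel_measurable_continuous_onI assms)
qed

lemma integral_Theta_FTC:
  fixes u :: "real \<Rightarrow> real"
  assumes u: "continuous_on UNIV u" and U: "\<And>\<theta>. (U has_real_derivative sin \<theta> * u \<theta>) (at \<theta>)"
  shows "(LINT \<theta>|Theta. u \<theta>) = U pi - U 0"
proof -
  have "(LINT \<theta>|Theta. u \<theta>) = (LINT \<theta>|lborel. (indicator {0..pi} \<theta> * sin \<theta>) *\<^sub>R u \<theta>)"
    unfolding Theta_eq by (rule integral_density) (auto intro!: borel_measurable_continuous_onI u simp: sin_ge_zero split: split_indicator)
  also have "\<dots> = (LINT \<theta>|lborel. indicator {0..pi} \<theta> *\<^sub>R (sin \<theta> * u \<theta>))" by (simp add: mult.assoc)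
  also have "\<dots> = U pi - U 0"
    by (rule integral_FTC_atLeastAtMost)
      (use U in \<open>auto intro!: continuous_intros continuous_on_subset[OF u] simp: has_real_derivative_iff_has_vector_derivative[symmetric] intro: has_field_derivative_at_within\<close>)
  finally show ?thesis .
qed

lemma integral_Theta_poly_cos: "(LINT \<theta>|Theta. poly (pderiv P) (cos \<theta>)) = poly P 1 - poly P (-1)"
  by (subst integral_Theta_FTC[where U="\<lambda>\<theta>. - poly P (cos \<theta>)"])
    (auto intro!: derivative_eq_intros continuous_intros)

lemma measure_Theta [simp]: "measure Theta UNIV = 2"
proof -
  have "(LINT \<theta>|Theta. 1) = (2::real)"
    by (subst integral_Theta_FTC[where U="\<lambda>\<theta>. - cos \<theta>"]) (auto intro!: derivative_eq_intros)
  then show ?thesis by simp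
qed

text \<open>On the closed interval from 0 to \<open>\<pi>\<close> the cosine is injective with measurable inverse, so it generates the Borel sets.\<close>

lemma Theta_AE_zero:
  assumes F: "integrable Theta F" and o: "\<And>q. (LINT \<theta>|Theta. poly q (cos \<theta>) * F \<theta>) = 0"
  shows "AE \<theta> in Theta. F \<theta> = 0"
proof -
  define M where "M = restrict_space Theta {0..pi}"
  have "AE \<theta> in M. F \<theta> = 0"
  proof (rule AE_zero_if_orthogonal_polynomials[where T=cos and K="{-1..1::real}"])
    show "integrable M F" unfolding M_def
      by (subst integrable_restrict_space) (use integrable_mult_indicator[OF _ F, of "{0..pi}"] in auto)
    show "cos \<in> borel_measurable M" unfolding M_def by (rule measurable_restrict_space1) measurable
    show "\<exists>B\<in>sets borel. A = cos -` B \<inter> space M" if A: "A \<in> sets M" for A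
    proof -
      obtain A' where A': "A' \<in> sets borel" "A = {0..pi} \<inter> A'"
        using A unfolding M_def by (auto simp: sets_restrict_space)
      have "arccos \<in> borel_measurable (restrict_space borel {-1..1})"
        by (rule borel_measurable_continuous_on_restrict) (auto intro: continuous_intros)
      from measurable_sets[OF this A'(1)] have B: "arccos -` A' \<inter> {-1..1} \<in> sets borel"
        by (auto simp: sets_restrict_space space_restrict_space)
      moreover have "A = cos -` (arccos -` A' \<inter> {-1..1}) \<inter> space M"
        by (auto simp: A'(2) M_def space_restrict_space arccos_cos)
      ultimately show ?thesis by blast
    qed
    fix p :: "real \<Rightarrow> real" assume "real_polynomial_function p"
    then obtain a N where a: "p = (\<lambda>x. \<Sum>i\<le>N. a i * x ^ i)" by (auto simp: real_polynomial_function_iff_sum)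
    define q where "q = (\<Sum>i\<le>N. monom (a i) i)"
    have pq: "p x = poly q x" for x by (simp add: a q_def poly_sum poly_monom)
    have "(LINT \<theta>|M. p (cos \<theta>) * F \<theta>) = (LINT \<theta>|Theta. indicator {0..pi} \<theta> *\<^sub>R (p (cos \<theta>) * F \<theta>))"
      unfolding M_def by (rule integral_restrict_space) simp
    also have "\<dots> = (LINT \<theta>|Theta. poly q (cos \<theta>) * F \<theta>)"
    proof (rule integral_cong_AE)
      have "(\<lambda>x. poly q (cos x)) \<in> borel_measurable borel"
        by (intro borel_measurable_continuous_onI continuous_intros)
      moreover have "F \<in> borel_measurable borel" using F by (simp add: measurable_cong_sets[OF sets_Theta refl, symmetric] borel_measurable_integrable)
      ultimately show "(\<lambda>x. poly q (cos x) * F x) \<in> borel_measurable Theta" "(\<lambda>x. indicat_real {0..pi} x *\<^sub>R (p (cos x) * F x)) \<in> borel_measurable Theta"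
        unfolding pq measurable_cong_sets[OF sets_Theta refl] by measurable
      show "AE x in Theta. indicat_real {0..pi} x *\<^sub>R (p (cos x) * F x) = poly q (cos x) * F x"
        using AE_Theta by eventually_elim (simp add: pq)
    qed
    finally show "(LINT \<theta>|M. p (cos \<theta>) * F \<theta>) = 0" using o by simp
  qed auto
  then have "AE \<theta> in Theta. \<theta> \<in> {0..pi} \<longrightarrow> F \<theta> = 0"
    unfolding M_def by (subst (asm) AE_restrict_space_iff) auto
  then show ?thesis using AE_Theta by eventually_elim auto
qed

lemma poly_antiderivative: "\<exists>P::real poly. pderiv P = p"
proof
  have "pderiv (\<Sum>i\<le>degree p. monom (coeff p i / real (Suc i)) (Suc i)) = (\<Sum>i\<le>degree p. monom (coeff p i) i)"
  proof -
    have "pderiv (sum f I) = (\<Sum>i\<in>I. pderiv (f i))" for f :: "nat \<Rightarrow> real poly" and I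
      by (induction I rule: infinite_finite_induct) (auto simp: pderiv_add)
    then show ?thesis by (simp add: pderiv_monom)
  qed
  then show "pderiv (\<Sum>i\<le>degree p. monom (coeff p i / real (Suc i)) (Suc i)) = p"
    by (simp add: poly_as_sum_of_monoms)
qed

text \<open>Cauchy-Schwarz on \<open>[-1, s]\<close> and on \<open>[s, 1]\<close>.  The factor \<open>1 - s\<^sup>2\<close> cancels
the weight of the sphere in \<open>slice_zonal_bound\<close>.  \<open>Q\<close> stands for a primitive of \<open>p\<^sup>2\<close>, so that
integrals of polynomials are differences of values.\<close>

lemma poly_primitive_bound:
  fixes P Q p :: "real poly"
  assumes P: "pderiv P = p" "poly P (-1) = 0" "poly P 1 = 0" and Q: "pderiv Q = p\<^sup>2" and s: "-1 \<le> s" "s \<le> 1"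
  shows "(poly P s)\<^sup>2 \<le> (1 - s\<^sup>2) * (poly Q 1 - poly Q (-1))"
proof -
  have inc: "0 \<le> (poly Q b - poly Q a) - 2 * t * (poly P b - poly P a) + t\<^sup>2 * (b - a)" if "a \<le> b" for a b t
  proof -
    have "poly (Q - smult (2 * t) P + [:0, t\<^sup>2:]) a \<le> poly (Q - smult (2 * t) P + [:0, t\<^sup>2:]) b"
    proof (rule DERIV_nonneg_imp_nondecreasing[OF that])
      fix x
      have "poly (pderiv (Q - smult (2 * t) P + [:0, t\<^sup>2:])) x = (poly p x - t)\<^sup>2"
        by (simp add: pderiv_add pderiv_diff pderiv_smult P Q pderiv_pCons power2_eq_square algebra_simps)
      then show "\<exists>y. (poly (Q - smult (2 * t) P + [:0, t\<^sup>2:]) has_real_derivative y) (at x) \<and> 0 \<le> y"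
        using poly_DERIV[of "Q - smult (2 * t) P + [:0, t\<^sup>2:]" x] by (metis zero_le_power2)
    qed
    then show ?thesis by (simp add: algebra_simps power2_eq_square)
  qed
  have CS: "(poly P b - poly P a)\<^sup>2 \<le> (b - a) * (poly Q b - poly Q a)" if "a < b" for a b
  proof -
    have ba: "b - a > 0" using that by simp
    have "0 \<le> (poly Q b - poly Q a) - (poly P b - poly P a)\<^sup>2 / (b - a)"
      using inc[of a b "(poly P b - poly P a) / (b - a)"] that ba
      by (simp add: power2_eq_square divide_simps) (simp add: algebra_simps)
    then show ?thesis using ba by (simp add: field_simps)
  qed
  define N where "N = poly Q 1 - poly Q (-1)"
  have mono: "poly Q a \<le> poly Q b" if "a \<le> b" for a b using inc[OF that, of 0] by simp
  have N0: "N \<ge> 0" using mono[of "-1" 1] by (simp add: N_def)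
  have 1: "(poly P s)\<^sup>2 \<le> (1 + s) * N"
  proof (cases "s = -1")
    case False
    then have "(poly P s)\<^sup>2 \<le> (s + 1) * (poly Q s - poly Q (-1))" using CS[of "-1" s] s P by simp
    also have "\<dots> \<le> (s + 1) * N" unfolding N_def using mono[of s 1] s by (intro mult_left_mono) auto
    finally show ?thesis by (simp add: add.commute)
  qed (use P in simp)
  have 2: "(poly P s)\<^sup>2 \<le> (1 - s) * N"
  proof (cases "s = 1")
    case False
    then have "(poly P s)\<^sup>2 \<le> (1 - s) * (poly Q 1 - poly Q s)" using CS[of s 1] s P by simp
    also have "\<dots> \<le> (1 - s) * N" unfolding N_def using mono[of "-1" s] s by (intro mult_left_mono) auto
    finally show ?thesis .
  qed (use P in simp)
  have e: "1 - s\<^sup>2 = (1 - s) * (1 + s)" by (simp add: power2_eq_square algebra_simps)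
  show ?thesis unfolding N_def[symmetric] e
  proof (cases "s \<ge> 0")
    case True
    have "(1 - s) * 1 \<le> (1 - s) * (1 + s)" using s True by (intro mult_left_mono) auto
    then have "(1 - s) * N \<le> (1 - s) * (1 + s) * N" using N0 by (intro mult_right_mono) auto
    then show "(poly P s)\<^sup>2 \<le> (1 - s) * (1 + s) * N" using 2 by linarith
  next
    case False
    have "1 * (1 + s) \<le> (1 - s) * (1 + s)" using s False by (intro mult_right_mono) auto
    then have "(1 + s) * N \<le> (1 - s) * (1 + s) * N" using N0 by (intro mult_right_mono) auto
    then show "(poly P s)\<^sup>2 \<le> (1 - s) * (1 + s) * N" using 1 by linarith
  qed
qed

section \<open>Azimuthal modes of a slice\<close>

lemma column_inner_rotated:
  assumes "rotation_matrix A" shows "column i A \<bullet> (A *v y) = y $ i"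
proof -
  have "transpose A *v (A *v y) = y"
    using assms by (simp add: rotation_matrix_def orthogonal_matrix matrix_vector_mul_assoc)
  then have "(transpose A *v (A *v y)) $ i = y $ i" by simp
  then show ?thesis by (simp add: matrix_vector_mul_component row_transpose[symmetric] row_def column_def transpose_def)
qed

lemma column_eq_axis: "column i A = A *v axis i (1::real)" for A :: "real^3^3"
  by (simp add: matrix_vector_mult_basis)

lemma cross3_columns:
  assumes "rotation_matrix A"
  shows "cross3 (column 1 A) (column 2 A) = column 3 A" "cross3 (column 2 A) (column 3 A) = column 1 A"
    "cross3 (column 3 A) (column 1 A) = column 2 A"
  by (simp_all add: column_eq_axis cross_rotation_matrix[OF assms] cross_basis)

lemma rotated_sph_inner [simp]:
  assumes "rotation_matrix A"
  shows "column 1 A \<bullet> (A *v sph \<theta> \<phi>) = sin \<theta> * cos \<phi>" "column 2 A \<bullet> (A *v sph \<theta> \<phi>) = sin \<theta> * sin \<phi>"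
    "column 3 A \<bullet> (A *v sph \<theta> \<phi>) = cos \<theta>"
  by (simp_all add: column_inner_rotated[OF assms])

lemma measurable_rotated_sph [measurable (raw)]:
  assumes "rotation_matrix A" "f \<in> borel_measurable M" "g \<in> borel_measurable M"
  shows "(\<lambda>x. A *v sph (f x) (g x)) \<in> M \<rightarrow>\<^sub>M S2"
  using measurable_compose[OF measurable_sph[OF assms(2,3)] measurable_rotation_S2[OF assms(1)]] .

lemma
  fixes u :: "real^3 \<Rightarrow> 'b::{banach, second_countable_topology}"
  assumes A: "rotation_matrix A" and u: "integrable S2 u"
  shows integrable_S2_rotated: "integrable (Theta \<Otimes>\<^sub>M Phi) (\<lambda>(\<theta>, \<phi>). u (A *v sph \<theta> \<phi>))"
    and integral_S2_rotated: "(LINT m|S2. u m) = (LINT \<theta>|Theta. LINT \<phi>|Phi. u (A *v sph \<theta> \<phi>))"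
proof -
  have [measurable]: "(\<lambda>m. A *v m) \<in> S2 \<rightarrow>\<^sub>M S2" by (rule measurable_rotation_S2[OF A])
  have [measurable]: "u \<in> borel_measurable S2" using u by auto
  have i: "integrable S2 (\<lambda>m. u (A *v m))"
    using u by (subst (asm) distr_S2_rotation[OF A, symmetric]) (simp add: integrable_distr_eq)
  show "integrable (Theta \<Otimes>\<^sub>M Phi) (\<lambda>(\<theta>, \<phi>). u (A *v sph \<theta> \<phi>))" by (rule integrable_S2_sph[OF i])
  have "(LINT m|S2. u m) = (LINT m|S2. u (A *v m))"
    by (subst (1) distr_S2_rotation[OF A, symmetric]) (simp add: integral_distr)
  also have "\<dots> = (LINT \<theta>|Theta. LINT \<phi>|Phi. u (A *v sph \<theta> \<phi>))" by (rule integral_S2_sph[OF i])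
  finally show "(LINT m|S2. u m) = (LINT \<theta>|Theta. LINT \<phi>|Phi. u (A *v sph \<theta> \<phi>))" .
qed

lemma
  fixes u :: "real^3 \<Rightarrow> 'b::{banach, second_countable_topology}"
  assumes A: "rotation_matrix A" and u: "integrable S2 u"
  shows AE_integrable_Phi_rotated: "AE \<theta> in Theta. integrable Phi (\<lambda>\<phi>. u (A *v sph \<theta> \<phi>))"
    and integrable_Theta_rotated: "integrable Theta (\<lambda>\<theta>. LINT \<phi>|Phi. u (A *v sph \<theta> \<phi>))"
  using TP.AE_integrable_fst'[OF integrable_S2_rotated[OF A u]] TP.integrable_fst'[OF integrable_S2_rotated[OF A u]]
  by auto

lemma real_polynomial_function_poly:
  "real_polynomial_function f \<Longrightarrow> real_polynomial_function (\<lambda>m. poly q (f m))"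
proof (induction q)
  case 0
  then show ?case using real_polynomial_function.intros(2)[of 0] by simp
next
  case (pCons a q)
  then show ?case
    unfolding poly_pCons by (intro real_polynomial_function.intros(2-4)) auto
qed

lemma real_polynomial_complex_power:
  assumes "real_polynomial_function f" "real_polynomial_function g"
  shows "real_polynomial_function (\<lambda>m. Re (Complex (f m) (g m) ^ k)) \<and> real_polynomial_function (\<lambda>m. Im (Complex (f m) (g m) ^ k))"
proof (induction k)
  case 0
  then show ?case using real_polynomial_function.intros(2)[of 1] real_polynomial_function.intros(2)[of 0] by simp
next
  case (Suc k)
  then show ?case using assms
    by (auto simp: intro!: real_polynomial_function_diff real_polynomial_function.intros(3,4))
qed

lemma real_polynomial_inner: "real_polynomial_function (\<lambda>m. a \<bullet> m)"
  by (intro real_polynomial_function.intros(1) bounded_linear_inner_right)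

lemma sq_integrable_S2_facts:
  fixes u :: "real^3 \<Rightarrow> 'b::euclidean_space"
  assumes "sq_integrable S2 u"
  shows "u \<in> borel_measurable S2" "integrable S2 (\<lambda>m. (norm (u m))\<^sup>2)" "integrable S2 u"
proof -
  show m: "u \<in> borel_measurable S2" and i: "integrable S2 (\<lambda>m. (norm (u m))\<^sup>2)" using assms by (auto simp: sq_integrable_def)
  have "integrable S2 (\<lambda>m. norm (u m))" by (rule S2.square_integrable_imp_integrable[OF measurable_compose[OF m borel_measurable_norm] i])
  then show "integrable S2 u" by (rule iffD1[OF integrable_norm_iff[OF m]])
qed

lemma slice_weak_rot_component:
  assumes sw: "slice_weak_rot u V" and w: "real_polynomial_function w"
  shows "integrable S2 (\<lambda>m. u m * (gradient w m \<bullet> cross3 e m) + w m * (V m \<bullet> e))"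
    and "(LINT m|S2. u m * (gradient w m \<bullet> cross3 e m) + w m * (V m \<bullet> e)) = 0"
proof -
  have i: "integrable S2 (\<lambda>m. u m *\<^sub>R cross3 m (gradient w m) + w m *\<^sub>R V m)"
    "(LINT m|S2. u m *\<^sub>R cross3 m (gradient w m) + w m *\<^sub>R V m) = 0"
    using sw w unfolding slice_weak_rot_def by blast+
  have e: "(u m *\<^sub>R cross3 m (gradient w m) + w m *\<^sub>R V m) \<bullet> e = u m * (gradient w m \<bullet> cross3 e m) + w m * (V m \<bullet> e)" for m
  proof -
    have "cross3 m (gradient w m) \<bullet> e = gradient w m \<bullet> cross3 e m"
      by (simp add: cross_components inner_vec_def sum_3 algebra_simps)
    then show ?thesis by (simp add: inner_add_left)
  qed
  show "integrable S2 (\<lambda>m. u m * (gradient w m \<bullet> cross3 e m) + w m * (V m \<bullet> e))"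
    using integrable_inner_left[of e, OF i(1)] unfolding e by simp
  show "(LINT m|S2. u m * (gradient w m \<bullet> cross3 e m) + w m * (V m \<bullet> e)) = 0"
    using integral_inner_left[of e, OF i(1)] unfolding e i(2) by simp
qed

text \<open>The generator of the rotation about the third column multiplies the complex coordinate
\<open>z\<close> of the first two columns by \<open>i\<close>, hence \<open>z^k\<close> by \<open>i k\<close>, and it does not move the third coordinate.\<close>

lemma azimuthal_mode_gradient:
  fixes q :: "real poly" and c :: complex
  assumes A: "rotation_matrix A" and k: "k \<ge> (1::nat)"
  defines "w \<equiv> \<lambda>m. poly q (column 3 A \<bullet> m) * Re (c * Complex (column 1 A \<bullet> m) (column 2 A \<bullet> m) ^ k)"
  shows "real_polynomial_function w"
    and "gradient w m \<bullet> cross3 (column 3 A) m =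
      real k * (poly q (column 3 A \<bullet> m) * Re (c * \<i> * Complex (column 1 A \<bullet> m) (column 2 A \<bullet> m) ^ k))"
proof -
  define z where "z = (\<lambda>m. Complex (column 1 A \<bullet> m) (column 2 A \<bullet> m))"
  have w: "w = (\<lambda>m. poly q (column 3 A \<bullet> m) * Re (c * z m ^ k))" by (simp add: w_def z_def)
  show p: "real_polynomial_function w"
    unfolding w_def times_complex.simps
    by (intro real_polynomial_function.intros(4) real_polynomial_function_diff real_polynomial_function_poly
      real_polynomial_inner real_polynomial_function.intros(2) conjunct1[OF real_polynomial_complex_power]
      conjunct2[OF real_polynomial_complex_power])
  have zl: "bounded_linear z"
    unfolding linear_conv_bounded_linear[symmetric]
    by (rule linearI) (auto simp: z_def complex_eq_iff inner_add_right)
  have dz: "(z has_derivative z) (at m)" by (rule bounded_linear_imp_has_derivative[OF zl])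
  have d1: "((\<lambda>m. Re (c * z m ^ k)) has_derivative (\<lambda>v. Re (c * (of_nat k * z v * z m ^ (k - 1))))) (at m)"
    by (intro bounded_linear.has_derivative[OF bounded_linear_Re] has_derivative_mult_right has_derivative_power dz)
  have "((\<lambda>m. column 3 A \<bullet> m) has_derivative (\<lambda>v. column 3 A \<bullet> v)) (at m)" by (auto intro!: derivative_eq_intros)
  from DERIV_compose_FDERIV[OF poly_DERIV this]
  have d2: "((\<lambda>m. poly q (column 3 A \<bullet> m)) has_derivative (\<lambda>v. (column 3 A \<bullet> v) * poly (pderiv q) (column 3 A \<bullet> m))) (at m)" .
  have "(w has_derivative (\<lambda>v. poly q (column 3 A \<bullet> m) * Re (c * (of_nat k * z v * z m ^ (k - 1)))
      + ((column 3 A \<bullet> v) * poly (pderiv q) (column 3 A \<bullet> m)) * Re (c * z m ^ k))) (at m)"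
    unfolding w by (rule has_derivative_mult[OF d2 d1])
  from has_derivative_unique[OF real_polynomial_has_gradient[OF p] this]
  have g: "gradient w m \<bullet> v = poly q (column 3 A \<bullet> m) * Re (c * (of_nat k * z v * z m ^ (k - 1)))
      + ((column 3 A \<bullet> v) * poly (pderiv q) (column 3 A \<bullet> m)) * Re (c * z m ^ k)" for v by metis
  have tri: "a \<bullet> cross3 b m = cross3 a b \<bullet> m" for a b
    by (simp add: cross_components inner_vec_def sum_3 algebra_simps)
  have zv: "z (cross3 (column 3 A) m) = \<i> * z m"
    using cross3_columns[OF A] cross_skew[of "column 1 A" "column 3 A"] by (simp add: z_def tri complex_eq_iff)
  have "z m * z m ^ (k - 1) = z m ^ k" using k by (metis power_Suc Suc_diff_1 less_le_trans zero_less_one)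
  then have "c * (of_nat k * (\<i> * z m) * z m ^ (k - 1)) = of_nat k * (c * \<i> * z m ^ k)" by (simp add: mult_ac)
  then have "Re (c * (of_nat k * (\<i> * z m) * z m ^ (k - 1))) = Re (of_nat k * (c * \<i> * z m ^ k))" by (simp only:)
  also have "\<dots> = real k * Re (c * \<i> * z m ^ k)" by (subst times_complex.simps(1)) simp
  finally have re: "Re (c * (of_nat k * (\<i> * z m) * z m ^ (k - 1))) = real k * Re (c * \<i> * z m ^ k)" .
  have t0: "column 3 A \<bullet> cross3 (column 3 A) m = 0" by (rule dot_cross_self)
  have z': "Complex (column 1 A \<bullet> m) (column 2 A \<bullet> m) = z m" by (simp add: z_def)
  show "gradient w m \<bullet> cross3 (column 3 A) m =
      real k * (poly q (column 3 A \<bullet> m) * Re (c * \<i> * Complex (column 1 A \<bullet> m) (column 2 A \<bullet> m) ^ k))"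
    unfolding g zv z' t0 re by (simp only: mult_zero_left add_0_right mult.left_commute)
qed

text \<open>The weak identity for the test function \<open>q(cos \<theta>) Re (c z^k)\<close>, read off at almost every \<open>\<theta>\<close> because \<open>q\<close>
is an arbitrary polynomial.  It states that the derivative of \<open>u\<close> in \<open>\<phi>\<close> is the third frame component of \<open>V\<close>,
mode by mode.\<close>

lemma slice_mode_identity:
  assumes sw: "slice_weak_rot u V" and A: "rotation_matrix A" and k: "k \<ge> (1::nat)"
    and u: "sq_integrable S2 u" and V: "sq_integrable S2 V"
  shows "AE \<theta> in Theta. real k * (LINT \<phi>|Phi. u (A *v sph \<theta> \<phi>) * Re (c * \<i> * cis (real k * \<phi>)))
     + (LINT \<phi>|Phi. (column 3 A \<bullet> V (A *v sph \<theta> \<phi>)) * Re (c * cis (real k * \<phi>))) = 0"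
proof -
  define X where "X = (\<lambda>\<theta> \<phi>. sin \<theta> ^ k * (real k * (u (A *v sph \<theta> \<phi>) * Re (c * \<i> * cis (real k * \<phi>)))
      + (column 3 A \<bullet> V (A *v sph \<theta> \<phi>)) * Re (c * cis (real k * \<phi>))))"
  have key: "integrable (Theta \<Otimes>\<^sub>M Phi) (\<lambda>(\<theta>, \<phi>). poly q (cos \<theta>) * X \<theta> \<phi>)"
    "(LINT \<theta>|Theta. LINT \<phi>|Phi. poly q (cos \<theta>) * X \<theta> \<phi>) = 0" for q
  proof -
    define w where "w = (\<lambda>m. poly q (column 3 A \<bullet> m) * Re (c * Complex (column 1 A \<bullet> m) (column 2 A \<bullet> m) ^ k))"
    note g = azimuthal_mode_gradient[OF A k, where q=q and c=c, folded w_def]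
    note s = slice_weak_rot_component[OF sw g(1), of "column 3 A"]
    have zk: "Complex (sin \<theta> * cos \<phi>) (sin \<theta> * sin \<phi>) ^ k = of_real (sin \<theta> ^ k) * cis (real k * \<phi>)" for \<theta> \<phi>
    proof -
      have "Complex (sin \<theta> * cos \<phi>) (sin \<theta> * sin \<phi>) = of_real (sin \<theta>) * cis \<phi>" by (simp add: complex_eq_iff)
      then show ?thesis by (simp add: power_mult_distrib Complex.DeMoivre)
    qed
    have e: "u m * (gradient w m \<bullet> cross3 (column 3 A) m) + w m * (V m \<bullet> column 3 A) = poly q (cos \<theta>) * X \<theta> \<phi>"
      if "m = A *v sph \<theta> \<phi>" for m \<theta> \<phi>
    proof -
      have r: "Re (d * (of_real (sin \<theta> ^ k) * cis (real k * \<phi>))) = sin \<theta> ^ k * Re (d * cis (real k * \<phi>))" for d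
        by (simp add: algebra_simps)
      show ?thesis unfolding g(2) unfolding w_def that X_def rotated_sph_inner[OF A] zk r
        by (simp add: inner_commute algebra_simps del: times_complex.simps)
    qed
    show "integrable (Theta \<Otimes>\<^sub>M Phi) (\<lambda>(\<theta>, \<phi>). poly q (cos \<theta>) * X \<theta> \<phi>)"
      using integrable_S2_rotated[OF A s(1)] by (simp only: e[OF refl])
    show "(LINT \<theta>|Theta. LINT \<phi>|Phi. poly q (cos \<theta>) * X \<theta> \<phi>) = 0"
      using integral_S2_rotated[OF A s(1)] s(2) by (simp only: e[OF refl])
  qed
  have "integrable Theta (\<lambda>\<theta>. LINT \<phi>|Phi. X \<theta> \<phi>)"
    using TP.integrable_fst'[OF key(1)[of 1]] by simp
  moreover have "(LINT \<theta>|Theta. poly q (cos \<theta>) * (LINT \<phi>|Phi. X \<theta> \<phi>)) = 0" for q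
    using key(2)[of q] by simp
  ultimately have "AE \<theta> in Theta. (LINT \<phi>|Phi. X \<theta> \<phi>) = 0"
    by (rule Theta_AE_zero)
  moreover have "AE \<theta> in Theta. integrable Phi (\<lambda>\<phi>. u (A *v sph \<theta> \<phi>))"
    by (rule AE_integrable_Phi_rotated[OF A sq_integrable_S2_facts(3)[OF u]])
  moreover have "AE \<theta> in Theta. integrable Phi (\<lambda>\<phi>. V (A *v sph \<theta> \<phi>))"
    by (rule AE_integrable_Phi_rotated[OF A sq_integrable_S2_facts(3)[OF V]])
  ultimately show ?thesis using AE_Theta
  proof eventually_elim
    case (elim \<theta>)
    have b: "\<bar>Re (d * cis t)\<bar> \<le> cmod d" for d t
      using abs_Re_le_cmod[of "d * cis t"] by (simp add: norm_mult)
    have m: "(\<lambda>\<phi>. Re (d * cis (real k * \<phi>))) \<in> borel_measurable Phi" for d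
      unfolding measurable_cong_sets[OF sets_Phi refl]
      by (intro borel_measurable_continuous_onI continuous_intros)
    have i1: "integrable Phi (\<lambda>\<phi>. u (A *v sph \<theta> \<phi>) * Re (c * \<i> * cis (real k * \<phi>)))"
      by (rule integrable_mult_bounded[OF elim(2) m b])
    have i2: "integrable Phi (\<lambda>\<phi>. (column 3 A \<bullet> V (A *v sph \<theta> \<phi>)) * Re (c * cis (real k * \<phi>)))"
      by (rule integrable_mult_bounded[OF integrable_inner_right[OF elim(3)] m b])
    have "(LINT \<phi>|Phi. X \<theta> \<phi>) = sin \<theta> ^ k * (real k * (LINT \<phi>|Phi. u (A *v sph \<theta> \<phi>) * Re (c * \<i> * cis (real k * \<phi>)))
     + (LINT \<phi>|Phi. (column 3 A \<bullet> V (A *v sph \<theta> \<phi>)) * Re (c * cis (real k * \<phi>))))"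
      unfolding X_def using i1 i2 by (simp del: times_complex.simps)
    then show ?case using elim(1,4) by simp
  qed
qed

text \<open>Bessel's inequality for the third frame component of \<open>V\<close>, whose modes are \<open>k\<close> times those of \<open>u\<close>.\<close>

lemma slice_mode_bound:
  assumes sw: "slice_weak_rot u V" and A: "rotation_matrix A"
    and u: "sq_integrable S2 u" and V: "sq_integrable S2 V"
  shows "AE \<theta> in Theta. \<forall>K. (\<Sum>k=1..K. (LINT \<phi>|Phi. u (A *v sph \<theta> \<phi>) * cos (real k * \<phi>))\<^sup>2
     + (LINT \<phi>|Phi. u (A *v sph \<theta> \<phi>) * sin (real k * \<phi>))\<^sup>2) \<le> pi * (LINT \<phi>|Phi. (norm (V (A *v sph \<theta> \<phi>)))\<^sup>2)"
proof -
  let ?c = "\<lambda>\<theta> k. LINT \<phi>|Phi. u (A *v sph \<theta> \<phi>) * cos (real k * \<phi>)"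
  let ?s = "\<lambda>\<theta> k. LINT \<phi>|Phi. u (A *v sph \<theta> \<phi>) * sin (real k * \<phi>)"
  let ?V = "\<lambda>\<theta> \<phi>. column 3 A \<bullet> V (A *v sph \<theta> \<phi>)"
  \<comment> \<open>\<open>c = 1\<close> gives the sine coefficients of \<open>u\<close>, and \<open>c = - i\<close> the cosine coefficients.\<close>
  have "AE \<theta> in Theta. \<forall>k. 1 \<le> k \<longrightarrow> (\<forall>c\<in>{1, - \<i>}. real k * (LINT \<phi>|Phi. u (A *v sph \<theta> \<phi>) * Re (c * \<i> * cis (real k * \<phi>)))
     + (LINT \<phi>|Phi. ?V \<theta> \<phi> * Re (c * cis (real k * \<phi>))) = 0)"
    unfolding AE_all_countable
    by (intro allI AE_impI AE_ball_countable[THEN iffD2] ballI slice_mode_identity[OF sw A _ u V]) (auto simp: countable_finite)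
  moreover have "AE \<theta> in Theta. integrable Phi (\<lambda>\<phi>. V (A *v sph \<theta> \<phi>))"
    by (rule AE_integrable_Phi_rotated[OF A sq_integrable_S2_facts(3)[OF V]])
  moreover have "AE \<theta> in Theta. integrable Phi (\<lambda>\<phi>. (norm (V (A *v sph \<theta> \<phi>)))\<^sup>2)"
    using AE_integrable_Phi_rotated[OF A sq_integrable_S2_facts(2)[OF V]] .
  ultimately show ?thesis
  proof eventually_elim
    case (elim \<theta>)
    have n3: "norm (column 3 A) = 1" by (simp add: column_eq_axis norm_rotation_matrix[OF A])
    have iV: "integrable Phi (?V \<theta>)" using elim(2) by simp
    have le: "(?V \<theta> \<phi>)\<^sup>2 \<le> (norm (V (A *v sph \<theta> \<phi>)))\<^sup>2" for \<phi>
      using Cauchy_Schwarz_ineq2[of "column 3 A" "V (A *v sph \<theta> \<phi>)"] by (simp add: n3 abs_le_square_iff[symmetric])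
    have iV2: "integrable Phi (\<lambda>\<phi>. (?V \<theta> \<phi>)\<^sup>2)"
      by (rule Bochner_Integration.integrable_bound[OF elim(3)]) (use iV le in auto)
    have id: "(LINT \<phi>|Phi. ?V \<theta> \<phi> * cos (real k * \<phi>)) = real k * ?s \<theta> k"
      "(LINT \<phi>|Phi. ?V \<theta> \<phi> * sin (real k * \<phi>)) = - (real k * ?c \<theta> k)" if k: "1 \<le> k" for k
      using elim(1)[rule_format, OF k, of 1] elim(1)[rule_format, OF k, of "- \<i>"] by simp_all
    show ?case
    proof
      fix K
      have "(\<Sum>k=1..K. (?c \<theta> k)\<^sup>2 + (?s \<theta> k)\<^sup>2) \<le> (\<Sum>k=1..K. (LINT \<phi>|Phi. ?V \<theta> \<phi> * cos (real k * \<phi>))\<^sup>2 + (LINT \<phi>|Phi. ?V \<theta> \<phi> * sin (real k * \<phi>))\<^sup>2)"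
      proof (rule sum_mono)
        fix k assume "k \<in> {1..K}"
        then have k: "1 \<le> k" by simp
        have "1 \<le> (real k)\<^sup>2" using k by simp
        then have "1 * ((?c \<theta> k)\<^sup>2 + (?s \<theta> k)\<^sup>2) \<le> (real k)\<^sup>2 * ((?c \<theta> k)\<^sup>2 + (?s \<theta> k)\<^sup>2)"
          by (intro mult_right_mono) auto
        then show "(?c \<theta> k)\<^sup>2 + (?s \<theta> k)\<^sup>2 \<le> (LINT \<phi>|Phi. ?V \<theta> \<phi> * cos (real k * \<phi>))\<^sup>2 + (LINT \<phi>|Phi. ?V \<theta> \<phi> * sin (real k * \<phi>))\<^sup>2"
          unfolding id[OF k] by (simp add: power_mult_distrib algebra_simps)
      qed
      also have "\<dots> \<le> pi * (LINT \<phi>|Phi. (?V \<theta> \<phi>)\<^sup>2)" by (rule Bessel_Phi[OF iV iV2])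
      also have "\<dots> \<le> pi * (LINT \<phi>|Phi. (norm (V (A *v sph \<theta> \<phi>)))\<^sup>2)"
        by (intro mult_left_mono integral_mono iV2 elim(3) le) simp
      finally show "(\<Sum>k=1..K. (?c \<theta> k)\<^sup>2 + (?s \<theta> k)\<^sup>2) \<le> pi * (LINT \<phi>|Phi. (norm (V (A *v sph \<theta> \<phi>)))\<^sup>2)" .
    qed
  qed
qed

section \<open>Square norms by duality with polynomials in \<open>cos \<theta>\<close>\<close>

text \<open>Every continuous function on \<open>[0, \<pi>]\<close> is a uniform limit of polynomials in \<open>cos \<theta>\<close>.\<close>

lemma Theta_L2_bound_continuous:
  assumes w: "w \<in> borel_measurable borel" "integrable Theta w"
    and poly: "\<And>q. (LINT \<theta>|Theta. w \<theta> * poly q (cos \<theta>))\<^sup>2 \<le> C * (LINT \<theta>|Theta. (poly q (cos \<theta>))\<^sup>2)"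
    and b: "continuous_on UNIV b"
  shows "(LINT \<theta>|Theta. w \<theta> * b \<theta>)\<^sup>2 \<le> C * (LINT \<theta>|Theta. (b \<theta>)\<^sup>2)"
proof -
  note w(1)[measurable]
  have [measurable]: "b \<in> borel_measurable borel" by (rule borel_measurable_continuous_onI[OF b])
  have pm[measurable]: "(\<lambda>\<theta>. poly q (cos \<theta>)) \<in> borel_measurable borel" for q :: "real poly"
    by (intro borel_measurable_continuous_onI continuous_intros)
  have "\<exists>q. \<forall>\<theta>\<in>{0..pi}. \<bar>b \<theta> - poly q (cos \<theta>)\<bar> < e" if "e > 0" for e
  proof -
    have "continuous_on {-1..1} (\<lambda>s. b (arccos s))"
      by (intro continuous_on_compose2[OF b] continuous_intros) auto
    from Stone_Weierstrass_real_polynomial_function[OF compact_Icc this that]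
    obtain p where p: "real_polynomial_function p" "\<And>s. s \<in> {-1..1} \<Longrightarrow> \<bar>b (arccos s) - p s\<bar> < e" by blast
    then obtain a N where a: "p = (\<lambda>x. \<Sum>i\<le>N. a i * x ^ i)" by (auto simp: real_polynomial_function_iff_sum)
    have "\<bar>b \<theta> - poly (\<Sum>i\<le>N. monom (a i) i) (cos \<theta>)\<bar> < e" if "\<theta> \<in> {0..pi}" for \<theta>
      using p(2)[of "cos \<theta>"] that by (simp add: a poly_sum poly_monom arccos_cos)
    then show ?thesis by blast
  qed
  then have "\<forall>n. \<exists>q. \<forall>\<theta>\<in>{0..pi}. \<bar>b \<theta> - poly q (cos \<theta>)\<bar> < inverse (real (Suc n))" by simp
  then obtain q where q: "\<And>n \<theta>. \<theta> \<in> {0..pi} \<Longrightarrow> \<bar>b \<theta> - poly (q n) (cos \<theta>)\<bar> < inverse (real (Suc n))" by metis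
  obtain B where B: "\<forall>\<theta>\<in>{0..pi}. \<bar>b \<theta>\<bar> \<le> B"
    using compact_imp_bounded[OF compact_continuous_image[OF continuous_on_subset[OF b] compact_Icc[of 0 pi]]] by (auto simp: bounded_iff)
  have qb: "\<bar>poly (q n) (cos \<theta>)\<bar> \<le> B + 1" if "\<theta> \<in> {0..pi}" for n \<theta>
  proof -
    have "inverse (real (Suc n)) \<le> 1" by (simp add: inverse_le_1_iff)
    then show ?thesis using q[OF that, of n] B that by (smt (verit))
  qed
  have ql: "(\<lambda>n. poly (q n) (cos \<theta>)) \<longlonglongrightarrow> b \<theta>" if "\<theta> \<in> {0..pi}" for \<theta>
  proof (rule LIMSEQ_I)
    fix r :: real assume "r > 0"
    then obtain N where N: "inverse (real (Suc N)) < r" using reals_Archimedean by blast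
    show "\<exists>N. \<forall>n\<ge>N. norm (poly (q n) (cos \<theta>) - b \<theta>) < r"
    proof (intro exI allI impI)
      fix n assume "n \<ge> N"
      then have "inverse (real (Suc n)) \<le> inverse (real (Suc N))" by (intro le_imp_inverse_le) auto
      then have "\<bar>b \<theta> - poly (q n) (cos \<theta>)\<bar> < r" using q[OF that, of n] N by linarith
      then show "norm (poly (q n) (cos \<theta>) - b \<theta>) < r" by (simp add: abs_minus_commute)
    qed
  qed
  have B0: "B \<ge> 0" using B[rule_format, of 0] by (simp add: order_trans[OF abs_ge_zero])
  have l1: "(\<lambda>n. LINT \<theta>|Theta. w \<theta> * poly (q n) (cos \<theta>)) \<longlonglongrightarrow> (LINT \<theta>|Theta. w \<theta> * b \<theta>)"
  proof (rule integral_dominated_convergence[where w="\<lambda>\<theta>. (B + 1) * \<bar>w \<theta>\<bar>"])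
    show "integrable Theta (\<lambda>\<theta>. (B + 1) * \<bar>w \<theta>\<bar>)" using w(2) by simp
    show "AE \<theta> in Theta. (\<lambda>n. w \<theta> * poly (q n) (cos \<theta>)) \<longlonglongrightarrow> w \<theta> * b \<theta>"
      using AE_Theta by eventually_elim (intro tendsto_intros ql, simp)
    show "AE \<theta> in Theta. norm (w \<theta> * poly (q n) (cos \<theta>)) \<le> (B + 1) * \<bar>w \<theta>\<bar>" for n
      using AE_Theta by eventually_elim (use qb in \<open>auto simp: abs_mult mult.commute[of "B + 1"] intro!: mult_left_mono\<close>)
  qed measurable
  have l2: "(\<lambda>n. LINT \<theta>|Theta. (poly (q n) (cos \<theta>))\<^sup>2) \<longlonglongrightarrow> (LINT \<theta>|Theta. (b \<theta>)\<^sup>2)"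
  proof (rule integral_dominated_convergence[where w="\<lambda>\<theta>. (B + 1)\<^sup>2"])
    show "AE \<theta> in Theta. (\<lambda>n. (poly (q n) (cos \<theta>))\<^sup>2) \<longlonglongrightarrow> (b \<theta>)\<^sup>2"
      using AE_Theta by eventually_elim (intro tendsto_intros ql, simp)
    show "AE \<theta> in Theta. norm ((poly (q n) (cos \<theta>))\<^sup>2) \<le> (B + 1)\<^sup>2" for n
      using AE_Theta by eventually_elim (use qb B0 in \<open>auto simp: abs_le_square_iff[symmetric]\<close>)
  qed simp_all
  show ?thesis
    by (rule LIMSEQ_le[OF tendsto_power[OF l1] tendsto_mult_left[OF l2]]) (use poly in auto)
qed

lemma AE_Theta_if_AE_lborel: "AE \<theta> in lborel. P \<theta> \<Longrightarrow> AE \<theta> in Theta. P \<theta>"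
  unfolding Theta_def by (subst AE_density) auto

lemma ex_continuous_limit:
  fixes w :: "real \<Rightarrow> real"
  assumes "w \<in> borel_measurable borel"
  shows "\<exists>g. (\<forall>n. continuous_on UNIV (g n)) \<and> (AE x in lborel. (\<lambda>n. g n x) \<longlonglongrightarrow> w x)"
proof -
  have "w \<in> borel_measurable lebesgue" using assms by (simp add: measurable_completion)
  from lebesgue_measurable_imp_measurable_on_real[OF this, of UNIV]
  obtain N g where N: "negligible N" "\<And>n. continuous_on UNIV (g n)" "\<And>x. x \<notin> N \<Longrightarrow> (\<lambda>n. g n x) \<longlonglongrightarrow> w x"
    unfolding measurable_on_def by auto
  have "AE x in lebesgue. (\<lambda>n. g n x) \<longlonglongrightarrow> w x"
    by (rule AE_I'[of N]) (use N in \<open>auto simp: negligible_iff_null_sets\<close>)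
  then have "AE x in lborel. (\<lambda>n. g n x) \<longlonglongrightarrow> w x" by (simp add: AE_completion_iff)
  then show ?thesis using N by blast
qed

text \<open>Formally one takes \<open>b = w\<close> in the preceding bound.  As \<open>w\<close> is only measurable, one takes instead the truncation of
\<open>w\<close> at height \<open>k\<close>, which is a bounded limit of continuous functions, and lets \<open>k\<close> tend to infinity.\<close>

lemma Theta_L2_bound:
  assumes w[measurable]: "w \<in> borel_measurable borel" and w2: "integrable Theta (\<lambda>\<theta>. (w \<theta>)\<^sup>2)"
    and poly: "\<And>q. (LINT \<theta>|Theta. w \<theta> * poly q (cos \<theta>))\<^sup>2 \<le> C * (LINT \<theta>|Theta. (poly q (cos \<theta>))\<^sup>2)"
  shows "(LINT \<theta>|Theta. (w \<theta>)\<^sup>2) \<le> C"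
proof -
  have w1: "integrable Theta w" by (rule Theta.square_integrable_imp_integrable[OF _ w2]) measurable
  have C0: "C \<ge> 0"
    using poly[of 1] by simp (meson order_trans zero_le_power2 zero_le_mult_iff not_numeral_le_zero)
  obtain g where g: "\<And>n. continuous_on UNIV (g n)" "AE x in lborel. (\<lambda>n. g n x) \<longlonglongrightarrow> w x"
    using ex_continuous_limit[OF w] by blast
  define T where "T = (\<lambda>(k::nat) y::real. max (- real k) (min (real k) y))"
  have Tc: "continuous_on UNIV (\<lambda>\<theta>. T k (u \<theta>))" if "continuous_on UNIV u" for k and u :: "real \<Rightarrow> real"
    unfolding T_def by (intro continuous_intros that)
  have Tm[measurable]: "T k \<in> borel_measurable borel" for k
    by (rule borel_measurable_continuous_onI) (use Tc[of "\<lambda>y. y" k] in auto)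
  have Tb: "\<bar>T k y\<bar> \<le> real k" for k y by (auto simp: T_def)
  have Tsq: "(T k y)\<^sup>2 \<le> y * T k y" "(T k y)\<^sup>2 \<le> y\<^sup>2" for k y
  proof -
    consider "y > real k" | "y < - real k" | "\<bar>y\<bar> \<le> real k" by linarith
    then have "(T k y)\<^sup>2 \<le> y * T k y \<and> (T k y)\<^sup>2 \<le> y\<^sup>2"
    proof cases
      case 1 then show ?thesis by (auto simp: T_def power2_eq_square intro: mult_right_mono mult_mono)
    next
      case 2
      then have "T k y = - real k" by (auto simp: T_def)
      moreover have "real k * real k \<le> (- y) * real k" using 2 by (intro mult_right_mono) auto
      moreover have "real k * real k \<le> (- y) * (- y)" using 2 by (intro mult_mono) auto
      ultimately show ?thesis by (simp add: power2_eq_square)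
    qed (auto simp: T_def power2_eq_square)
    then show "(T k y)\<^sup>2 \<le> y * T k y" "(T k y)\<^sup>2 \<le> y\<^sup>2" by auto
  qed
  have gm[measurable]: "g n \<in> borel_measurable borel" for n by (rule borel_measurable_continuous_onI[OF g(1)])
  have gl: "AE \<theta> in Theta. (\<lambda>n. T k (g n \<theta>)) \<longlonglongrightarrow> T k (w \<theta>)" for k
  proof -
    have ic: "isCont (T k) y" for y using Tc[of "\<lambda>y. y" k] by (auto simp: continuous_on_eq_continuous_at)
    show ?thesis using AE_Theta_if_AE_lborel[OF g(2)]
    proof eventually_elim
      case (elim \<theta>)
      show ?case by (rule isCont_tendsto_compose[OF ic elim])
    qed
  qed
  have bnd: "(LINT \<theta>|Theta. (T k (w \<theta>))\<^sup>2) \<le> C" for k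
  proof -
    have l1: "(\<lambda>n. LINT \<theta>|Theta. w \<theta> * T k (g n \<theta>)) \<longlonglongrightarrow> (LINT \<theta>|Theta. w \<theta> * T k (w \<theta>))"
    proof (rule integral_dominated_convergence[where w="\<lambda>\<theta>. real k * \<bar>w \<theta>\<bar>"])
      show "AE \<theta> in Theta. (\<lambda>n. w \<theta> * T k (g n \<theta>)) \<longlonglongrightarrow> w \<theta> * T k (w \<theta>)"
        using gl[of k] by eventually_elim (intro tendsto_intros)
      show "AE \<theta> in Theta. norm (w \<theta> * T k (g n \<theta>)) \<le> real k * \<bar>w \<theta>\<bar>" for n
        using mult_right_mono[OF Tb[of k "g n _"], of "\<bar>w _\<bar>"] by (simp add: abs_mult mult.commute)
    qed (use w1 in simp_all)
    have l2: "(\<lambda>n. LINT \<theta>|Theta. (T k (g n \<theta>))\<^sup>2) \<longlonglongrightarrow> (LINT \<theta>|Theta. (T k (w \<theta>))\<^sup>2)"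
    proof (rule integral_dominated_convergence[where w="\<lambda>\<theta>. (real k)\<^sup>2"])
      show "AE \<theta> in Theta. (\<lambda>n. (T k (g n \<theta>))\<^sup>2) \<longlonglongrightarrow> (T k (w \<theta>))\<^sup>2"
        using gl[of k] by eventually_elim (intro tendsto_intros)
      show "AE \<theta> in Theta. norm ((T k (g n \<theta>))\<^sup>2) \<le> (real k)\<^sup>2" for n
        using Tb[of k "g n _"] by (auto simp: abs_le_square_iff[symmetric])
    qed simp_all
    have "(LINT \<theta>|Theta. w \<theta> * T k (g n \<theta>))\<^sup>2 \<le> C * (LINT \<theta>|Theta. (T k (g n \<theta>))\<^sup>2)" for n
      by (rule Theta_L2_bound_continuous[OF w w1 poly Tc[OF g(1)]])
    then have le: "(LINT \<theta>|Theta. w \<theta> * T k (w \<theta>))\<^sup>2 \<le> C * (LINT \<theta>|Theta. (T k (w \<theta>))\<^sup>2)"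
      by (intro LIMSEQ_le[OF tendsto_power[OF l1] tendsto_mult_left[OF l2]]) auto
    define X where "X = (LINT \<theta>|Theta. (T k (w \<theta>))\<^sup>2)"
    have X0: "X \<ge> 0" unfolding X_def by (rule integral_nonneg_AE) simp
    have "X \<le> (LINT \<theta>|Theta. w \<theta> * T k (w \<theta>))" unfolding X_def
    proof (rule integral_mono)
      show "integrable Theta (\<lambda>\<theta>. (T k (w \<theta>))\<^sup>2)"
        by (rule Bochner_Integration.integrable_bound[OF w2]) (use Tsq(2) in auto)
      show "integrable Theta (\<lambda>\<theta>. w \<theta> * T k (w \<theta>))"
        by (rule integrable_mult_bounded[OF w1 _ Tb]) measurable
    qed (rule Tsq(1))
    then have "X\<^sup>2 \<le> (LINT \<theta>|Theta. w \<theta> * T k (w \<theta>))\<^sup>2" using X0 by (intro power_mono)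
    then have "X * X \<le> C * X" using le by (simp add: X_def power2_eq_square)
    then show ?thesis using X0 C0 unfolding X_def[symmetric] by (cases "X = 0") auto
  qed
  have "(\<lambda>k. LINT \<theta>|Theta. (T k (w \<theta>))\<^sup>2) \<longlonglongrightarrow> (LINT \<theta>|Theta. (w \<theta>)\<^sup>2)"
  proof (rule integral_dominated_convergence[where w="\<lambda>\<theta>. (w \<theta>)\<^sup>2", OF _ _ w2])
    have "(\<lambda>k. (T k y)\<^sup>2) \<longlonglongrightarrow> y\<^sup>2" for y
    proof (rule tendsto_eventually)
      obtain N :: nat where N: "\<bar>y\<bar> \<le> real N" using real_arch_simple by blast
      show "eventually (\<lambda>k. (T k y)\<^sup>2 = y\<^sup>2) sequentially"
      proof (rule eventually_sequentiallyI[of N])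
        fix k assume "N \<le> k"
        then have "\<bar>y\<bar> \<le> real k" using N by linarith
        then have "T k y = y" unfolding T_def by linarith
        then show "(T k y)\<^sup>2 = y\<^sup>2" by simp
      qed
    qed
    then show "AE \<theta> in Theta. (\<lambda>k. (T k (w \<theta>))\<^sup>2) \<longlonglongrightarrow> (w \<theta>)\<^sup>2" by simp
    show "AE \<theta> in Theta. norm ((T k (w \<theta>))\<^sup>2) \<le> (w \<theta>)\<^sup>2" for k using Tsq(2) by simp
  qed measurable
  then show ?thesis by (rule LIMSEQ_le_const2) (use bnd in auto)
qed

section \<open>The zonal mode of a slice\<close>

lemma zonal_field_gradient:
  assumes A: "rotation_matrix A"
  shows "real_polynomial_function (\<lambda>m. (column i A \<bullet> m) * poly \<eta> (column 3 A \<bullet> m))"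
    and "gradient (\<lambda>m. (column i A \<bullet> m) * poly \<eta> (column 3 A \<bullet> m)) m \<bullet> v
      = (column i A \<bullet> v) * poly \<eta> (column 3 A \<bullet> m) + (column i A \<bullet> m) * ((column 3 A \<bullet> v) * poly (pderiv \<eta>) (column 3 A \<bullet> m))"
proof -
  show p: "real_polynomial_function (\<lambda>m. (column i A \<bullet> m) * poly \<eta> (column 3 A \<bullet> m))"
    by (intro real_polynomial_function.intros(4) real_polynomial_function_poly real_polynomial_inner)
  have d: "((\<lambda>m. column i A \<bullet> m) has_derivative (\<lambda>v. column i A \<bullet> v)) (at m)" for i by (auto intro!: derivative_eq_intros)
  from has_derivative_mult[OF d[of i] DERIV_compose_FDERIV[OF poly_DERIV d[of 3]]]
  have "((\<lambda>m. (column i A \<bullet> m) * poly \<eta> (column 3 A \<bullet> m)) has_derivative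
     (\<lambda>v. (column i A \<bullet> m) * ((column 3 A \<bullet> v) * poly (pderiv \<eta>) (column 3 A \<bullet> m)) + (column i A \<bullet> v) * poly \<eta> (column 3 A \<bullet> m))) (at m)" .
  from has_derivative_unique[OF real_polynomial_has_gradient[OF p] this]
  show "gradient (\<lambda>m. (column i A \<bullet> m) * poly \<eta> (column 3 A \<bullet> m)) m \<bullet> v
      = (column i A \<bullet> v) * poly \<eta> (column 3 A \<bullet> m) + (column i A \<bullet> m) * ((column 3 A \<bullet> v) * poly (pderiv \<eta>) (column 3 A \<bullet> m))"
    by (simp add: fun_eq_iff)
qed

text \<open>The test field is \<open>\<eta>(k3 \<bullet> m) (k3 \<times> m)\<close>, which points along the parallels; its components
are polynomials.  Its rotational divergence is, up to sign, the derivative of \<open>(1 - s\<^sup>2) \<eta>(s)\<close> at \<open>s = cos \<theta>\<close>,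
and only the mean of \<open>u\<close> over the parallel is seen by it.\<close>

lemma slice_zonal_identity:
  assumes sw: "slice_weak_rot u V" and A: "rotation_matrix A"
    and u: "sq_integrable S2 u" and V: "sq_integrable S2 V"
  shows "(LINT \<theta>|Theta. LINT \<phi>|Phi. u (A *v sph \<theta> \<phi>) * poly (pderiv ([:1, 0, -1:] * \<eta>)) (cos \<theta>))
    = (LINT \<theta>|Theta. LINT \<phi>|Phi. (poly \<eta> (cos \<theta>) * sin \<theta>) *
        (cos \<phi> * (column 2 A \<bullet> V (A *v sph \<theta> \<phi>)) - sin \<phi> * (column 1 A \<bullet> V (A *v sph \<theta> \<phi>))))"
proof -
  let ?k = "\<lambda>i. column i A"
  let ?w = "\<lambda>i m. (?k i \<bullet> m) * poly \<eta> (?k 3 \<bullet> m)"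
  have tri: "?k i \<bullet> cross3 (?k j) m = cross3 (?k i) (?k j) \<bullet> m" for i j m
    by (simp add: cross_components inner_vec_def sum_3 algebra_simps)
  have skew: "cross3 (?k 2) (?k 1) = - ?k 3" "cross3 (?k 3) (?k 2) = - ?k 1"
    using cross3_columns[OF A] cross_skew[of "?k 2" "?k 1"] cross_skew[of "?k 3" "?k 2"] by simp_all
  note s1 = slice_weak_rot_component[OF sw zonal_field_gradient(1)[OF A, of 2 \<eta>], of "?k 1"]
  note s2 = slice_weak_rot_component[OF sw zonal_field_gradient(1)[OF A, of 1 \<eta>], of "?k 2"]
  define I where "I = (\<lambda>m. (u m * (gradient (?w 1) m \<bullet> cross3 (?k 2) m) + ?w 1 m * (V m \<bullet> ?k 2))
     - (u m * (gradient (?w 2) m \<bullet> cross3 (?k 1) m) + ?w 2 m * (V m \<bullet> ?k 1)))"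
  have iI: "integrable S2 I" unfolding I_def by (intro Bochner_Integration.integrable_diff s1 s2)
  have I0: "(LINT m|S2. I m) = 0" unfolding I_def using s1 s2 by simp
  define a where "a = (\<lambda>\<theta> \<phi>. u (A *v sph \<theta> \<phi>) * poly (pderiv ([:1, 0, -1:] * \<eta>)) (cos \<theta>))"
  define b where "b = (\<lambda>\<theta> \<phi>. (poly \<eta> (cos \<theta>) * sin \<theta>) *
        (cos \<phi> * (column 2 A \<bullet> V (A *v sph \<theta> \<phi>)) - sin \<phi> * (column 1 A \<bullet> V (A *v sph \<theta> \<phi>))))"
  have e: "I (A *v sph \<theta> \<phi>) = b \<theta> \<phi> - a \<theta> \<phi>" for \<theta> \<phi>
  proof -
    have c2: "(cos \<theta>)\<^sup>2 = 1 - (sin \<theta>)\<^sup>2" "(cos \<phi>)\<^sup>2 = 1 - (sin \<phi>)\<^sup>2" by (simp_all add: cos_squared_eq)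
    have p: "poly (pderiv ([:1, 0, -1:] * \<eta>)) x = (1 - x\<^sup>2) * poly (pderiv \<eta>) x - 2 * x * poly \<eta> x" for x
      unfolding pderiv_mult by (simp add: pderiv_pCons power2_eq_square algebra_simps)
    define E E' U where EE: "E = poly \<eta> (cos \<theta>)" "E' = poly (pderiv \<eta>) (cos \<theta>)" "U = u (A *v sph \<theta> \<phi>)"
    have g1: "gradient (?w 1) (A *v sph \<theta> \<phi>) \<bullet> cross3 (?k 2) (A *v sph \<theta> \<phi>) = cos \<theta> * E - (sin \<theta> * cos \<phi>)\<^sup>2 * E'"
      unfolding zonal_field_gradient(2)[OF A] tri skew cross3_columns[OF A] inner_minus_left rotated_sph_inner[OF A]
      by (simp add: EE power2_eq_square)
    have g2: "gradient (?w 2) (A *v sph \<theta> \<phi>) \<bullet> cross3 (?k 1) (A *v sph \<theta> \<phi>) = (sin \<theta> * sin \<phi>)\<^sup>2 * E' - cos \<theta> * E"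
      unfolding zonal_field_gradient(2)[OF A] tri skew cross3_columns[OF A] inner_minus_left rotated_sph_inner[OF A]
      by (simp add: EE power2_eq_square)
    have sc: "(sin \<theta> * cos \<phi>)\<^sup>2 + (sin \<theta> * sin \<phi>)\<^sup>2 = 1 - (cos \<theta>)\<^sup>2"
      unfolding power_mult_distrib c2 by (simp add: algebra_simps)
    have "U * (cos \<theta> * E - (sin \<theta> * cos \<phi>)\<^sup>2 * E') - U * ((sin \<theta> * sin \<phi>)\<^sup>2 * E' - cos \<theta> * E)
       = U * (2 * cos \<theta> * E - ((sin \<theta> * cos \<phi>)\<^sup>2 + (sin \<theta> * sin \<phi>)\<^sup>2) * E')" by (simp add: algebra_simps)
    also have "\<dots> = - (U * ((1 - (cos \<theta>)\<^sup>2) * E' - 2 * cos \<theta> * E))" unfolding sc by (simp add: algebra_simps)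
    finally have k: "U * (cos \<theta> * E - (sin \<theta> * cos \<phi>)\<^sup>2 * E') - U * ((sin \<theta> * sin \<phi>)\<^sup>2 * E' - cos \<theta> * E)
      = - (U * ((1 - (cos \<theta>)\<^sup>2) * E' - 2 * cos \<theta> * E))" .
    show ?thesis
      unfolding I_def g1 g2 a_def b_def p EE[symmetric] rotated_sph_inner[OF A]
      using k by (simp add: inner_commute algebra_simps)
  qed
  have iu: "integrable (Theta \<Otimes>\<^sub>M Phi) (\<lambda>(\<theta>, \<phi>). a \<theta> \<phi>)"
  proof -
    obtain C where C: "\<forall>x\<in>{-1..1}. \<bar>poly (pderiv ([:1, 0, -1:] * \<eta>)) x\<bar> \<le> C"
      using compact_imp_bounded[OF compact_continuous_image[OF continuous_on_poly[OF continuous_on_id] compact_Icc[of "-1" 1]]]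
      by (auto simp: bounded_iff)
    have m: "(\<lambda>x. poly (pderiv ([:1, 0, -1:] * \<eta>)) (cos (fst x))) \<in> borel_measurable (Theta \<Otimes>\<^sub>M Phi)"
      by (rule measurable_compose[OF measurable_fst])
        (simp add: measurable_cong_sets[OF sets_Theta refl], intro borel_measurable_continuous_onI continuous_intros)
    show ?thesis unfolding a_def
      using integrable_mult_bounded[OF integrable_S2_rotated[OF A sq_integrable_S2_facts(3)[OF u]] m, of C] C
      by (simp add: split_beta')
  qed
  have iba: "integrable (Theta \<Otimes>\<^sub>M Phi) (\<lambda>(\<theta>, \<phi>). b \<theta> \<phi> - a \<theta> \<phi>)"
    using integrable_S2_rotated[OF A iI] unfolding e .
  have ib: "integrable (Theta \<Otimes>\<^sub>M Phi) (\<lambda>(\<theta>, \<phi>). b \<theta> \<phi>)"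
    using Bochner_Integration.integrable_add[OF iba iu] by (simp add: split_beta')
  have "0 = (LINT x|(Theta \<Otimes>\<^sub>M Phi). (case x of (\<theta>, \<phi>) \<Rightarrow> b \<theta> \<phi> - a \<theta> \<phi>))"
    using I0 integral_S2_rotated[OF A iI] TP.integral_fst'[OF iba] by (simp add: e)
  also have "\<dots> = (LINT x|(Theta \<Otimes>\<^sub>M Phi). (case x of (\<theta>, \<phi>) \<Rightarrow> b \<theta> \<phi>)) - (LINT x|(Theta \<Otimes>\<^sub>M Phi). (case x of (\<theta>, \<phi>) \<Rightarrow> a \<theta> \<phi>))"
    using Bochner_Integration.integral_diff[OF ib iu] by (simp add: split_beta')
  finally have "(LINT \<theta>|Theta. LINT \<phi>|Phi. a \<theta> \<phi>) = (LINT \<theta>|Theta. LINT \<phi>|Phi. b \<theta> \<phi>)"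
    using TP.integral_fst'[OF ib] TP.integral_fst'[OF iu] by simp
  then show ?thesis by (simp only: a_def b_def)
qed

text \<open>A Poincare inequality for the mean over the parallels.  A polynomial \<open>p\<close> with mean zero on \<open>[-1, 1]\<close> has a primitive
\<open>P\<close> that vanishes at both ends, so \<open>P = (1 - s\<^sup>2) \<eta>\<close> and \<open>slice_zonal_identity\<close> expresses the pairing of \<open>p\<close> with
the mean of \<open>u\<close> by \<open>V\<close>.  By \<open>poly_primitive_bound\<close> the test field is bounded by the norm of \<open>p\<close>, and
the bound passes to the function itself by \<open>Theta_L2_bound\<close>.\<close>

lemma slice_zonal_bound:
  assumes sw: "slice_weak_rot u V" and A: "rotation_matrix A"
    and u: "sq_integrable S2 u" and V: "sq_integrable S2 V"
  defines "\<alpha> \<equiv> \<lambda>\<theta>. (LINT \<phi>|Phi. u (A *v sph \<theta> \<phi>)) / (2 * pi)"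
  shows "integrable Theta (\<lambda>\<theta>. (\<alpha> \<theta>)\<^sup>2)"
    and "\<exists>c. (LINT \<theta>|Theta. (\<alpha> \<theta> - c)\<^sup>2) \<le> (LINT m|S2. (norm (V m))\<^sup>2) / pi"
proof -
  note uD = sq_integrable_S2_facts[OF u] and VD = sq_integrable_S2_facts[OF V]
  have [measurable]: "(\<lambda>x. u (A *v sph (fst x) (snd x))) \<in> borel_measurable (Theta \<Otimes>\<^sub>M Phi)"
    using integrable_S2_rotated[OF A uD(3)] by (auto simp: split_beta' dest: borel_measurable_integrable)
  have am: "\<alpha> \<in> borel_measurable borel"
    using integrable_Theta_rotated[OF A uD(3)] unfolding \<alpha>_def
    by (auto simp: measurable_cong_sets[OF sets_Theta refl, symmetric] intro!: borel_measurable_divide borel_measurable_integrable)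
  have ai: "integrable Theta \<alpha>" unfolding \<alpha>_def using integrable_Theta_rotated[OF A uD(3)] by simp
  show a2: "integrable Theta (\<lambda>\<theta>. (\<alpha> \<theta>)\<^sup>2)"
  proof (rule Bochner_Integration.integrable_bound)
    show "integrable Theta (\<lambda>\<theta>. (LINT \<phi>|Phi. (norm (u (A *v sph \<theta> \<phi>)))\<^sup>2) / (2 * pi))"
      using integrable_Theta_rotated[OF A uD(2)] by simp
    show "(\<lambda>\<theta>. (\<alpha> \<theta>)\<^sup>2) \<in> borel_measurable Theta" using am by (simp add: measurable_cong_sets[OF sets_Theta refl])
    show "AE \<theta> in Theta. norm ((\<alpha> \<theta>)\<^sup>2) \<le> norm ((LINT \<phi>|Phi. (norm (u (A *v sph \<theta> \<phi>)))\<^sup>2) / (2 * pi))"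
      using AE_integrable_Phi_rotated[OF A uD(3)] AE_integrable_Phi_rotated[OF A uD(2)]
    proof eventually_elim
      case (elim \<theta>)
      have "(LINT \<phi>|Phi. u (A *v sph \<theta> \<phi>) * 1)\<^sup>2 \<le> (LINT \<phi>|Phi. (u (A *v sph \<theta> \<phi>))\<^sup>2) * (LINT \<phi>|Phi. 1\<^sup>2)"
        by (rule Cauchy_Schwarz_integral(2)) (use elim in auto)
      then have "(LINT \<phi>|Phi. u (A *v sph \<theta> \<phi>))\<^sup>2 \<le> (LINT \<phi>|Phi. (u (A *v sph \<theta> \<phi>))\<^sup>2) * (2 * pi)" by simp
      then have "(\<alpha> \<theta>)\<^sup>2 \<le> (LINT \<phi>|Phi. (u (A *v sph \<theta> \<phi>))\<^sup>2) / (2 * pi)"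
        unfolding \<alpha>_def power_divide by (simp add: divide_simps power2_eq_square)
      then show ?case by simp
    qed
  qed
  define K where "K = (LINT m|S2. (norm (V m))\<^sup>2) / pi"
  have K0: "K \<ge> 0" unfolding K_def by (intro divide_nonneg_pos integral_nonneg_AE) auto
  have mean_zero: "(LINT \<theta>|Theta. \<alpha> \<theta> * poly p (cos \<theta>))\<^sup>2 \<le> K * (LINT \<theta>|Theta. (poly p (cos \<theta>))\<^sup>2)"
    if p0: "(LINT \<theta>|Theta. poly p (cos \<theta>)) = 0" for p
  proof -
    obtain P0 where P0: "pderiv P0 = p" using poly_antiderivative by blast
    define P where "P = P0 - [:poly P0 (-1):]"
    have P: "pderiv P = p" "poly P (-1) = 0" by (simp_all add: P_def P0 pderiv_diff pderiv_pCons)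
    have P1: "poly P 1 = 0" using integral_Theta_poly_cos[of P] p0 P by simp
    \<comment> \<open>\<open>P\<close> vanishes at 1 and -1, so it is divisible by \<open>s\<^sup>2 - 1\<close>.\<close>
    obtain R1 where R1: "P = [:-1, 1:] * R1" using P1 by (auto simp: poly_eq_0_iff_dvd dvd_def)
    have "poly R1 (-1) = 0" using P(2) by (simp add: R1)
    then obtain R2 where R2: "R1 = [:1, 1:] * R2" by (auto simp: poly_eq_0_iff_dvd dvd_def)
    define \<eta> where "\<eta> = - R2"
    have Pn: "P = [:1, 0, -1:] * \<eta>" by (simp add: R1 R2 \<eta>_def mult.assoc[symmetric])
    obtain Q where Q: "pderiv Q = p\<^sup>2" using poly_antiderivative by blast
    define N where "N = poly Q 1 - poly Q (-1)"
    have N: "(LINT \<theta>|Theta. (poly p (cos \<theta>))\<^sup>2) = N"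
      using integral_Theta_poly_cos[of Q] by (simp add: Q N_def)
    define f where "f = (\<lambda>x::real\<times>real. poly \<eta> (cos (fst x)) * sin (fst x))"
    define g where "g = (\<lambda>x. cos (snd x) * (column 2 A \<bullet> V (A *v sph (fst x) (snd x))) - sin (snd x) * (column 1 A \<bullet> V (A *v sph (fst x) (snd x))))"
    have Vm[measurable]: "(\<lambda>x. V (A *v sph (fst x) (snd x))) \<in> borel_measurable (Theta \<Otimes>\<^sub>M Phi)"
      using integrable_S2_rotated[OF A VD(3)] by (auto simp: split_beta' dest: borel_measurable_integrable)
    have [measurable]: "fst \<in> borel_measurable (Theta \<Otimes>\<^sub>M Phi)" "snd \<in> borel_measurable (Theta \<Otimes>\<^sub>M Phi)"
      using measurable_fst[of Theta Phi] measurable_snd[of Theta Phi]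
      by (simp_all add: measurable_cong_sets[OF refl sets_Theta] measurable_cong_sets[OF refl sets_Phi])
    have [measurable]: "(\<lambda>x. poly \<eta> (cos x)) \<in> borel_measurable borel" by (intro borel_measurable_continuous_onI continuous_intros)
    have fm[measurable]: "f \<in> borel_measurable (Theta \<Otimes>\<^sub>M Phi)" unfolding f_def by measurable
    have gm[measurable]: "g \<in> borel_measurable (Theta \<Otimes>\<^sub>M Phi)" unfolding g_def by measurable
    have g_le: "(g x)\<^sup>2 \<le> (norm (V (A *v sph (fst x) (snd x))))\<^sup>2" for x
    proof -
      define e where "e = cos (snd x) *\<^sub>R column 2 A - sin (snd x) *\<^sub>R column 1 A"
      have n: "column i A \<bullet> column j A = (if i = j then 1 else 0)" for i j
        using column_inner_rotated[OF A, of i "axis j 1"] by (simp add: column_eq_axis axis_def)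
      have "e \<bullet> e = (cos (snd x))\<^sup>2 + (sin (snd x))\<^sup>2"
        by (simp add: e_def inner_diff_left inner_diff_right n power2_eq_square)
      then have "norm e = 1" by (simp add: norm_eq_sqrt_inner)
      moreover have "g x = e \<bullet> V (A *v sph (fst x) (snd x))" by (simp add: g_def e_def inner_diff_left)
      ultimately have "\<bar>g x\<bar> \<le> norm (V (A *v sph (fst x) (snd x)))" using Cauchy_Schwarz_ineq2[of e "V (A *v sph (fst x) (snd x))"] by simp
      then show ?thesis by (simp add: abs_le_square_iff[symmetric])
    qed
    have iV: "integrable (Theta \<Otimes>\<^sub>M Phi) (\<lambda>x. (norm (V (A *v sph (fst x) (snd x))))\<^sup>2)"
      using integrable_S2_rotated[OF A VD(2)] by (simp add: split_beta')
    have ig: "integrable (Theta \<Otimes>\<^sub>M Phi) (\<lambda>x. (g x)\<^sup>2)"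
      by (rule Bochner_Integration.integrable_bound[OF iV]) (use g_le in auto)
    have "(LINT x|(Theta \<Otimes>\<^sub>M Phi). (g x)\<^sup>2) \<le> (LINT x|(Theta \<Otimes>\<^sub>M Phi). (norm (V (A *v sph (fst x) (snd x))))\<^sup>2)"
      by (rule integral_mono[OF ig iV g_le])
    also have "\<dots> = K * pi"
      using integral_S2_rotated[OF A VD(2)] TP.integral_fst'[OF iV] by (simp add: K_def)
    finally have gK: "(LINT x|(Theta \<Otimes>\<^sub>M Phi). (g x)\<^sup>2) \<le> K * pi" .
    have N0: "N \<ge> 0" unfolding N[symmetric] by (rule integral_nonneg_AE) simp
    have fN: "(poly \<eta> (cos \<theta>) * sin \<theta>)\<^sup>2 \<le> N" if "\<theta> \<in> {0..pi} \<and> sin \<theta> > 0" for \<theta>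
    proof -
      have s: "(sin \<theta>)\<^sup>2 > 0" using that by simp
      have "(poly P (cos \<theta>))\<^sup>2 \<le> (sin \<theta>)\<^sup>2 * N"
        unfolding N_def sin_squared_eq by (rule poly_primitive_bound[OF P P1 Q]) auto
      moreover have "poly P (cos \<theta>) = (sin \<theta>)\<^sup>2 * poly \<eta> (cos \<theta>)"
      proof -
        have "poly P (cos \<theta>) = (1 - (cos \<theta>)\<^sup>2) * poly \<eta> (cos \<theta>)"
          unfolding Pn by (simp add: power2_eq_square algebra_simps)
        then show ?thesis by (simp only: sin_squared_eq)
      qed
      ultimately have "(sin \<theta>)\<^sup>2 * (poly \<eta> (cos \<theta>) * sin \<theta>)\<^sup>2 \<le> (sin \<theta>)\<^sup>2 * N"
        by (simp add: power_mult_distrib power2_eq_square mult_ac)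
      then show ?thesis using s by (simp add: mult_le_cancel_left_pos)
    qed
    have cf: "continuous_on UNIV (\<lambda>\<theta>. (poly \<eta> (cos \<theta>) * sin \<theta>)\<^sup>2)" by (intro continuous_intros)
    have if2: "integrable Theta (\<lambda>\<theta>. (poly \<eta> (cos \<theta>) * sin \<theta>)\<^sup>2)" by (rule integrable_Theta_continuous[OF cf])
    have if3: "integrable (Theta \<Otimes>\<^sub>M Phi) (\<lambda>x. (f x)\<^sup>2)"
    proof (rule TP.Fubini_integrable)
      show "integrable Theta (\<lambda>x. LINT y|Phi. norm ((f (x, y))\<^sup>2))"
        using if2 by (simp add: f_def)
    qed (auto simp: f_def)
    have f2: "(LINT x|(Theta \<Otimes>\<^sub>M Phi). (f x)\<^sup>2) \<le> 4 * pi * N"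
    proof -
      have "(LINT x|(Theta \<Otimes>\<^sub>M Phi). (f x)\<^sup>2) = 2 * pi * (LINT \<theta>|Theta. (poly \<eta> (cos \<theta>) * sin \<theta>)\<^sup>2)"
        using TP.integral_fst'[OF if3] by (simp add: f_def)
      moreover have "(LINT \<theta>|Theta. (poly \<eta> (cos \<theta>) * sin \<theta>)\<^sup>2) \<le> (LINT \<theta>|Theta. N)"
        by (rule integral_mono_AE[OF if2]) (use AE_Theta fN in \<open>auto elim: eventually_mono\<close>)
      ultimately show ?thesis using pi_gt_zero by (simp add: mult_left_mono)
    qed
    have ifg: "integrable (Theta \<Otimes>\<^sub>M Phi) (\<lambda>x. f x * g x)"
      by (rule integrable_mult_L2[OF fm gm if3 ig])
    have "2 * pi * (LINT \<theta>|Theta. \<alpha> \<theta> * poly p (cos \<theta>)) = (LINT \<theta>|Theta. LINT \<phi>|Phi. u (A *v sph \<theta> \<phi>) * poly p (cos \<theta>))"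
      by (simp add: \<alpha>_def)
    also have "\<dots> = (LINT \<theta>|Theta. LINT \<phi>|Phi. f (\<theta>, \<phi>) * g (\<theta>, \<phi>))"
      using slice_zonal_identity[OF sw A u V, of \<eta>] by (simp only: Pn[symmetric] P(1)) (simp add: f_def g_def)
    also have "\<dots> = (LINT x|(Theta \<Otimes>\<^sub>M Phi). f x * g x)"
      using TP.integral_fst'[OF ifg] by simp
    finally have "(2 * pi * (LINT \<theta>|Theta. \<alpha> \<theta> * poly p (cos \<theta>)))\<^sup>2 = (LINT x|(Theta \<Otimes>\<^sub>M Phi). f x * g x)\<^sup>2" by simp
    also have "\<dots> \<le> (LINT x|(Theta \<Otimes>\<^sub>M Phi). (f x)\<^sup>2) * (LINT x|(Theta \<Otimes>\<^sub>M Phi). (g x)\<^sup>2)"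
      by (rule Cauchy_Schwarz_integral(2)[OF fm gm if3 ig])
    also have "\<dots> \<le> (4 * pi * N) * (K * pi)"
      by (rule mult_mono[OF f2 gK]) (use N0 in \<open>auto intro!: integral_nonneg_AE\<close>)
    finally have "(LINT \<theta>|Theta. \<alpha> \<theta> * poly p (cos \<theta>))\<^sup>2 \<le> N * K"
      by (simp add: power_mult_distrib power2_eq_square)
    then show ?thesis unfolding N by (simp add: mult.commute)
  qed
  \<comment> \<open>\<open>Theta\<close> has total mass 2, so \<open>c\<close> is the mean of \<open>\<alpha>\<close>, and subtracting it allows arbitrary polynomials.\<close>
  define c where "c = (LINT \<theta>|Theta. \<alpha> \<theta>) / 2"
  have ip: "integrable Theta (\<lambda>\<theta>. poly q (cos \<theta>))" "integrable Theta (\<lambda>\<theta>. (poly q (cos \<theta>))\<^sup>2)" for q :: "real poly"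
    by (intro integrable_Theta_continuous continuous_intros)+
  have iap: "integrable Theta (\<lambda>\<theta>. \<alpha> \<theta> * poly q (cos \<theta>))" for q
    by (rule integrable_mult_L2[OF _ _ a2 ip(2)])
      (use am ip(1) in \<open>auto simp: measurable_cong_sets[OF sets_Theta refl] dest: borel_measurable_integrable\<close>)
  have "(LINT \<theta>|Theta. (\<alpha> \<theta> - c)\<^sup>2) \<le> K"
  proof (rule Theta_L2_bound)
    show "(\<lambda>\<theta>. \<alpha> \<theta> - c) \<in> borel_measurable borel" using am by measurable
    show "integrable Theta (\<lambda>\<theta>. (\<alpha> \<theta> - c)\<^sup>2)" unfolding power2_diff using a2 ai by simp
    fix q :: "real poly"
    define d where "d = (LINT \<theta>|Theta. poly q (cos \<theta>)) / 2"
    \<comment> \<open>The projection of \<open>q\<close> to mean zero has at most the norm of \<open>q\<close> and the same pairing with \<open>\<alpha> - c\<close>.\<close>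
    define p where "p = q - [:d:]"
    have pq: "poly p (cos \<theta>) = poly q (cos \<theta>) - d" for \<theta> by (simp add: p_def)
    have d2: "(LINT \<theta>|Theta. poly q (cos \<theta>)) = 2 * d" by (simp add: d_def)
    have c2: "(LINT \<theta>|Theta. \<alpha> \<theta>) = 2 * c" by (simp add: c_def)
    have p0: "(LINT \<theta>|Theta. poly p (cos \<theta>)) = 0" unfolding pq using ip(1)[of q] by (simp add: d2)
    have "(LINT \<theta>|Theta. (\<alpha> \<theta> - c) * poly q (cos \<theta>)) = (LINT \<theta>|Theta. \<alpha> \<theta> * poly q (cos \<theta>)) - 2 * c * d"
      using iap ip(1)[of q] by (simp add: left_diff_distrib d2)
    moreover have "(LINT \<theta>|Theta. \<alpha> \<theta> * poly p (cos \<theta>)) = (LINT \<theta>|Theta. \<alpha> \<theta> * poly q (cos \<theta>)) - 2 * c * d"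
      unfolding pq using iap[of q] ai by (simp add: right_diff_distrib c2)
    ultimately have e: "(LINT \<theta>|Theta. (\<alpha> \<theta> - c) * poly q (cos \<theta>)) = (LINT \<theta>|Theta. \<alpha> \<theta> * poly p (cos \<theta>))" by simp
    have "(LINT \<theta>|Theta. (poly p (cos \<theta>))\<^sup>2) = (LINT \<theta>|Theta. (poly q (cos \<theta>))\<^sup>2 - 2 * d * poly q (cos \<theta>) + d\<^sup>2)"
      unfolding pq power2_diff by (intro Bochner_Integration.integral_cong) (auto simp: algebra_simps)
    also have "\<dots> = (LINT \<theta>|Theta. (poly q (cos \<theta>))\<^sup>2) - 2 * d\<^sup>2"
      using ip[of q] by (simp add: d2 power2_eq_square)
    finally have "(LINT \<theta>|Theta. (poly p (cos \<theta>))\<^sup>2) \<le> (LINT \<theta>|Theta. (poly q (cos \<theta>))\<^sup>2)" by simp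
    then have "K * (LINT \<theta>|Theta. (poly p (cos \<theta>))\<^sup>2) \<le> K * (LINT \<theta>|Theta. (poly q (cos \<theta>))\<^sup>2)" using K0 by (rule mult_left_mono)
    then show "(LINT \<theta>|Theta. (\<alpha> \<theta> - c) * poly q (cos \<theta>))\<^sup>2 \<le> K * (LINT \<theta>|Theta. (poly q (cos \<theta>))\<^sup>2)"
      using mean_zero[OF p0] unfolding e by linarith
  qed
  then show "\<exists>c. (LINT \<theta>|Theta. (\<alpha> \<theta> - c)\<^sup>2) \<le> (LINT m|S2. (norm (V m))\<^sup>2) / pi" unfolding K_def by blast
qed

section \<open>The interaction potential\<close>

lemma nn_integral_lborel_affine:
  fixes f :: "'a::euclidean_space \<Rightarrow> ennreal"
  assumes [measurable]: "f \<in> borel_measurable borel" and c: "c \<noteq> 0"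
  shows "(\<integral>\<^sup>+x. f x \<partial>lborel) = ennreal (\<bar>c\<bar> ^ DIM('a)) * (\<integral>\<^sup>+x. f (t + c *\<^sub>R x) \<partial>lborel)"
proof -
  have m: "(\<lambda>x. t + c *\<^sub>R x) \<in> borel_measurable (lborel :: 'a measure)" by simp
  have "(\<integral>\<^sup>+x. f x \<partial>lborel) = (\<integral>\<^sup>+x. f x \<partial>density (distr lborel borel (\<lambda>x. t + c *\<^sub>R x)) (\<lambda>_. \<bar>c\<bar> ^ DIM('a)))"
    using lborel_affine[OF c, of t] by simp
  also have "\<dots> = (\<integral>\<^sup>+x. ennreal (\<bar>c\<bar> ^ DIM('a)) * f x \<partial>distr lborel borel (\<lambda>x. t + c *\<^sub>R x))"
    by (rule nn_integral_density) simp_all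
  also have "\<dots> = (\<integral>\<^sup>+x. ennreal (\<bar>c\<bar> ^ DIM('a)) * f (t + c *\<^sub>R x) \<partial>lborel)"
    by (rule nn_integral_distr[OF m]) simp
  also have "\<dots> = ennreal (\<bar>c\<bar> ^ DIM('a)) * (\<integral>\<^sup>+x. f (t + c *\<^sub>R x) \<partial>lborel)"
    by (rule nn_integral_cmult) (rule measurable_compose[OF m assms(1)])
  finally show ?thesis .
qed

lemma integrable_lborel_affine:
  fixes f :: "'a::euclidean_space \<Rightarrow> real"
  assumes f: "integrable lborel f" and c: "c \<noteq> 0"
  shows "integrable lborel (\<lambda>x. f (t + c *\<^sub>R x))"
proof -
  have [measurable]: "f \<in> borel_measurable borel" using f by (simp add: borel_measurable_integrable)
  have "ennreal (\<bar>c\<bar> ^ DIM('a)) * (\<integral>\<^sup>+x. ennreal \<bar>f (t + c *\<^sub>R x)\<bar> \<partial>lborel) < \<infinity>"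
    using f by (subst nn_integral_lborel_affine[symmetric, OF _ c]) (auto simp: integrable_iff_bounded)
  moreover have "ennreal (\<bar>c\<bar> ^ DIM('a)) \<noteq> 0" using c by (simp add: ennreal_eq_0_iff not_le)
  ultimately have "(\<integral>\<^sup>+x. ennreal \<bar>f (t + c *\<^sub>R x)\<bar> \<partial>lborel) < \<infinity>"
    by (auto simp: ennreal_mult_less_top)
  then show ?thesis by (simp add: integrable_iff_bounded)
qed

definition convolution :: "(real^3 \<Rightarrow> real) \<Rightarrow> (real^3 \<Rightarrow> real) \<Rightarrow> real^3 \<Rightarrow> real" where
  "convolution k F x = (LINT y|lborel. k (x - y) * F y)"

text \<open>The bound in square mean is Young's inequality: by Cauchy-Schwarz for the measure with density \<open>abs (k (x - y))\<close>,
the square of the convolution is at most the mass of \<open>k\<close> times the convolution of \<open>abs k\<close> and \<open>F\<^sup>2\<close>.\<close>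

lemma convolution_facts:
  assumes k: "integrable lborel k" "\<And>x. \<bar>k x\<bar> \<le> C" and F[measurable]: "F \<in> borel_measurable borel"
    and F2: "integrable lborel (\<lambda>x. (F x)\<^sup>2)"
  shows convolution_integrable: "integrable lborel (\<lambda>y. k (x - y) * F y)"
    and convolution_measurable: "convolution k F \<in> borel_measurable borel"
    and convolution_bounded: "\<exists>B. \<forall>x. \<bar>convolution k F x\<bar> \<le> B"
    and convolution_L2: "integrable lborel (\<lambda>x. (convolution k F x)\<^sup>2)"
proof -
  note measurable_S2_borel[measurable del]
  have [measurable]: "k \<in> borel_measurable borel" using k(1) by (simp add: borel_measurable_integrable)
  have k2: "integrable lborel (\<lambda>x. (k x)\<^sup>2)"
    unfolding power2_eq_square by (rule integrable_mult_bounded[OF k(1) _ k(2)]) simp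
  have sh: "integrable lborel (\<lambda>y. q (x - y))" if "integrable lborel q" for q :: "real^3 \<Rightarrow> real" and x
    using integrable_lborel_affine[OF that, of "-1" x] by simp
  have k2x: "integrable lborel (\<lambda>y. (k (x - y))\<^sup>2)" for x by (rule sh[OF k2])
  show i: "integrable lborel (\<lambda>y. k (x - y) * F y)" for x
    by (rule integrable_mult_L2[OF _ _ k2x F2]) simp_all
  show m[measurable]: "convolution k F \<in> borel_measurable borel"
  proof -
    have "(\<lambda>x. LINT y|lborel. k (x - y) * F y) \<in> borel_measurable borel"
      by (rule lborel.borel_measurable_lebesgue_integral) (simp add: split_beta')
    then show ?thesis by (simp add: convolution_def[abs_def])
  qed
  have shn: "(\<integral>\<^sup>+y. ennreal (q (x - y)) \<partial>lborel) = (\<integral>\<^sup>+y. ennreal (q y) \<partial>lborel)"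
    if "q \<in> borel_measurable borel" for q :: "real^3 \<Rightarrow> real" and x
    using nn_integral_lborel_affine[of "\<lambda>y. ennreal (q y)" "-1" x] that by simp
  have shn': "(\<integral>\<^sup>+x. ennreal (q (x - y)) \<partial>lborel) = (\<integral>\<^sup>+y. ennreal (q y) \<partial>lborel)"
    if "q \<in> borel_measurable borel" for q :: "real^3 \<Rightarrow> real" and y
    using nn_integral_lborel_affine[of "\<lambda>y. ennreal (q y)" "1" "- y"] that by (simp add: add.commute)
  have "(convolution k F x)\<^sup>2 \<le> (LINT y|lborel. (k y)\<^sup>2) * (LINT y|lborel. (F y)\<^sup>2)" for x
  proof -
    have "(convolution k F x)\<^sup>2 \<le> (LINT y|lborel. (k (x - y))\<^sup>2) * (LINT y|lborel. (F y)\<^sup>2)"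
      unfolding convolution_def by (rule Cauchy_Schwarz_integral(2)[OF _ _ k2x F2]) simp_all
    also have "(LINT y|lborel. (k (x - y))\<^sup>2) = (LINT y|lborel. (k y)\<^sup>2)"
      using shn[of "\<lambda>y. (k y)\<^sup>2" x] by (simp add: integral_eq_nn_integral)
    finally show ?thesis .
  qed
  then have "\<bar>convolution k F x\<bar> \<le> sqrt ((LINT y|lborel. (k y)\<^sup>2) * (LINT y|lborel. (F y)\<^sup>2))" for x
    using real_le_rsqrt[of "\<bar>convolution k F x\<bar>"] by simp
  then show "\<exists>B. \<forall>x. \<bar>convolution k F x\<bar> \<le> B" by blast
  define S where "S = (\<integral>\<^sup>+y. ennreal \<bar>k y\<bar> \<partial>lborel)"
  have S: "S < \<infinity>" using k(1) by (simp add: S_def integrable_iff_bounded)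
  have Sx: "(\<integral>\<^sup>+y. ennreal \<bar>k (x - y)\<bar> \<partial>lborel) = S" "(\<integral>\<^sup>+x. ennreal \<bar>k (x - y)\<bar> \<partial>lborel) = S" for x y
    using shn[of "\<lambda>y. \<bar>k y\<bar>" x] shn'[of "\<lambda>y. \<bar>k y\<bar>" y] by (simp_all add: S_def)
  have bound: "ennreal ((convolution k F x)\<^sup>2) \<le> S * (\<integral>\<^sup>+y. ennreal (\<bar>k (x - y)\<bar> * (F y)\<^sup>2) \<partial>lborel)" for x
  proof -
    have "ennreal \<bar>convolution k F x\<bar> \<le> (\<integral>\<^sup>+y. ennreal \<bar>k (x - y) * F y\<bar> \<partial>lborel)"
      using integral_norm_bound_ennreal[OF i[of x]] by (simp add: convolution_def)
    also have "\<dots> = (\<integral>\<^sup>+y. ennreal (sqrt \<bar>k (x - y)\<bar>) * ennreal (sqrt \<bar>k (x - y)\<bar> * \<bar>F y\<bar>) \<partial>lborel)"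
      by (intro nn_integral_cong) (simp add: ennreal_mult[symmetric] abs_mult mult.assoc[symmetric])
    finally have "(ennreal \<bar>convolution k F x\<bar>)\<^sup>2 \<le> (\<integral>\<^sup>+y. ennreal (sqrt \<bar>k (x - y)\<bar>) * ennreal (sqrt \<bar>k (x - y)\<bar> * \<bar>F y\<bar>) \<partial>lborel)\<^sup>2"
      by (intro power_mono) auto
    also have "\<dots> \<le> (\<integral>\<^sup>+y. (ennreal (sqrt \<bar>k (x - y)\<bar>))\<^sup>2 \<partial>lborel) * (\<integral>\<^sup>+y. (ennreal (sqrt \<bar>k (x - y)\<bar> * \<bar>F y\<bar>))\<^sup>2 \<partial>lborel)"
      by (rule Cauchy_Schwarz_nn_integral) simp_all
    also have "(\<integral>\<^sup>+y. (ennreal (sqrt \<bar>k (x - y)\<bar>))\<^sup>2 \<partial>lborel) = S"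
      unfolding Sx(1)[of x, symmetric] by (intro nn_integral_cong) (simp add: ennreal_power)
    also have "(\<integral>\<^sup>+y. (ennreal (sqrt \<bar>k (x - y)\<bar> * \<bar>F y\<bar>))\<^sup>2 \<partial>lborel) = (\<integral>\<^sup>+y. ennreal (\<bar>k (x - y)\<bar> * (F y)\<^sup>2) \<partial>lborel)"
      by (intro nn_integral_cong) (simp add: ennreal_power power_mult_distrib)
    finally show ?thesis by (simp add: ennreal_power)
  qed
  have "(\<integral>\<^sup>+x. ennreal ((convolution k F x)\<^sup>2) \<partial>lborel) \<le> (\<integral>\<^sup>+x. S * (\<integral>\<^sup>+y. ennreal (\<bar>k (x - y)\<bar> * (F y)\<^sup>2) \<partial>lborel) \<partial>lborel)"
    by (intro nn_integral_mono bound)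
  also have "\<dots> = S * (\<integral>\<^sup>+x. \<integral>\<^sup>+y. ennreal (\<bar>k (x - y)\<bar> * (F y)\<^sup>2) \<partial>lborel \<partial>lborel)"
    by (rule nn_integral_cmult) measurable
  also have "(\<integral>\<^sup>+x. \<integral>\<^sup>+y. ennreal (\<bar>k (x - y)\<bar> * (F y)\<^sup>2) \<partial>lborel \<partial>lborel) = (\<integral>\<^sup>+y. \<integral>\<^sup>+x. ennreal (\<bar>k (x - y)\<bar> * (F y)\<^sup>2) \<partial>lborel \<partial>lborel)"
    by (rule lborel_pair.Fubini') measurable
  also have "\<dots> = (\<integral>\<^sup>+y. S * ennreal ((F y)\<^sup>2) \<partial>lborel)"
    by (intro nn_integral_cong) (simp add: ennreal_mult' nn_integral_multc Sx)
  also have "\<dots> = S * (\<integral>\<^sup>+y. ennreal ((F y)\<^sup>2) \<partial>lborel)" by (rule nn_integral_cmult) measurable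
  finally have "(\<integral>\<^sup>+x. ennreal ((convolution k F x)\<^sup>2) \<partial>lborel) \<le> S * (S * (\<integral>\<^sup>+y. ennreal ((F y)\<^sup>2) \<partial>lborel))" .
  also have "\<dots> < \<infinity>" using S F2 by (auto simp: ennreal_mult_less_top integrable_iff_bounded)
  finally show "integrable lborel (\<lambda>x. (convolution k F x)\<^sup>2)"
    by (intro integrableI_bounded) simp_all
qed

lemma g_eps_integrable_bounded:
  assumes "admissible_kernel g" "\<epsilon> > 0"
  shows "integrable lborel (g_eps g \<epsilon>)" "\<exists>C. \<forall>x. \<bar>g_eps g \<epsilon> x\<bar> \<le> C"
proof -
  have "(LINT x|lborel. g x) = 1" and s: "schwartz g" using assms(1) unfolding admissible_kernel_def by blast+
  then have i: "integrable lborel g" by (metis not_integrable_integral_eq zero_neq_one)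
  have "\<exists>C. \<forall>x. norm x ^ 0 * \<bar>iter_deriv [] g x\<bar> \<le> C" using s unfolding schwartz_def by blast
  then obtain C where C: "\<And>x. \<bar>g x\<bar> \<le> C" by auto
  have "integrable lborel (\<lambda>x. g (0 + inverse (sqrt \<epsilon>) *\<^sub>R x))"
    by (rule integrable_lborel_affine[OF i]) (use assms in simp)
  then show "integrable lborel (g_eps g \<epsilon>)" unfolding g_eps_def by simp
  have "\<bar>g_eps g \<epsilon> x\<bar> \<le> \<epsilon> powr (- 3 / 2) * C" for x
    unfolding g_eps_def abs_mult using C by (intro mult_mono) auto
  then show "\<exists>C. \<forall>x. \<bar>g_eps g \<epsilon> x\<bar> \<le> C" by blast
qed

lemma sq_integrable_phase_slices:
  fixes F :: "(real^3) \<times> (real^3) \<Rightarrow> 'b::euclidean_space"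
  assumes "sq_integrable phase F"
  shows "AE x in lborel. sq_integrable S2 (\<lambda>m. F (x, m))"
proof -
  have m: "F \<in> borel_measurable phase" and i: "integrable phase (\<lambda>p. (norm (F p))\<^sup>2)"
    using assms by (auto simp: sq_integrable_def)
  have ms: "(\<lambda>m. F (x, m)) \<in> borel_measurable S2" for x
    using measurable_compose[OF measurable_Pair1' m[unfolded phase_def], of x] by simp
  show ?thesis using phase_AE_slice_integrable[OF i] by eventually_elim (simp add: sq_integrable_def ms)
qed

lemma abs_component_sphere_le: "norm m = 1 \<Longrightarrow> \<bar>m $ i\<bar> \<le> 1" for m :: "real^3"
  using component_le_norm_cart[of m i] by simp

lemma moment_facts:
  assumes f: "sq_integrable phase f"
  shows "(\<lambda>x. M_mom f x $ k $ l) \<in> borel_measurable borel"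
    and "integrable lborel (\<lambda>x. (M_mom f x $ k $ l)\<^sup>2)"
proof -
  have m[measurable]: "f \<in> borel_measurable (lborel \<Otimes>\<^sub>M S2)" and i: "integrable phase (\<lambda>p. (norm (f p))\<^sup>2)"
    using f by (auto simp: sq_integrable_def phase_def)
  have [measurable]: "(\<lambda>m::real^3. m $ i) \<in> borel_measurable S2" for i
    by (rule measurable_compose[OF measurable_S2_borel]) (intro borel_measurable_continuous_onI continuous_intros)
  show mm: "(\<lambda>x. M_mom f x $ k $ l) \<in> borel_measurable borel"
  proof -
    have "(\<lambda>x. LINT m|S2. m $ k * m $ l * f (x, m)) \<in> borel_measurable lborel"
      by (rule S2.borel_measurable_lebesgue_integral) (simp add: split_beta')
    then show ?thesis by (simp add: M_mom_def)
  qed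
  show "integrable lborel (\<lambda>x. (M_mom f x $ k $ l)\<^sup>2)"
  proof (rule Bochner_Integration.integrable_bound)
    show "integrable lborel (\<lambda>x. measure S2 (sphere 0 1) * (LINT m|S2. (norm (f (x, m)))\<^sup>2))"
      using phase_integrable_slice[OF i] by simp
    show "(\<lambda>x. (M_mom f x $ k $ l)\<^sup>2) \<in> borel_measurable lborel" using mm by simp
    show "AE x in lborel. norm ((M_mom f x $ k $ l)\<^sup>2) \<le> norm (measure S2 (sphere 0 1) * (LINT m|S2. (norm (f (x, m)))\<^sup>2))"
      using sq_integrable_phase_slices[OF f]
    proof eventually_elim
      case (elim x)
      note fx = sq_integrable_S2_facts[OF elim]
      have le: "\<bar>m $ k * m $ l\<bar> \<le> 1" if "norm m = 1" for m :: "real^3"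
        unfolding abs_mult using abs_component_sphere_le[OF that] by (intro mult_le_one) auto
      have c: "integrable S2 (\<lambda>m. (m $ k * m $ l)\<^sup>2)"
        by (rule S2.integrable_const_bound[of _ 1]) (use le in \<open>auto simp: abs_square_le_1\<close>)
      have "(LINT m|S2. (m $ k * m $ l) * f (x, m))\<^sup>2 \<le> (LINT m|S2. (m $ k * m $ l)\<^sup>2) * (LINT m|S2. (f (x, m))\<^sup>2)"
        by (rule Cauchy_Schwarz_integral(2)[OF _ fx(1) c]) (use fx in auto)
      also have "\<dots> \<le> (LINT m|S2. 1) * (LINT m|S2. (f (x, m))\<^sup>2)"
      proof (intro mult_right_mono integral_mono c)
        show "(m $ k * m $ l)\<^sup>2 \<le> 1" if "m \<in> space S2" for m
          using le[of m] that by (simp add: abs_square_le_1)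
      qed (auto intro!: integral_nonneg_AE)
      finally show ?case by (simp add: M_mom_def abs_mult)
    qed
  qed
qed

text \<open>The smoothed second moments in fixed coordinates; \<open>N_mom\<close> is the same matrix in the frame.\<close>

definition Q_mom :: "(real^3 \<Rightarrow> real) \<Rightarrow> real \<Rightarrow> field \<Rightarrow> real^3 \<Rightarrow> real^3^3" where
  "Q_mom g \<epsilon> f x = (\<chi> k l. convolution (g_eps g \<epsilon>) (\<lambda>y. M_mom f y $ k $ l) x)"

lemma Q_mom_facts:
  assumes g: "admissible_kernel g" "\<epsilon> > 0" and f: "sq_integrable phase f"
  shows "(\<lambda>x. Q_mom g \<epsilon> f x $ k $ l) \<in> borel_measurable borel"
    and "integrable lborel (\<lambda>x. (Q_mom g \<epsilon> f x $ k $ l)\<^sup>2)"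
    and "\<exists>B. \<forall>x. \<bar>Q_mom g \<epsilon> f x $ k $ l\<bar> \<le> B"
    and "integrable lborel (\<lambda>y. g_eps g \<epsilon> (x - y) * M_mom f y $ k $ l)"
    and "transpose (Q_mom g \<epsilon> f x) = Q_mom g \<epsilon> f x"
proof -
  obtain C where C: "\<And>x. \<bar>g_eps g \<epsilon> x\<bar> \<le> C" using g_eps_integrable_bounded(2)[OF g] by blast
  note c = convolution_facts[OF g_eps_integrable_bounded(1)[OF g] C moment_facts[OF f, of k l]]
  show "(\<lambda>x. Q_mom g \<epsilon> f x $ k $ l) \<in> borel_measurable borel"
    "integrable lborel (\<lambda>x. (Q_mom g \<epsilon> f x $ k $ l)\<^sup>2)" "\<exists>B. \<forall>x. \<bar>Q_mom g \<epsilon> f x $ k $ l\<bar> \<le> B"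
    "integrable lborel (\<lambda>y. g_eps g \<epsilon> (x - y) * M_mom f y $ k $ l)"
    using c by (simp_all add: Q_mom_def)
  show "transpose (Q_mom g \<epsilon> f x) = Q_mom g \<epsilon> f x"
    by (simp add: Q_mom_def transpose_def vec_eq_iff M_mom_def mult.commute)
qed

text \<open>For unit vectors \<open>(norm (cross3 m m'))\<^sup>2 = 1 - (m \<bullet> m')\<^sup>2\<close>, and the constant term is
annihilated by the mean-zero condition.\<close>

lemma U_eps_eq:
  assumes g: "admissible_kernel g" "\<epsilon> > 0" and f: "sq_integrable phase f"
    and z: "AE x in lborel. (LINT m|S2. f (x, m)) = 0" and m: "norm m = 1"
  shows "U_eps \<alpha> g \<epsilon> f (x, m) = - \<alpha> * (m \<bullet> (Q_mom g \<epsilon> f x *v m))"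
proof -
  have fm[measurable]: "f \<in> borel_measurable (lborel \<Otimes>\<^sub>M S2)" using f by (auto simp: sq_integrable_def phase_def)
  have [measurable]: "g_eps g \<epsilon> \<in> borel_measurable borel"
    using g_eps_integrable_bounded(1)[OF g] by (simp add: borel_measurable_integrable)
  have [measurable]: "(\<lambda>m::real^3. m $ i) \<in> borel_measurable S2" for i
    by (rule measurable_compose[OF measurable_S2_borel]) (intro borel_measurable_continuous_onI continuous_intros)
  have sq: "(m \<bullet> m')\<^sup>2 = (\<Sum>k\<in>UNIV. \<Sum>l\<in>UNIV. m $ k * m $ l * (m' $ k * m' $ l))" for m' :: "real^3"
    by (simp add: power2_eq_square inner_vec_def sum_product mult_ac)
  have cr: "(norm (cross3 m m'))\<^sup>2 = 1 - (m \<bullet> m')\<^sup>2" if "norm m' = 1" for m'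
    using norm_cross_dot[of m m'] by (simp add: m that)
  have "(LINT x'|lborel. LINT m'|S2. (norm (cross3 m m'))\<^sup>2 * g_eps g \<epsilon> (x - x') * f (x', m'))
     = (LINT x'|lborel. - (\<Sum>k\<in>UNIV. \<Sum>l\<in>UNIV. m $ k * m $ l * (g_eps g \<epsilon> (x - x') * M_mom f x' $ k $ l)))"
  proof (rule integral_cong_AE)
    have [measurable]: "(\<lambda>m'. (norm (cross3 m m'))\<^sup>2) \<in> borel_measurable S2" by measurable
    show "(\<lambda>x'. LINT m'|S2. (norm (cross3 m m'))\<^sup>2 * g_eps g \<epsilon> (x - x') * f (x', m')) \<in> borel_measurable lborel"
      by (rule S2.borel_measurable_lebesgue_integral) (simp add: split_beta')
    show "(\<lambda>x'. - (\<Sum>k\<in>UNIV. \<Sum>l\<in>UNIV. m $ k * m $ l * (g_eps g \<epsilon> (x - x') * M_mom f x' $ k $ l))) \<in> borel_measurable lborel"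
      by (intro borel_measurable_uminus borel_measurable_sum borel_measurable_times borel_measurable_const
          borel_measurable_integrable[OF Q_mom_facts(4)[OF g f]])
    show "AE x' in lborel. (LINT m'|S2. (norm (cross3 m m'))\<^sup>2 * g_eps g \<epsilon> (x - x') * f (x', m')) =
       - (\<Sum>k\<in>UNIV. \<Sum>l\<in>UNIV. m $ k * m $ l * (g_eps g \<epsilon> (x - x') * M_mom f x' $ k $ l))"
      using z sq_integrable_phase_slices[OF f]
    proof eventually_elim
      case (elim y)
      have i: "integrable S2 (\<lambda>m'. f (y, m'))" by (rule sq_integrable_S2_facts(3)[OF elim(2)])
      have ikl: "integrable S2 (\<lambda>m'. m' $ k * m' $ l * f (y, m'))" for k l
      proof (rule Bochner_Integration.integrable_bound[OF i])
        have le: "\<bar>m' $ k * m' $ l\<bar> \<le> 1" if "norm m' = 1" for m' :: "real^3"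
          unfolding abs_mult using abs_component_sphere_le[OF that] by (intro mult_le_one) auto
        show "AE m' in S2. norm (m' $ k * m' $ l * f (y, m')) \<le> norm (f (y, m'))"
          by (rule AE_I2) (use mult_right_mono[OF le] in \<open>auto simp: abs_mult\<close>)
      qed (use i in \<open>auto dest: borel_measurable_integrable\<close>)
      let ?S = "\<lambda>m'. \<Sum>k\<in>UNIV. \<Sum>l\<in>UNIV. (m $ k * m $ l * g_eps g \<epsilon> (x - y)) * (m' $ k * m' $ l * f (y, m'))"
      have "(LINT m'|S2. (norm (cross3 m m'))\<^sup>2 * g_eps g \<epsilon> (x - y) * f (y, m'))
         = (LINT m'|S2. g_eps g \<epsilon> (x - y) * f (y, m') - ?S m')"
      proof (rule Bochner_Integration.integral_cong[OF refl])
        fix m' assume "m' \<in> space S2"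
        then have n: "norm m' = 1" by simp
        have "(norm (cross3 m m'))\<^sup>2 * g_eps g \<epsilon> (x - y) * f (y, m') = g_eps g \<epsilon> (x - y) * f (y, m') - (m \<bullet> m')\<^sup>2 * (g_eps g \<epsilon> (x - y) * f (y, m'))"
          unfolding cr[OF n] by (simp add: algebra_simps)
        also have "(m \<bullet> m')\<^sup>2 * (g_eps g \<epsilon> (x - y) * f (y, m')) = ?S m'"
          unfolding sq sum_distrib_right by (intro sum.cong refl) (simp add: mult_ac)
        finally show "(norm (cross3 m m'))\<^sup>2 * g_eps g \<epsilon> (x - y) * f (y, m') = g_eps g \<epsilon> (x - y) * f (y, m') - ?S m'" .
      qed
      also have "\<dots> = g_eps g \<epsilon> (x - y) * (LINT m'|S2. f (y, m')) - (LINT m'|S2. ?S m')"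
      proof -
        have iS: "integrable S2 ?S" by (intro Bochner_Integration.integrable_sum integrable_mult_right ikl)
        show ?thesis by (subst Bochner_Integration.integral_diff[OF integrable_mult_right[OF i] iS]) simp
      qed
      also have "(LINT m'|S2. ?S m') = (\<Sum>k\<in>UNIV. \<Sum>l\<in>UNIV. (m $ k * m $ l * g_eps g \<epsilon> (x - y)) * (LINT m'|S2. m' $ k * m' $ l * f (y, m')))"
        by (subst Bochner_Integration.integral_sum, (intro Bochner_Integration.integrable_sum integrable_mult_right ikl)[1],
            intro sum.cong refl, subst Bochner_Integration.integral_sum, (intro integrable_mult_right ikl)[1], simp)
      finally show ?case by (simp add: elim(1) M_mom_def mult.assoc)
    qed
  qed
  also have "\<dots> = - (\<Sum>k\<in>UNIV. \<Sum>l\<in>UNIV. m $ k * m $ l * Q_mom g \<epsilon> f x $ k $ l)"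
  proof -
    note i = Q_mom_facts(4)[OF g f]
    have "(LINT x'|lborel. (\<Sum>k\<in>UNIV. \<Sum>l\<in>UNIV. m $ k * m $ l * (g_eps g \<epsilon> (x - x') * M_mom f x' $ k $ l)))
      = (\<Sum>k\<in>UNIV. \<Sum>l\<in>UNIV. m $ k * m $ l * (LINT x'|lborel. g_eps g \<epsilon> (x - x') * M_mom f x' $ k $ l))"
      by (subst Bochner_Integration.integral_sum, (intro Bochner_Integration.integrable_sum integrable_mult_right i)[1],
          intro sum.cong refl, subst Bochner_Integration.integral_sum, (intro integrable_mult_right i)[1], simp)
    then show ?thesis by (simp add: Q_mom_def convolution_def)
  qed
  also have "(\<Sum>k\<in>UNIV. \<Sum>l\<in>UNIV. m $ k * m $ l * Q_mom g \<epsilon> f x $ k $ l) = m \<bullet> (Q_mom g \<epsilon> f x *v m)"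
    by (simp add: inner_vec_def matrix_vector_mult_def sum_distrib_left mult_ac)
  finally show ?thesis by (simp add: U_eps_def)
qed

section \<open>The energy identity\<close>

lemma Theta_set_integral:
  fixes u :: "real \<Rightarrow> real"
  assumes "u \<in> borel_measurable borel"
  shows "(LINT \<theta>|Theta. u \<theta>) = (LINT \<theta>:{0..pi}|lborel. sin \<theta> * u \<theta>)"
proof -
  have "(LINT \<theta>|Theta. u \<theta>) = (LINT \<theta>|lborel. (indicator {0..pi} \<theta> * sin \<theta>) *\<^sub>R u \<theta>)"
    unfolding Theta_eq by (rule integral_density) (use assms in \<open>auto simp: sin_ge_zero split: split_indicator\<close>)
  then show ?thesis by (simp add: set_lebesgue_integral_def mult.assoc)
qed

lemma Ak_eq_Theta: "Ak \<eta> k = (LINT \<theta>|Theta. exp (\<eta> * (cos \<theta>)\<^sup>2) * cos \<theta> ^ k)"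
  by (subst Theta_set_integral) (auto simp: Ak_def mult_ac intro!: borel_measurable_continuous_onI continuous_intros)

lemma exp_quadratic_bounds:
  assumes "\<bar>t\<bar> \<le> (1::real)"
  shows "exp (- \<bar>\<eta>\<bar>) \<le> exp (\<eta> * t\<^sup>2)" "exp (\<eta> * t\<^sup>2) \<le> exp \<bar>\<eta>\<bar>"
proof -
  have "\<bar>\<eta> * t\<^sup>2\<bar> \<le> \<bar>\<eta>\<bar> * 1"
    unfolding abs_mult using assms by (intro mult_left_mono) (simp_all add: abs_square_le_1)
  then show "exp (- \<bar>\<eta>\<bar>) \<le> exp (\<eta> * t\<^sup>2)" "exp (\<eta> * t\<^sup>2) \<le> exp \<bar>\<eta>\<bar>" by auto
qed

lemma Ak_0_pos: "Ak \<eta> 0 > 0"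
proof -
  have "0 < (LINT \<theta>|Theta. exp (- \<bar>\<eta>\<bar>))" by simp
  also have "\<dots> \<le> Ak \<eta> 0" unfolding Ak_eq_Theta
  proof (intro integral_mono integrable_Theta_continuous continuous_intros)
    show "exp (- \<bar>\<eta>\<bar>) \<le> exp (\<eta> * (cos x)\<^sup>2) * cos x ^ 0" for x
      using exp_quadratic_bounds(1)[of "cos x" \<eta>] by simp
  qed
  finally show ?thesis .
qed

lemma h_eq_rotated:
  assumes A: "rotation_matrix A"
  shows "h_eq \<eta> (column 3 A) m = exp (\<eta> * (m \<bullet> column 3 A)\<^sup>2) / (2 * pi * Ak \<eta> 0)"
proof -
  have "integrable S2 (\<lambda>m. exp (\<eta> * (m \<bullet> column 3 A)\<^sup>2))"
    by (intro continuous_on_sphere_integrable_S2 continuous_intros)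
  from integral_S2_rotated[OF A this]
  have "(LINT m|S2. exp (\<eta> * (m \<bullet> column 3 A)\<^sup>2)) = 2 * pi * Ak \<eta> 0"
    by (simp add: inner_commute[of _ "column 3 A"] A Ak_eq_Theta)
  then show ?thesis by (simp add: h_eq_def)
qed

lemma sq_integrable_bound:
  fixes F :: "'a \<Rightarrow> 'b::euclidean_space" and G :: "'a \<Rightarrow> 'c::euclidean_space"
  assumes G: "sq_integrable M G" and F: "F \<in> borel_measurable M" and le: "\<And>p. p \<in> space M \<Longrightarrow> norm (F p) \<le> C * norm (G p)"
  shows "sq_integrable M F"
  unfolding sq_integrable_def
proof (intro conjI F)
  show "integrable M (\<lambda>p. (norm (F p))\<^sup>2)"
  proof (rule Bochner_Integration.integrable_bound)
    show "integrable M (\<lambda>p. C\<^sup>2 * (norm (G p))\<^sup>2)" using G by (simp add: sq_integrable_def)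
    show "(\<lambda>p. (norm (F p))\<^sup>2) \<in> borel_measurable M" using F by simp
    show "AE p in M. norm ((norm (F p))\<^sup>2) \<le> norm (C\<^sup>2 * (norm (G p))\<^sup>2)"
    proof (rule AE_I2)
      fix p assume "p \<in> space M"
      from power_mono[OF le[OF this] norm_ge_zero, of 2] show "norm ((norm (F p))\<^sup>2) \<le> norm (C\<^sup>2 * (norm (G p))\<^sup>2)"
        by (simp add: power_mult_distrib)
    qed
  qed
qed

lemma sq_integrable_add:
  fixes F G :: "'a \<Rightarrow> 'b::euclidean_space"
  assumes "sq_integrable M F" "sq_integrable M G"
  shows "sq_integrable M (\<lambda>p. F p + G p)"
  unfolding sq_integrable_def
proof (intro conjI)
  have m[measurable]: "F \<in> borel_measurable M" "G \<in> borel_measurable M" using assms by (auto simp: sq_integrable_def)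
  show "(\<lambda>p. F p + G p) \<in> borel_measurable M" using m by simp
  show "integrable M (\<lambda>p. (norm (F p + G p))\<^sup>2)"
  proof (rule Bochner_Integration.integrable_bound)
    show "integrable M (\<lambda>p. 2 * (norm (F p))\<^sup>2 + 2 * (norm (G p))\<^sup>2)" using assms by (simp add: sq_integrable_def)
    show "(\<lambda>p. (norm (F p + G p))\<^sup>2) \<in> borel_measurable M" using m by simp
    show "AE p in M. norm ((norm (F p + G p))\<^sup>2) \<le> norm (2 * (norm (F p))\<^sup>2 + 2 * (norm (G p))\<^sup>2)"
    proof (rule AE_I2)
      fix p
      have "(norm (F p + G p))\<^sup>2 \<le> (norm (F p) + norm (G p))\<^sup>2" by (intro power_mono norm_triangle_ineq) simp
      also have "\<dots> \<le> 2 * (norm (F p))\<^sup>2 + 2 * (norm (G p))\<^sup>2"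
        using sum_squares_bound[of "norm (F p)" "norm (G p)"] by (simp add: power2_sum)
      finally show "norm ((norm (F p + G p))\<^sup>2) \<le> norm (2 * (norm (F p))\<^sup>2 + 2 * (norm (G p))\<^sup>2)" by simp
    qed
  qed
qed

lemma integrable_phase_fst:
  fixes q :: "real^3 \<Rightarrow> real"
  assumes "integrable lborel q" shows "integrable phase (\<lambda>p. q (fst p))"
  unfolding phase_def
proof (rule XS.Fubini_integrable)
  show "(\<lambda>p. q (fst p)) \<in> borel_measurable (lborel \<Otimes>\<^sub>M S2)"
    by (rule measurable_compose[OF measurable_fst]) (use assms in \<open>simp add: borel_measurable_integrable\<close>)
  show "integrable lborel (\<lambda>x. LINT y|S2. norm (q (fst (x, y))))" using assms by simp
qed simp

lemma loc_integrable_bounded: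
  fixes F :: "(real^3) \<times> (real^3) \<Rightarrow> 'b::{banach, second_countable_topology}"
  assumes m: "F \<in> borel_measurable phase" and b: "\<And>p. p \<in> space phase \<Longrightarrow> norm (F p) \<le> C"
  shows "loc_integrable F"
  unfolding loc_integrable_def set_integrable_def
proof
  fix r :: real
  have i: "integrable phase (\<lambda>p. C * indicator (cball 0 r) (fst p))"
  proof -
    have "integrable lborel (\<lambda>x. indicator (cball 0 r) x :: real)"
      using emeasure_lborel_cball_finite[of 0 r] by (intro integrable_real_indicator) auto
    from integrable_phase_fst[OF integrable_mult_right[OF this, of C]] show ?thesis by simp
  qed
  show "integrable phase (\<lambda>x. indicat_real (cball 0 r \<times> sphere 0 1) x *\<^sub>R F x)"
  proof (rule Bochner_Integration.integrable_bound[OF i])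
    show "(\<lambda>x. indicat_real (cball 0 r \<times> sphere 0 1) x *\<^sub>R F x) \<in> borel_measurable phase"
      using cball_sphere_measurable m by measurable
    show "AE p in phase. norm (indicat_real (cball 0 r \<times> sphere 0 1) p *\<^sub>R F p) \<le> norm (C * indicator (cball 0 r) (fst p))"
    proof (rule AE_I2)
      fix p assume p: "p \<in> space phase"
      then have "norm (F p) \<le> \<bar>C\<bar>" using b[OF p] by linarith
      then show "norm (indicat_real (cball 0 r \<times> sphere 0 1) p *\<^sub>R F p) \<le> norm (C * indicator (cball 0 r) (fst p))"
        using p by (cases p) (auto simp: indicator_def)
    qed
  qed
qed

lemma norm_matrix_vector_unit_le:
  fixes Q :: "real^3^3"
  assumes "norm m = 1"
  shows "(norm (Q *v m))\<^sup>2 \<le> (\<Sum>i\<in>UNIV. \<Sum>j\<in>UNIV. (Q $ i $ j)\<^sup>2)"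
proof -
  have "((Q *v m) $ i)\<^sup>2 \<le> (\<Sum>j\<in>UNIV. (Q $ i $ j)\<^sup>2)" for i
  proof -
    have "\<bar>Q $ i \<bullet> m\<bar> \<le> norm (Q $ i)" using Cauchy_Schwarz_ineq2[of "Q $ i" m] assms by simp
    then have "(Q $ i \<bullet> m)\<^sup>2 \<le> (norm (Q $ i))\<^sup>2" by (simp add: abs_le_square_iff[symmetric])
    moreover have "(norm (Q $ i))\<^sup>2 = (\<Sum>j\<in>UNIV. (Q $ i $ j)\<^sup>2)"
      unfolding power2_norm_eq_inner inner_vec_def by (simp add: power2_eq_square)
    ultimately show ?thesis by (simp add: matrix_vector_mul_component)
  qed
  moreover have "(norm (Q *v m))\<^sup>2 = (\<Sum>i\<in>UNIV. ((Q *v m) $ i)\<^sup>2)"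
    unfolding power2_norm_eq_inner inner_vec_def by (simp add: power2_eq_square)
  ultimately show ?thesis by (simp add: sum_mono)
qed

lemma measurable_matrix_vector_phase:
  fixes Q :: "real^3 \<Rightarrow> real^3^3"
  assumes "\<And>k l. (\<lambda>x. Q x $ k $ l) \<in> borel_measurable borel"
  shows "(\<lambda>p. Q (fst p) *v snd p) \<in> borel_measurable phase"
proof -
  have e: "(\<lambda>p. Q (fst p) *v snd p) = (\<lambda>p. \<Sum>i\<in>UNIV. (\<Sum>j\<in>UNIV. Q (fst p) $ i $ j * (snd p \<bullet> axis j 1)) *\<^sub>R axis i 1)"
    by (simp add: fun_eq_iff vec_eq_iff matrix_vector_mult_def inner_axis)
      (simp add: axis_def if_distrib cong: if_cong)
  have 1: "(\<lambda>p. Q (fst p) $ k $ l) \<in> borel_measurable phase" for k l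
    by (rule measurable_compose[OF measurable_fst_phase assms])
  show ?thesis unfolding e
    by (intro borel_measurable_sum borel_measurable_scaleR borel_measurable_times 1 borel_measurable_inner measurable_snd_phase borel_measurable_const)
qed

lemma U_eps_weak_rot:
  assumes g: "admissible_kernel g" "\<epsilon> > 0" and f: "sq_integrable phase f"
    and z: "AE x in lborel. (LINT m|S2. f (x, m)) = 0"
  shows "has_weak_rot (U_eps \<alpha> g \<epsilon> f) (\<lambda>p. cross3 (snd p) ((- 2 * \<alpha>) *\<^sub>R (Q_mom g \<epsilon> f (fst p) *v snd p)))"
    and "sq_integrable phase (U_eps \<alpha> g \<epsilon> f)"
    and "sq_integrable phase (\<lambda>p. cross3 (snd p) ((- 2 * \<alpha>) *\<^sub>R (Q_mom g \<epsilon> f (fst p) *v snd p)))"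
proof -
  define Q where "Q = Q_mom g \<epsilon> f"
  note qf = Q_mom_facts[OF g f, folded Q_def]
  define b where "b = (\<lambda>p::(real^3) \<times> (real^3). sqrt (\<Sum>i\<in>UNIV. \<Sum>j\<in>UNIV. (Q (fst p) $ i $ j)\<^sup>2))"
  have s0: "(\<Sum>i\<in>UNIV. \<Sum>j\<in>UNIV. (Q x $ i $ j)\<^sup>2) \<ge> 0" for x by (intro sum_nonneg) auto
  have b0: "b p \<ge> 0" for p by (simp add: b_def s0)
  have Qb: "norm (Q (fst p) *v snd p) \<le> b p" if "p \<in> space phase" for p
    unfolding b_def by (rule real_le_rsqrt, rule norm_matrix_vector_unit_le) (use that in auto)
  have bm: "b \<in> borel_measurable phase" unfolding b_def
    by (rule measurable_compose[of _ phase borel sqrt], intro borel_measurable_sum borel_measurable_power measurable_compose[OF measurable_fst_phase qf(1)])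
      (intro borel_measurable_continuous_onI continuous_intros)
  have b2: "sq_integrable phase b"
    unfolding sq_integrable_def
  proof (intro conjI bm)
    have "integrable lborel (\<lambda>x. \<Sum>i\<in>UNIV. \<Sum>j\<in>UNIV. (Q x $ i $ j)\<^sup>2)"
      by (intro Bochner_Integration.integrable_sum qf(2))
    from integrable_phase_fst[OF this] show "integrable phase (\<lambda>p. (norm (b p))\<^sup>2)"
      by (simp add: b_def s0)
  qed
  obtain B where B: "\<And>k l x. \<bar>Q x $ k $ l\<bar> \<le> B k l" using qf(3) by metis
  have bb: "\<exists>C. \<forall>p. b p \<le> C"
  proof (intro exI allI)
    fix p
    show "b p \<le> sqrt (\<Sum>i\<in>UNIV. \<Sum>j\<in>UNIV. (B i j)\<^sup>2)" unfolding b_def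
      by (intro real_sqrt_le_mono sum_mono) (use B in \<open>auto simp: abs_le_square_iff[symmetric] intro: order_trans[OF _ abs_ge_self]\<close>)
  qed
  then obtain C where C: "\<And>p. b p \<le> C" by blast
  define F where "F = U_eps \<alpha> g \<epsilon> f"
  define w where "w = (\<lambda>x m. - \<alpha> * (m \<bullet> (Q x *v m)))"
  define D where "D = (\<lambda>x m. (- 2 * \<alpha>) *\<^sub>R (Q x *v m))"
  have Fw: "F (x, m) = w x m" if "norm m = 1" for x m
    unfolding F_def w_def Q_def by (rule U_eps_eq[OF g f z that])
  have Qm: "(\<lambda>p. Q (fst p) *v snd p) \<in> borel_measurable phase" by (rule measurable_matrix_vector_phase[OF qf(1)])
  have Fm: "F \<in> borel_measurable phase"
  proof (subst measurable_cong)
    show "F p = - \<alpha> * (snd p \<bullet> (Q (fst p) *v snd p))" if "p \<in> space phase" for p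
      using Fw[of "snd p" "fst p"] that by (auto simp: w_def)
    show "(\<lambda>p. - \<alpha> * (snd p \<bullet> (Q (fst p) *v snd p))) \<in> borel_measurable phase"
      by (intro borel_measurable_times borel_measurable_const borel_measurable_inner measurable_snd_phase Qm)
  qed
  have Fb: "norm (F p) \<le> \<bar>\<alpha>\<bar> * b p" if "p \<in> space phase" for p
  proof -
    have n: "norm (snd p) = 1" using that by auto
    have "\<bar>snd p \<bullet> (Q (fst p) *v snd p)\<bar> \<le> norm (Q (fst p) *v snd p)"
      using Cauchy_Schwarz_ineq2[of "snd p" "Q (fst p) *v snd p"] n by simp
    then have "\<bar>\<alpha>\<bar> * \<bar>snd p \<bullet> (Q (fst p) *v snd p)\<bar> \<le> \<bar>\<alpha>\<bar> * b p" using Qb[OF that] by (intro mult_left_mono) auto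
    then show ?thesis using Fw[OF n, of "fst p"] by (simp add: w_def abs_mult)
  qed
  define R where "R = (\<lambda>p. cross3 (snd p) (D (fst p) (snd p)))"
  have Rm: "R \<in> borel_measurable phase" unfolding R_def D_def
    by (intro measurable_cross3 measurable_snd_phase borel_measurable_scaleR borel_measurable_const Qm)
  have Rb: "norm (R p) \<le> (2 * \<bar>\<alpha>\<bar>) * b p" if "p \<in> space phase" for p
  proof -
    have n: "norm (snd p) = 1" using that by auto
    have "norm (R p) \<le> norm (D (fst p) (snd p))" unfolding R_def using norm_cross3_le[of "snd p"] n by simp
    also have "\<dots> \<le> 2 * \<bar>\<alpha>\<bar> * b p" unfolding D_def using Qb[OF that] by (simp add: abs_mult mult_left_mono)
    finally show ?thesis .
  qed
  show "sq_integrable phase (U_eps \<alpha> g \<epsilon> f)"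
    unfolding F_def[symmetric] by (rule sq_integrable_bound[OF b2 Fm, of "\<bar>\<alpha>\<bar>"]) (use Fb b0 in auto)
  have "sq_integrable phase R"
    by (rule sq_integrable_bound[OF b2 Rm, of "2 * \<bar>\<alpha>\<bar>"]) (use Rb b0 in auto)
  then show "sq_integrable phase (\<lambda>p. cross3 (snd p) ((- 2 * \<alpha>) *\<^sub>R (Q_mom g \<epsilon> f (fst p) *v snd p)))"
    by (simp add: R_def D_def Q_def)
  have "has_weak_rot F (\<lambda>p. cross3 (snd p) (D (fst p) (snd p)))"
  proof (rule has_weak_rot_classical)
    show "loc_integrable F"
      by (rule loc_integrable_bounded[OF Fm, of "\<bar>\<alpha>\<bar> * C"]) (meson Fb C abs_ge_zero mult_left_mono order_trans)
    show "loc_integrable (\<lambda>p. cross3 (snd p) (D (fst p) (snd p)))"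
      unfolding R_def[symmetric]
    proof (rule loc_integrable_bounded[OF Rm, of "(2 * \<bar>\<alpha>\<bar>) * C"])
      fix p assume "p \<in> space phase"
      have "(2 * \<bar>\<alpha>\<bar>) * b p \<le> (2 * \<bar>\<alpha>\<bar>) * C" using C by (intro mult_left_mono) auto
      then show "norm (R p) \<le> (2 * \<bar>\<alpha>\<bar>) * C" using Rb[OF \<open>p \<in> space phase\<close>] by linarith
    qed
    have lin: "bounded_linear (\<lambda>m. Q x *v m)" for x by (rule matrix_vector_mul_bounded_linear)
    show "(w x has_derivative (\<lambda>v. D x m \<bullet> v)) (at m)" for x m
    proof -
      have "((\<lambda>m. m \<bullet> (Q x *v m)) has_derivative (\<lambda>v. m \<bullet> (Q x *v v) + v \<bullet> (Q x *v m))) (at m)"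
        by (rule has_derivative_inner[OF has_derivative_ident bounded_linear_imp_has_derivative[OF lin]])
      from has_derivative_mult_right[OF this, of "- \<alpha>"]
      have d: "(w x has_derivative (\<lambda>v. - \<alpha> * (m \<bullet> (Q x *v v) + v \<bullet> (Q x *v m)))) (at m)" by (simp add: w_def)
      have "m \<bullet> (Q x *v v) = (Q x *v m) \<bullet> v" for v
        using dot_lmul_matrix[of m "Q x" v] qf(5)[of x] by (metis vector_transpose_matrix)
      then show ?thesis using d by (simp add: D_def inner_commute algebra_simps)
    qed
    show "continuous_on (sphere 0 1) (D x)" for x unfolding D_def
      by (intro continuous_intros linear_continuous_on lin)
  qed (rule Fw)
  then show "has_weak_rot (U_eps \<alpha> g \<epsilon> f) (\<lambda>p. cross3 (snd p) ((- 2 * \<alpha>) *\<^sub>R (Q_mom g \<epsilon> f (fst p) *v snd p)))"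
    by (simp add: F_def D_def Q_def)
qed

lemma rot_AE_eq:
  assumes "has_weak_rot F G" shows "AE p in phase. rot F p = G p"
proof -
  have "has_weak_rot F (rot F)" unfolding rot_def by (rule someI[of "has_weak_rot F", OF assms])
  from weak_rot_unique[OF this assms] show ?thesis .
qed

text \<open>At a critical point \<open>U_op \<alpha> h\<close> equals \<open>- ln h\<close> up to a function of \<open>x\<close>, so it is a
quadratic polynomial in \<open>m\<close> on each slice.\<close>

lemma U_op_equilibrium_weak_rot:
  assumes n[measurable]: "n \<in> borel_measurable borel" and n1: "\<And>x. norm (n x) = 1" and Z0: "Z > 0"
    and h: "\<And>x m. h (x, m) = exp (\<eta> * (m \<bullet> n x)\<^sup>2) / Z"
    and crit: "\<And>x. critical_point \<alpha> (\<lambda>m. h (x, m))"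
  shows "has_weak_rot (\<lambda>(x, m). U_op \<alpha> (\<lambda>m'. h (x, m')) m) (\<lambda>p. cross3 (snd p) ((- 2 * \<eta> * (snd p \<bullet> n (fst p))) *\<^sub>R n (fst p)))"
proof -
  from crit obtain C where C: "\<And>x m. norm m = 1 \<Longrightarrow> ln (h (x, m)) + U_op \<alpha> (\<lambda>m. h (x, m)) m = C x"
    unfolding critical_point_def by (auto simp: Ball_def) metis
  define w where "w = (\<lambda>x m. (C x + ln Z) - \<eta> * (m \<bullet> n x)\<^sup>2)"
  define D where "D = (\<lambda>x m. (- 2 * \<eta> * (m \<bullet> n x)) *\<^sub>R n x)"
  have Fw: "U_op \<alpha> (\<lambda>m. h (x, m)) m = w x m" if "norm m = 1" for x m
    using C[OF that, of x] Z0 by (simp add: w_def h ln_div)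
  define F where "F = (\<lambda>(x, m). U_op \<alpha> (\<lambda>m'. h (x, m')) m)"
  have Fm: "F \<in> borel_measurable phase"
  proof -
    have [measurable]: "(\<lambda>q. fst (fst q)) \<in> borel_measurable (phase \<Otimes>\<^sub>M S2)" "(\<lambda>q. snd (fst q)) \<in> borel_measurable (phase \<Otimes>\<^sub>M S2)"
      "snd \<in> borel_measurable (phase \<Otimes>\<^sub>M S2)"
      by (rule measurable_compose[OF measurable_fst measurable_fst_phase], rule measurable_compose[OF measurable_fst measurable_snd_phase],
        rule measurable_compose[OF measurable_snd measurable_S2_borel])
    have "(\<lambda>p. LINT m'|S2. (norm (cross3 (snd p) m'))\<^sup>2 * (exp (\<eta> * (m' \<bullet> n (fst p))\<^sup>2) / Z)) \<in> borel_measurable phase"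
      by (rule S2.borel_measurable_lebesgue_integral) (simp add: split_beta')
    then have "(\<lambda>p. \<alpha> * (LINT m'|S2. (norm (cross3 (snd p) m'))\<^sup>2 * (exp (\<eta> * (m' \<bullet> n (fst p))\<^sup>2) / Z))) \<in> borel_measurable phase"
      by simp
    then show ?thesis by (simp add: F_def U_op_def split_beta' h)
  qed
  have Fb: "norm (F p) \<le> \<bar>\<alpha>\<bar> * (exp \<bar>\<eta>\<bar> / Z * measure S2 (sphere 0 1))" if "p \<in> space phase" for p
  proof -
    define x m where "x = fst p" "m = snd p"
    then have p: "p = (x, m)" and m: "norm m = 1" using that by auto
    have le: "norm ((norm (cross3 m m'))\<^sup>2 * (exp (\<eta> * (m' \<bullet> n x)\<^sup>2) / Z)) \<le> exp \<bar>\<eta>\<bar> / Z" if "norm m' = 1" for m'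
    proof -
      have 1: "norm (cross3 m m') \<le> 1" using norm_cross3_le[of m m'] by (simp add: m that)
      have "(norm (cross3 m m'))\<^sup>2 \<le> 1" using power_mono[OF 1, of 2] by simp
      moreover have "exp (\<eta> * (m' \<bullet> n x)\<^sup>2) / Z \<le> exp \<bar>\<eta>\<bar> / Z"
        using exp_quadratic_bounds(2)[OF abs_inner_unit_le[OF that n1]] Z0 by (simp add: divide_right_mono)
      ultimately have "(norm (cross3 m m'))\<^sup>2 * (exp (\<eta> * (m' \<bullet> n x)\<^sup>2) / Z) \<le> 1 * (exp \<bar>\<eta>\<bar> / Z)"
        using Z0 by (intro mult_mono) auto
      then show ?thesis using Z0 by (simp add: abs_mult)
    qed
    have "norm (LINT m'|S2. (norm (cross3 m m'))\<^sup>2 * (exp (\<eta> * (m' \<bullet> n x)\<^sup>2) / Z)) \<le> (LINT m'|S2. exp \<bar>\<eta>\<bar> / Z)"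
    proof (rule Bochner_Integration.integral_norm_bound_integral)
      show "integrable S2 (\<lambda>m'. (norm (cross3 m m'))\<^sup>2 * (exp (\<eta> * (m' \<bullet> n x)\<^sup>2) / Z))"
        using Z0 by (intro continuous_on_sphere_integrable_S2 continuous_intros continuous_on_cross) auto
    qed (use le in auto)
    then have "\<bar>\<alpha>\<bar> * norm (LINT m'|S2. (norm (cross3 m m'))\<^sup>2 * (exp (\<eta> * (m' \<bullet> n x)\<^sup>2) / Z)) \<le> \<bar>\<alpha>\<bar> * (LINT m'|S2. exp \<bar>\<eta>\<bar> / Z)"
      by (intro mult_left_mono) auto
    then show ?thesis by (simp add: F_def p U_op_def h abs_mult mult.commute)
  qed
  have "has_weak_rot F (\<lambda>p. cross3 (snd p) (D (fst p) (snd p)))"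
  proof (rule has_weak_rot_classical)
    show "loc_integrable F" by (rule loc_integrable_bounded[OF Fm Fb])
    show "loc_integrable (\<lambda>p. cross3 (snd p) (D (fst p) (snd p)))"
    proof (rule loc_integrable_bounded[where C="2 * \<bar>\<eta>\<bar>"])
      show "(\<lambda>p. cross3 (snd p) (D (fst p) (snd p))) \<in> borel_measurable phase" unfolding D_def by measurable
      fix p :: "(real^3) \<times> (real^3)" assume "p \<in> space phase"
      then have m: "norm (snd p) = 1" by auto
      have "norm (cross3 (snd p) (D (fst p) (snd p))) \<le> norm (D (fst p) (snd p))" using norm_cross3_le[of "snd p"] m by simp
      also have "\<dots> = 2 * \<bar>\<eta>\<bar> * \<bar>snd p \<bullet> n (fst p)\<bar>" by (simp add: D_def n1 abs_mult)
      also have "\<dots> \<le> 2 * \<bar>\<eta>\<bar> * 1" by (intro mult_left_mono abs_inner_unit_le m n1) simp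
      finally show "norm (cross3 (snd p) (D (fst p) (snd p))) \<le> 2 * \<bar>\<eta>\<bar>" by simp
    qed
    show "(w x has_derivative (\<lambda>v. D x m \<bullet> v)) (at m)" for x m
      unfolding w_def D_def by (auto intro!: derivative_eq_intros simp: inner_commute algebra_simps)
    show "continuous_on (sphere 0 1) (D x)" for x unfolding D_def by (intro continuous_intros)
    show "F (x, m) = w x m" if "norm m = 1" for x m using Fw[OF that, of x] by (simp add: F_def)
  qed
  then show ?thesis by (simp add: F_def D_def)
qed

lemma has_weak_rot_measurable: "has_weak_rot F G \<Longrightarrow> G \<in> borel_measurable phase"
  by (auto simp: has_weak_rot_def loc_integrable_measurable)

text \<open>The term \<open>f R(U h)\<close> of the flux is what the product rule for \<open>h R(f / h)\<close> produces, so the flux is \<open>h V\<close>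
almost everywhere.  The functions \<open>rot\<close> are arbitrary representatives, but they are unique up to null sets.\<close>

lemma energy_identity:
  assumes g: "admissible_kernel g" "\<epsilon> > 0" and n[measurable]: "n \<in> borel_measurable borel" and n1: "\<And>x. norm (n x) = 1" and Z0: "Z > 0"
    and h: "\<And>x m. h (x, m) = exp (\<eta> * (m \<bullet> n x)\<^sup>2) / Z"
    and crit: "\<And>x. critical_point \<alpha> (\<lambda>m. h (x, m))"
    and f: "f \<in> H1" and z: "AE x in lborel. (LINT m|S2. f (x, m)) = 0"
  shows "\<exists>V. has_weak_rot (H_op \<alpha> g \<epsilon> h f) V \<and> sq_integrable phase V \<and> sq_integrable phase (H_op \<alpha> g \<epsilon> h f)
     \<and> - G_op \<alpha> g \<epsilon> h f (H_op \<alpha> g \<epsilon> h f) = (LINT p|phase. h p * (norm (V p))\<^sup>2)"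
proof -
  from f obtain G where G: "has_weak_rot f G" "sq_integrable phase G" and f2: "sq_integrable phase f"
    unfolding H1_def by blast
  have fm[measurable]: "f \<in> borel_measurable phase" using f2 by (simp add: sq_integrable_def)
  have Gm[measurable]: "G \<in> borel_measurable phase" using G by (simp add: sq_integrable_def)
  \<comment> \<open>\<open>\<kappa>\<close> is \<open>1 / h\<close>.\<close>
  define \<kappa> where "\<kappa> = (\<lambda>p. Z * exp (- \<eta> * (snd p \<bullet> n (fst p))\<^sup>2))"
  have \<kappa>m[measurable]: "\<kappa> \<in> borel_measurable phase" unfolding \<kappa>_def by measurable
  have hp: "h p = exp (\<eta> * (snd p \<bullet> n (fst p))\<^sup>2) / Z" for p using h[of "fst p" "snd p"] by simp
  have h\<kappa>: "h p * \<kappa> p = 1" for p using Z0 by (simp add: hp \<kappa>_def exp_minus field_simps)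
  have h0: "h p > 0" for p using Z0 by (simp add: hp)
  have div: "f p / h p = \<kappa> p * f p" for p using h\<kappa>[of p] h0[of p] by (simp add: field_simps)
  define W where "W = (\<lambda>p. \<kappa> p *\<^sub>R G p + (f p * (\<kappa> p * (- 2 * \<eta> * (snd p \<bullet> n (fst p))))) *\<^sub>R cross3 (snd p) (n (fst p)))"
  define R where "R = (\<lambda>p. cross3 (snd p) ((- 2 * \<alpha>) *\<^sub>R (Q_mom g \<epsilon> f (fst p) *v snd p)))"
  define V where "V = (\<lambda>p. W p + R p)"
  have wW: "has_weak_rot (\<lambda>p. \<kappa> p * f p) W"
    unfolding W_def \<kappa>_def by (rule has_weak_rot_gaussian_mult[OF G(1) n n1])
  note U = U_eps_weak_rot[OF g f2 z, of \<alpha>, folded R_def]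
  have Hf: "H_op \<alpha> g \<epsilon> h f = (\<lambda>p. \<kappa> p * f p + U_eps \<alpha> g \<epsilon> f p)"
    by (simp add: H_op_def div)
  have wV: "has_weak_rot (H_op \<alpha> g \<epsilon> h f) V" unfolding Hf V_def by (rule has_weak_rot_add[OF wW U(1)])
  have \<kappa>b: "\<bar>\<kappa> p\<bar> \<le> Z * exp \<bar>\<eta>\<bar>" if "p \<in> space phase" for p
    using exp_quadratic_bounds(2)[OF abs_inner_unit_le[of "snd p" "n (fst p)"], of "- \<eta>"] that Z0 n1
    by (auto simp: \<kappa>_def abs_mult)
  have \<kappa>f: "sq_integrable phase (\<lambda>p. \<kappa> p * f p)"
  proof (rule sq_integrable_bound[OF f2])
    show "norm (\<kappa> p * f p) \<le> (Z * exp \<bar>\<eta>\<bar>) * norm (f p)" if "p \<in> space phase" for p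
      using mult_right_mono[OF \<kappa>b[OF that], of "\<bar>f p\<bar>"] by (simp add: abs_mult)
  qed measurable
  have \<kappa>G: "sq_integrable phase (\<lambda>p. \<kappa> p *\<^sub>R G p)"
  proof (rule sq_integrable_bound[OF G(2)])
    show "norm (\<kappa> p *\<^sub>R G p) \<le> (Z * exp \<bar>\<eta>\<bar>) * norm (G p)" if "p \<in> space phase" for p
      using mult_right_mono[OF \<kappa>b[OF that], of "norm (G p)"] by simp
  qed measurable
  have fK: "sq_integrable phase (\<lambda>p. (f p * (\<kappa> p * (- 2 * \<eta> * (snd p \<bullet> n (fst p))))) *\<^sub>R cross3 (snd p) (n (fst p)))"
  proof (rule sq_integrable_bound[OF \<kappa>f])
    fix p :: "(real^3) \<times> (real^3)" assume "p \<in> space phase"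
    then have m: "norm (snd p) = 1" by auto
    have "\<bar>2 * \<eta> * (snd p \<bullet> n (fst p))\<bar> \<le> 2 * \<bar>\<eta>\<bar> * 1"
      unfolding abs_mult by (intro mult_mono abs_inner_unit_le m n1) auto
    moreover have "norm (cross3 (snd p) (n (fst p))) \<le> 1" using norm_cross3_le[of "snd p" "n (fst p)"] by (simp add: m n1)
    ultimately have "\<bar>2 * \<eta> * (snd p \<bullet> n (fst p))\<bar> * norm (cross3 (snd p) (n (fst p))) \<le> (2 * \<bar>\<eta>\<bar>) * 1"
      by (intro mult_mono) auto
    from mult_left_mono[OF this, of "\<bar>\<kappa> p * f p\<bar>"]
    show "norm ((f p * (\<kappa> p * (- 2 * \<eta> * (snd p \<bullet> n (fst p))))) *\<^sub>R cross3 (snd p) (n (fst p))) \<le> (2 * \<bar>\<eta>\<bar>) * norm (\<kappa> p * f p)"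
      by (simp add: abs_mult mult_ac)
  qed measurable
  have V2: "sq_integrable phase V" unfolding V_def W_def
    by (intro sq_integrable_add \<kappa>G fK U(3))
  have H2: "sq_integrable phase (H_op \<alpha> g \<epsilon> h f)" unfolding Hf by (intro sq_integrable_add \<kappa>f U(2))
  have Vm[measurable]: "V \<in> borel_measurable phase" using V2 by (simp add: sq_integrable_def)
  note wO = U_op_equilibrium_weak_rot[OF n n1 Z0 h crit]
  have ae: "AE p in phase. flux \<alpha> g \<epsilon> h f p \<bullet> rot (H_op \<alpha> g \<epsilon> h f) p = h p * (norm (V p))\<^sup>2"
    using rot_AE_eq[OF G(1)] rot_AE_eq[OF U(1)] rot_AE_eq[OF wO] rot_AE_eq[OF wV]
  proof eventually_elim
    case (elim p)
    have "flux \<alpha> g \<epsilon> h f p = G p + h p *\<^sub>R R p + f p *\<^sub>R cross3 (snd p) ((- 2 * \<eta> * (snd p \<bullet> n (fst p))) *\<^sub>R n (fst p))"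
      unfolding flux_def elim(1-3) ..
    also have "\<dots> = h p *\<^sub>R V p"
    proof -
      have 1: "h p *\<^sub>R (\<kappa> p *\<^sub>R G p) = G p" by (simp add: h\<kappa>)
      have 2: "h p *\<^sub>R ((f p * (\<kappa> p * c)) *\<^sub>R v) = f p *\<^sub>R (c *\<^sub>R v)" for c and v :: "real^3"
      proof -
        have "h p * (f p * (\<kappa> p * c)) = (h p * \<kappa> p) * (f p * c)" by (simp only: mult_ac)
        then show ?thesis by (simp add: h\<kappa>)
      qed
      show ?thesis unfolding V_def W_def scaleR_add_right 1 2 cross_mult_right by (simp add: add_ac)
    qed
    finally show ?case unfolding elim(4) by (simp add: power2_norm_eq_inner)
  qed
  have "(LINT p|phase. flux \<alpha> g \<epsilon> h f p \<bullet> rot (H_op \<alpha> g \<epsilon> h f) p) = (LINT p|phase. h p * (norm (V p))\<^sup>2)"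
  proof (rule integral_cong_AE)
    have hm: "h \<in> borel_measurable phase" unfolding hp[abs_def] by measurable
    then show "(\<lambda>p. h p * (norm (V p))\<^sup>2) \<in> borel_measurable phase" by measurable
    have some: "rot F \<in> borel_measurable phase" if "has_weak_rot F G'" for F G'
      unfolding rot_def by (rule has_weak_rot_measurable[OF someI[of "has_weak_rot F", OF that]])
    note [measurable] = hm some[OF G(1)] some[OF U(1)] some[OF wO] some[OF wV]
    show "(\<lambda>p. flux \<alpha> g \<epsilon> h f p \<bullet> rot (H_op \<alpha> g \<epsilon> h f) p) \<in> borel_measurable phase"
      unfolding flux_def
      by (intro borel_measurable_inner borel_measurable_add borel_measurable_scaleR hm fm some[OF G(1)] some[OF U(1)] some[OF wO] some[OF wV])
  qed (rule ae)
  then show ?thesis using wV V2 H2 by (intro exI[of _ V]) (simp add: G_op_def)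
qed

section \<open>Splitting a mode into its critical direction and a remainder\<close>

lemma continuous_f0: "continuous_on UNIV (f0 \<eta>)"
  unfolding f0_def using Ak_0_pos[of \<eta>] by (intro continuous_intros) auto

text \<open>Bounds for the equilibrium density, from \<open>0 \<le> (cos \<theta>)\<^sup>2 \<le> 1\<close>.\<close>

definition f0_max :: "real \<Rightarrow> real" where "f0_max \<eta> = exp \<bar>\<eta>\<bar> / (2 * pi * Ak \<eta> 0)"
definition f0_min :: "real \<Rightarrow> real" where "f0_min \<eta> = exp (- \<bar>\<eta>\<bar>) / (2 * pi * Ak \<eta> 0)"

lemma f0_bounds: "0 < f0_min \<eta>" "f0_min \<eta> \<le> f0 \<eta> \<theta>" "f0 \<eta> \<theta> \<le> f0_max \<eta>" "0 < f0 \<eta> \<theta>" "0 < f0_max \<eta>"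
  using Ak_0_pos[of \<eta>] exp_quadratic_bounds[of "cos \<theta>" \<eta>]
  by (auto simp: f0_def f0_max_def f0_min_def intro!: divide_right_mono)

lemma set_integral_Theta_AE:
  fixes \<gamma> \<gamma>' w :: "real \<Rightarrow> real"
  assumes m: "(\<lambda>\<theta>. indicator {0..pi} \<theta> * \<gamma> \<theta>) \<in> borel_measurable borel" and m': "\<gamma>' \<in> borel_measurable borel"
    and w: "w \<in> borel_measurable borel" and ae: "AE \<theta> in Theta. \<gamma> \<theta> = \<gamma>' \<theta>"
  shows "(LINT \<theta>:{0..pi}|lborel. w \<theta> * \<gamma> \<theta> * sin \<theta>) = (LINT \<theta>|Theta. w \<theta> * \<gamma>' \<theta>)"
proof -
  have wm: "(\<lambda>\<theta>. w \<theta> * (indicator {0..pi} \<theta> * \<gamma> \<theta>)) \<in> borel_measurable borel" by (rule borel_measurable_times[OF w m])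
  have "(LINT \<theta>:{0..pi}|lborel. w \<theta> * \<gamma> \<theta> * sin \<theta>) = (LINT \<theta>:{0..pi}|lborel. sin \<theta> * (w \<theta> * (indicator {0..pi} \<theta> * \<gamma> \<theta>)))"
    unfolding set_lebesgue_integral_def
    by (intro Bochner_Integration.integral_cong) (auto split: split_indicator)
  also have "\<dots> = (LINT \<theta>|Theta. w \<theta> * (indicator {0..pi} \<theta> * \<gamma> \<theta>))" by (rule Theta_set_integral[OF wm, symmetric])
  also have "\<dots> = (LINT \<theta>|Theta. w \<theta> * \<gamma>' \<theta>)"
  proof (rule integral_cong_AE)
    show "(\<lambda>\<theta>. w \<theta> * (indicator {0..pi} \<theta> * \<gamma> \<theta>)) \<in> borel_measurable Theta" using wm by (simp add: measurable_cong_sets[OF sets_Theta refl])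
    show "(\<lambda>\<theta>. w \<theta> * \<gamma>' \<theta>) \<in> borel_measurable Theta" using w m' by (simp add: measurable_cong_sets[OF sets_Theta refl])
    show "AE \<theta> in Theta. w \<theta> * (indicator {0..pi} \<theta> * \<gamma> \<theta>) = w \<theta> * \<gamma>' \<theta>"
      using AE_Theta ae by eventually_elim auto
  qed
  finally show ?thesis .
qed

text \<open>In the application \<open>\<alpha>\<close> is a Fourier coefficient of the function \<open>u\<close>, \<open>a\<close> the corresponding coefficient of \<open>f\<close>,
\<open>\<tau>\<close> that of the quadratic form (with one constant subtracted from \<open>\<alpha>\<close> and \<open>\<tau>\<close> in the mode 0), and \<open>P\<close> the critical profile.  Then \<open>\<alpha> = q P + \<gamma> / f0 + cc\<close>; in the integral of
\<open>f0 \<alpha>\<^sup>2\<close> all mixed terms vanish, which leaves three nonnegative terms.  The equation for \<open>\<gamma>\<close> is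
given on \<open>[0, \<pi>]\<close> only, so integrals are formed with a Borel function \<open>\<gamma>'\<close> that agrees with \<open>\<gamma>\<close> almost everywhere.\<close>

lemma mode_bound:
  fixes \<alpha> a \<tau> P \<gamma> wa wb :: "real \<Rightarrow> real"
  assumes \<alpha>[measurable]: "\<alpha> \<in> borel_measurable borel" and \<alpha>2: "integrable Theta (\<lambda>\<theta>. (\<alpha> \<theta>)\<^sup>2)" and E: "(LINT \<theta>|Theta. (\<alpha> \<theta>)\<^sup>2) \<le> E"
    and rel: "AE \<theta> in Theta. a \<theta> = f0 \<eta> \<theta> * (\<alpha> \<theta> - \<tau> \<theta>)"
    and \<tau>: "\<And>\<theta>. \<tau> \<theta> + \<zeta> * P \<theta> = q * P \<theta> + cc"
    and split: "\<And>\<theta>. \<theta> \<in> {0..pi} \<Longrightarrow> a \<theta> = \<zeta> * (f0 \<eta> \<theta> * P \<theta>) + \<gamma> \<theta>"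
    and am: "(\<lambda>\<theta>. indicator {0..pi} \<theta> * a \<theta>) \<in> borel_measurable borel"
    and P: "continuous_on UNIV P" and w: "continuous_on UNIV wa" "continuous_on UNIV wb" "\<And>\<theta>. P \<theta> = ra * wa \<theta> + rb * wb \<theta>"
    and orth: "(LINT \<theta>:{0..pi}|lborel. wa \<theta> * \<gamma> \<theta> * sin \<theta>) = 0" "(LINT \<theta>:{0..pi}|lborel. wb \<theta> * \<gamma> \<theta> * sin \<theta>) = 0"
    and cc: "cc \<noteq> 0 \<Longrightarrow> (LINT \<theta>:{0..pi}|lborel. 1 * \<gamma> \<theta> * sin \<theta>) = 0 \<and> (LINT \<theta>|Theta. f0 \<eta> \<theta> * P \<theta>) = 0"
  shows "\<exists>\<gamma>'. \<gamma>' \<in> borel_measurable borel \<and> integrable Theta (\<lambda>\<theta>. (\<gamma>' \<theta>)\<^sup>2) \<and> (AE \<theta> in Theta. \<gamma> \<theta> = \<gamma>' \<theta>)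
     \<and> (LINT \<theta>|Theta. (\<gamma>' \<theta>)\<^sup>2) \<le> (f0_max \<eta>)\<^sup>2 * E \<and> q\<^sup>2 * (LINT \<theta>|Theta. f0 \<eta> \<theta> * (P \<theta>)\<^sup>2) \<le> f0_max \<eta> * E"
proof -
  have [measurable]: "P \<in> borel_measurable borel" "wa \<in> borel_measurable borel" "wb \<in> borel_measurable borel" "f0 \<eta> \<in> borel_measurable borel"
    using P w continuous_f0 by (auto intro: borel_measurable_continuous_onI)
  define F where "F = f0_max \<eta>"
  have F: "0 < f0 \<eta> \<theta>" "f0 \<eta> \<theta> \<le> F" "0 < F" for \<theta> using f0_bounds by (auto simp: F_def)
  \<comment> \<open>Solving \<open>\<alpha> = q P + \<gamma> / f0 + cc\<close> for \<open>\<gamma>\<close> gives a formula that makes sense for all \<open>\<theta>\<close>.\<close>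
  define \<gamma>' where "\<gamma>' = (\<lambda>\<theta>. f0 \<eta> \<theta> * (\<alpha> \<theta> - (q * P \<theta> + cc)))"
  have gm[measurable]: "\<gamma>' \<in> borel_measurable borel" unfolding \<gamma>'_def by measurable
  have tm: "h \<in> borel_measurable Theta" if "h \<in> borel_measurable borel" for h :: "real \<Rightarrow> real"
    using that by (simp add: measurable_cong_sets[OF sets_Theta refl])
  have ae: "AE \<theta> in Theta. \<gamma> \<theta> = \<gamma>' \<theta>"
    using AE_Theta rel
  proof eventually_elim
    case (elim \<theta>)
    have "\<gamma> \<theta> = a \<theta> - \<zeta> * (f0 \<eta> \<theta> * P \<theta>)" using split elim by simp
    also have "\<dots> = f0 \<eta> \<theta> * (\<alpha> \<theta> - (\<tau> \<theta> + \<zeta> * P \<theta>))" using elim by (simp add: algebra_simps)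
    finally show ?case by (simp add: \<tau> \<gamma>'_def)
  qed
  have \<gamma>m: "(\<lambda>\<theta>. indicator {0..pi} \<theta> * \<gamma> \<theta>) \<in> borel_measurable borel"
  proof -
    have "(\<lambda>\<theta>. indicator {0..pi} \<theta> * \<gamma> \<theta>) = (\<lambda>\<theta>. indicator {0..pi} \<theta> * a \<theta> - indicator {0..pi} \<theta> * (\<zeta> * (f0 \<eta> \<theta> * P \<theta>)))"
      using split by (auto simp: fun_eq_iff indicator_def)
    then show ?thesis using am by simp
  qed
  have cont2: "integrable Theta (\<lambda>\<theta>. (c \<theta>)\<^sup>2)" "integrable Theta c" if "continuous_on UNIV c" for c :: "real \<Rightarrow> real"
    using that by (auto intro!: integrable_Theta_continuous continuous_intros)
  have \<gamma>2: "integrable Theta (\<lambda>\<theta>. (\<gamma>' \<theta>)\<^sup>2)"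
  proof (rule Bochner_Integration.integrable_bound)
    show "integrable Theta (\<lambda>\<theta>. 2 * F\<^sup>2 * (\<alpha> \<theta>)\<^sup>2 + 2 * F\<^sup>2 * (q * P \<theta> + cc)\<^sup>2)"
    proof -
      have "continuous_on UNIV (\<lambda>\<theta>. q * P \<theta> + cc)" by (intro continuous_intros P)
      from cont2(1)[OF this] \<alpha>2 show ?thesis by simp
    qed
    show "(\<lambda>\<theta>. (\<gamma>' \<theta>)\<^sup>2) \<in> borel_measurable Theta" by (rule tm) measurable
    show "AE \<theta> in Theta. norm ((\<gamma>' \<theta>)\<^sup>2) \<le> norm (2 * F\<^sup>2 * (\<alpha> \<theta>)\<^sup>2 + 2 * F\<^sup>2 * (q * P \<theta> + cc)\<^sup>2)"
    proof (rule AE_I2)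
      fix \<theta>
      have sq: "(x - y)\<^sup>2 \<le> 2 * x\<^sup>2 + 2 * y\<^sup>2" for x y :: real
      proof -
        have "0 \<le> (x + y)\<^sup>2" by simp
        then show ?thesis unfolding power2_sum power2_diff by linarith
      qed
      have "(\<alpha> \<theta> - (q * P \<theta> + cc))\<^sup>2 \<le> 2 * (\<alpha> \<theta>)\<^sup>2 + 2 * (q * P \<theta> + cc)\<^sup>2" by (rule sq)
      moreover have "(f0 \<eta> \<theta>)\<^sup>2 \<le> F\<^sup>2" using F(1,2)[of \<theta>] F(3) by (intro power_mono) auto
      ultimately have "(\<gamma>' \<theta>)\<^sup>2 \<le> F\<^sup>2 * (2 * (\<alpha> \<theta>)\<^sup>2 + 2 * (q * P \<theta> + cc)\<^sup>2)"
        unfolding \<gamma>'_def power_mult_distrib by (intro mult_mono) auto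
      then show "norm ((\<gamma>' \<theta>)\<^sup>2) \<le> norm (2 * F\<^sup>2 * (\<alpha> \<theta>)\<^sup>2 + 2 * F\<^sup>2 * (q * P \<theta> + cc)\<^sup>2)"
        by (simp add: algebra_simps)
    qed
  qed
  have \<gamma>1: "integrable Theta (\<lambda>\<theta>. c \<theta> * \<gamma>' \<theta>)" if "continuous_on UNIV c" for c
    by (rule integrable_mult_L2[OF _ _ cont2(1)[OF that] \<gamma>2]) (auto intro!: tm borel_measurable_continuous_onI that)
  have o: "(LINT \<theta>|Theta. wa \<theta> * \<gamma>' \<theta>) = 0" "(LINT \<theta>|Theta. wb \<theta> * \<gamma>' \<theta>) = 0"
    using orth set_integral_Theta_AE[OF \<gamma>m gm _ ae, of wa] set_integral_Theta_AE[OF \<gamma>m gm _ ae, of wb] by simp_all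
  have oP: "(LINT \<theta>|Theta. P \<theta> * \<gamma>' \<theta>) = 0"
  proof -
    have "(LINT \<theta>|Theta. P \<theta> * \<gamma>' \<theta>) = (LINT \<theta>|Theta. ra * (wa \<theta> * \<gamma>' \<theta>) + rb * (wb \<theta> * \<gamma>' \<theta>))"
      unfolding w(3) by (simp add: algebra_simps)
    also have "\<dots> = ra * (LINT \<theta>|Theta. wa \<theta> * \<gamma>' \<theta>) + rb * (LINT \<theta>|Theta. wb \<theta> * \<gamma>' \<theta>)"
      using \<gamma>1[OF w(1)] \<gamma>1[OF w(2)] by simp
    finally show ?thesis by (simp add: o)
  qed
  have oc: "cc * (LINT \<theta>|Theta. \<gamma>' \<theta>) = 0" "cc * (LINT \<theta>|Theta. f0 \<eta> \<theta> * P \<theta>) = 0"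
    using cc set_integral_Theta_AE[OF \<gamma>m gm _ ae, of "\<lambda>_. 1"] by (auto simp: mult_eq_0_iff)
  have \<alpha>eq: "\<alpha> \<theta> = q * P \<theta> + \<gamma>' \<theta> / f0 \<eta> \<theta> + cc" for \<theta>
    using F(1)[of \<theta>] by (simp add: \<gamma>'_def field_simps)
  have exp: "f0 \<eta> \<theta> * (\<alpha> \<theta>)\<^sup>2 = q\<^sup>2 * (f0 \<eta> \<theta> * (P \<theta>)\<^sup>2) + (\<gamma>' \<theta>)\<^sup>2 / f0 \<eta> \<theta> + cc\<^sup>2 * f0 \<eta> \<theta>
      + 2 * q * (P \<theta> * \<gamma>' \<theta>) + 2 * (cc * \<gamma>' \<theta>) + 2 * q * (cc * (f0 \<eta> \<theta> * P \<theta>))" for \<theta>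
    unfolding \<alpha>eq using F(1)[of \<theta>] by (simp add: power2_eq_square field_simps)
  have i1: "integrable Theta (\<lambda>\<theta>. f0 \<eta> \<theta> * (\<alpha> \<theta>)\<^sup>2)"
  proof (rule Bochner_Integration.integrable_bound)
    show "integrable Theta (\<lambda>\<theta>. F * (\<alpha> \<theta>)\<^sup>2)" using \<alpha>2 by simp
    show "(\<lambda>\<theta>. f0 \<eta> \<theta> * (\<alpha> \<theta>)\<^sup>2) \<in> borel_measurable Theta" by (rule tm) measurable
    have "f0 \<eta> \<theta> * (\<alpha> \<theta>)\<^sup>2 \<le> F * (\<alpha> \<theta>)\<^sup>2" for \<theta> using F(1,2)[of \<theta>] F(3) by (intro mult_right_mono) auto
    then show "AE \<theta> in Theta. norm (f0 \<eta> \<theta> * (\<alpha> \<theta>)\<^sup>2) \<le> norm (F * (\<alpha> \<theta>)\<^sup>2)" using F less_imp_le[OF F(1)] by simp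
  qed
  have "(LINT \<theta>|Theta. f0 \<eta> \<theta> * (\<alpha> \<theta>)\<^sup>2) \<le> (LINT \<theta>|Theta. F * (\<alpha> \<theta>)\<^sup>2)"
    by (rule integral_mono[OF i1]) (use \<alpha>2 F in \<open>auto intro!: mult_right_mono\<close>)
  also have "\<dots> \<le> F * E" using E F by simp
  finally have up: "(LINT \<theta>|Theta. f0 \<eta> \<theta> * (\<alpha> \<theta>)\<^sup>2) \<le> F * E" .
  have c1: "continuous_on UNIV (\<lambda>\<theta>. f0 \<eta> \<theta> * (P \<theta>)\<^sup>2)" "continuous_on UNIV (\<lambda>\<theta>. f0 \<eta> \<theta> * P \<theta>)"
    by (intro continuous_intros continuous_f0 P)+
  have i2: "integrable Theta (\<lambda>\<theta>. (\<gamma>' \<theta>)\<^sup>2 / f0 \<eta> \<theta>)"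
  proof (rule Bochner_Integration.integrable_bound)
    show "integrable Theta (\<lambda>\<theta>. (\<gamma>' \<theta>)\<^sup>2 / f0_min \<eta>)" using \<gamma>2 by simp
    show "(\<lambda>\<theta>. (\<gamma>' \<theta>)\<^sup>2 / f0 \<eta> \<theta>) \<in> borel_measurable Theta" by (rule tm) measurable
    have "(\<gamma>' \<theta>)\<^sup>2 / f0 \<eta> \<theta> \<le> (\<gamma>' \<theta>)\<^sup>2 / f0_min \<eta>" for \<theta>
      using f0_bounds(1,2)[of \<eta>] by (intro divide_left_mono) (auto intro!: mult_pos_pos F(1))
    then show "AE \<theta> in Theta. norm ((\<gamma>' \<theta>)\<^sup>2 / f0 \<eta> \<theta>) \<le> norm ((\<gamma>' \<theta>)\<^sup>2 / f0_min \<eta>)"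
      using F f0_bounds(1)[of \<eta>] less_imp_le[OF F(1)] by simp
  qed
  have \<gamma>i: "integrable Theta \<gamma>'" using \<gamma>1[of "\<lambda>_. 1"] by simp
  have "(LINT \<theta>|Theta. f0 \<eta> \<theta> * (\<alpha> \<theta>)\<^sup>2) = q\<^sup>2 * (LINT \<theta>|Theta. f0 \<eta> \<theta> * (P \<theta>)\<^sup>2) + (LINT \<theta>|Theta. (\<gamma>' \<theta>)\<^sup>2 / f0 \<eta> \<theta>)
     + cc\<^sup>2 * (LINT \<theta>|Theta. f0 \<eta> \<theta>) + 2 * q * (LINT \<theta>|Theta. P \<theta> * \<gamma>' \<theta>) + 2 * (cc * (LINT \<theta>|Theta. \<gamma>' \<theta>))
     + 2 * q * (cc * (LINT \<theta>|Theta. f0 \<eta> \<theta> * P \<theta>))"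
    unfolding exp using cont2(2)[OF c1(1)] cont2(2)[OF c1(2)] i2 cont2(2)[OF continuous_f0] \<gamma>1[OF P] \<gamma>i
    by (simp del: mult_eq_0_iff)
  then have eq: "(LINT \<theta>|Theta. f0 \<eta> \<theta> * (\<alpha> \<theta>)\<^sup>2) = q\<^sup>2 * (LINT \<theta>|Theta. f0 \<eta> \<theta> * (P \<theta>)\<^sup>2) + (LINT \<theta>|Theta. (\<gamma>' \<theta>)\<^sup>2 / f0 \<eta> \<theta>)
     + cc\<^sup>2 * (LINT \<theta>|Theta. f0 \<eta> \<theta>)" unfolding oP oc by simp
  have n1: "0 \<le> (LINT \<theta>|Theta. f0 \<eta> \<theta> * (P \<theta>)\<^sup>2)" by (rule integral_nonneg_AE) (use less_imp_le[OF F(1)] in auto)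
  have n2: "0 \<le> cc\<^sup>2 * (LINT \<theta>|Theta. f0 \<eta> \<theta>)" by (intro mult_nonneg_nonneg integral_nonneg_AE) (use less_imp_le[OF F(1)] in auto)
  have n4: "0 \<le> q\<^sup>2 * (LINT \<theta>|Theta. f0 \<eta> \<theta> * (P \<theta>)\<^sup>2)" using n1 by simp
  have low: "(LINT \<theta>|Theta. (\<gamma>' \<theta>)\<^sup>2) / F \<le> (LINT \<theta>|Theta. (\<gamma>' \<theta>)\<^sup>2 / f0 \<eta> \<theta>)"
  proof -
    have "(LINT \<theta>|Theta. (\<gamma>' \<theta>)\<^sup>2 / F) \<le> (LINT \<theta>|Theta. (\<gamma>' \<theta>)\<^sup>2 / f0 \<eta> \<theta>)"
    proof (rule integral_mono[OF _ i2])
      show "integrable Theta (\<lambda>\<theta>. (\<gamma>' \<theta>)\<^sup>2 / F)" using \<gamma>2 by simp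
      show "(\<gamma>' \<theta>)\<^sup>2 / F \<le> (\<gamma>' \<theta>)\<^sup>2 / f0 \<eta> \<theta>" for \<theta> using F by (intro divide_left_mono) (auto intro!: mult_pos_pos)
    qed
    then show ?thesis by simp
  qed
  have n3: "0 \<le> (LINT \<theta>|Theta. (\<gamma>' \<theta>)\<^sup>2) / F" using F by (intro divide_nonneg_pos integral_nonneg_AE) auto
  have "(LINT \<theta>|Theta. (\<gamma>' \<theta>)\<^sup>2) / F \<le> F * E" using up eq low n2 n4 by linarith
  then have A: "(LINT \<theta>|Theta. (\<gamma>' \<theta>)\<^sup>2) \<le> F\<^sup>2 * E" using F by (simp add: power2_eq_square field_simps)
  have B: "q\<^sup>2 * (LINT \<theta>|Theta. f0 \<eta> \<theta> * (P \<theta>)\<^sup>2) \<le> F * E" using up eq low n2 n3 by linarith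
  show ?thesis using gm \<gamma>2 ae A B unfolding F_def by blast
qed

text \<open>The number 8/45 is the minimum over \<open>r\<close> of the integral of \<open>(s\<^sup>2 - r)\<^sup>2\<close> over \<open>[-1, 1]\<close>, attained
at \<open>r = 1/3\<close>.  The other two profiles have the larger norms 4/15 and 16/15; one common constant
is sufficient.\<close>

lemma weighted_mode_norms:
  "(LINT \<theta>|Theta. f0 \<eta> \<theta> * ((cos \<theta>)\<^sup>2 - r)\<^sup>2) \<ge> f0_min \<eta> * (8/45)"
  "(LINT \<theta>|Theta. f0 \<eta> \<theta> * (sin \<theta> * cos \<theta>)\<^sup>2) \<ge> f0_min \<eta> * (8/45)"
  "(LINT \<theta>|Theta. f0 \<eta> \<theta> * ((sin \<theta>)\<^sup>2)\<^sup>2) \<ge> f0_min \<eta> * (8/45)"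
proof -
  have gen: "f0_min \<eta> * (8/45) \<le> (LINT \<theta>|Theta. f0 \<eta> \<theta> * k \<theta>)"
    if k: "continuous_on UNIV k" "\<And>\<theta>. k \<theta> \<ge> 0" and e: "\<And>\<theta>. k \<theta> = poly (pderiv Q) (cos \<theta>)" and l: "poly Q 1 - poly Q (-1) \<ge> 8/45" for k Q
  proof -
    have "f0_min \<eta> * (8/45) \<le> f0_min \<eta> * (poly Q 1 - poly Q (-1))" using l f0_bounds(1)[of \<eta>] by (intro mult_left_mono) auto
    also have "\<dots> = (LINT \<theta>|Theta. f0_min \<eta> * k \<theta>)" by (simp add: e integral_Theta_poly_cos)
    also have "\<dots> \<le> (LINT \<theta>|Theta. f0 \<eta> \<theta> * k \<theta>)"
      by (intro integral_mono integrable_Theta_continuous continuous_intros continuous_f0 k mult_right_mono f0_bounds)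
    finally show ?thesis .
  qed
  show "(LINT \<theta>|Theta. f0 \<eta> \<theta> * ((cos \<theta>)\<^sup>2 - r)\<^sup>2) \<ge> f0_min \<eta> * (8/45)"
  proof (rule gen[where Q="[:0, r\<^sup>2, 0, - 2 * r / 3, 0, 1/5:]"])
    \<comment> \<open>The integral equals \<open>8/45 + 2 (r - 1/3)\<^sup>2\<close>.\<close>
    have "0 \<le> 2 * (r - 1/3)\<^sup>2" by simp
    then show "8 / 45 \<le> poly [:0, r\<^sup>2, 0, - 2 * r / 3, 0, 1 / 5:] 1 - poly [:0, r\<^sup>2, 0, - 2 * r / 3, 0, 1 / 5:] (- 1)"
      by (simp add: power2_eq_square algebra_simps)
    show "continuous_on UNIV (\<lambda>\<theta>. ((cos \<theta>)\<^sup>2 - r)\<^sup>2)" by (intro continuous_intros)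
    show "((cos \<theta>)\<^sup>2 - r)\<^sup>2 = poly (pderiv [:0, r\<^sup>2, 0, - 2 * r / 3, 0, 1/5:]) (cos \<theta>)" for \<theta>
      by (simp add: pderiv_pCons power2_eq_square algebra_simps)
  qed simp
  have s2: "(sin \<theta>)\<^sup>2 = 1 - (cos \<theta>)\<^sup>2" for \<theta> :: real by (rule sin_squared_eq)
  show "(LINT \<theta>|Theta. f0 \<eta> \<theta> * (sin \<theta> * cos \<theta>)\<^sup>2) \<ge> f0_min \<eta> * (8/45)"
  proof (rule gen[where Q="[:0, 0, 0, 1/3, 0, -1/5:]"])
    show "continuous_on UNIV (\<lambda>\<theta>::real. (sin \<theta> * cos \<theta>)\<^sup>2)" by (intro continuous_intros)
    show "(sin \<theta> * cos \<theta>)\<^sup>2 = poly (pderiv [:0, 0, 0, 1/3, 0, -1/5:]) (cos \<theta>)" for \<theta> :: real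
      unfolding power_mult_distrib s2 by (simp add: pderiv_pCons power2_eq_square algebra_simps)
  qed simp_all
  show "(LINT \<theta>|Theta. f0 \<eta> \<theta> * ((sin \<theta>)\<^sup>2)\<^sup>2) \<ge> f0_min \<eta> * (8/45)"
  proof (rule gen[where Q="[:0, 1, 0, -2/3, 0, 1/5:]"])
    show "continuous_on UNIV (\<lambda>\<theta>::real. ((sin \<theta>)\<^sup>2)\<^sup>2)" by (intro continuous_intros)
    show "((sin \<theta>)\<^sup>2)\<^sup>2 = poly (pderiv [:0, 1, 0, -2/3, 0, 1/5:]) (cos \<theta>)" for \<theta> :: real
      unfolding s2 by (simp add: pderiv_pCons power2_eq_square algebra_simps)
  qed simp_all
qed

text \<open>The reason for subtracting \<open>Ak \<eta> 2 / Ak \<eta> 0\<close>: the zonal profile has mean zero with respect to the equilibrium.\<close>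

lemma integral_f0_zonal: "(LINT \<theta>|Theta. f0 \<eta> \<theta> * ((cos \<theta>)\<^sup>2 - Ak \<eta> 2 / Ak \<eta> 0)) = 0"
proof -
  have i: "integrable Theta (\<lambda>\<theta>. exp (\<eta> * (cos \<theta>)\<^sup>2) * cos \<theta> ^ k)" for k
    by (intro integrable_Theta_continuous continuous_intros)
  have "(LINT \<theta>|Theta. f0 \<eta> \<theta> * ((cos \<theta>)\<^sup>2 - Ak \<eta> 2 / Ak \<eta> 0))
     = (LINT \<theta>|Theta. (exp (\<eta> * (cos \<theta>)\<^sup>2) * cos \<theta> ^ 2 - Ak \<eta> 2 / Ak \<eta> 0 * (exp (\<eta> * (cos \<theta>)\<^sup>2) * cos \<theta> ^ 0)) / (2 * pi * Ak \<eta> 0))"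
    by (intro Bochner_Integration.integral_cong) (auto simp: f0_def diff_divide_distrib algebra_simps)
  also have "\<dots> = (Ak \<eta> 2 - Ak \<eta> 2 / Ak \<eta> 0 * Ak \<eta> 0) / (2 * pi * Ak \<eta> 0)"
    using i[of 2] i[of 0] by (simp add: Ak_eq_Theta)
  also have "\<dots> = 0" using Ak_0_pos[of \<eta>] by simp
  finally show ?thesis .
qed

lemma nn_integral_Phi: "u \<in> borel_measurable borel \<Longrightarrow> (\<integral>\<^sup>+\<phi>. u \<phi> \<partial>Phi) = (\<integral>\<^sup>+\<phi>\<in>{0..2*pi}. u \<phi> \<partial>lborel)"
  unfolding Phi_def by (subst nn_integral_density) (auto simp: mult.commute)

lemma nn_integral_Theta: "u \<in> borel_measurable borel \<Longrightarrow> (\<integral>\<^sup>+\<theta>. u \<theta> \<partial>Theta) = (\<integral>\<^sup>+\<theta>\<in>{0..pi}. u \<theta> * ennreal (sin \<theta>) \<partial>lborel)"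
  unfolding Theta_def by (subst nn_integral_density) (auto simp: mult_ac)

section \<open>The lower bound on one slice\<close>

text \<open>The double-angle formulas.  They produce \<open>(N11 - N22) / 2\<close> but \<open>N12\<close> in the mode 2, which is the source of the
different factors in front of \<open>\<zeta>a2\<close> and \<open>\<zeta>b2\<close> in the claim.\<close>

lemma quadratic_form_trig:
  fixes N :: "real^3^3"
  assumes sym: "\<And>i j. N $ i $ j = N $ j $ i"
  shows "sph \<theta> \<phi> \<bullet> (N *v sph \<theta> \<phi>) = trig_poly
    ((2 * N $ 3 $ 3 - N $ 1 $ 1 - N $ 2 $ 2) / 2 * (cos \<theta>)\<^sup>2 + (N $ 1 $ 1 + N $ 2 $ 2) / 2)
    (\<lambda>k. if k = 1 then 2 * N $ 1 $ 3 * (sin \<theta> * cos \<theta>) else if k = 2 then (N $ 1 $ 1 - N $ 2 $ 2) / 2 * (sin \<theta>)\<^sup>2 else 0)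
    (\<lambda>k. if k = 1 then 2 * N $ 2 $ 3 * (sin \<theta> * cos \<theta>) else if k = 2 then N $ 1 $ 2 * (sin \<theta>)\<^sup>2 else 0) 2 \<phi>"
proof -
  have s12: "{1..2::nat} = {1, 2}" by auto
  define s c t k where "s = sin \<theta>" "c = cos \<theta>" "t = sin \<phi>" "k = cos \<phi>"
  have r: "s\<^sup>2 = 1 - c\<^sup>2" by (simp add: s_c_t_k_def sin_squared_eq)
  have d: "cos (2 * \<phi>) = k\<^sup>2 - t\<^sup>2" "sin (2 * \<phi>) = 2 * t * k" "t\<^sup>2 + k\<^sup>2 = 1"
    by (simp_all add: s_c_t_k_def cos_double sin_double)
  have e: "N $ 2 $ 1 = N $ 1 $ 2" "N $ 3 $ 1 = N $ 1 $ 3" "N $ 3 $ 2 = N $ 2 $ 3" using sym by auto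
  have L: "sph \<theta> \<phi> \<bullet> (N *v sph \<theta> \<phi>) = N $ 1 $ 1 * (s * k)\<^sup>2 + N $ 2 $ 2 * (s * t)\<^sup>2 + N $ 3 $ 3 * c\<^sup>2
      + 2 * N $ 1 $ 2 * (s\<^sup>2 * k * t) + 2 * N $ 1 $ 3 * (s * c * k) + 2 * N $ 2 $ 3 * (s * c * t)"
    by (simp add: inner_vec_def sum_3 matrix_vector_mult_def e s_c_t_k_def power2_eq_square algebra_simps)
  define n11 n22 n33 n12 n13 n23 where "n11 = N $ 1 $ 1" "n22 = N $ 2 $ 2" "n33 = N $ 3 $ 3" "n12 = N $ 1 $ 2" "n13 = N $ 1 $ 3" "n23 = N $ 2 $ 3"
  note nn = this
  have "2 * (n11 * (s * k)\<^sup>2 + n22 * (s * t)\<^sup>2 + n33 * c\<^sup>2 + 2 * n12 * (s\<^sup>2 * k * t) + 2 * n13 * (s * c * k) + 2 * n23 * (s * c * t))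
    = (2 * n33 - n11 - n22) * c\<^sup>2 + (n11 + n22) + 2 * (2 * n13 * (s * c) * k + 2 * n23 * (s * c) * t)
      + ((n11 - n22) * s\<^sup>2 * (k\<^sup>2 - t\<^sup>2) + 2 * n12 * s\<^sup>2 * (2 * t * k))"
    using r d(3) by algebra
  then show ?thesis
    unfolding L trig_poly_def s12 by (simp add: d(1,2) nn[symmetric] s_c_t_k_def[symmetric]) (simp add: field_simps)
qed

lemma trig_poly_combine:
  assumes "2 \<le> K" and z: "\<And>k. k > 2 \<Longrightarrow> c k = 0 \<and> d k = 0"
  shows "trig_poly (a0 / e + t0) (\<lambda>k. a k / e + c k) (\<lambda>k. b k / e + d k) K \<phi> = trig_poly a0 a b K \<phi> / e + trig_poly t0 c d 2 \<phi>"
proof -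
  have "(\<Sum>k=1..K. c k * cos (real k * \<phi>) + d k * sin (real k * \<phi>)) = (\<Sum>k=1..2. c k * cos (real k * \<phi>) + d k * sin (real k * \<phi>))"
    using assms(1) by (intro sum.mono_neutral_right) (auto simp: z)
  moreover have "(\<Sum>k=1..K. (a k / e + c k) * cos (real k * \<phi>) + (b k / e + d k) * sin (real k * \<phi>))
    = (\<Sum>k=1..K. a k * cos (real k * \<phi>) + b k * sin (real k * \<phi>)) / e + (\<Sum>k=1..K. c k * cos (real k * \<phi>) + d k * sin (real k * \<phi>))"
    unfolding sum_divide_distrib sum.distrib[symmetric] by (intro sum.cong refl) (simp add: add_divide_distrib algebra_simps)
  ultimately show ?thesis by (simp add: trig_poly_def add_divide_distrib)
qed

text \<open>Every mode of \<open>u\<close> has square norm at most \<open>E / pi\<close>.  Five applications of \<open>mode_bound\<close> give the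
remainders \<open>\<gamma>\<close> and the critical amplitudes, and the modes from 3 on are those of \<open>u\<close> times \<open>f0\<close>.
In the first bound the five remainders and the tail contribute one multiple of \<open>(f0_max \<eta>)\<^sup>2 E / pi\<close> each, and in
the second the amplitudes contribute 4 + 1 + 1 + 4 + 1 = 11 multiples of \<open>f0_max \<eta> (E / pi) / (8/45 f0_min \<eta>)\<close>.\<close>

lemma slice_lower_bound:
  fixes N A :: "real^3^3" and a b :: "nat \<Rightarrow> real \<Rightarrow> real"
  assumes A: "rotation_matrix A" and sw: "slice_weak_rot u V" and u2: "sq_integrable S2 u" and V2: "sq_integrable S2 V"
    and fm: "fx \<in> borel_measurable S2"
    and u: "\<And>\<theta> \<phi>. u (A *v sph \<theta> \<phi>) = fx (A *v sph \<theta> \<phi>) / f0 \<eta> \<theta> - \<alpha> * (sph \<theta> \<phi> \<bullet> (N *v sph \<theta> \<phi>))"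
    and sym: "\<And>i j. N $ i $ j = N $ j $ i"
    and am: "\<And>k. (\<lambda>\<theta>. indicator {0..pi} \<theta> * a k \<theta>) \<in> borel_measurable borel"
    and bm: "\<And>k. (\<lambda>\<theta>. indicator {0..pi} \<theta> * b k \<theta>) \<in> borel_measurable borel"
    and lim: "AE \<theta> in Theta. (\<lambda>K. \<integral>\<^sup>+\<phi>\<in>{0..2 * pi}. ennreal ((fx (A *v sph \<theta> \<phi>) -
              (a 0 \<theta> + (\<Sum>k=1..K. a k \<theta> * cos (real k * \<phi>) + b k \<theta> * sin (real k * \<phi>))))\<^sup>2) \<partial>lborel) \<longlonglongrightarrow> 0"
    and s0: "\<And>\<theta>. \<theta> \<in> {0..pi} \<Longrightarrow> a 0 \<theta> = \<zeta>0 * (f0 \<eta> \<theta> * ((cos \<theta>)\<^sup>2 - Ak \<eta> 2 / Ak \<eta> 0)) + \<gamma>0 \<theta>"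
    and o0: "(LINT \<theta>:{0..pi}|lborel. 1 * \<gamma>0 \<theta> * sin \<theta>) = 0" "(LINT \<theta>:{0..pi}|lborel. (3 * (cos \<theta>)\<^sup>2 - 1) * \<gamma>0 \<theta> * sin \<theta>) = 0"
    and sa1: "\<And>\<theta>. \<theta> \<in> {0..pi} \<Longrightarrow> a 1 \<theta> = \<zeta>a1 * (f0 \<eta> \<theta> * sin \<theta> * cos \<theta>) + \<gamma>a1 \<theta>"
    and oa1: "(LINT \<theta>:{0..pi}|lborel. (sin \<theta> * cos \<theta>) * \<gamma>a1 \<theta> * sin \<theta>) = 0"
    and sb1: "\<And>\<theta>. \<theta> \<in> {0..pi} \<Longrightarrow> b 1 \<theta> = \<zeta>b1 * (f0 \<eta> \<theta> * sin \<theta> * cos \<theta>) + \<gamma>b1 \<theta>"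
    and ob1: "(LINT \<theta>:{0..pi}|lborel. (sin \<theta> * cos \<theta>) * \<gamma>b1 \<theta> * sin \<theta>) = 0"
    and sa2: "\<And>\<theta>. \<theta> \<in> {0..pi} \<Longrightarrow> a 2 \<theta> = \<zeta>a2 * (f0 \<eta> \<theta> * (sin \<theta>)\<^sup>2) + \<gamma>a2 \<theta>"
    and oa2: "(LINT \<theta>:{0..pi}|lborel. (sin \<theta>)\<^sup>2 * \<gamma>a2 \<theta> * sin \<theta>) = 0"
    and sb2: "\<And>\<theta>. \<theta> \<in> {0..pi} \<Longrightarrow> b 2 \<theta> = \<zeta>b2 * (f0 \<eta> \<theta> * (sin \<theta>)\<^sup>2) + \<gamma>b2 \<theta>"
    and ob2: "(LINT \<theta>:{0..pi}|lborel. (sin \<theta>)\<^sup>2 * \<gamma>b2 \<theta> * sin \<theta>) = 0"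
  defines "E \<equiv> (LINT m|S2. (norm (V m))\<^sup>2)"
  shows "(\<integral>\<^sup>+\<theta>\<in>{0..pi}. (ennreal ((\<gamma>0 \<theta>)\<^sup>2 + (\<gamma>a1 \<theta>)\<^sup>2 + (\<gamma>b1 \<theta>)\<^sup>2 + (\<gamma>a2 \<theta>)\<^sup>2 + (\<gamma>b2 \<theta>)\<^sup>2)
             + (\<Sum>k. ennreal ((a (k + 3) \<theta>)\<^sup>2 + (b (k + 3) \<theta>)\<^sup>2))) * ennreal (sin \<theta>) \<partial>lborel)
      \<le> ennreal (6 * (f0_max \<eta>)\<^sup>2 / pi * E)" (is ?A)
    and "(2 * \<zeta>0 - \<alpha> * (2 * N $ 3 $ 3 - N $ 1 $ 1 - N $ 2 $ 2))\<^sup>2 + (\<zeta>a1 - 2 * \<alpha> * N $ 1 $ 3)\<^sup>2 + (\<zeta>b1 - 2 * \<alpha> * N $ 2 $ 3)\<^sup>2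
      + (2 * \<zeta>a2 - \<alpha> * (N $ 1 $ 1 - N $ 2 $ 2))\<^sup>2 + (\<zeta>b2 - \<alpha> * N $ 1 $ 2)\<^sup>2
      \<le> 495 * f0_max \<eta> / (8 * pi * f0_min \<eta>) * E" (is ?B)
proof -
  define F where "F = f0_max \<eta>"
  define v where "v = (\<lambda>\<theta>. LINT \<phi>|Phi. (norm (V (A *v sph \<theta> \<phi>)))\<^sup>2)"
  note uD = sq_integrable_S2_facts[OF u2] and VD = sq_integrable_S2_facts[OF V2]
  have vi: "integrable Theta v" unfolding v_def by (rule integrable_Theta_rotated[OF A VD(2)])
  have vE: "(LINT \<theta>|Theta. v \<theta>) = E" unfolding v_def E_def by (rule integral_S2_rotated[OF A VD(2), symmetric])
  have v0: "v \<theta> \<ge> 0" for \<theta> unfolding v_def by (rule integral_nonneg_AE) simp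
  have tm: "h \<in> borel_measurable borel" if "h \<in> borel_measurable Theta" for h :: "real \<Rightarrow> real"
    using that by (simp add: measurable_cong_sets[OF sets_Theta refl])
  have tm': "h \<in> borel_measurable Theta" if "h \<in> borel_measurable borel" for h :: "real \<Rightarrow> real"
    using that by (simp add: measurable_cong_sets[OF sets_Theta refl])
  define ac where "ac = (\<lambda>k \<theta>. (LINT \<phi>|Phi. u (A *v sph \<theta> \<phi>) * cos (real k * \<phi>)) / pi)"
  define as where "as = (\<lambda>k \<theta>. (LINT \<phi>|Phi. u (A *v sph \<theta> \<phi>) * sin (real k * \<phi>)) / pi)"
  \<comment> \<open>\<open>a00\<close>, \<open>ac\<close>, \<open>as\<close> are the Fourier coefficients of \<open>u\<close>, and \<open>t0\<close>, \<open>tc\<close>, \<open>ts\<close> below those of \<open>- \<alpha> (y \<bullet> N y)\<close>.\<close>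
  define a00 where "a00 = (\<lambda>\<theta>. (LINT \<phi>|Phi. u (A *v sph \<theta> \<phi>)) / (2 * pi))"
  have um: "(\<lambda>x. u (A *v sph (fst x) (snd x))) \<in> borel_measurable (Theta \<Otimes>\<^sub>M Phi)"
    using integrable_S2_rotated[OF A uD(3)] by (auto simp: split_beta' dest: borel_measurable_integrable)
  have sndm: "(\<lambda>x. q (snd x)) \<in> borel_measurable (Theta \<Otimes>\<^sub>M Phi)" if "continuous_on UNIV q" for q :: "real \<Rightarrow> real"
    by (rule measurable_compose[OF measurable_snd])
      (simp add: measurable_cong_sets[OF sets_Phi refl] borel_measurable_continuous_onI that)
  have coef_m: "(\<lambda>\<theta>. LINT \<phi>|Phi. u (A *v sph \<theta> \<phi>) * q \<phi>) \<in> borel_measurable borel" if "continuous_on UNIV q" for q :: "real \<Rightarrow> real"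
    by (rule tm, rule Phi.borel_measurable_lebesgue_integral)
      (use borel_measurable_times[OF um sndm[OF that]] in \<open>simp add: split_beta'\<close>)
  have acm: "ac k \<in> borel_measurable borel" and asm: "as k \<in> borel_measurable borel" for k
    unfolding ac_def as_def by (intro borel_measurable_divide coef_m continuous_intros borel_measurable_const)+
  have a00m: "a00 \<in> borel_measurable borel"
    unfolding a00_def using coef_m[of "\<lambda>_. 1"] by simp
  have sum_le: "AE \<theta> in Theta. \<forall>K. (\<Sum>k=1..K. (ac k \<theta>)\<^sup>2 + (as k \<theta>)\<^sup>2) \<le> v \<theta> / pi"
    using slice_mode_bound[OF sw A u2 V2]
  proof eventually_elim
    case (elim \<theta>)
    show ?case
    proof
      fix K
      have "(\<Sum>k=1..K. (ac k \<theta>)\<^sup>2 + (as k \<theta>)\<^sup>2) = (\<Sum>k=1..K. (LINT \<phi>|Phi. u (A *v sph \<theta> \<phi>) * cos (real k * \<phi>))\<^sup>2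
          + (LINT \<phi>|Phi. u (A *v sph \<theta> \<phi>) * sin (real k * \<phi>))\<^sup>2) / pi\<^sup>2"
        unfolding sum_divide_distrib ac_def as_def by (intro sum.cong refl) (simp add: power_divide add_divide_distrib)
      also have "\<dots> \<le> (pi * v \<theta>) / pi\<^sup>2" using elim by (intro divide_right_mono) (auto simp: v_def)
      finally show "(\<Sum>k=1..K. (ac k \<theta>)\<^sup>2 + (as k \<theta>)\<^sup>2) \<le> v \<theta> / pi" by (simp add: power2_eq_square)
    qed
  qed
  have one: "integrable Theta (\<lambda>\<theta>. (h \<theta>)\<^sup>2) \<and> (LINT \<theta>|Theta. (h \<theta>)\<^sup>2) \<le> E / pi"
    if k: "k \<ge> 1" and h: "h = ac k \<or> h = as k" for h and k :: nat
  proof -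
    have hm: "h \<in> borel_measurable borel" using h acm asm by auto
    have le: "AE \<theta> in Theta. (h \<theta>)\<^sup>2 \<le> v \<theta> / pi"
      using sum_le
    proof eventually_elim
      case (elim \<theta>)
      have "(ac k \<theta>)\<^sup>2 + (as k \<theta>)\<^sup>2 \<le> (\<Sum>k=1..k. (ac k \<theta>)\<^sup>2 + (as k \<theta>)\<^sup>2)"
        using k by (intro member_le_sum) auto
      then show ?case using elim[rule_format, of k] h by (auto intro: order_trans[rotated])
    qed
    have vp: "integrable Theta (\<lambda>\<theta>. v \<theta> / pi)" using vi by simp
    have i: "integrable Theta (\<lambda>\<theta>. (h \<theta>)\<^sup>2)"
    proof (rule Bochner_Integration.integrable_bound[OF vp])
      show "(\<lambda>\<theta>. (h \<theta>)\<^sup>2) \<in> borel_measurable Theta" using tm'[OF hm] by simp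
      show "AE \<theta> in Theta. norm ((h \<theta>)\<^sup>2) \<le> norm (v \<theta> / pi)" using le by eventually_elim (use v0 in simp)
    qed
    show ?thesis using integral_mono_AE[OF i vp le] i vE by simp
  qed
  obtain c where c: "(LINT \<theta>|Theta. (a00 \<theta> - c)\<^sup>2) \<le> E / pi"
    using slice_zonal_bound(2)[OF sw A u2 V2] unfolding a00_def E_def by blast
  have a00i: "integrable Theta (\<lambda>\<theta>. (a00 \<theta>)\<^sup>2)" unfolding a00_def by (rule slice_zonal_bound(1)[OF sw A u2 V2])
  have a00c: "integrable Theta (\<lambda>\<theta>. (a00 \<theta> - c)\<^sup>2)"
    unfolding power2_diff using a00i Theta.square_integrable_imp_integrable[OF tm'[OF a00m] a00i] by simp
  define n0 n2 where "n0 = 2 * N $ 3 $ 3 - N $ 1 $ 1 - N $ 2 $ 2" "n2 = N $ 1 $ 1 - N $ 2 $ 2"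
  define t0 where "t0 = (\<lambda>\<theta>. - \<alpha> * (n0 / 2 * (cos \<theta>)\<^sup>2 + (N $ 1 $ 1 + N $ 2 $ 2) / 2))"
  define tc where "tc = (\<lambda>\<theta> k::nat. - \<alpha> * (if k = 1 then 2 * N $ 1 $ 3 * (sin \<theta> * cos \<theta>) else if k = 2 then n2 / 2 * (sin \<theta>)\<^sup>2 else 0))"
  define ts where "ts = (\<lambda>\<theta> k::nat. - \<alpha> * (if k = 1 then 2 * N $ 2 $ 3 * (sin \<theta> * cos \<theta>) else if k = 2 then N $ 1 $ 2 * (sin \<theta>)\<^sup>2 else 0))"
  have scale: "trig_poly (r * x) (\<lambda>k. r * p k) (\<lambda>k. r * q k) K \<phi> = r * trig_poly x p q K \<phi>" for r x p q K \<phi>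
    by (simp add: trig_poly_def algebra_simps sum_distrib_left)
  have u': "u (A *v sph \<theta> \<phi>) = fx (A *v sph \<theta> \<phi>) / f0 \<eta> \<theta> + trig_poly (t0 \<theta>) (tc \<theta>) (ts \<theta>) 2 \<phi>" for \<theta> \<phi>
    unfolding u quadratic_form_trig[of N, OF sym] t0_def tc_def ts_def scale n0_n2_def by simp
  have rel: "AE \<theta> in Theta. a 0 \<theta> = f0 \<eta> \<theta> * (a00 \<theta> - t0 \<theta>) \<and> (\<forall>k\<ge>1. a k \<theta> = f0 \<eta> \<theta> * (ac k \<theta> - tc \<theta> k) \<and> b k \<theta> = f0 \<eta> \<theta> * (as k \<theta> - ts \<theta> k))"
    using lim
  proof eventually_elim
    case (elim \<theta>)
    define e where "e = f0 \<eta> \<theta>"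
    have e0: "e > 0" using f0_bounds by (simp add: e_def)
    have sm: "(\<lambda>\<phi>. A *v sph \<theta> \<phi>) \<in> borel \<rightarrow>\<^sub>M S2" by (rule measurable_rotated_sph[OF A]) simp_all
    have fsm: "(\<lambda>\<phi>. fx (A *v sph \<theta> \<phi>)) \<in> borel_measurable borel" by (rule measurable_compose[OF sm fm])
    have usm: "(\<lambda>\<phi>. u (A *v sph \<theta> \<phi>)) \<in> borel_measurable Phi"
      using measurable_compose[OF sm uD(1)] by (simp add: measurable_cong_sets[OF sets_Phi refl])
    define S where "S = (\<lambda>K. \<integral>\<^sup>+\<phi>. ennreal ((fx (A *v sph \<theta> \<phi>) - trig_poly (a 0 \<theta>) (\<lambda>k. a k \<theta>) (\<lambda>k. b k \<theta>) K \<phi>)\<^sup>2) \<partial>Phi)"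
    have tpm: "trig_poly (a 0 \<theta>) (\<lambda>k. a k \<theta>) (\<lambda>k. b k \<theta>) K \<in> borel_measurable borel" for K
      by (rule borel_measurable_continuous_onI[OF continuous_trig_poly])
    have dm: "(\<lambda>\<phi>. ennreal ((fx (A *v sph \<theta> \<phi>) - trig_poly (a 0 \<theta>) (\<lambda>k. a k \<theta>) (\<lambda>k. b k \<theta>) K \<phi>)\<^sup>2)) \<in> borel_measurable borel" for K
      using fsm tpm[of K] by simp
    have S0: "S \<longlonglongrightarrow> 0"
      using elim unfolding S_def nn_integral_Phi[OF dm] by (simp only: trig_poly_def)
    have "(\<lambda>K. ennreal (1 / e\<^sup>2) * S K) \<longlonglongrightarrow> ennreal (1 / e\<^sup>2) * 0"
      by (rule ennreal_tendsto_cmult[OF _ S0]) simp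
    moreover have "eventually (\<lambda>K. ennreal (1 / e\<^sup>2) * S K = (\<integral>\<^sup>+\<phi>. ennreal ((u (A *v sph \<theta> \<phi>) -
        trig_poly (a 0 \<theta> / e + t0 \<theta>) (\<lambda>k. a k \<theta> / e + tc \<theta> k) (\<lambda>k. b k \<theta> / e + ts \<theta> k) K \<phi>)\<^sup>2) \<partial>Phi)) sequentially"
    proof (rule eventually_sequentiallyI[of 2])
      fix K :: nat assume K: "2 \<le> K"
      have "u (A *v sph \<theta> \<phi>) - trig_poly (a 0 \<theta> / e + t0 \<theta>) (\<lambda>k. a k \<theta> / e + tc \<theta> k) (\<lambda>k. b k \<theta> / e + ts \<theta> k) K \<phi>
         = (fx (A *v sph \<theta> \<phi>) - trig_poly (a 0 \<theta>) (\<lambda>k. a k \<theta>) (\<lambda>k. b k \<theta>) K \<phi>) / e" for \<phi>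
        by (subst trig_poly_combine[OF K]) (auto simp: tc_def ts_def u' e_def[symmetric] diff_divide_distrib)
      then show "ennreal (1 / e\<^sup>2) * S K = (\<integral>\<^sup>+\<phi>. ennreal ((u (A *v sph \<theta> \<phi>) -
        trig_poly (a 0 \<theta> / e + t0 \<theta>) (\<lambda>k. a k \<theta> / e + tc \<theta> k) (\<lambda>k. b k \<theta> / e + ts \<theta> k) K \<phi>)\<^sup>2) \<partial>Phi)"
        unfolding S_def using dm[of K]
        by (subst nn_integral_cmult[symmetric])
          (auto simp: measurable_cong_sets[OF sets_Phi refl] power_divide ennreal_mult[symmetric] intro!: nn_integral_cong)
    qed
    ultimately have "(\<lambda>K. \<integral>\<^sup>+\<phi>. ennreal ((u (A *v sph \<theta> \<phi>) -
        trig_poly (a 0 \<theta> / e + t0 \<theta>) (\<lambda>k. a k \<theta> / e + tc \<theta> k) (\<lambda>k. b k \<theta> / e + ts \<theta> k) K \<phi>)\<^sup>2) \<partial>Phi) \<longlonglongrightarrow> 0"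
      using Lim_transform_eventually by fastforce
    note co = L2_series_coefficients(3-5)[OF usm this]
    have "a00 \<theta> = a 0 \<theta> / e + t0 \<theta>" using co(1) by (simp add: a00_def)
    moreover have "ac k \<theta> = a k \<theta> / e + tc \<theta> k" "as k \<theta> = b k \<theta> / e + ts \<theta> k" if "k \<ge> 1" for k
      using co(2,3)[OF that] by (simp_all add: ac_def as_def)
    ultimately show ?case unfolding e_def[symmetric] using e0 by simp
  qed
  have rk: "AE \<theta> in Theta. a k \<theta> = f0 \<eta> \<theta> * (ac k \<theta> - tc \<theta> k)" "AE \<theta> in Theta. b k \<theta> = f0 \<eta> \<theta> * (as k \<theta> - ts \<theta> k)"
    if "k \<ge> 1" for k using rel by (eventually_elim, use that in auto)+
  define EE where "EE = E / pi"
  let ?P0 = "\<lambda>\<theta>. (cos \<theta>)\<^sup>2 - Ak \<eta> 2 / Ak \<eta> 0"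
  obtain g0 where g0: "g0 \<in> borel_measurable borel" "integrable Theta (\<lambda>\<theta>. (g0 \<theta>)\<^sup>2)" "AE \<theta> in Theta. \<gamma>0 \<theta> = g0 \<theta>"
      "(LINT \<theta>|Theta. (g0 \<theta>)\<^sup>2) \<le> F\<^sup>2 * EE" "(\<zeta>0 - \<alpha> * n0 / 2)\<^sup>2 * (LINT \<theta>|Theta. f0 \<eta> \<theta> * (?P0 \<theta>)\<^sup>2) \<le> F * EE"
  proof -
    have r0: "AE \<theta> in Theta. a 0 \<theta> = f0 \<eta> \<theta> * ((a00 \<theta> - c) - (t0 \<theta> - c))" using rel by eventually_elim simp
    have "\<exists>\<gamma>'. \<gamma>' \<in> borel_measurable borel \<and> integrable Theta (\<lambda>\<theta>. (\<gamma>' \<theta>)\<^sup>2) \<and> (AE \<theta> in Theta. \<gamma>0 \<theta> = \<gamma>' \<theta>)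
     \<and> (LINT \<theta>|Theta. (\<gamma>' \<theta>)\<^sup>2) \<le> (f0_max \<eta>)\<^sup>2 * EE \<and> (\<zeta>0 - \<alpha> * n0 / 2)\<^sup>2 * (LINT \<theta>|Theta. f0 \<eta> \<theta> * (?P0 \<theta>)\<^sup>2) \<le> f0_max \<eta> * EE"
    \<comment> \<open>The constant \<open>cc\<close> collects the part of the quadratic form that is constant in \<open>\<theta>\<close> and the mean \<open>c\<close>; the profile is a combination of the two weights.\<close>
    proof (rule mode_bound[where wa="\<lambda>_. 1" and wb="\<lambda>\<theta>. 3 * (cos \<theta>)\<^sup>2 - 1" and ra="1/3 - Ak \<eta> 2 / Ak \<eta> 0" and rb="1/3"
          and cc="- \<alpha> * (n0 / 2 * (Ak \<eta> 2 / Ak \<eta> 0) + (N $ 1 $ 1 + N $ 2 $ 2) / 2) - c" and \<zeta>=\<zeta>0, OF _ a00c _ r0])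
      show "(LINT \<theta>|Theta. (a00 \<theta> - c)\<^sup>2) \<le> EE" using c by (simp add: EE_def)
      show "(\<lambda>\<theta>. a00 \<theta> - c) \<in> borel_measurable borel" using a00m by simp
      show "t0 \<theta> - c + \<zeta>0 * ?P0 \<theta> = (\<zeta>0 - \<alpha> * n0 / 2) * ?P0 \<theta> + (- \<alpha> * (n0 / 2 * (Ak \<eta> 2 / Ak \<eta> 0) + (N $ 1 $ 1 + N $ 2 $ 2) / 2) - c)" for \<theta>
      proof -
        have "t0 \<theta> - c + \<zeta>0 * ((cos \<theta>)\<^sup>2 - r) = (\<zeta>0 - \<alpha> * n0 / 2) * ((cos \<theta>)\<^sup>2 - r)
            + (- \<alpha> * (n0 / 2 * r + (N $ 1 $ 1 + N $ 2 $ 2) / 2) - c)" for r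
          unfolding t0_def by (simp add: algebra_simps)
        then show ?thesis .
      qed
      show "(cos \<theta>)\<^sup>2 - Ak \<eta> 2 / Ak \<eta> 0 = (1/3 - Ak \<eta> 2 / Ak \<eta> 0) * 1 + 1/3 * (3 * (cos \<theta>)\<^sup>2 - 1)" for \<theta> by (simp add: algebra_simps diff_divide_distrib)
      show "(LINT \<theta>:{0..pi}|lborel. 1 * \<gamma>0 \<theta> * sin \<theta>) = 0 \<and> (LINT \<theta>|Theta. f0 \<eta> \<theta> * ?P0 \<theta>) = 0"
        using o0(1) integral_f0_zonal by blast
    qed (use s0 am o0 in \<open>auto intro!: continuous_intros\<close>)
    then show ?thesis using that unfolding F_def by blast
  qed
  have mk: "\<exists>\<gamma>'. \<gamma>' \<in> borel_measurable borel \<and> integrable Theta (\<lambda>\<theta>. (\<gamma>' \<theta>)\<^sup>2) \<and> (AE \<theta> in Theta. \<gamma> \<theta> = \<gamma>' \<theta>)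
     \<and> (LINT \<theta>|Theta. (\<gamma>' \<theta>)\<^sup>2) \<le> F\<^sup>2 * EE \<and> (\<zeta> + r)\<^sup>2 * (LINT \<theta>|Theta. f0 \<eta> \<theta> * (P \<theta>)\<^sup>2) \<le> F * EE"
    if k: "k \<ge> 1" and h: "h = ac k \<or> h = as k" and rr: "AE \<theta> in Theta. d \<theta> = f0 \<eta> \<theta> * (h \<theta> - r * P \<theta>)"
      and sp: "\<And>\<theta>. \<theta> \<in> {0..pi} \<Longrightarrow> d \<theta> = \<zeta> * (f0 \<eta> \<theta> * P \<theta>) + \<gamma> \<theta>" and dm: "(\<lambda>\<theta>. indicator {0..pi} \<theta> * d \<theta>) \<in> borel_measurable borel"
      and P: "continuous_on UNIV P" and oo: "(LINT \<theta>:{0..pi}|lborel. P \<theta> * \<gamma> \<theta> * sin \<theta>) = 0"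
    for k :: nat and h d \<gamma> P :: "real \<Rightarrow> real" and \<zeta> r :: real
    unfolding F_def
  proof (rule mode_bound[where wa=P and wb=P and ra=1 and rb=0 and cc=0 and \<alpha>=h and \<zeta>=\<zeta>, OF _ _ _ rr])
    show "h \<in> borel_measurable borel" using h acm asm by auto
    show "integrable Theta (\<lambda>\<theta>. (h \<theta>)\<^sup>2)" "(LINT \<theta>|Theta. (h \<theta>)\<^sup>2) \<le> EE" using one[OF k h] by (auto simp: EE_def)
  qed (use sp dm P oo in \<open>auto simp: algebra_simps\<close>)
  let ?P1 = "\<lambda>\<theta>::real. sin \<theta> * cos \<theta>" and ?P2 = "\<lambda>\<theta>::real. (sin \<theta>)\<^sup>2"
  have cP: "continuous_on UNIV ?P1" "continuous_on UNIV ?P2" by (intro continuous_intros)+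
  obtain ga1 where ga1: "ga1 \<in> borel_measurable borel" "integrable Theta (\<lambda>\<theta>. (ga1 \<theta>)\<^sup>2)" "AE \<theta> in Theta. \<gamma>a1 \<theta> = ga1 \<theta>"
      "(LINT \<theta>|Theta. (ga1 \<theta>)\<^sup>2) \<le> F\<^sup>2 * EE" "(\<zeta>a1 + - 2 * \<alpha> * N $ 1 $ 3)\<^sup>2 * (LINT \<theta>|Theta. f0 \<eta> \<theta> * (?P1 \<theta>)\<^sup>2) \<le> F * EE"
    using mk[of 1 "ac 1" "a 1" "- 2 * \<alpha> * N $ 1 $ 3" ?P1 \<zeta>a1 \<gamma>a1, OF _ _ _ _ am cP(1) oa1] rk(1)[of 1] sa1
    by (simp add: tc_def mult_ac) blast
  obtain gb1 where gb1: "gb1 \<in> borel_measurable borel" "integrable Theta (\<lambda>\<theta>. (gb1 \<theta>)\<^sup>2)" "AE \<theta> in Theta. \<gamma>b1 \<theta> = gb1 \<theta>"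
      "(LINT \<theta>|Theta. (gb1 \<theta>)\<^sup>2) \<le> F\<^sup>2 * EE" "(\<zeta>b1 + - 2 * \<alpha> * N $ 2 $ 3)\<^sup>2 * (LINT \<theta>|Theta. f0 \<eta> \<theta> * (?P1 \<theta>)\<^sup>2) \<le> F * EE"
    using mk[of 1 "as 1" "b 1" "- 2 * \<alpha> * N $ 2 $ 3" ?P1 \<zeta>b1 \<gamma>b1, OF _ _ _ _ bm cP(1) ob1] rk(2)[of 1] sb1
    by (simp add: ts_def mult_ac) blast
  obtain ga2 where ga2: "ga2 \<in> borel_measurable borel" "integrable Theta (\<lambda>\<theta>. (ga2 \<theta>)\<^sup>2)" "AE \<theta> in Theta. \<gamma>a2 \<theta> = ga2 \<theta>"
      "(LINT \<theta>|Theta. (ga2 \<theta>)\<^sup>2) \<le> F\<^sup>2 * EE" "(\<zeta>a2 + - \<alpha> * n2 / 2)\<^sup>2 * (LINT \<theta>|Theta. f0 \<eta> \<theta> * (?P2 \<theta>)\<^sup>2) \<le> F * EE"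
    using mk[of 2 "ac 2" "a 2" "- \<alpha> * n2 / 2" ?P2 \<zeta>a2 \<gamma>a2, OF _ _ _ _ am cP(2) oa2] rk(1)[of 2] sa2
    by (simp add: tc_def mult_ac) blast
  obtain gb2 where gb2: "gb2 \<in> borel_measurable borel" "integrable Theta (\<lambda>\<theta>. (gb2 \<theta>)\<^sup>2)" "AE \<theta> in Theta. \<gamma>b2 \<theta> = gb2 \<theta>"
      "(LINT \<theta>|Theta. (gb2 \<theta>)\<^sup>2) \<le> F\<^sup>2 * EE" "(\<zeta>b2 + - \<alpha> * N $ 1 $ 2)\<^sup>2 * (LINT \<theta>|Theta. f0 \<eta> \<theta> * (?P2 \<theta>)\<^sup>2) \<le> F * EE"
    using mk[of 2 "as 2" "b 2" "- \<alpha> * N $ 1 $ 2" ?P2 \<zeta>b2 \<gamma>b2, OF _ _ _ _ bm cP(2) ob2] rk(2)[of 2] sb2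
    by (simp add: ts_def mult_ac) blast
  show ?B
  proof -
    \<comment> \<open>A common lower bound for the weighted norms of the three profiles.\<close>
    define \<kappa> where "\<kappa> = f0_min \<eta> * (8/45)"
    have \<kappa>0: "\<kappa> > 0" using f0_bounds by (simp add: \<kappa>_def)
    have est: "x\<^sup>2 \<le> F * EE / \<kappa>" if "x\<^sup>2 * I \<le> F * EE" "I \<ge> \<kappa>" for x I :: real
    proof -
      have "x\<^sup>2 * \<kappa> \<le> x\<^sup>2 * I" using that(2) by (intro mult_left_mono) auto
      then have "x\<^sup>2 * \<kappa> \<le> F * EE" using that(1) by linarith
      then show ?thesis using \<kappa>0 by (simp add: field_simps)
    qed
    note w = weighted_mode_norms[of \<eta>, folded \<kappa>_def]
    have 0: "(2 * \<zeta>0 - \<alpha> * n0)\<^sup>2 \<le> 4 * (F * EE / \<kappa>)"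
    proof -
      have "(2 * \<zeta>0 - \<alpha> * n0)\<^sup>2 = 4 * (\<zeta>0 - \<alpha> * n0 / 2)\<^sup>2" by (simp add: power2_eq_square algebra_simps)
      then show ?thesis using est[OF g0(5) w(1)] by linarith
    qed
    have 1: "(\<zeta>a1 - 2 * \<alpha> * N $ 1 $ 3)\<^sup>2 \<le> F * EE / \<kappa>" using est[OF ga1(5) w(2)] by simp
    have 2: "(\<zeta>b1 - 2 * \<alpha> * N $ 2 $ 3)\<^sup>2 \<le> F * EE / \<kappa>" using est[OF gb1(5) w(2)] by simp
    have 3: "(2 * \<zeta>a2 - \<alpha> * n2)\<^sup>2 \<le> 4 * (F * EE / \<kappa>)"
    proof -
      have "(2 * \<zeta>a2 - \<alpha> * n2)\<^sup>2 = 4 * (\<zeta>a2 + - \<alpha> * n2 / 2)\<^sup>2" by (simp add: power2_eq_square algebra_simps)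
      then show ?thesis using est[OF ga2(5) w(3)] by linarith
    qed
    have 4: "(\<zeta>b2 - \<alpha> * N $ 1 $ 2)\<^sup>2 \<le> F * EE / \<kappa>" using est[OF gb2(5) w(3)] by simp
    have "11 * (F * EE / \<kappa>) = 495 * f0_max \<eta> / (8 * pi * f0_min \<eta>) * E"
      by (simp add: F_def EE_def \<kappa>_def field_simps)
    then show ?thesis using 0 1 2 3 4 unfolding n0_n2_def by linarith
  qed
  \<comment> \<open>A measurable majorant: the tail is bounded by Bessel's inequality at fixed \<open>\<theta>\<close>.\<close>
  define R where "R = (\<lambda>\<theta>. (g0 \<theta>)\<^sup>2 + (ga1 \<theta>)\<^sup>2 + (gb1 \<theta>)\<^sup>2 + (ga2 \<theta>)\<^sup>2 + (gb2 \<theta>)\<^sup>2 + F\<^sup>2 / pi * v \<theta>)"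
  have Ri: "integrable Theta R" unfolding R_def using g0 ga1 gb1 ga2 gb2 vi by simp
  have RE: "(LINT \<theta>|Theta. R \<theta>) \<le> 6 * F\<^sup>2 / pi * E"
  proof -
    have "(LINT \<theta>|Theta. R \<theta>) = (LINT \<theta>|Theta. (g0 \<theta>)\<^sup>2) + (LINT \<theta>|Theta. (ga1 \<theta>)\<^sup>2) + (LINT \<theta>|Theta. (gb1 \<theta>)\<^sup>2)
       + (LINT \<theta>|Theta. (ga2 \<theta>)\<^sup>2) + (LINT \<theta>|Theta. (gb2 \<theta>)\<^sup>2) + F\<^sup>2 / pi * E"
      unfolding R_def using g0(2) ga1(2) gb1(2) ga2(2) gb2(2) vi by (simp add: vE)
    also have "\<dots> \<le> 5 * (F\<^sup>2 * EE) + F\<^sup>2 / pi * E" using g0(4) ga1(4) gb1(4) ga2(4) gb2(4) by linarith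
    also have "\<dots> = 6 * F\<^sup>2 / pi * E" by (simp add: EE_def)
    finally show ?thesis .
  qed
  have Rm: "(\<lambda>\<theta>. ennreal (R \<theta>)) \<in> borel_measurable borel" using tm[OF borel_measurable_integrable[OF Ri]] by simp
  have R0: "R \<theta> \<ge> 0" for \<theta> unfolding R_def using v0[of \<theta>] by simp
  have "AE \<theta> in Theta. ennreal ((\<gamma>0 \<theta>)\<^sup>2 + (\<gamma>a1 \<theta>)\<^sup>2 + (\<gamma>b1 \<theta>)\<^sup>2 + (\<gamma>a2 \<theta>)\<^sup>2 + (\<gamma>b2 \<theta>)\<^sup>2)
             + (\<Sum>k. ennreal ((a (k + 3) \<theta>)\<^sup>2 + (b (k + 3) \<theta>)\<^sup>2)) \<le> ennreal (R \<theta>)"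
    using g0(3) ga1(3) gb1(3) ga2(3) gb2(3) rel sum_le
  proof eventually_elim
    case (elim \<theta>)
    define e where "e = f0 \<eta> \<theta>"
    have e: "0 < e" "e \<le> F" using f0_bounds by (auto simp: e_def F_def)
    have e2: "e\<^sup>2 \<le> F\<^sup>2" using e by (intro power_mono) auto
    have part: "(\<Sum>k<n. (a (k + 3) \<theta>)\<^sup>2 + (b (k + 3) \<theta>)\<^sup>2) \<le> F\<^sup>2 / pi * v \<theta>" for n
    proof -
      let ?g = "\<lambda>k. (ac k \<theta>)\<^sup>2 + (as k \<theta>)\<^sup>2"
      have "(\<Sum>k<n. (a (k + 3) \<theta>)\<^sup>2 + (b (k + 3) \<theta>)\<^sup>2) = (\<Sum>k<n. e\<^sup>2 * ?g (k + 3))"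
        using elim(6) by (intro sum.cong refl) (simp add: tc_def ts_def e_def power_mult_distrib algebra_simps)
      also have "\<dots> = e\<^sup>2 * (\<Sum>k\<in>(\<lambda>k. k + 3) ` {..<n}. ?g k)" by (simp add: sum_distrib_left sum.reindex)
      also have "\<dots> \<le> e\<^sup>2 * (\<Sum>k=1..n+3. ?g k)" by (intro mult_left_mono sum_mono2) auto
      also have "\<dots> \<le> F\<^sup>2 * (v \<theta> / pi)" using elim(7) e2 by (intro mult_mono) (auto intro!: sum_nonneg)
      finally show ?thesis by simp
    qed
    have "(\<Sum>k. ennreal ((a (k + 3) \<theta>)\<^sup>2 + (b (k + 3) \<theta>)\<^sup>2)) \<le> ennreal (F\<^sup>2 / pi * v \<theta>)"
      unfolding suminf_eq_SUP by (rule SUP_least) (subst sum_ennreal, simp, rule ennreal_leI, rule part)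
    then have "ennreal ((g0 \<theta>)\<^sup>2 + (ga1 \<theta>)\<^sup>2 + (gb1 \<theta>)\<^sup>2 + (ga2 \<theta>)\<^sup>2 + (gb2 \<theta>)\<^sup>2)
             + (\<Sum>k. ennreal ((a (k + 3) \<theta>)\<^sup>2 + (b (k + 3) \<theta>)\<^sup>2)) \<le> ennreal ((g0 \<theta>)\<^sup>2 + (ga1 \<theta>)\<^sup>2 + (gb1 \<theta>)\<^sup>2 + (ga2 \<theta>)\<^sup>2 + (gb2 \<theta>)\<^sup>2) + ennreal (F\<^sup>2 / pi * v \<theta>)"
      by (rule add_left_mono)
    also have "\<dots> = ennreal (R \<theta>)" unfolding R_def using v0[of \<theta>] by (subst ennreal_plus[symmetric]) auto
    finally show ?case unfolding elim(1-5) .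
  qed
  then have "AE \<theta> in lborel. 0 < ennreal (sin \<theta>) * indicator {0..pi} \<theta> \<longrightarrow> ennreal ((\<gamma>0 \<theta>)\<^sup>2 + (\<gamma>a1 \<theta>)\<^sup>2 + (\<gamma>b1 \<theta>)\<^sup>2 + (\<gamma>a2 \<theta>)\<^sup>2 + (\<gamma>b2 \<theta>)\<^sup>2)
             + (\<Sum>k. ennreal ((a (k + 3) \<theta>)\<^sup>2 + (b (k + 3) \<theta>)\<^sup>2)) \<le> ennreal (R \<theta>)"
    unfolding Theta_def by (subst (asm) AE_density) auto
  then have "(\<integral>\<^sup>+\<theta>\<in>{0..pi}. (ennreal ((\<gamma>0 \<theta>)\<^sup>2 + (\<gamma>a1 \<theta>)\<^sup>2 + (\<gamma>b1 \<theta>)\<^sup>2 + (\<gamma>a2 \<theta>)\<^sup>2 + (\<gamma>b2 \<theta>)\<^sup>2)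
             + (\<Sum>k. ennreal ((a (k + 3) \<theta>)\<^sup>2 + (b (k + 3) \<theta>)\<^sup>2))) * ennreal (sin \<theta>) \<partial>lborel) \<le> (\<integral>\<^sup>+\<theta>\<in>{0..pi}. ennreal (R \<theta>) * ennreal (sin \<theta>) \<partial>lborel)"
  proof (intro nn_integral_mono_AE, eventually_elim)
    case (elim \<theta>)
    show ?case
    proof (cases "0 < ennreal (sin \<theta>) * indicator {0..pi} \<theta>")
      case True
      then show ?thesis using elim by (intro mult_right_mono) auto
    next
      case False
      then have z: "ennreal (sin \<theta>) * indicator {0..pi} \<theta> = 0" by (simp add: not_less)
      show ?thesis unfolding mult.assoc z by simp
    qed
  qed
  also have "\<dots> = (\<integral>\<^sup>+\<theta>. ennreal (R \<theta>) \<partial>Theta)" by (rule nn_integral_Theta[OF Rm, symmetric])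
  also have "\<dots> = ennreal (LINT \<theta>|Theta. R \<theta>)" by (rule nn_integral_eq_integral[OF Ri]) (use R0 in auto)
  also have "\<dots> \<le> ennreal (6 * F\<^sup>2 / pi * E)" by (rule ennreal_leI[OF RE])
  finally show ?A unfolding F_def .
qed

section \<open>Integration over the position variable\<close>

lemma N_mom_quadratic:
  "(A x *v y) \<bullet> (Q_mom g \<epsilon> f x *v (A x *v y)) = y \<bullet> (N_mom A g \<epsilon> f x *v y)"
proof -
  let ?Q = "Q_mom g \<epsilon> f x"
  have "N_mom A g \<epsilon> f x $ i $ j = (transpose (A x) ** ?Q ** A x) $ i $ j" for i j
  proof -
    have "N_mom A g \<epsilon> f x $ i $ j = (\<Sum>k\<in>UNIV. \<Sum>l\<in>UNIV. A x $ k $ i * A x $ l $ j * ?Q $ k $ l)"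
      by (simp add: N_mom_def Q_mom_def convolution_def)
    also have "\<dots> = (\<Sum>l\<in>UNIV. \<Sum>k\<in>UNIV. A x $ k $ i * A x $ l $ j * ?Q $ k $ l)" by (rule sum.swap)
    also have "\<dots> = (transpose (A x) ** ?Q ** A x) $ i $ j"
      by (simp add: matrix_matrix_mult_def transpose_def sum_distrib_left mult_ac)
    finally show ?thesis .
  qed
  then have "N_mom A g \<epsilon> f x = transpose (A x) ** ?Q ** A x" by (simp add: vec_eq_iff)
  then have "y \<bullet> (N_mom A g \<epsilon> f x *v y) = y \<bullet> (transpose (A x) *v (?Q *v (A x *v y)))"
    by (simp add: matrix_vector_mul_assoc matrix_mul_assoc)
  also have "\<dots> = (A x *v y) \<bullet> (?Q *v (A x *v y))"
    by (metis dot_lmul_matrix vector_transpose_matrix transpose_transpose)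
  finally show ?thesis by simp
qed

lemma N_mom_symmetric:
  assumes "transpose (Q_mom g \<epsilon> f x) = Q_mom g \<epsilon> f x"
  shows "N_mom A g \<epsilon> f x $ i $ j = N_mom A g \<epsilon> f x $ j $ i"
proof -
  have s: "Q_mom g \<epsilon> f x $ k $ l = Q_mom g \<epsilon> f x $ l $ k" for k l
    using arg_cong[OF assms, of "\<lambda>M. M $ l $ k"] by (simp add: transpose_def)
  have "N_mom A g \<epsilon> f x $ i $ j = (\<Sum>k\<in>UNIV. \<Sum>l\<in>UNIV. A x $ k $ i * A x $ l $ j * Q_mom g \<epsilon> f x $ k $ l)" for i j
    by (simp add: N_mom_def Q_mom_def convolution_def)
  note N = this
  show ?thesis unfolding N[of i j] N[of j i] by (subst sum.swap) (simp add: s mult_ac)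
qed

lemma azimuthal_expansion_slices:
  assumes "azimuthal_expansion A f a b"
  shows "AE x in lborel. AE \<theta> in Theta. (\<lambda>K. \<integral>\<^sup>+\<phi>\<in>{0..2 * pi}. ennreal ((f (x, A x *v sph \<theta> \<phi>) -
              (a 0 x \<theta> + (\<Sum>k=1..K. a k x \<theta> * cos (real k * \<phi>) + b k x \<theta> * sin (real k * \<phi>))))\<^sup>2) \<partial>lborel) \<longlonglongrightarrow> 0" (is "AE x in lborel. AE \<theta> in Theta. ?P x \<theta>")
    and "(\<lambda>\<theta>. indicator {0..pi} \<theta> * a k x \<theta>) \<in> borel_measurable borel"
    and "(\<lambda>\<theta>. indicator {0..pi} \<theta> * b k x \<theta>) \<in> borel_measurable borel"
proof -
  let ?R = "restrict_space lborel {0..pi}"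
  interpret R: sigma_finite_measure ?R
    by (rule sigma_finite_measure_restrict_space) (simp_all add: lborel.sigma_finite_measure_axioms)
  interpret P: pair_sigma_finite lborel ?R by standard
  have "AE p in lborel \<Otimes>\<^sub>M ?R. case p of (x, \<theta>) \<Rightarrow> ?P x \<theta>"
    using assms unfolding azimuthal_expansion_def by blast
  from P.AE_pair[OF this] have "AE x in lborel. AE \<theta> in ?R. ?P x \<theta>" by simp
  then show "AE x in lborel. AE \<theta> in Theta. ?P x \<theta>"
  proof eventually_elim
    case (elim x)
    then have "AE \<theta> in lborel. \<theta> \<in> {0..pi} \<longrightarrow> ?P x \<theta>"
      by (subst (asm) AE_restrict_space_iff) simp_all
    from AE_Theta_if_AE_lborel[OF this] AE_Theta show ?case by eventually_elim simp
  qed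
  have m: "(\<lambda>\<theta>. indicator {0..pi} \<theta> * c \<theta>) \<in> borel_measurable borel" if "c \<in> borel_measurable ?R" for c :: "real \<Rightarrow> real"
    using that by (subst (asm) borel_measurable_restrict_space_iff) (simp_all add: mult.commute)
  have ab: "case_prod (a k) \<in> borel_measurable (lborel \<Otimes>\<^sub>M ?R)" "case_prod (b k) \<in> borel_measurable (lborel \<Otimes>\<^sub>M ?R)"
    using assms unfolding azimuthal_expansion_def by blast+
  have sl: "c x \<in> borel_measurable ?R" if "case_prod c \<in> borel_measurable (lborel \<Otimes>\<^sub>M ?R)" for c :: "real^3 \<Rightarrow> real \<Rightarrow> real"
    using measurable_compose[OF measurable_Pair1' that, of x] by simp
  show "(\<lambda>\<theta>. indicator {0..pi} \<theta> * a k x \<theta>) \<in> borel_measurable borel"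
    "(\<lambda>\<theta>. indicator {0..pi} \<theta> * b k x \<theta>) \<in> borel_measurable borel"
    using m sl ab by blast+
qed

text \<open>In the claim, the integrands in \<open>x\<close> are built from coefficients that are arbitrary functions of \<open>x\<close>; they
are replaced by a measurable majorant, the energy of the slice, before the integral is taken.\<close>

lemma phase_energy_bound:
  assumes V: "sq_integrable phase V" and h: "\<And>p. norm (snd p) = 1 \<Longrightarrow> l \<le> h p \<and> h p \<le> u" and l: "l > 0"
    and hm: "h \<in> borel_measurable phase"
    and C: "C \<ge> 0" and X: "AE x in lborel. X x \<le> ennreal (C * (LINT m|S2. (norm (V (x, m)))\<^sup>2))"
  shows "(\<integral>\<^sup>+x. X x \<partial>lborel) \<le> ennreal (C / l * (LINT p|phase. h p * (norm (V p))\<^sup>2))"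
proof -
  have Vm: "V \<in> borel_measurable phase" and Vi: "integrable phase (\<lambda>p. (norm (V p))\<^sup>2)"
    using V by (auto simp: sq_integrable_def)
  define E where "E = (\<lambda>x. LINT m|S2. (norm (V (x, m)))\<^sup>2)"
  have Ei: "integrable lborel E" unfolding E_def by (rule phase_integrable_slice[OF Vi])
  have E0: "E x \<ge> 0" for x unfolding E_def by (rule integral_nonneg_AE) simp
  have hi: "integrable phase (\<lambda>p. h p * (norm (V p))\<^sup>2)"
  proof (rule Bochner_Integration.integrable_bound[OF integrable_mult_right[OF Vi, of u]])
    show "(\<lambda>p. h p * (norm (V p))\<^sup>2) \<in> borel_measurable phase" using hm Vm by measurable
    have "norm (h p * (norm (V p))\<^sup>2) \<le> norm (u * (norm (V p))\<^sup>2)" if "p \<in> space phase" for p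
    proof -
      have "norm (snd p) = 1" using that by (auto simp: dist_norm)
      then have "\<bar>h p\<bar> \<le> \<bar>u\<bar>" using h[of p] l by auto
      then show ?thesis by (simp add: abs_mult mult_right_mono)
    qed
    then show "AE p in phase. norm (h p * (norm (V p))\<^sup>2) \<le> norm (u * (norm (V p))\<^sup>2)" by (rule AE_I2)
  qed
  have "l * (LINT x|lborel. E x) = (LINT p|phase. l * (norm (V p))\<^sup>2)"
    unfolding E_def phase_integral[OF Vi, symmetric] by simp
  also have "\<dots> \<le> (LINT p|phase. h p * (norm (V p))\<^sup>2)"
  proof (rule integral_mono[OF integrable_mult_right[OF Vi] hi])
    fix p assume "p \<in> space phase"
    then have "norm (snd p) = 1" by (auto simp: dist_norm)
    then show "l * (norm (V p))\<^sup>2 \<le> h p * (norm (V p))\<^sup>2" using h[of p] by (simp add: mult_right_mono)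
  qed
  finally have le: "(LINT x|lborel. E x) \<le> (LINT p|phase. h p * (norm (V p))\<^sup>2) / l" using l by (simp add: field_simps)
  have "(\<integral>\<^sup>+x. X x \<partial>lborel) \<le> (\<integral>\<^sup>+x. ennreal (C * E x) \<partial>lborel)" using X unfolding E_def by (rule nn_integral_mono_AE)
  also have "\<dots> = ennreal (LINT x|lborel. C * E x)"
    by (rule nn_integral_eq_integral) (use Ei E0 C in auto)
  also have "\<dots> \<le> ennreal (C / l * (LINT p|phase. h p * (norm (V p))\<^sup>2))"
    using mult_left_mono[OF le C] by (intro ennreal_leI) simp
  finally show ?thesis .
qed

theorem proposition5p1:
  fixes \<alpha> \<eta> :: real and g :: "real^3 \<Rightarrow> real"
    and n :: "real^3 \<Rightarrow> real^3" and A :: "real^3 \<Rightarrow> real^3^3" and h :: field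
  assumes "\<alpha> > 0"
    and "admissible_kernel g"
    and "n \<in> borel_measurable borel"
    and "\<And>x. n x \<in> sphere 0 1"
    and "adapted_frame n A"
    and "h = (\<lambda>(x, m). h_eq \<eta> (n x) m)"
    and "\<And>x. critical_point \<alpha> (\<lambda>m. h (x, m))"
    and "\<And>x. stable_eq \<alpha> (\<lambda>m. h (x, m))"
  shows "\<exists>c>0. \<forall>\<epsilon>>0. \<forall>f\<in>H1. (AE x in lborel. (LINT m|S2. f (x, m)) = 0) \<longrightarrow>
    (\<forall>a b \<zeta>0 \<zeta>a1 \<zeta>b1 \<zeta>a2 \<zeta>b2 \<gamma>0 \<gamma>a1 \<gamma>b1 \<gamma>a2 \<gamma>b2.
       azimuthal_expansion A f a b \<longrightarrow>
       mode_split (\<lambda>\<theta>. f0 \<eta> \<theta> * ((cos \<theta>)\<^sup>2 - Ak \<eta> 2 / Ak \<eta> 0))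
         {\<lambda>\<theta>. 1, \<lambda>\<theta>. 3 * (cos \<theta>)\<^sup>2 - 1} (a 0) \<zeta>0 \<gamma>0 \<longrightarrow>
       mode_split (\<lambda>\<theta>. f0 \<eta> \<theta> * sin \<theta> * cos \<theta>) {\<lambda>\<theta>. sin \<theta> * cos \<theta>} (a 1) \<zeta>a1 \<gamma>a1 \<longrightarrow>
       mode_split (\<lambda>\<theta>. f0 \<eta> \<theta> * sin \<theta> * cos \<theta>) {\<lambda>\<theta>. sin \<theta> * cos \<theta>} (b 1) \<zeta>b1 \<gamma>b1 \<longrightarrow>
       mode_split (\<lambda>\<theta>. f0 \<eta> \<theta> * (sin \<theta>)\<^sup>2) {\<lambda>\<theta>. (sin \<theta>)\<^sup>2} (a 2) \<zeta>a2 \<gamma>a2 \<longrightarrow>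
       mode_split (\<lambda>\<theta>. f0 \<eta> \<theta> * (sin \<theta>)\<^sup>2) {\<lambda>\<theta>. (sin \<theta>)\<^sup>2} (b 2) \<zeta>b2 \<gamma>b2 \<longrightarrow>
       ereal (- G_op \<alpha> g \<epsilon> h f (H_op \<alpha> g \<epsilon> h f)) \<ge>
       ereal c * enn2ereal (
         (\<integral>\<^sup>+x. (\<integral>\<^sup>+\<theta>\<in>{0..pi}.
            (ennreal ((\<gamma>0 x \<theta>)\<^sup>2 + (\<gamma>a1 x \<theta>)\<^sup>2 + (\<gamma>b1 x \<theta>)\<^sup>2 + (\<gamma>a2 x \<theta>)\<^sup>2 + (\<gamma>b2 x \<theta>)\<^sup>2)
             + (\<Sum>k. ennreal ((a (k + 3) x \<theta>)\<^sup>2 + (b (k + 3) x \<theta>)\<^sup>2))) * ennreal (sin \<theta>)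
            \<partial>lborel) \<partial>lborel)
         + (\<integral>\<^sup>+x. ennreal ((2 * \<zeta>0 x - \<alpha> * N0 A g \<epsilon> f x)\<^sup>2
             + (\<zeta>a1 x - 2 * \<alpha> * N_mom A g \<epsilon> f x $ 1 $ 3)\<^sup>2
             + (\<zeta>b1 x - 2 * \<alpha> * N_mom A g \<epsilon> f x $ 2 $ 3)\<^sup>2
             + (2 * \<zeta>a2 x - \<alpha> * N2 A g \<epsilon> f x)\<^sup>2
             + (\<zeta>b2 x - \<alpha> * N_mom A g \<epsilon> f x $ 1 $ 2)\<^sup>2) \<partial>lborel)))"
proof -
  define Z where "Z = 2 * pi * Ak \<eta> 0"
  have Z0: "Z > 0" using Ak_0_pos by (simp add: Z_def)
  have A: "rotation_matrix (A x)" and A3: "column 3 (A x) = n x" for x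
    using assms(5) by (auto simp: adapted_frame_def)
  have n1: "norm (n x) = 1" for x using assms(4)[of x] by simp
  have h: "h (x, m) = exp (\<eta> * (m \<bullet> n x)\<^sup>2) / Z" for x m
    using h_eq_rotated[OF A, of \<eta> x m] by (simp add: assms(6) A3 Z_def)
  have hf0: "h (x, A x *v sph \<theta> \<phi>) = f0 \<eta> \<theta>" for x \<theta> \<phi>
    by (simp add: h f0_def Z_def A A3[symmetric] inner_commute[of _ "column 3 (A x)"])
  have hb: "f0_min \<eta> \<le> h p \<and> h p \<le> f0_max \<eta>" if "norm (snd p) = 1" for p
  proof -
    have "\<bar>snd p \<bullet> n (fst p)\<bar> \<le> 1" using Cauchy_Schwarz_ineq2[of "snd p" "n (fst p)"] that n1 by simp
    from exp_quadratic_bounds[OF this, of \<eta>] show ?thesis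
      using h[of "fst p" "snd p"] Z0 by (simp add: f0_min_def f0_max_def Z_def[symmetric] divide_right_mono)
  qed
  have hm: "h \<in> borel_measurable phase"
  proof -
    note assms(3)[measurable]
    have "h = (\<lambda>p. exp (\<eta> * (snd p \<bullet> n (fst p))\<^sup>2) / Z)" using h by auto
    then show ?thesis by simp
  qed
  define l where "l = f0_min \<eta>"
  have l0: "l > 0" using f0_bounds by (simp add: l_def)
  define C1 C2 where "C1 = 6 * (f0_max \<eta>)\<^sup>2 / pi" and "C2 = 495 * f0_max \<eta> / (8 * pi * f0_min \<eta>)"
  have C: "C1 > 0" "C2 > 0" unfolding C1_def C2_def using f0_bounds[of \<eta>] by (auto intro!: divide_pos_pos mult_pos_pos)
  \<comment> \<open>It depends on \<open>\<eta>\<close> only, through the bounds for the equilibrium density.\<close>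
  define c where "c = l / (C1 + C2)"
  have c0: "c > 0" using C l0 by (simp add: c_def)
  show ?thesis
  proof (intro exI[of _ c] conjI allI impI ballI c0)
    fix \<epsilon> :: real and f a b \<zeta>0 \<zeta>a1 \<zeta>b1 \<zeta>a2 \<zeta>b2 \<gamma>0 \<gamma>a1 \<gamma>b1 \<gamma>a2 \<gamma>b2
    assume \<epsilon>: "\<epsilon> > 0" and f: "f \<in> H1" and z: "AE x in lborel. (LINT m|S2. f (x, m)) = 0"
      and az: "azimuthal_expansion A f a b"
      and m0: "mode_split (\<lambda>\<theta>. f0 \<eta> \<theta> * ((cos \<theta>)\<^sup>2 - Ak \<eta> 2 / Ak \<eta> 0)) {\<lambda>\<theta>. 1, \<lambda>\<theta>. 3 * (cos \<theta>)\<^sup>2 - 1} (a 0) \<zeta>0 \<gamma>0"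
      and ma1: "mode_split (\<lambda>\<theta>. f0 \<eta> \<theta> * sin \<theta> * cos \<theta>) {\<lambda>\<theta>. sin \<theta> * cos \<theta>} (a 1) \<zeta>a1 \<gamma>a1"
      and mb1: "mode_split (\<lambda>\<theta>. f0 \<eta> \<theta> * sin \<theta> * cos \<theta>) {\<lambda>\<theta>. sin \<theta> * cos \<theta>} (b 1) \<zeta>b1 \<gamma>b1"
      and ma2: "mode_split (\<lambda>\<theta>. f0 \<eta> \<theta> * (sin \<theta>)\<^sup>2) {\<lambda>\<theta>. (sin \<theta>)\<^sup>2} (a 2) \<zeta>a2 \<gamma>a2"
      and mb2: "mode_split (\<lambda>\<theta>. f0 \<eta> \<theta> * (sin \<theta>)\<^sup>2) {\<lambda>\<theta>. (sin \<theta>)\<^sup>2} (b 2) \<zeta>b2 \<gamma>b2"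
    have f2: "sq_integrable phase f" using f by (simp add: H1_def)
    have fm: "f \<in> borel_measurable (lborel \<Otimes>\<^sub>M S2)" using f2 by (simp add: sq_integrable_def phase_def)
    have fx: "(\<lambda>m. f (x, m)) \<in> borel_measurable S2" for x
      using measurable_compose[OF measurable_Pair1' fm, of x] by simp
    let ?u = "H_op \<alpha> g \<epsilon> h f" and ?N = "N_mom A g \<epsilon> f"
    obtain V where V: "has_weak_rot ?u V" "sq_integrable phase V" "sq_integrable phase ?u"
      and en: "- G_op \<alpha> g \<epsilon> h f ?u = (LINT p|phase. h p * (norm (V p))\<^sup>2)"
      using energy_identity[OF assms(2) \<epsilon> assms(3) n1 Z0 h assms(7) f z] by blast
    define EN where "EN = (LINT p|phase. h p * (norm (V p))\<^sup>2)"
    have EN0: "EN \<ge> 0" unfolding EN_def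
    proof (rule integral_nonneg_AE, rule AE_I2)
      fix p assume "p \<in> space phase"
      then have "norm (snd p) = 1" by (auto simp: dist_norm)
      then show "0 \<le> h p * (norm (V p))\<^sup>2" using hb[of p] f0_bounds(1)[of \<eta>] by simp
    qed
    have ueq: "?u (x, A x *v sph \<theta> \<phi>) = f (x, A x *v sph \<theta> \<phi>) / f0 \<eta> \<theta> - \<alpha> * (sph \<theta> \<phi> \<bullet> (?N x *v sph \<theta> \<phi>))" for x \<theta> \<phi>
      using U_eps_eq[OF assms(2) \<epsilon> f2 z, of "A x *v sph \<theta> \<phi>" \<alpha> x]
      by (simp add: H_op_def hf0 norm_rotation_matrix[OF A] N_mom_quadratic)
    note Nsym = N_mom_symmetric[OF Q_mom_facts(5)[OF assms(2) \<epsilon> f2]]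
    let ?X = "\<lambda>x. \<integral>\<^sup>+\<theta>\<in>{0..pi}. (ennreal ((\<gamma>0 x \<theta>)\<^sup>2 + (\<gamma>a1 x \<theta>)\<^sup>2 + (\<gamma>b1 x \<theta>)\<^sup>2 + (\<gamma>a2 x \<theta>)\<^sup>2 + (\<gamma>b2 x \<theta>)\<^sup>2)
             + (\<Sum>k. ennreal ((a (k + 3) x \<theta>)\<^sup>2 + (b (k + 3) x \<theta>)\<^sup>2))) * ennreal (sin \<theta>) \<partial>lborel"
    let ?Y = "\<lambda>x. (2 * \<zeta>0 x - \<alpha> * N0 A g \<epsilon> f x)\<^sup>2 + (\<zeta>a1 x - 2 * \<alpha> * ?N x $ 1 $ 3)\<^sup>2 + (\<zeta>b1 x - 2 * \<alpha> * ?N x $ 2 $ 3)\<^sup>2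
             + (2 * \<zeta>a2 x - \<alpha> * N2 A g \<epsilon> f x)\<^sup>2 + (\<zeta>b2 x - \<alpha> * ?N x $ 1 $ 2)\<^sup>2"
    have XY: "AE x in lborel. ?X x \<le> ennreal (C1 * (LINT m|S2. (norm (V (x, m)))\<^sup>2)) \<and> ?Y x \<le> C2 * (LINT m|S2. (norm (V (x, m)))\<^sup>2)"
      using AE_slice_weak_rot[OF V(1)] sq_integrable_phase_slices[OF V(3)] sq_integrable_phase_slices[OF V(2)]
        azimuthal_expansion_slices(1)[OF az] m0[unfolded mode_split_def] ma1[unfolded mode_split_def] mb1[unfolded mode_split_def]
        ma2[unfolded mode_split_def] mb2[unfolded mode_split_def]
    proof eventually_elim
      case (elim x)
      note sl = slice_lower_bound[where a="\<lambda>k. a k x" and b="\<lambda>k. b k x" and N="?N x" and fx="\<lambda>m. f (x, m)"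
          and \<eta>=\<eta> and \<alpha>=\<alpha> and ?\<zeta>0.0="\<zeta>0 x" and ?\<zeta>a1.0="\<zeta>a1 x" and ?\<zeta>b1.0="\<zeta>b1 x" and ?\<zeta>a2.0="\<zeta>a2 x" and ?\<zeta>b2.0="\<zeta>b2 x"
          and ?\<gamma>0.0="\<gamma>0 x" and ?\<gamma>a1.0="\<gamma>a1 x" and ?\<gamma>b1.0="\<gamma>b1 x" and ?\<gamma>a2.0="\<gamma>a2 x" and ?\<gamma>b2.0="\<gamma>b2 x",
          OF A elim(1-3) fx ueq Nsym azimuthal_expansion_slices(2,3)[OF az] elim(4)]
      show ?case unfolding C1_def C2_def N0_def N2_def
        by (intro conjI sl) (use elim(5-9) in auto)
    qed
    have X: "(\<integral>\<^sup>+x. ?X x \<partial>lborel) \<le> ennreal (C1 / l * EN)"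
      unfolding EN_def
      by (rule phase_energy_bound[OF V(2), where u="f0_max \<eta>"]) (use XY hb hm l0 C in \<open>auto simp: l_def\<close>)
    have Y: "(\<integral>\<^sup>+x. ennreal (?Y x) \<partial>lborel) \<le> ennreal (C2 / l * EN)"
      unfolding EN_def
    proof (rule phase_energy_bound[OF V(2), where u="f0_max \<eta>"])
      show "AE x in lborel. ennreal (?Y x) \<le> ennreal (C2 * (LINT m|S2. (norm (V (x, m)))\<^sup>2))"
        using XY by eventually_elim (blast intro: ennreal_leI)
    qed (use hb hm l0 C in \<open>auto simp: l_def\<close>)
    have "(\<integral>\<^sup>+x. ?X x \<partial>lborel) + (\<integral>\<^sup>+x. ennreal (?Y x) \<partial>lborel) \<le> ennreal (C1 / l * EN) + ennreal (C2 / l * EN)"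
      by (rule add_mono[OF X Y])
    also have "\<dots> = ennreal (EN / c)"
      using C l0 EN0 by (subst ennreal_plus[symmetric]) (auto simp: c_def field_simps)
    finally have le: "(\<integral>\<^sup>+x. ?X x \<partial>lborel) + (\<integral>\<^sup>+x. ennreal (?Y x) \<partial>lborel) \<le> ennreal (EN / c)" (is "?S \<le> _") .
    have "enn2ereal ?S \<le> ereal (EN / c)"
      using le EN0 c0 by (simp add: less_eq_ennreal.rep_eq)
    then have "ereal c * enn2ereal ?S \<le> ereal c * ereal (EN / c)"
      using c0 by (intro ereal_mult_left_mono) auto
    then show "ereal c * enn2ereal ?S \<le> ereal (- G_op \<alpha> g \<epsilon> h f ?u)"
      using c0 unfolding en EN_def[symmetric] by simp
  qed
qed

end
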